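(* Let $M$ be a matroid with lattice of flats $\Lambda$. Let $\mathcal L_M$ be the diagram of all upper sublattices of $\Lambda$ of types $U_{2,4}$, $U_{2,5}$, $U_{3,5}$, $C_5$, $F_7$ and $F_7^\ast$, together with all lattice embeddings (inclusions of one upper sublattice of $\Lambda$ in another as an upper sublattice), and let $\mathcal F_M$ be the associated diagram of the foundations of these upper sublattices, together with the induced morphisms. Then the canonical morphism $\mathrm{colim}\,\mathcal F_M\to F_M$ (colimit in the category of pastures) is an isomorphism.
   Context: **Pastures.** A pointed group is a multiplicatively written commutative monoid $P$ with neutral element $1$ and absorbing element $0\ne1$ in which every nonzero element is invertible; $P^\times=P\setminus\{0\}$. In $\mathrm{Sym}^3(P)=P^3/S_3$ write $a+b+c$ for the class of $(a,b,c)$, $a+b$ for $a+b+0$ and $a$ for $a+0+0$. A pasture is a pointed group $P$ with a subset $N_P\subseteq\mathrm{Sym}^3(P)$ (the null set) that is invariant under multiplication by elements of $P$ and such that for every $a\in P$ there is a unique $b\in P$, denoted $-a$, with $a+b\in N_P$. A pasture morphism $g:P\to Q$ is a multiplicative map preserving $0$ and $1$ with $g(a)+g(b)+g(c)\in N_Q$ whenever $a+b+c\in N_P$. The category of pastures is complete and cocomplete; its initial object (the colimit of the empty diagram) is $\mathbb F_1^\pm=\{0,1,-1\}$ with null set $\{0,1-1\}$. **Representations and foundation.** Let $M$ be a matroid on a finite set $E$ with set of hyperplanes $\mathcal H$. A $P$-representation of $M$ is a family $\varphi=(\varphi_H:E\to P)_{H\in\mathcal H}$ with $\varphi_H(e)=0$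 iff $e\in H$, such that for all distinct hyperplanes $H_1,H_2,H_3$ whose intersection is a corank $2$ flat there is $(a,b,c)\in P^3\setminus\{(0,0,0)\}$ with $a\varphi_{H_1}(e)+b\varphi_{H_2}(e)+c\varphi_{H_3}(e)\in N_P$ for all $e\in E$. Two representations $\varphi,\varphi'$ are rescaling equivalent if $\varphi'_H(e)=a_Ht_e\varphi_H(e)$ for some $(a_H)\in(P^\times)^{\mathcal H}$, $(t_e)\in(P^\times)^E$. $\mathrm R_M(P)$ is the set of rescaling classes of $P$-representations of $M$, a functor in $P$ by composing hyperplane functions with morphisms. The foundation $F_M$ is the pasture representing this functor: $\mathrm R_M(P)=\mathrm{Hom}(F_M,P)$ functorially in $P$. It depends only on the lattice of flats of $M$, so it makes sense to speak of the foundation of a geometric lattice. **Upper sublattices and induced morphisms.** $\langle S\rangle$ denotes closure in $M$. An upper sublattice of $\Lambda$ is a subset $\Lambda'$ of the form $\{\langle S\rangle: I\subseteq S\subseteq E-J\}$ for disjoint $I,J\subseteq E$ with $I$ independent and $E-J$ spanning, ordered by inclusion (equivalently: a subset that is a geometric lattice under inclusion, has the same joins as $\Lambda$, and whose rank equals the corank in $\Lambda$ of its bottom element). It is canonically isomorphic to the lattice of flats of the minor $M'=M\backslash J/I$. Its type is the isomorphism type of the simple matroid with lattice of flats $\Lambda'$. The hyperplanes of $\Lambda'$ are hyperplanes of $M$. Restricting a $P$-representation $\varphi$ of $M$ to the hyperplanes in $\Lambda'$ (and to the elements of $E-(I\cup J)$) yields a $P$-representation of $M'$; this is compatible with rescaling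 and functorial in $P$, so it defines $\mathrm R_M(P)\to\mathrm R_{M'}(P)$, hence by Yoneda a morphism $F_{\Lambda'}=F_{M'}\to F_M$, the induced morphism. In the same way an inclusion $\Lambda''\subseteq\Lambda'$ of upper sublattices induces $F_{\Lambda''}\to F_{\Lambda'}$. The canonical morphism $\mathrm{colim}\,\mathcal F_M\to F_M$ is the one determined by the induced morphisms to $F_M$. **Matroids.** $U_{r,n}$ is the uniform matroid of rank $r$ on $n$ elements; $C_5$ is the rank $3$ matroid on $\{1,\dots,5\}$ whose bases are all $3$-subsets except $\{1,2,3\}$; $F_7$ is the Fano matroid and $F_7^\ast$ its dual. *)

theory Defs
  imports "HOL-Algebra.Group" "HOL-Library.Multiset"
begin

section \<open>Matroids\<close>

record 'a matroid =
  ground :: "'a set"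
  indep :: "'a set \<Rightarrow> bool"

locale matroid =
  fixes M :: "'a matroid"
  assumes finite_ground: "finite (ground M)"
    and indep_subset_ground: "indep M X \<Longrightarrow> X \<subseteq> ground M"
    and indep_empty: "indep M {}"
    and indep_subset: "indep M X \<Longrightarrow> Y \<subseteq> X \<Longrightarrow> indep M Y"
    and indep_augment: "indep M X \<Longrightarrow> indep M Y \<Longrightarrow> card X < card Y
      \<Longrightarrow> \<exists>y\<in>Y - X. indep M (insert y X)"

definition rk :: "'a matroid \<Rightarrow> 'a set \<Rightarrow> nat" where
  "rk M S = Max (card ` {X. X \<subseteq> S \<and> indep M X})"

definition cl :: "'a matroid \<Rightarrow> 'a set \<Rightarrow> 'a set" where
  "cl M S = {e \<in> ground M. rk M (insert e S) = rk M S}"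

definition flat :: "'a matroid \<Rightarrow> 'a set \<Rightarrow> bool" where
  "flat M F \<longleftrightarrow> F \<subseteq> ground M \<and> cl M F = F"

definition flat_of_corank :: "'a matroid \<Rightarrow> nat \<Rightarrow> 'a set \<Rightarrow> bool" where
  "flat_of_corank M k F \<longleftrightarrow> flat M F \<and> rk M F + k = rk M (ground M)"

definition hyperplanes :: "'a matroid \<Rightarrow> 'a set set" where
  "hyperplanes M = {H. flat_of_corank M 1 H}"

definition loops :: "'a matroid \<Rightarrow> 'a set" where
  "loops M = cl M {}"

text \<open>The minor \<open>M\J/I\<close>; the description of its independent sets is the right one only
  for independent \<open>I\<close>, the only case in which it is used.\<close>

definition minor :: "'a matroid \<Rightarrow> 'a set \<Rightarrow> 'a set \<Rightarrow> 'a matroid" where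
  "minor M J I = \<lparr>ground = ground M - (I \<union> J),
     indep = (\<lambda>X. X \<subseteq> ground M - (I \<union> J) \<and> indep M (X \<union> I))\<rparr>"

definition basis :: "'a matroid \<Rightarrow> 'a set \<Rightarrow> bool" where
  "basis M B \<longleftrightarrow> indep M B \<and> (\<forall>X. indep M X \<longrightarrow> B \<subseteq> X \<longrightarrow> X = B)"

definition dual_matroid :: "'a matroid \<Rightarrow> 'a matroid" where
  "dual_matroid M = \<lparr>ground = ground M,
     indep = (\<lambda>X. X \<subseteq> ground M \<and> (\<exists>B. basis M B \<and> X \<inter> B = {}))\<rparr>"

definition matroid_of_bases :: "'a set \<Rightarrow> 'a set set \<Rightarrow> 'a matroid" where
  "matroid_of_bases E \<B> = \<lparr>ground = E, indep = (\<lambda>X. \<exists>B\<in>\<B>. X \<subseteq> B)\<rparr>"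

definition matroid_isomorphic :: "'a matroid \<Rightarrow> 'b matroid \<Rightarrow> bool" where
  "matroid_isomorphic M N \<longleftrightarrow> (\<exists>f. bij_betw f (ground M) (ground N) \<and>
     (\<forall>X. X \<subseteq> ground M \<longrightarrow> (indep M X \<longleftrightarrow> indep N (f ` X))))"

definition uniform_matroid :: "nat \<Rightarrow> nat \<Rightarrow> nat matroid" where
  "uniform_matroid r n = matroid_of_bases {1..n} {B. B \<subseteq> {1..n} \<and> card B = r}"

definition C5_matroid :: "nat matroid" where
  "C5_matroid = matroid_of_bases {1..5} ({B. B \<subseteq> {1..5} \<and> card B = 3} - {{1,2,3}})"

definition Fano_matroid :: "nat matroid" where
  "Fano_matroid = matroid_of_bases {1..7} ({B. B \<subseteq> {1..7} \<and> card B = 3}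
     - {{1,2,3}, {1,4,5}, {1,6,7}, {2,4,6}, {2,5,7}, {3,4,7}, {3,5,6}})"


section \<open>Upper sublattices of the lattice of flats\<close>

definition presents :: "'a matroid \<Rightarrow> 'a set set \<Rightarrow> 'a set \<Rightarrow> 'a set \<Rightarrow> bool" where
  "presents M L I J \<longleftrightarrow> I \<subseteq> ground M \<and> J \<subseteq> ground M \<and> I \<inter> J = {} \<and> indep M I
     \<and> cl M (ground M - J) = ground M
     \<and> L = {cl M S | S. I \<subseteq> S \<and> S \<subseteq> ground M - J}"

definition upper_sublattice :: "'a matroid \<Rightarrow> 'a set set \<Rightarrow> bool" where
  "upper_sublattice M L \<longleftrightarrow> (\<exists>I J. presents M L I J)"

text \<open>The bottom element of an upper sublattice \<open>L\<close>, presented by \<open>I\<close> and \<open>J\<close>, is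
  \<open>cl M I = \<Inter>L\<close>.\<close>

definition atoms :: "'a set set \<Rightarrow> 'a set set" where
  "atoms L = {A \<in> L. A \<noteq> \<Inter>L \<and> (\<forall>F\<in>L. F \<subset> A \<longrightarrow> F = \<Inter>L)}"

definition atoms_below :: "'a set set \<Rightarrow> 'a set \<Rightarrow> 'a set set" where
  "atoms_below L F = {A \<in> atoms L. A \<subseteq> F}"

text \<open>The simple matroid with lattice of flats \<open>L\<close>, realized on the atoms of \<open>L\<close>; its flats are
  the sets \<open>atoms_below L F\<close> with \<open>F \<in> L\<close>. A set of atoms is independent if none of its
  elements lies below the join (in \<open>L\<close>) of the others, i.e. below all upper bounds of the others.\<close>

definition simple_matroid :: "'a set set \<Rightarrow> 'a set matroid" where
  "simple_matroid L = \<lparr>ground = atoms L,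
     indep = (\<lambda>X. X \<subseteq> atoms L \<and> (\<forall>A\<in>X. \<exists>F\<in>L. (\<forall>A'\<in>X - {A}. A' \<subseteq> F) \<and> \<not> A \<subseteq> F))\<rparr>"

definition has_type :: "'a set set \<Rightarrow> 'b matroid \<Rightarrow> bool" where
  "has_type L N \<longleftrightarrow> matroid_isomorphic (simple_matroid L) N"

definition special_sublattices :: "'a matroid \<Rightarrow> 'a set set set" where
  "special_sublattices M = {L. upper_sublattice M L \<and>
     (has_type L (uniform_matroid 2 4) \<or> has_type L (uniform_matroid 2 5)
      \<or> has_type L (uniform_matroid 3 5) \<or> has_type L C5_matroid
      \<or> has_type L Fano_matroid \<or> has_type L (dual_matroid Fano_matroid))}"

text \<open>An arrow \<open>(L', L)\<close> is an inclusion of \<open>L'\<close> in \<open>L\<close> as an upper sublattice of \<open>L\<close>,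
  where \<open>L\<close> is identified with the lattice of flats of its simple matroid.\<close>

definition special_inclusions :: "'a matroid \<Rightarrow> ('a set set \<times> 'a set set) set" where
  "special_inclusions M = {(L', L). L' \<in> special_sublattices M \<and> L \<in> special_sublattices M
     \<and> L' \<subseteq> L \<and> upper_sublattice (simple_matroid L) (atoms_below L ` L')}"


section \<open>Pastures\<close>

text \<open>Elements of \<open>Sym\<^sup>3(P)\<close> are multisets of size 3.\<close>

record 'u pasture = "'u monoid" +
  pzero :: 'u
  nullset :: "'u multiset set"

definition sym3 :: "'u set \<Rightarrow> 'u multiset set" where
  "sym3 A = {s. size s = 3 \<and> set_mset s \<subseteq> A}"

locale pointed_group = comm_monoid P for P :: "'u pasture" (structure) +
  assumes zero_closed: "pzero P \<in> carrier P"
    and zero_absorbing: "a \<in> carrier P \<Longrightarrow> pzero P \<otimes> a = pzero P"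
    and zero_neq_one: "pzero P \<noteq> \<one>"
    and nonzero_invertible: "a \<in> carrier P \<Longrightarrow> a \<noteq> pzero P \<Longrightarrow> a \<in> Units P"

locale pasture = pointed_group P for P :: "'u pasture" (structure) +
  assumes nullset_sym3: "nullset P \<subseteq> sym3 (carrier P)"
    and nullset_scale: "p \<in> carrier P \<Longrightarrow> s \<in> nullset P \<Longrightarrow> image_mset (\<lambda>a. p \<otimes> a) s \<in> nullset P"
    and ex1_negative: "a \<in> carrier P \<Longrightarrow> \<exists>!b. b \<in> carrier P \<and> {#a, b, pzero P#} \<in> nullset P"

definition nonzeros :: "'u pasture \<Rightarrow> 'u set" where
  "nonzeros P = carrier P - {pzero P}"

text \<open>Morphisms are extensional, so that equality of functions is equality of morphisms.
  The composite of \<open>f\<close> from \<open>P\<close> to \<open>Q\<close> followed by \<open>g\<close> is \<open>compose (carrier P) g f\<close>.\<close>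

definition pasture_hom :: "'u pasture \<Rightarrow> 'u pasture \<Rightarrow> ('u \<Rightarrow> 'u) set" where
  "pasture_hom P Q = {g \<in> carrier P \<rightarrow>\<^sub>E carrier Q.
     (\<forall>a\<in>carrier P. \<forall>b\<in>carrier P. g (a \<otimes>\<^bsub>P\<^esub> b) = g a \<otimes>\<^bsub>Q\<^esub> g b)
     \<and> g (pzero P) = pzero Q \<and> g \<one>\<^bsub>P\<^esub> = \<one>\<^bsub>Q\<^esub>
     \<and> (\<forall>s\<in>nullset P. image_mset g s \<in> nullset Q)}"

definition pasture_iso :: "'u pasture \<Rightarrow> 'u pasture \<Rightarrow> ('u \<Rightarrow> 'u) \<Rightarrow> bool" where
  "pasture_iso P Q g \<longleftrightarrow> g \<in> pasture_hom P Q \<and>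
     (\<exists>h\<in>pasture_hom Q P. compose (carrier P) h g = (\<lambda>x\<in>carrier P. x)
        \<and> compose (carrier Q) g h = (\<lambda>x\<in>carrier Q. x))"

text \<open>Colimits of diagrams of pastures with objects \<open>F i\<close> for \<open>i \<in> Ob\<close> and a morphism
  \<open>d i j\<close> from \<open>F i\<close> to \<open>F j\<close> for each \<open>(i, j) \<in> Ar\<close>. The category of pastures is, here and in
  the definition of foundations, that of all pastures with carrier contained in \<open>'u\<close>. All
  foundations of matroids, and colimits of finite diagrams of these, are countable. So if \<open>'u\<close>
  is infinite, then they exist in this category, and the universal properties below determine
  the same pastures as in the category of all pastures.\<close>

definition is_cocone :: "'i set \<Rightarrow> ('i \<times> 'i) set \<Rightarrow> ('i \<Rightarrow> 'u pasture) \<Rightarrow> ('i \<Rightarrow> 'i \<Rightarrow> 'u \<Rightarrow> 'u)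
    \<Rightarrow> 'u pasture \<Rightarrow> ('i \<Rightarrow> 'u \<Rightarrow> 'u) \<Rightarrow> bool" where
  "is_cocone Ob Ar F d P \<kappa> \<longleftrightarrow> pasture P \<and> (\<forall>i\<in>Ob. \<kappa> i \<in> pasture_hom (F i) P)
     \<and> (\<forall>(i, j)\<in>Ar. compose (carrier (F i)) (\<kappa> j) (d i j) = \<kappa> i)"

definition mediates :: "'i set \<Rightarrow> ('i \<Rightarrow> 'u pasture) \<Rightarrow> 'u pasture \<Rightarrow> ('i \<Rightarrow> 'u \<Rightarrow> 'u)
    \<Rightarrow> 'u pasture \<Rightarrow> ('i \<Rightarrow> 'u \<Rightarrow> 'u) \<Rightarrow> ('u \<Rightarrow> 'u) \<Rightarrow> bool" where
  "mediates Ob F C \<iota> P \<kappa> h \<longleftrightarrow> h \<in> pasture_hom C P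
     \<and> (\<forall>i\<in>Ob. compose (carrier (F i)) h (\<iota> i) = \<kappa> i)"

definition is_colimit :: "'i set \<Rightarrow> ('i \<times> 'i) set \<Rightarrow> ('i \<Rightarrow> 'u pasture) \<Rightarrow> ('i \<Rightarrow> 'i \<Rightarrow> 'u \<Rightarrow> 'u)
    \<Rightarrow> 'u pasture \<Rightarrow> ('i \<Rightarrow> 'u \<Rightarrow> 'u) \<Rightarrow> bool" where
  "is_colimit Ob Ar F d C \<iota> \<longleftrightarrow> is_cocone Ob Ar F d C \<iota>
     \<and> (\<forall>P \<kappa>. is_cocone Ob Ar F d P \<kappa> \<longrightarrow> (\<exists>!h. mediates Ob F C \<iota> P \<kappa> h))"


section \<open>Representations and foundations\<close>

text \<open>Only the values \<open>\<phi> H e\<close> for hyperplanes \<open>H\<close> and elements \<open>e\<close> of the matroid matter; families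
  which agree on these are rescaling equivalent.\<close>

type_synonym ('a, 'u) rep = "'a set \<Rightarrow> 'a \<Rightarrow> 'u"

definition reps :: "'a matroid \<Rightarrow> 'u pasture \<Rightarrow> ('a, 'u) rep set" where
  "reps M P = {\<phi>.
     (\<forall>H\<in>hyperplanes M. \<forall>e\<in>ground M. \<phi> H e \<in> carrier P \<and> (\<phi> H e = pzero P \<longleftrightarrow> e \<in> H))
     \<and> (\<forall>H1\<in>hyperplanes M. \<forall>H2\<in>hyperplanes M. \<forall>H3\<in>hyperplanes M.
         H1 \<noteq> H2 \<longrightarrow> H1 \<noteq> H3 \<longrightarrow> H2 \<noteq> H3 \<longrightarrow> flat_of_corank M 2 (H1 \<inter> H2 \<inter> H3) \<longrightarrow>
         (\<exists>a\<in>carrier P. \<exists>b\<in>carrier P. \<exists>c\<in>carrier P. (a, b, c) \<noteq> (pzero P, pzero P, pzero P) \<and>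
           (\<forall>e\<in>ground M. {#a \<otimes>\<^bsub>P\<^esub> \<phi> H1 e, b \<otimes>\<^bsub>P\<^esub> \<phi> H2 e, c \<otimes>\<^bsub>P\<^esub> \<phi> H3 e#} \<in> nullset P)))}"

definition rescaling :: "'a matroid \<Rightarrow> 'u pasture \<Rightarrow> (('a, 'u) rep \<times> ('a, 'u) rep) set" where
  "rescaling M P = {(\<phi>, \<phi>'). \<phi> \<in> reps M P \<and> \<phi>' \<in> reps M P \<and>
     (\<exists>a t. (\<forall>H\<in>hyperplanes M. a H \<in> nonzeros P) \<and> (\<forall>e\<in>ground M. t e \<in> nonzeros P) \<and>
       (\<forall>H\<in>hyperplanes M. \<forall>e\<in>ground M. \<phi>' H e = a H \<otimes>\<^bsub>P\<^esub> t e \<otimes>\<^bsub>P\<^esub> \<phi> H e))}"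

definition rep_classes :: "'a matroid \<Rightarrow> 'u pasture \<Rightarrow> ('a, 'u) rep set set" where
  "rep_classes M P = reps M P // rescaling M P"

definition rep_classes_map ::
    "'a matroid \<Rightarrow> 'u pasture \<Rightarrow> ('u \<Rightarrow> 'u) \<Rightarrow> ('a, 'u) rep set \<Rightarrow> ('a, 'u) rep set" where
  "rep_classes_map M Q k X = rescaling M Q `` ((\<lambda>\<phi> H e. k (\<phi> H e)) ` X)"

text \<open>A foundation is a pasture \<open>F\<close> with a natural bijection \<open>\<eta> P\<close> between the morphisms from
  \<open>F\<close> to \<open>P\<close> and the rescaling classes of \<open>P\<close>-representations.\<close>

type_synonym ('a, 'u) rep_bij = "'u pasture \<Rightarrow> ('u \<Rightarrow> 'u) \<Rightarrow> ('a, 'u) rep set"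

definition is_foundation :: "'a matroid \<Rightarrow> 'u pasture \<Rightarrow> ('a, 'u) rep_bij \<Rightarrow> bool" where
  "is_foundation M F \<eta> \<longleftrightarrow> pasture F
     \<and> (\<forall>P. pasture P \<longrightarrow> bij_betw (\<eta> P) (pasture_hom F P) (rep_classes M P))
     \<and> (\<forall>P Q k h. pasture P \<longrightarrow> pasture Q \<longrightarrow> k \<in> pasture_hom P Q \<longrightarrow> h \<in> pasture_hom F P
          \<longrightarrow> \<eta> Q (compose (carrier F) k h) = rep_classes_map M Q k (\<eta> P h))"


section \<open>Induced morphisms\<close>

definition restrict_rep :: "'a matroid \<Rightarrow> 'a set \<Rightarrow> ('a, 'u) rep \<Rightarrow> ('a, 'u) rep" where
  "restrict_rep N I \<phi> = (\<lambda>H e. \<phi> (cl N (H \<union> I)) e)"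

text \<open>Let \<open>f\<close> identify the parallel classes of non-loops of \<open>K\<close> with the elements of a simple
  matroid \<open>S\<close> and the lattice of flats of \<open>K\<close> with that of \<open>S\<close>. Pulling back along \<open>f\<close> is the
  canonical bijection from the rescaling classes of representations of \<open>S\<close> to those of \<open>K\<close>.\<close>

definition pullback_rep ::
    "'a matroid \<Rightarrow> 'u pasture \<Rightarrow> ('a \<Rightarrow> 'b) \<Rightarrow> ('b, 'u) rep \<Rightarrow> ('a, 'u) rep" where
  "pullback_rep K P f \<psi> = (\<lambda>H e. if e \<in> loops K then pzero P else \<psi> (f ` (H - loops K)) (f e))"

text \<open>The map from rescaling classes of representations of \<open>N\<close> to those of \<open>S\<close> that restricts
  to \<open>K = N\J/I\<close> and then transports along the inverse of this bijection.\<close>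

definition restrict_class :: "'a matroid \<Rightarrow> 'a set \<Rightarrow> 'a set \<Rightarrow> ('a \<Rightarrow> 'b) \<Rightarrow> 'b matroid
    \<Rightarrow> 'u pasture \<Rightarrow> ('a, 'u) rep set \<Rightarrow> ('b, 'u) rep set" where
  "restrict_class N J I f S P X = {\<psi> \<in> reps S P. \<exists>\<phi>\<in>X.
     (restrict_rep N I \<phi>, pullback_rep (minor N J I) P f \<psi>) \<in> rescaling (minor N J I) P}"

text \<open>The Yoneda correspondence: precomposition with \<open>g\<close> is restriction of representations.\<close>

definition corresponds :: "'a matroid \<Rightarrow> 'a set \<Rightarrow> 'a set \<Rightarrow> ('a \<Rightarrow> 'b) \<Rightarrow> 'b matroid
    \<Rightarrow> 'u pasture \<Rightarrow> ('a, 'u) rep_bij \<Rightarrow> 'u pasture \<Rightarrow> ('b, 'u) rep_bij \<Rightarrow> ('u \<Rightarrow> 'u) \<Rightarrow> bool" where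
  "corresponds N J I f S F \<eta> F' \<eta>' g \<longleftrightarrow> g \<in> pasture_hom F' F \<and>
     (\<forall>P h. pasture P \<longrightarrow> h \<in> pasture_hom F P \<longrightarrow>
        \<eta>' P (compose (carrier F') h g) = restrict_class N J I f S P (\<eta> P h))"

text \<open>The foundation of an upper sublattice is that of its simple matroid. In the
  next two definitions, \<open>f\<close> sends a non-loop of the minor to the atom of the sublattice that
  it spans together with the bottom element. The morphisms do not depend on the presentation.\<close>

definition induced_to_matroid :: "'a matroid \<Rightarrow> 'u pasture \<Rightarrow> ('a, 'u) rep_bij
    \<Rightarrow> 'a set set \<Rightarrow> 'u pasture \<Rightarrow> ('a set, 'u) rep_bij \<Rightarrow> 'u \<Rightarrow> 'u" where
  "induced_to_matroid M F \<eta> L' F' \<eta>' = (THE g. \<forall>I J. presents M L' I J \<longrightarrow>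
     corresponds M J I (\<lambda>e. cl M (insert e (\<Inter>L'))) (simple_matroid L') F \<eta> F' \<eta>' g)"

definition induced_to_sublattice :: "'a matroid \<Rightarrow> 'a set set \<Rightarrow> 'u pasture \<Rightarrow> ('a set, 'u) rep_bij
    \<Rightarrow> 'a set set \<Rightarrow> 'u pasture \<Rightarrow> ('a set, 'u) rep_bij \<Rightarrow> 'u \<Rightarrow> 'u" where
  "induced_to_sublattice M L F \<eta> L' F' \<eta>' =
     (THE g. \<forall>I J. presents (simple_matroid L) (atoms_below L ` L') I J \<longrightarrow>
        corresponds (simple_matroid L) J I (\<lambda>A. cl M (A \<union> \<Inter>L')) (simple_matroid L') F \<eta> F' \<eta>' g)"

end

theory Submission
 imports Defs "HOL-Algebra.Free_Abelian_Groups"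
begin

notation insert (infixr "+:" 66)

text \<open>The proof avoids Tutte's homotopy theorem. Up to rescaling, a representation is determined by its
 cross ratios, one for each four hyperplanes over a common flat of corank 2, and such hyperplanes span an
 upper sublattice of type \<open>U\<^sub>2\<^sub>,\<^sub>4\<close>. So it suffices to glue compatible representations of the special sublattices.
 In terms of logarithms, a representation amounts to a function \<open>f\<close> on the bases for which
 \<open>f(Sac) + f(Sbd) - f(Sad) - f(Sbc)\<close> is the cross ratio, up to signs. Given the cross ratios, \<open>f\<close> is found
 by induction on the number of elements that are neither loops nor coloops. If there are at least six of them, pick
 \<open>e\<close> and \<open>y\<close> whose removal keeps a fundamental graph connected; solutions on the deletions of \<open>e\<close> and of
 \<open>y\<close> agree on the common bases up to a choice of rescaling, and extend to all bases unless some minor is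
 \<open>F\<^sub>7\<close> or its dual.\<close>

text \<open>Why six: a discrepancy involves \<open>e\<close>, \<open>y\<close> and at most three
  further elements, so a sixth active element z gives a slice (all bases with z, or all without) in
  which these elements survive and a solution is already known; there the discrepancy can be
  measured. The discrepancy at a, b vanishes as soon as a and b are joined, in a fundamental graph
  without \<open>e\<close> and \<open>y\<close>, by a path that misses some z. If it does not
  vanish, a shortest path from a to b runs through all other elements, and pivoting cuts long paths
  short, so exactly five others remain: this is where seven elements come from. Six lines of the
  Fano plane are then forced; if the seventh is missing, another pair \<open>e\<close>,
  \<open>y\<close> is used. Two more obstacles shape the set-up. And f lives on sets whereas
  determinants alternate, so the equations carry signs that come from an arbitrary linear order of
  the elements.\<close>

locale basis_family =
 fixes \<B> :: "'e set set"
 assumes finite_elements: "finite (\<Union>\<B>)"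
  and exchange1: "[|B : \<B>; B' : \<B>; x : B; x ~: B'|] ==> EX y. y : B' & y ~: B & (y+:(B - {x})) : \<B>"
  and exchange2: "[|B : \<B>; B' : \<B>; y : B'; y ~: B|] ==> EX x. x : B & x ~: B' & (y+:(B - {x})) : \<B>"
begin

lemma finite_basis: "B : \<B> ==> finite B"
 using finite_elements by (meson Union_upper finite_subset)

lemma card_basis: "B : \<B> ==> B' : \<B> ==> card B = card B'"
proof (induction "card (B - B')" arbitrary: B rule: less_induct)
 case less
 show ?case
 proof (cases "B <= B'")
  case True
  show ?thesis
  proof (cases "B' <= B")
   case False
   then obtain y where "y : B'" "y ~: B" by blast
   then obtain x where "x : B" "x ~: B'" using exchange2 less.prems by meson
   thus ?thesis using True by blast
  qed (use True in \<open>simp add: subset_antisym\<close>)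
 next
  case False
  then obtain x where x: "x : B" "x ~: B'" by blast
  then obtain y where y: "y : B'" "y ~: B" "(y+:(B - {x})) : \<B>" using exchange1 less.prems by meson
  have "(y+:(B - {x})) - B' \<subset> B - B'" using x y by auto
  hence "card ((y+:(B - {x})) - B') < card (B - B')"
   using finite_basis[OF less.prems(1)] by (simp add: psubset_card_mono)
  from less.hyps[OF this y(3) less.prems(2)] show ?thesis
   using x y finite_basis[OF less.prems(1)] by (metis Diff_iff card_Suc_Diff1 card_insert_disjoint finite_Diff)
 qed
qed

end

section \<open>Fundamental graphs, minors and active elements\<close>

definition edge :: "'e set set => 'e set => 'e => 'e => bool" where
 "edge \<B> B r c \<longleftrightarrow> r : B & c ~: B & (c+:(B - {r})) : \<B>"

text \<open>The minor that contracts \<open>I\<close> and deletes \<open>J\<close>, with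
  \<open>I\<close> kept inside each of its bases. In this form a function on the bases of a matroid
  restricts to its minors without any relabelling.\<close>

definition interval :: "'e set set => 'e set => 'e set => 'e set set" where
 "interval \<B> I J = {B : \<B>. I <= B & B Int J = {}}"

text \<open>The bases of an \<open>interval\<close> keep the contracted elements, so the size of a
  minor has to be measured by its active elements.\<close>

definition active :: "'e set set => 'e set" where
 "active \<B> = {x. (EX B:\<B>. x : B) & (EX B:\<B>. x ~: B)}"

lemma interval_basis_family:
 assumes "basis_family \<B>" shows "basis_family (interval \<B> I J)"
proof -
 interpret basis_family \<B> by fact
 show ?thesis
 proof
  show "finite (\<Union> (interval \<B> I J))"
   by (rule finite_subset[OF _ finite_elements]) (auto simp: interval_def)
 next
  fix B B' x assume *: "B : interval \<B> I J" "B' : interval \<B> I J" "x : B" "x ~: B'"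
  then obtain y where "y : B'" "y ~: B" "(y+:(B - {x})) : \<B>"
   using exchange1[of B B' x] by (auto simp: interval_def)
  thus "EX y. y : B' & y ~: B & (y+:(B - {x})) : interval \<B> I J"
   using * by (intro exI[of _ y]) (auto simp: interval_def)
 next
  fix B B' y assume *: "B : interval \<B> I J" "B' : interval \<B> I J" "y : B'" "y ~: B"
  then obtain x where "x : B" "x ~: B'" "(y+:(B - {x})) : \<B>"
   using exchange2[of B B' y] by (auto simp: interval_def)
  thus "EX x. x : B & x ~: B' & (y+:(B - {x})) : interval \<B> I J"
   using * by (intro exI[of _ x]) (auto simp: interval_def)
 qed
qed

context basis_family
begin

text \<open>In a matrix whose unit columns are \<open>B\<close>, an edge is a nonzero entry. The 2 x
  2 minor in question is triangular with nonzero diagonal, so it cannot vanish; the exchange axiom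
  gives the same for every matroid.\<close>

lemma double_exchange:
 assumes B: "B : \<B>" and e1: "edge \<B> B r1 c1" and e2: "edge \<B> B r2 c2" and ne: "~ edge \<B> B r1 c2"
  and d: "r1 ~= r2"
 shows "(c1+:c2+:(B - {r1, r2})) : \<B>"
proof -
 have *: "r1 : B" "r2 : B" "c1 ~: B" "c2 ~: B" "(c1+:(B - {r1})) : \<B>" "(c2+:(B - {r2})) : \<B>"
  "(c2+:(B - {r1})) ~: \<B>"
  using e1 e2 ne by (auto simp: edge_def)
 have "c1 ~= c2" using * by auto
 have "r1 : (c2+:(B - {r2}))" "r1 ~: (c1+:(B - {r1}))" using * d by auto
 from exchange1[OF *(6) *(5) this] obtain y where y: "y : (c1+:(B - {r1}))" "y ~: (c2+:(B - {r2}))"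
  "(y+:((c2+:(B - {r2})) - {r1})) : \<B>" by blast
 hence "y = c1 \<or> y = r2" by auto
 moreover have "y ~= r2"
 proof
  assume "y = r2"
  hence "(y+:((c2+:(B - {r2})) - {r1})) = (c2+:(B - {r1}))" using * d by auto
  thus False using y(3) * by simp
 qed
 ultimately have "y = c1" by simp
 moreover have "(c1+:((c2+:(B - {r2})) - {r1})) = (c1+:c2+:(B - {r1, r2}))"
  using * d by auto
 ultimately show ?thesis using y(3) by simp
qed

lemma double_exchange':
 assumes B: "B : \<B>" and e1: "edge \<B> B r1 c1" and e2: "edge \<B> B r2 c2" and ne: "~ edge \<B> B r2 c1"
  and d: "r1 ~= r2"
 shows "(c1+:c2+:(B - {r1, r2})) : \<B>"
 using double_exchange[OF B e2 e1 ne] d by (metis insert_commute)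

text \<open>The counterpart of the fact that a nonzero 2 x 2 determinant has a nonzero term.
  Exchange gives an edge at each of the two rows and at each of the two columns, which is enough for
  a perfect matching.\<close>

lemma matching:
 assumes B: "B : \<B>" and T: "(c1+:c2+:(B - {r1, r2})) : \<B>"
  and *: "r1 : B" "r2 : B" "c1 ~: B" "c2 ~: B" "r1 ~= r2" "c1 ~= c2"
 shows "edge \<B> B r1 c1 & edge \<B> B r2 c2 \<or> edge \<B> B r1 c2 & edge \<B> B r2 c1"
proof -
 let ?T = "(c1+:c2+:(B - {r1, r2}))"
 have r: "edge \<B> B r c1 \<or> edge \<B> B r c2" if "r = r1 \<or> r = r2" for r
 proof -
  have "r : B" "r ~: ?T" using that * by auto
  from exchange1[OF B T this] obtain y where "y : ?T" "y ~: B" "(y+:(B - {r})) : \<B>" by blast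
  thus ?thesis using that * by (auto simp: edge_def)
 qed
 have c: "edge \<B> B r1 c \<or> edge \<B> B r2 c" if "c = c1 \<or> c = c2" for c
 proof -
  have "c ~: B" "c : ?T" using that * by auto
  from exchange2[OF B T this(2,1)] obtain y where "y : B" "y ~: ?T" "(c+:(B - {y})) : \<B>" by blast
  thus ?thesis using that * by (auto simp: edge_def)
 qed
 show ?thesis using r[of r1] r[of r2] c[of c1] c[of c2] by blast
qed

end

section \<open>Congruence modulo a subgroup\<close>

text \<open>The unit group of a pasture is a quotient of a group that is a type of class
  \<open>ab_group_add\<close>, but is not such a type itself. Hence values are compared modulo
  \<open>K\<close> instead of being taken in a quotient.\<close>

locale mod_subgroup =
 fixes K :: "'v::ab_group_add set"
 assumes K_zero: "0 : K" and K_diff: "x : K ==> y : K ==> x - y : K"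
begin

definition cg :: "'v => 'v => bool" (infix "\<doteq>" 50) where "x \<doteq> y \<longleftrightarrow> x - y : K"

lemma K_uminus: "x : K ==> - x : K" using K_diff[OF K_zero] by fastforce
lemma K_add: "x : K ==> y : K ==> x + y : K" using K_diff[of x "- y"] K_uminus[of y] by simp

lemma cg_refl [simp, intro]: "x \<doteq> x" by (simp add: cg_def K_zero)
lemma cg_sym: "x \<doteq> y ==> y \<doteq> x" unfolding cg_def using K_uminus by fastforce
lemma cg_commute: "x \<doteq> y \<longleftrightarrow> y \<doteq> x" using cg_sym by blast
lemma cg_trans [trans]: "x \<doteq> y ==> y \<doteq> z ==> x \<doteq> z" unfolding cg_def using K_add by fastforce
lemma cg_add: "x \<doteq> y ==> x' \<doteq> y' ==> x + x' \<doteq> y + y'"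
 unfolding cg_def using K_add[of "x - y" "x' - y'"] by (simp add: algebra_simps)
lemma cg_minus: "x \<doteq> y ==> - x \<doteq> - y"
 unfolding cg_def using K_uminus by fastforce
text \<open>Linear combination of congruences: the facts are supplied with their signs fixed by
  \<open>cg_sym\<close>, and what is left is an identity of abelian groups that \<open>simp\<close>
  can close.\<close>

lemma cg_lin1: "p \<doteq> q ==> x - y = p - q ==> x \<doteq> y" by (simp add: cg_def)
lemma cg_lin2: "p \<doteq> q ==> p' \<doteq> q' ==> x - y = (p - q) + (p' - q') ==> x \<doteq> y"
 by (simp add: cg_def K_add)
lemma cg_lin3: "p \<doteq> q ==> p' \<doteq> q' ==> p'' \<doteq> q'' ==> x - y = (p - q) + (p' - q') + (p'' - q'') ==> x \<doteq> y"
 by (simp add: cg_def K_add)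
lemma cg_lin4: "p \<doteq> q ==> p' \<doteq> q' ==> p'' \<doteq> q'' ==> p3 \<doteq> q3
 ==> x - y = (p - q) + (p' - q') + (p'' - q'') + (p3 - q3) ==> x \<doteq> y"
 by (simp add: cg_def K_add)
lemma cg_lin5: "p \<doteq> q ==> p' \<doteq> q' ==> p'' \<doteq> q'' ==> p3 \<doteq> q3 ==> p4 \<doteq> q4
 ==> x - y = (p - q) + (p' - q') + (p'' - q'') + (p3 - q3) + (p4 - q4) ==> x \<doteq> y"
 by (simp add: cg_def K_add)

end

section \<open>Squares of bases and the equations on them\<close>

definition square :: "'e set set => 'e set => 'e => 'e => 'e => 'e => bool" where
 "square \<C> S a b c d \<longleftrightarrow> distinct [a, b, c, d] & a ~: S & b ~: S & c ~: S & d ~: S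
  & (a+:c+:S) : \<C> & (b+:d+:S) : \<C>
  & (a+:d+:S) : \<C> & (b+:c+:S) : \<C>"

type_synonym ('e, 'v) label = "'e set => 'e => 'e => 'e => 'e => 'v"

context mod_subgroup
begin

definition solves :: "('e, 'v) label => 'e set set => ('e set => 'v) => bool" where
 "solves W \<C> f \<longleftrightarrow> (ALL S a b c d. square \<C> S a b c d -->
  f (a+:c+:S) + f (b+:d+:S)
   \<doteq> W S a b c d + (f (a+:d+:S) + f (b+:c+:S)))"

lemma solves_diff:
 assumes "solves W \<C> f" "solves W' \<C> g"
 shows "solves (\<lambda>S a b c d. W S a b c d - W' S a b c d) \<C> (\<lambda>B. f B - g B)"
 unfolding solves_def
proof (intro allI impI)
 fix S a b c d assume s: "square \<C> S a b c d"
 show "f (a+:c+:S) - g (a+:c+:S) +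
   (f (b+:d+:S) - g (b+:d+:S)) \<doteq>
   W S a b c d - W' S a b c d + (f (a+:d+:S) - g (a+:d+:S) +
    (f (b+:c+:S) - g (b+:c+:S)))"
  by (rule cg_lin2[OF assms(1)[unfolded solves_def, rule_format, OF s]
    cg_sym[OF assms(2)[unfolded solves_def, rule_format, OF s]]]) (simp add: algebra_simps)
qed

lemma solves_cong:
 assumes "solves W \<C> f" "!!B. B : \<C> ==> f B \<doteq> g B"
 shows "solves W \<C> g"
 unfolding solves_def
proof (intro allI impI)
 fix S a b c d assume s: "square \<C> S a b c d"
 hence *: "f (a+:c+:S) \<doteq> g (a+:c+:S)"
  "f (b+:d+:S) \<doteq> g (b+:d+:S)"
  "f (a+:d+:S) \<doteq> g (a+:d+:S)"
  "f (b+:c+:S) \<doteq> g (b+:c+:S)"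
  using assms(2) by (auto simp: square_def)
 show "g (a+:c+:S) + g (b+:d+:S) \<doteq>
   W S a b c d + (g (a+:d+:S) + g (b+:c+:S))"
  by (rule cg_lin5[OF assms(1)[unfolded solves_def, rule_format, OF s] cg_sym[OF *(1)] cg_sym[OF *(2)] *(3,4)])
   (simp add: algebra_simps)
qed

lemma solves_mono: "solves W \<C> f ==> \<C>' <= \<C> ==> solves W \<C>' f"
 unfolding solves_def square_def by (meson subset_iff)

lemma square_finite:
 assumes "square \<C> S a b c d" "!!B. B : \<C> ==> finite B" shows "finite S"
 using assms unfolding square_def by (metis finite_insert)

text \<open>Each of \<open>a\<close>, \<open>b\<close>, \<open>c\<close>, \<open>d\<close> occurs
  once on either side and each element of \<open>S\<close> twice. These are the logarithms of
  rescalings; \<open>homogeneous_weights\<close> shows that there are no other homogeneous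
  solutions.\<close>

lemma solves_weights:
 fixes t :: "'e => 'v"
 assumes "!!B. B : \<C> ==> finite B"
 shows "solves (\<lambda>S a b c d. 0) \<C> (\<lambda>B. k + sum t B)"
 unfolding solves_def
proof (intro allI impI)
 fix S :: "'e set" and a b c d assume s: "square \<C> S a b c d"
 from square_finite[OF s assms] have "finite S" .
 thus "k + sum t (a+:c+:S) + (k + sum t (b+:d+:S))
  \<doteq> 0 + (k + sum t (a+:d+:S) + (k + sum t (b+:c+:S)))"
  using s by (simp add: square_def algebra_simps)
qed

lemma solves_add_weights:
 fixes t :: "'e => 'v"
 assumes "solves W \<C> f" "!!B. B : \<C> ==> finite B"
 shows "solves W \<C> (\<lambda>B. f B - (k + sum t B))"
 using solves_diff[OF assms(1) solves_weights[of \<C> k t]] assms(2) by simp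

end

section \<open>Homogeneous solutions are weights\<close>

lemma (in basis_family) pivot_edge:
 assumes B: "B : \<B>" and e: "edge \<B> B x y" and e': "edge \<B> (y+:(B - {x})) r c"
 shows "edge \<B> B r c \<or> (edge \<B> B r y & edge \<B> B x c) \<or> (r = y & edge \<B> B x c)
  \<or> (c = x & edge \<B> B r y) \<or> (r = y & c = x)"
proof -
 let ?B' = "(y+:(B - {x}))"
 have *: "x : B" "y ~: B" "?B' : \<B>" using e by (auto simp: edge_def)
 have **: "r : ?B'" "c ~: ?B'" "(c+:(?B' - {r})) : \<B>" using e' by (auto simp: edge_def)
 consider "r = y" "c = x" | "r = y" "c ~= x" | "r ~= y" "c = x" | "r ~= y" "c ~= x" by blast
 thus ?thesis
 proof cases
  case 2
  hence "(c+:(?B' - {r})) = (c+:(B - {x}))" using * by auto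
  thus ?thesis using 2 * ** by (auto simp: edge_def)
 next
  case 3
  hence "(c+:(?B' - {r})) = (y+:(B - {r}))" using * ** by auto
  thus ?thesis using 3 * ** by (auto simp: edge_def)
 next
  case 4
  hence "(c+:(?B' - {r})) = (c+:y+:(B - {r, x}))" using * ** by auto
  hence "(c+:y+:(B - {r, x})) : \<B>" using ** by simp
  from matching[OF B this] show ?thesis using 4 * ** by auto
 qed simp
qed

context mod_subgroup
begin

text \<open>Pivoting creates an edge only where there was an edge or a path of three edges.\<close>

lemma sum_weights_const:
 assumes bf: "basis_family \<B>" and B: "B : \<B>" and B': "B' : \<B>"
  and t: "!!r c. edge \<B> B r c ==> t r \<doteq> t c"
 shows "sum t B' \<doteq> sum t B"
proof -
 interpret basis_family \<B> by fact
 show ?thesis using B t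
 proof (induction "card (B - B')" arbitrary: B rule: less_induct)
  case less
  have fin: "finite B" "finite B'" using finite_basis less.prems B' by auto
  show ?case
  proof (cases "B <= B'")
   case True
   hence "B = B'" using card_basis[OF less.prems(1) B'] fin by (simp add: card_subset_eq)
   thus ?thesis by simp
  next
   case False
   then obtain x where x: "x : B" "x ~: B'" by blast
   then obtain y where y: "y : B'" "y ~: B" "(y+:(B - {x})) : \<B>" using exchange1 less.prems B' by meson
   let ?C = "(y+:(B - {x}))"
   have xy: "edge \<B> B x y" using x y by (simp add: edge_def)
   have "?C - B' \<subset> B - B'" using x y by auto
   hence "card (?C - B') < card (B - B')" using fin by (simp add: psubset_card_mono)
   moreover have "t r \<doteq> t c" if "edge \<B> ?C r c" for r c
    using pivot_edge[OF less.prems(1) xy that] less.prems(2) xy by (meson cg_sym cg_trans cg_refl)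
   ultimately have "sum t B' \<doteq> sum t ?C" using less.hyps y(3) by blast
   moreover have "sum t ?C \<doteq> sum t B"
   proof -
    have "sum t ?C = t y + sum t (B - {x})" using y fin by simp
    moreover have "sum t B = t x + sum t (B - {x})" by (rule sum.remove[OF fin(1) x(1)])
    ultimately show ?thesis
    using less.prems(2)[OF xy] cg_lin1[of "t y" "t x" "sum t ?C" "sum t B"] by (simp add: cg_commute)
   qed
   ultimately show ?thesis by (rule cg_trans)
  qed
 qed
qed

end

text \<open>After a subtraction of weights, \<open>\<rho>\<close> vanishes on the deletion of
  \<open>e\<close>, and on the bases through \<open>e\<close> that avoid \<open>Y\<close> it is
  given by weights \<open>t\<close>. The set \<open>Y\<close> is empty for
  \<open>homogeneous_weights\<close> and \<open>{y}\<close> for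
  \<open>homogeneous_weights_pair\<close>, where bases through both \<open>e\<close> and
  \<open>y\<close> are excluded.\<close>

locale partial_solution = mod_subgroup K + basis_family \<B>
 for K :: "'v::ab_group_add set" and \<B> :: "'e set set" +
 fixes e :: 'e and Y :: "'e set" and \<rho> :: "'e set => 'v" and c0 :: 'v and t :: "'e => 'v"
 assumes Y_le_one: "y : Y ==> y' : Y ==> y = y'" and e_notin_Y: "e ~: Y"
  and homogeneous: "solves (\<lambda>S a b c d. 0) {B : \<B>. e : B --> B Int Y = {}} \<rho>"
  and trivial: "!!B. B : \<B> ==> e ~: B ==> \<rho> B \<doteq> 0"
  and weights: "!!B. B : \<B> ==> e : B ==> B Int Y = {} ==> \<rho> B \<doteq> c0 + sum t B"
begin

text \<open>In the square of \<open>a\<close>, \<open>b\<close> against \<open>c\<close>,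
  \<open>e\<close> the two bases without \<open>e\<close> contribute nothing, and the values on the
  other two differ by \<open>t a - t b\<close>.\<close>

lemma visible:
 assumes B: "B : \<B>" "e ~: B" "B Int Y = {}" and "edge \<B> B a c" "edge \<B> B b c" "c ~= e"
  and ae: "edge \<B> B a e" and be: "edge \<B> B b e"
 shows "t a \<doteq> t b"
proof (cases "a = b")
 case False
 let ?S = "B - {a, b}"
 have *: "a : B" "b : B" "c ~: B" using assms by (auto simp: edge_def)
 have eq: "(a+:c+:?S) = (c+:(B - {b}))" "(b+:e+:?S) = (e+:(B - {a}))"
  "(a+:e+:?S) = (e+:(B - {b}))" "(b+:c+:?S) = (c+:(B - {a}))"
  using * False by auto
 have bs: "(c+:(B - {b})) : \<B>" "(e+:(B - {a})) : \<B>" "(e+:(B - {b})) : \<B>" "(c+:(B - {a})) : \<B>"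
  using assms by (auto simp: edge_def)
 have "square {B : \<B>. e : B --> B Int Y = {}} ?S a b c e"
  unfolding square_def eq mem_Collect_eq
 proof (intro conjI impI)
  show "distinct [a, b, c, e]" using * B False \<open>c ~= e\<close> by auto
  show "(e+:(B - {a})) Int Y = {}" "(e+:(B - {b})) Int Y = {}" using B(3) e_notin_Y by blast+
  show "(c+:(B - {a})) Int Y = {}" if "e : (c+:(B - {a}))" using that B(2) \<open>c ~= e\<close> by blast
  show "(c+:(B - {b})) Int Y = {}" if "e : (c+:(B - {b}))" using that B(2) \<open>c ~= e\<close> by blast
 qed (use bs * B(2) in simp_all)
 from homogeneous[unfolded solves_def, rule_format, OF this]
 have h: "\<rho> (c+:(B - {b})) + \<rho> (e+:(B - {a})) \<doteq> 0 + (\<rho> (e+:(B - {b})) + \<rho> (c+:(B - {a})))"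
  unfolding eq .
 have z: "\<rho> (c+:(B - {b})) \<doteq> 0" "\<rho> (c+:(B - {a})) \<doteq> 0"
  using trivial[OF bs(1)] trivial[OF bs(4)] B(2) \<open>c ~= e\<close> by blast+
 have w: "\<rho> (e+:(B - {a})) \<doteq> c0 + sum t (e+:(B - {a}))"
  "\<rho> (e+:(B - {b})) \<doteq> c0 + sum t (e+:(B - {b}))"
  using weights[OF bs(2)] weights[OF bs(3)] B(3) e_notin_Y by blast+
 have s: "sum t (e+:(B - {x})) = t e + sum t B - t x" if "x : B" for x
  using that finite_basis[OF B(1)] B(2) by (simp add: sum_diff1)
 show ?thesis
  by (rule cg_sym, rule cg_lin5[OF h cg_sym[OF z(1)] z(2) w(2) cg_sym[OF w(1)]])
   (simp add: s[OF *(1)] s[OF *(2)] algebra_simps del: sum.insert sum.insert_if)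
qed simp

definition row_path :: "'e set => nat => (nat => 'e) => (nat => 'e) => bool" where
 "row_path B k r c \<longleftrightarrow> (ALL i<k. edge \<B> B (r i) (c i) & edge \<B> B (r (Suc i)) (c i) & c i ~= e)
  & edge \<B> B (r 0) e & edge \<B> B (r k) e"

lemma row_pathD:
 assumes "row_path B k r c"
 shows "i < k ==> edge \<B> B (r i) (c i)" "i < k ==> edge \<B> B (r (Suc i)) (c i)" "i < k ==> c i ~= e"
  "edge \<B> B (r 0) e" "edge \<B> B (r k) e"
 using assms unfolding row_path_def by blast+

lemma row_pathI:
 assumes "!!i. i < k ==> edge \<B> B (r i) (c i)" "!!i. i < k ==> edge \<B> B (r (Suc i)) (c i)"
  "!!i. i < k ==> c i ~= e" "edge \<B> B (r 0) e" "edge \<B> B (r k) e"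
 shows "row_path B k r c"
 unfolding row_path_def using assms by blast

text \<open>If \<open>r 1\<close> is adjacent to \<open>e\<close>, \<open>visible\<close> settles
  the first step and \<open>IH\<close> the rest. Otherwise pivot on \<open>r 1\<close> and
  \<open>c 0\<close>: since \<open>r 0\<close> is not adjacent to \<open>c 1\<close> before, it is
  afterwards, so the path loses a row and a column while both end rows stay adjacent to
  \<open>e\<close>. The pivot brings \<open>c 0\<close> into the basis, hence
  \<open>c 0 ~: Y\<close>.\<close>

lemma induced_row_path:
 assumes IH: "!!B r c. [|B : \<B>; e ~: B; B Int Y = {}; row_path B (k - 1) r c|] ==> t (r 0) \<doteq> t (r (k - 1))"
  and B: "B : \<B>" "e ~: B" "B Int Y = {}" and rp: "row_path B k r c" and k: "k \<ge> 2" and c0: "c 0 ~: Y"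
  and nochord: "!!i j. i + 1 < j ==> j <= k ==> ~ edge \<B> B (r j) (c i)"
   "!!i j. j < i ==> i < k ==> ~ edge \<B> B (r j) (c i)"
 shows "t (r 0) \<doteq> t (r k)"
proof -
 note path = row_pathD[OF rp]
 have p0: "edge \<B> B (r 0) (c 0)" "edge \<B> B (r 1) (c 0)" "c 0 ~= e" using path(1)[of 0] path(2)[of 0] path(3)[of 0] k by auto
 have p1: "edge \<B> B (r 1) (c 1)" "edge \<B> B (r 2) (c 1)" "c 1 ~= e"
  using path(1)[of 1] path(2)[of 1, unfolded Suc_1] path(3)[of 1] k by linarith+
 have k1: "Suc (k - 1) = k" using k by simp
 show ?thesis
 proof (cases "edge \<B> B (r 1) e")
  case True
  have "t (r 0) \<doteq> t (r 1)" using visible[OF B p0 path(4) True] .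
  moreover have "row_path B (k - 1) (\<lambda>i. r (Suc i)) (\<lambda>i. c (Suc i))"
   by (rule row_pathI) (use path True k1 in simp_all)
  from IH[OF B this] have "t (r 1) \<doteq> t (r k)" using k1 by simp
  ultimately show ?thesis by (rule cg_trans)
 next
  case False
  let ?B = "((c 0)+:(B - {r 1}))"
  have B': "?B : \<B>" "e ~: ?B" "?B Int Y = {}" using p0 B c0 by (auto simp: edge_def)
  have new: "edge \<B> ?B x y"
   if xy: "edge \<B> B x y" "x ~= r 1" "y ~= c 0" "~ edge \<B> B (r 1) y \<or> ~ edge \<B> B x (c 0)" for x y
  proof -
   have "((c 0)+:y+:(B - {r 1, x})) : \<B>"
    using double_exchange[OF B(1) p0(2) xy(1) _ xy(2)[symmetric]]
    double_exchange'[OF B(1) p0(2) xy(1) _ xy(2)[symmetric]] xy(4) by blast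
   moreover have "(y+:(?B - {x})) = ((c 0)+:y+:(B - {r 1, x}))"
    using xy p0 by (auto simp: edge_def)
   ultimately show ?thesis using xy by (simp add: edge_def)
  qed
  have d0: "r 0 ~= r 1" using False path(4) by metis
  have dk: "r k ~= r 1" using False path(5) by metis
  have n01: "~ edge \<B> B (r 0) (c 1)" using nochord(2)[of 0 1] k by simp
  have c01: "c 1 ~= c 0" using n01 p0(1) by metis
  have left: "edge \<B> ?B (r 0) (c 1)"
  proof -
   have "((c 0)+:(c 1)+:(B - {r 0, r 1})) : \<B>"
    using double_exchange[OF B(1) p0(1) p1(1) n01 d0] .
   moreover have "((c 1)+:(?B - {r 0})) = ((c 0)+:(c 1)+:(B - {r 0, r 1}))"
    using p0 p1 d0 by (auto simp: edge_def)
   ultimately show ?thesis using p0 p1 d0 c01 by (simp add: edge_def)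
  qed
  have right: "edge \<B> ?B (r (Suc j)) (c i)"
   if "i \<ge> 1" "i < k" "j \<ge> 1" "j < k" "edge \<B> B (r (Suc j)) (c i)" for i j
  proof (rule new[OF that(5)])
   have n: "~ edge \<B> B (r (Suc j)) (c 0)" using nochord(1)[of 0 "Suc j"] that by simp
   thus "~ edge \<B> B (r 1) (c i) \<or> ~ edge \<B> B (r (Suc j)) (c 0)" ..
   show "r (Suc j) ~= r 1" using n p0(2) by metis
   show "c i ~= c 0" using n that(5) by metis
  qed
  define r' where "r' i = (if i = 0 then r 0 else r (Suc i))" for i
  have "row_path ?B (k - 1) r' (\<lambda>i. c (Suc i))"
  proof (rule row_pathI)
   show "edge \<B> ?B (r' 0) e" using new[OF path(4) d0] p0(3) False by (simp add: r'_def)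
   show "edge \<B> ?B (r' (k - 1)) e" using new[OF path(5) dk] p0(3) False k by (simp add: r'_def)
   fix i assume i: "i < k - 1"
   hence i': "Suc i < k" by simp
   show "c (Suc i) ~= e" using path(3)[OF i'] .
   show "edge \<B> ?B (r' (Suc i)) (c (Suc i))"
    using right[of "Suc i" "Suc i"] path(2)[OF i'] i' by (simp add: r'_def)
   show "edge \<B> ?B (r' i) (c (Suc i))"
   proof (cases "i = 0")
    case True
    thus ?thesis using left by (simp add: r'_def)
   next
    case False
    thus ?thesis using right[of "Suc i" i] path(1)[OF i'] i' by (simp add: r'_def)
   qed
  qed
  from IH[OF B' this] show ?thesis using k1 k by (simp add: r'_def)
 qed
qed

text \<open>This makes it possible to carry \<open>t\<close> from the neighbours of \<open>e\<close>
  to whole components of the fundamental graph without \<open>e\<close>. The induction is over all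
  bases at once, because the path is shortened by pivots as well as by chords.\<close>

lemma connected_rows:
 assumes "B : \<B>" "e ~: B" "B Int Y = {}" "row_path B k r c"
 shows "t (r 0) \<doteq> t (r k)"
 using assms
proof (induction k arbitrary: B r c rule: less_induct)
 case (less k)
 note B = less.prems(1-3) and rp = less.prems(4)
 note path = row_pathD[OF rp]
 consider "k = 0" | "k = 1" | "k \<ge> 2" by linarith
 thus ?case
 proof cases
  case 2
  hence "edge \<B> B (r 0) (c 0)" "edge \<B> B (r 1) (c 0)" "c 0 ~= e" "edge \<B> B (r 0) e" "edge \<B> B (r 1) e"
   using path(1-3)[of 0] path(4,5) by simp_all
  from visible[OF B this] 2 show ?thesis by simp
 next
  case k: 3
  show ?thesis
  proof (cases "EX i j. j <= k & i < k & edge \<B> B (r j) (c i) & (i + 1 < j \<or> j < i)")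
   case True
   \<comment> \<open>a chord shortens the path\<close>
   then obtain i j where ij: "j <= k" "i < k" "edge \<B> B (r j) (c i)" "i + 1 < j \<or> j < i" by blast
   show ?thesis
   proof (cases "i + 1 < j")
    case True
    define n where "n = j - i - 1"
    have n: "n > 0" "j = i + 1 + n" "i + 1 + n <= k" using True ij by (auto simp: n_def)
    define r' where "r' m = (if m <= i then r m else r (m + n))" for m
    define c' where "c' m = (if m <= i then c m else c (m + n))" for m
    have "row_path B (k - n) r' c'"
    proof (rule row_pathI)
    show "edge \<B> B (r' 0) e" "edge \<B> B (r' (k - n)) e" using path(4,5) n by (simp_all add: r'_def)
    fix m assume m: "m < k - n"
    hence m': "m < k" "m + n < k" by simp_all
    show "edge \<B> B (r' m) (c' m)" "c' m ~= e"
    using path(1,3)[OF m'(1)] path(1,3)[OF m'(2)] by (simp_all add: r'_def c'_def)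
    show "edge \<B> B (r' (Suc m)) (c' m)"
    using path(2)[OF m'(1)] path(2)[OF m'(2)] ij(3) n by (cases "m = i") (simp_all add: r'_def c'_def)
    qed
    hence "t (r' 0) \<doteq> t (r' (k - n))" using less.IH[of "k - n" B r' c', OF _ B] n by simp
    moreover have "~ k - n <= i" using n by simp
    ultimately show ?thesis using n by (simp add: r'_def)
   next
    case False
    hence ji: "j < i" using ij by simp
    define n where "n = i - j"
    have n: "n > 0" "i = j + n" "j + n < k" using ji ij by (auto simp: n_def)
    define r' where "r' m = (if m <= j then r m else r (m + n))" for m
    define c' where "c' m = (if m < j then c m else c (m + n))" for m
    have "row_path B (k - n) r' c'"
    proof (rule row_pathI)
    show "edge \<B> B (r' 0) e" "edge \<B> B (r' (k - n)) e" using path(4,5) n by (simp_all add: r'_def)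
    fix m assume m: "m < k - n"
    hence m': "m < k" "m + n < k" by simp_all
    show "edge \<B> B (r' (Suc m)) (c' m)" "c' m ~= e"
    using path(2,3)[OF m'(1)] path(2,3)[OF m'(2)] by (simp_all add: r'_def c'_def)
    show "edge \<B> B (r' m) (c' m)"
    using path(1)[OF m'(1)] path(1)[OF m'(2)] ij(3) n by (cases "m = j") (simp_all add: r'_def c'_def)
    qed
    hence "t (r' 0) \<doteq> t (r' (k - n))" using less.IH[of "k - n" B r' c', OF _ B] n by simp
    moreover have "~ k - n <= j" using n by simp
    ultimately show ?thesis using n by (simp add: r'_def)
   qed
  next
   case False
   hence nochord: "~ edge \<B> B (r j) (c i)" if "j <= k" "i < k" "i + 1 < j \<or> j < i" for i j
    using that by blast
   have IH: "t (r 0) \<doteq> t (r (k - 1))" if "B : \<B>" "e ~: B" "B Int Y = {}" "row_path B (k - 1) r c" for B r c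
    using less.IH[OF _ that] k by simp
   \<comment> \<open>at most one column of the path lies in \<open>Y\<close>, so one of its two ends admits a pivot\<close>
   show ?thesis
   proof (cases "c 0 : Y")
    case False
    show ?thesis
    proof (rule induced_row_path[of k B r c, OF _ B rp k False])
    show "t (r 0) \<doteq> t (r (k - 1))" if "B : \<B>" "e ~: B" "B Int Y = {}" "row_path B (k - 1) r c" for B r c
    using IH[OF that] .
    next
    fix i j assume "i + 1 < j" "j <= k"
    thus "~ edge \<B> B (r j) (c i)" by (intro nochord) auto
    next
    fix i j assume "j < i" "i < k"
    thus "~ edge \<B> B (r j) (c i)" by (intro nochord) auto
    qed
   next
    case True
    have "c (k - 1) ~= c 0"
    proof
    assume "c (k - 1) = c 0"
    thus False using nochord[of k 0] path(2)[of "k - 1"] k by simp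
    qed
    hence last: "c (k - 1) ~: Y" using True Y_le_one by auto
    define r' where "r' i = r (k - i)" for i
    define c' where "c' i = c (k - 1 - i)" for i
    have rp': "row_path B k r' c'"
    proof (rule row_pathI)
    show "edge \<B> B (r' 0) e" "edge \<B> B (r' k) e" using path(4,5) by (simp_all add: r'_def)
    fix i assume i: "i < k"
    hence *: "Suc (k - 1 - i) = k - i" "k - 1 - i < k" "k - Suc i = k - 1 - i" by simp_all
    show "edge \<B> B (r' i) (c' i)" using path(2)[OF *(2)] unfolding *(1) r'_def c'_def .
    show "edge \<B> B (r' (Suc i)) (c' i)" using path(1)[OF *(2)] unfolding r'_def c'_def *(3) .
    show "c' i ~= e" using path(3)[OF *(2)] unfolding c'_def .
    qed
    have "c' 0 ~: Y" using last by (simp add: c'_def)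
    have "t (r' 0) \<doteq> t (r' k)"
    proof (rule induced_row_path[of k B r' c', OF _ B rp' k \<open>c' 0 ~: Y\<close>])
    show "t (r 0) \<doteq> t (r (k - 1))" if "B : \<B>" "e ~: B" "B Int Y = {}" "row_path B (k - 1) r c" for B r c
    using IH[OF that] .
    next
    fix i j assume "i + 1 < j" "j <= k"
    thus "~ edge \<B> B (r' j) (c' i)" unfolding r'_def c'_def by (intro nochord) auto
    next
    fix i j assume "j < i" "i < k"
    thus "~ edge \<B> B (r' j) (c' i)" unfolding r'_def c'_def by (intro nochord) auto
    qed
    thus ?thesis by (simp add: cg_commute r'_def)
   qed
  qed
 qed simp
qed

end

lemma edge_interval_del:
 "edge (interval \<B> {} {e}) B r c \<longleftrightarrow> edge \<B> B r c & c ~= e & (e : B --> r = e)"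
 by (auto simp: edge_def interval_def)

lemma (in partial_solution) row_path_of_connected:
 assumes "(\<lambda>x y. (edge \<B> B x y \<or> edge \<B> B y x) & x ~= e & y ~= e)\<^sup>*\<^sup>* x z" and "x : B"
 shows "EX k r c. r 0 = x & (ALL i<k. edge \<B> B (r i) (c i) & edge \<B> B (r (Suc i)) (c i) & c i ~= e)
  & (z : B --> r k = z) & (z ~: B --> edge \<B> B (r k) z & z ~= e)"
 using assms
proof (induction rule: rtranclp_induct)
 case base
 thus ?case by (intro exI[of _ 0] exI[of _ "\<lambda>_. x"]) auto
next
 case (step y z)
 then obtain k r c where *: "r 0 = x" "ALL i<k. edge \<B> B (r i) (c i) & edge \<B> B (r (Suc i)) (c i) & c i ~= e"
  "y : B --> r k = y" "y ~: B --> edge \<B> B (r k) y & y ~= e" by blast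
 show ?case
 proof (cases "y : B")
  case True
  hence "z ~: B" "edge \<B> B (r k) z" "z ~= e" using step.hyps(2) * by (auto simp: edge_def)
  thus ?thesis
   by (intro exI[of _ k] exI[of _ r] exI[of _ c] conjI impI) (rule *(1), rule *(2), simp_all)
 next
  case False
  hence z: "z : B" "edge \<B> B z y" using step.hyps(2) by (auto simp: edge_def)
  define r' where "r' i = (if i <= k then r i else z)" for i
  define c' where "c' i = (if i < k then c i else y)" for i
  have "edge \<B> B (r' i) (c' i)" "edge \<B> B (r' (Suc i)) (c' i)" "c' i ~= e" if "i < Suc k" for i
  proof -
   have "edge \<B> B (r' i) (c' i) & edge \<B> B (r' (Suc i)) (c' i) & c' i ~= e"
   proof (cases "i = k")
    case True
    thus ?thesis using *(4) False z by (simp add: r'_def c'_def)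
   next
    case False
    hence "i < k" using that by simp
    thus ?thesis using *(2) by (simp add: r'_def c'_def)
   qed
   thus "edge \<B> B (r' i) (c' i)" "edge \<B> B (r' (Suc i)) (c' i)" "c' i ~= e" by blast+
  qed
  moreover have "r' 0 = x" "r' (Suc k) = z" using * by (auto simp: r'_def)
  ultimately show ?thesis using z(1)
   by (intro exI[of _ "Suc k"] exI[of _ r'] exI[of _ c'] conjI impI allI) simp_all
 qed
qed

text \<open>Weights that are constant on the components of the fundamental graph of
  \<open>B0\<close> without \<open>e\<close> change the values on bases avoiding \<open>e\<close>
  only by a common constant. So \<open>t\<close> can be replaced by such weights
  \<open>\<tau>\<close>, provided they agree with \<open>t\<close> at the neighbours of
  \<open>e\<close>; this is what \<open>connected_rows\<close> allows.\<close>

lemma (in partial_solution) extends_to_weights: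
 assumes B0: "B0 : \<B>" "e ~: B0" "B0 Int Y = {}"
 shows "EX k \<tau>. ALL B:\<B>. (e : B --> B Int Y = {}) --> \<rho> B \<doteq> k + sum \<tau> B"
proof -
 define R where "R = (\<lambda>x y. (edge \<B> B0 x y \<or> edge \<B> B0 y x) & x ~= e & y ~= e)\<^sup>*\<^sup>*"
 define X where "X = {x. edge \<B> B0 x e}"
 \<comment> \<open>A component takes the value of \<open>t\<close> at one of the neighbours of
   \<open>e\<close> in it; components without such a neighbour get the default 0.\<close>
 define \<tau> where "\<tau> z = (if EX x:X. R x z then t (SOME x. x : X & R x z) else 0)" for z
 have fin: "finite B0" using B0 finite_basis by blast
 have \<tau>_edge: "\<tau> r = \<tau> c" if "edge \<B> B0 r c" "r ~= e" "c ~= e" for r c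
 proof -
  have "R x r \<longleftrightarrow> R x c" for x
   using that unfolding R_def by (auto intro: rtranclp.rtrancl_into_rtrancl)
  thus ?thesis by (simp add: \<tau>_def)
 qed
 have \<tau>_X: "\<tau> x \<doteq> t x" if "x : X" for x
 proof -
  have "R x x" by (simp add: R_def)
  define x' where "x' = (SOME x'. x' : X & R x' x)"
  have x': "x' : X" "R x' x" using someI[of "\<lambda>x'. x' : X & R x' x" x] that \<open>R x x\<close> by (auto simp: x'_def)
  have "x' : B0" "x : B0" using x' that by (auto simp: X_def edge_def)
  with row_path_of_connected[OF x'(2)[unfolded R_def]] obtain k r c
   where *: "r 0 = x'" "ALL i<k. edge \<B> B0 (r i) (c i) & edge \<B> B0 (r (Suc i)) (c i) & c i ~= e" "r k = x" by blast
  hence "row_path B0 k r c" using x' that by (simp add: row_path_def X_def)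
  from connected_rows[OF B0 this] * have "t x' \<doteq> t x" by simp
  moreover have "\<tau> x = t x'" using that \<open>R x x\<close> by (auto simp: \<tau>_def x'_def)
  ultimately show ?thesis by simp
 qed
 define m where "m = sum \<tau> B0"
 have \<tau>_sum: "sum \<tau> B \<doteq> m" if "B : \<B>" "e ~: B" for B
  unfolding m_def
 proof (rule sum_weights_const)
  show "basis_family (interval \<B> {} {e})" using interval_basis_family basis_family_axioms by blast
  show "B0 : interval \<B> {} {e}" "B : interval \<B> {} {e}" using that B0 by (auto simp: interval_def)
  show "\<tau> r \<doteq> \<tau> c" if "edge (interval \<B> {} {e}) B0 r c" for r c
  proof -
   have "edge \<B> B0 r c" "c ~= e" using that by (simp_all add: edge_interval_del)
   moreover have "r ~= e" using \<open>edge \<B> B0 r c\<close> B0 by (auto simp: edge_def)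
   ultimately show ?thesis using \<tau>_edge by simp
  qed
 qed
 \<comment> \<open>The value at \<open>e\<close> that makes \<open>\<rho>'\<close> vanish on the
   bases \<open>B0 - x + e\<close>: there \<open>t x\<close> cancels against
   \<open>\<tau> x\<close>, and \<open>\<kappa>\<close> absorbs the rest.\<close>
 define \<kappa> where "\<kappa> = c0 + sum t B0 + t e"
 define \<tau>' where "\<tau>' = \<tau>(e := \<kappa>)"
 define \<rho>' where "\<rho>' B = \<rho> B - (- m + sum \<tau>' B)" for B
 let ?C = "{B : \<B>. e : B --> B Int Y = {}}"
 have hom: "solves (\<lambda>S a b c d. 0) ?C \<rho>'"
  unfolding \<rho>'_def by (rule solves_add_weights[OF homogeneous]) (use finite_basis in blast)
 have zero0: "\<rho>' B \<doteq> 0" if "B : \<B>" "e ~: B" for B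
 proof -
  have "sum \<tau>' B = sum \<tau> B" using that(2) by (intro sum.cong) (auto simp: \<tau>'_def)
  thus ?thesis unfolding \<rho>'_def
   by (intro cg_lin2[OF trivial[OF that] cg_sym[OF \<tau>_sum[OF that]]]) simp
 qed
 have sum': "sum f (e+:(B0 - {x})) = f e + sum f B0 - f x" if "x : B0" for x and f :: "'e => 'v"
  using that fin B0 by (simp add: sum_diff1)
 have zeroX: "\<rho>' (e+:(B0 - {x})) \<doteq> 0" if "x : X" for x
 proof -
  have x: "x : B0" "(e+:(B0 - {x})) : \<B>" using that by (auto simp: X_def edge_def)
  have "(e+:(B0 - {x})) Int Y = {}" using B0 e_notin_Y by blast
  with weights[OF x(2)] have w: "\<rho> (e+:(B0 - {x})) \<doteq> c0 + (t e + sum t B0 - t x)" using sum'[OF x(1)] by simp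
  have "sum \<tau>' (e+:(B0 - {x})) = \<kappa> + (sum \<tau> B0 - \<tau> x)"
  proof -
   have "sum \<tau>' (e+:(B0 - {x})) = \<tau>' e + sum \<tau>' B0 - \<tau>' x" by (rule sum'[OF x(1)])
   moreover have "sum \<tau>' B0 = sum \<tau> B0" using B0 by (intro sum.cong) (auto simp: \<tau>'_def)
   moreover have "\<tau>' x = \<tau> x" using x B0 by (auto simp: \<tau>'_def)
   ultimately show ?thesis by (simp add: \<tau>'_def)
  qed
  thus ?thesis unfolding \<rho>'_def
   by (intro cg_lin2[OF w \<tau>_X[OF that]]) (simp add: \<kappa>_def m_def algebra_simps)
 qed
 \<comment> \<open>On the bases through \<open>e\<close> that avoid \<open>Y\<close>,
   \<open>\<rho>'\<close> is given by weights \<open>t1\<close>. Every basis next to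
   \<open>?A\<close> is either some \<open>B0 - r + e\<close> or completes a square whose other
   three values are known to vanish. Hence \<open>t1\<close> is constant along the edges at
   \<open>?A\<close>, and \<open>sum_weights_const\<close> applies.\<close>
 have zero1: "\<rho>' B \<doteq> 0" if B: "B : \<B>" "e : B" "B Int Y = {}" for B
 proof -
  let ?B1 = "interval \<B> {e} Y"
  from exchange2[OF B0(1) B(1,2) B0(2)] obtain x0 where x0: "x0 : B0" "(e+:(B0 - {x0})) : \<B>" by blast
  hence x0X: "x0 : X" using B0 by (simp add: X_def edge_def)
  let ?A = "(e+:(B0 - {x0}))"
  have A: "?A : ?B1" using x0 B0 e_notin_Y by (auto simp: interval_def)
  define t1 where "t1 z = t z - \<tau>' z" for z
  have w: "\<rho>' B \<doteq> c0 + m + sum t1 B" if "B : ?B1" for B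
   using weights[of B] that cg_lin1[of "\<rho> B" "c0 + sum t B" "\<rho>' B" "c0 + m + sum t1 B"]
   by (simp add: interval_def \<rho>'_def t1_def sum_subtractf algebra_simps)
  have "t1 r \<doteq> t1 c" if "edge ?B1 ?A r c" for r c
  proof -
   let ?T = "(c+:(?A - {r}))"
   have r: "r : ?A" "c ~: ?A" "?T : ?B1" using that by (auto simp: edge_def)
   hence r': "r ~= e" "c ~= e" "r : B0" "r ~= x0" "c ~: Y" "?T : \<B>" "e : ?T" "?T Int Y = {}"
    by (auto simp: interval_def)
   have "\<rho>' ?T \<doteq> 0"
   proof (cases "c = x0")
    case True
    hence T: "?T = (e+:(B0 - {r}))" using x0 r' B0 by auto
    hence "r : X" using r' B0 by (simp add: X_def edge_def)
    from zeroX[OF this] show ?thesis unfolding T .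
   next
    case False
    hence cB: "c ~: B0" using r by auto
    have T: "?T = (e+:c+:(B0 - {x0, r}))" using False r' by auto
    have S: "(r+:(B0 - {x0, r})) = B0 - {x0}" "(x0+:(B0 - {x0, r})) = B0 - {r}"
    "(x0+:(B0 - {x0})) = B0" "(r+:(B0 - {r})) = B0"
    using x0 r' by auto
    from matching[OF B0(1) r'(6)[unfolded T] x0(1) r'(3) B0(2) cB] r'
    consider "edge \<B> B0 x0 e" "edge \<B> B0 r c" | "edge \<B> B0 x0 c" "edge \<B> B0 r e" by blast
    thus ?thesis
    proof cases
    case 1
    have *: "(c+:(B0 - {r})) : \<B>" using 1 by (simp add: edge_def)
    have "square ?C (B0 - {x0, r}) x0 e r c"
    unfolding square_def S insert_commute[of x0 c] mem_Collect_eq T[symmetric]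
    using x0 r' B0 cB * A by (auto simp: interval_def)
    from hom[unfolded solves_def, rule_format, OF this]
    have "\<rho>' B0 + \<rho>' ?T \<doteq> 0 + (\<rho>' (c+:(B0 - {r})) + \<rho>' ?A)"
    unfolding S insert_commute[of x0 c] T[symmetric] .
    moreover have "\<rho>' B0 \<doteq> 0" "\<rho>' (c+:(B0 - {r})) \<doteq> 0" "\<rho>' ?A \<doteq> 0"
    using zero0[OF B0(1,2)] zero0[OF *] B0 r' zeroX[OF x0X] by auto
    ultimately show ?thesis
    using cg_lin4[of "\<rho>' B0 + \<rho>' ?T" "0 + (\<rho>' (c+:(B0 - {r})) + \<rho>' ?A)" 0 "\<rho>' B0"
    "\<rho>' (c+:(B0 - {r}))" 0 "\<rho>' ?A" 0 "\<rho>' ?T" 0] cg_sym by simp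
    next
    case 2
    have *: "(c+:(B0 - {x0})) : \<B>" "(e+:(B0 - {r})) : \<B>" using 2 by (auto simp: edge_def)
    have rX: "r : X" using 2 by (simp add: X_def)
    have "square ?C (B0 - {x0, r}) r e x0 c"
    unfolding square_def S insert_commute[of r c] mem_Collect_eq T[symmetric]
    using x0 r' B0 cB * e_notin_Y by auto
    from hom[unfolded solves_def, rule_format, OF this]
    have "\<rho>' B0 + \<rho>' ?T \<doteq> 0 + (\<rho>' (c+:(B0 - {x0})) + \<rho>' (e+:(B0 - {r})))"
    unfolding S insert_commute[of r c] T[symmetric] .
    moreover have "\<rho>' B0 \<doteq> 0" "\<rho>' (c+:(B0 - {x0})) \<doteq> 0" "\<rho>' (e+:(B0 - {r})) \<doteq> 0"
    using zero0[OF B0(1,2)] zero0[OF *(1)] B0 r' zeroX[OF rX] by auto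
    ultimately show ?thesis
    using cg_lin4[of "\<rho>' B0 + \<rho>' ?T" "0 + (\<rho>' (c+:(B0 - {x0})) + \<rho>' (e+:(B0 - {r})))" 0 "\<rho>' B0"
    "\<rho>' (c+:(B0 - {x0}))" 0 "\<rho>' (e+:(B0 - {r}))" 0 "\<rho>' ?T" 0] cg_sym by simp
    qed
   qed
   hence zT: "0 \<doteq> \<rho>' ?T" by (rule cg_sym)
   have "finite ?A" using fin by simp
   hence "sum t1 ?T = t1 c + sum t1 ?A - t1 r"
    using r by (simp add: sum_diff1 del: sum.insert_if insert_Diff_single)
   hence "t1 r - t1 c = (c0 + m + sum t1 ?A - \<rho>' ?A) + (\<rho>' ?A - 0) + (0 - \<rho>' ?T) + (\<rho>' ?T - (c0 + m + sum t1 ?T))"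
    by (simp add: algebra_simps)
   from cg_lin4[OF cg_sym[OF w[OF A]] zeroX[OF x0X] zT w[OF r(3)] this] show ?thesis .
  qed
  hence "sum t1 B \<doteq> sum t1 ?A"
   using sum_weights_const[OF interval_basis_family[OF basis_family_axioms] A, of B t1] B by (simp add: interval_def)
  thus ?thesis
   using cg_lin4[of "\<rho>' B" "c0 + m + sum t1 B" "sum t1 B" "sum t1 ?A" "c0 + m + sum t1 ?A" "\<rho>' ?A" "\<rho>' ?A" 0 "\<rho>' B" 0]
    w[of B] cg_sym[OF w[OF A]] zeroX[OF x0X] B by (simp add: interval_def)
 qed
 have "\<rho> B \<doteq> - m + sum \<tau>' B" if "B : \<B>" "e : B --> B Int Y = {}" for B
  using zero0[of B] zero1[of B] that cg_lin1[of "\<rho>' B" 0 "\<rho> B" "- m + sum \<tau>' B"] by (auto simp: \<rho>'_def)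
 thus ?thesis by blast
qed

lemma active_finite: "basis_family \<B> ==> finite (active \<B>)"
 by (rule finite_subset[OF _ basis_family.finite_elements[of \<B>]]) (auto simp: active_def)

lemma active_interval_subset: "active (interval \<B> I J) <= active \<B> - (I Un J)"
 by (auto simp: active_def interval_def)

lemma active_interval_less:
 assumes "basis_family \<B>" "e : active \<B>" "e : I Un J"
 shows "card (active (interval \<B> I J)) < card (active \<B>)"
 by (rule psubset_card_mono[OF active_finite[OF assms(1)]]) (use active_interval_subset[of \<B> I J] assms in blast)

context mod_subgroup
begin

text \<open>Uniqueness: functions on the bases with the same cross ratios differ by a rescaling.
  Once \<open>\<rho>\<close> is normalized to vanish on the deletion of \<open>e\<close>, the
  weights found on the contraction are matched with that normalization by
  \<open>extends_to_weights\<close>.\<close>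

theorem homogeneous_weights:
 assumes "basis_family \<B>" "solves (\<lambda>S a b c d. 0) \<B> \<rho>"
 shows "EX k \<tau>. ALL B:\<B>. \<rho> B \<doteq> k + sum \<tau> B"
 using assms
proof (induction "card (active \<B>)" arbitrary: \<B> \<rho> rule: less_induct)
 case less
 interpret basis_family \<B> by fact
 show ?case
 proof (cases "active \<B> = {}")
  case True
  have "B = B'" if "B : \<B>" "B' : \<B>" for B B' using True that by (auto simp: active_def)
  thus ?thesis by (intro exI[of _ "\<rho> (SOME B. B : \<B>)"] exI[of _ "\<lambda>_. 0"]) (metis cg_refl someI add.right_neutral sum.neutral_const)
 next
  case False
  then obtain e where e: "e : active \<B>" by blast
  let ?D = "interval \<B> {} {e}" and ?C = "interval \<B> {e} {}"
  have sub: "?D <= \<B>" "?C <= \<B>" by (auto simp: interval_def)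
  have "EX k \<tau>. ALL B:?D. \<rho> B \<doteq> k + sum \<tau> B"
   by (rule less.hyps) (use e less.prems interval_basis_family active_interval_less[OF less.prems(1) e] sub in \<open>auto intro: solves_mono\<close>)
  then obtain k \<tau> where k: "ALL B:?D. \<rho> B \<doteq> k + sum \<tau> B" by blast
  define \<rho>' where "\<rho>' B = \<rho> B - (k + sum \<tau> B)" for B
  have hom: "solves (\<lambda>S a b c d. 0) \<B> \<rho>'" unfolding \<rho>'_def
   by (rule solves_add_weights[OF less.prems(2)]) (rule finite_basis)
  have "EX k \<tau>. ALL B:?C. \<rho>' B \<doteq> k + sum \<tau> B"
   by (rule less.hyps) (use e less.prems hom interval_basis_family active_interval_less[OF less.prems(1) e] sub in \<open>auto intro: solves_mono\<close>)
  then obtain c0 t where t: "ALL B:?C. \<rho>' B \<doteq> c0 + sum t B" by blast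
  interpret partial_solution K \<B> e "{}" \<rho>' c0 t
  proof
   show "solves (\<lambda>S a b c d. 0) {B : \<B>. e : B --> B Int {} = {}} \<rho>'" using hom by simp
   show "\<rho>' B \<doteq> 0" if "B : \<B>" "e ~: B" for B
    using k that cg_lin1[of "\<rho> B" "k + sum \<tau> B" "\<rho>' B" 0] by (auto simp: interval_def \<rho>'_def)
   show "\<rho>' B \<doteq> c0 + sum t B" if "B : \<B>" "e : B" for B
    using t that by (auto simp: interval_def)
  qed auto
  obtain B0 where "B0 : \<B>" "e ~: B0" using e by (auto simp: active_def)
  from extends_to_weights[OF this] obtain k' \<tau>' where "ALL B:\<B>. \<rho>' B \<doteq> k' + sum \<tau>' B" by auto
  hence "\<rho> B \<doteq> (k + k') + sum (\<lambda>x. \<tau> x + \<tau>' x) B" if "B : \<B>" for B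
   using that cg_lin1[of "\<rho>' B" "k' + sum \<tau>' B" "\<rho> B" "(k + k') + sum (\<lambda>x. \<tau> x + \<tau>' x) B"]
   by (simp add: \<rho>'_def sum.distrib algebra_simps)
  thus ?thesis by blast
 qed
qed

text \<open>Used where only the deletions of \<open>e\<close> and of \<open>y\<close> are under
  control. Bases through both are left out, and uniqueness survives because some basis avoids
  both.\<close>

theorem homogeneous_weights_pair:
 assumes "basis_family \<B>" and hom: "solves (\<lambda>S a b c d. 0) {B : \<B>. ~ (e : B & y : B)} \<rho>"
  and "e ~= y" "B0 : \<B>" "e ~: B0" "y ~: B0"
 shows "EX k \<tau>. ALL B:\<B>. ~ (e : B & y : B) --> \<rho> B \<doteq> k + sum \<tau> B"
proof -
 interpret basis_family \<B> by fact
 let ?D = "interval \<B> {} {e}" and ?C = "interval \<B> {e} {y}" and ?P = "{B : \<B>. ~ (e : B & y : B)}"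
 have sub: "?D <= ?P" "?C <= ?P" by (auto simp: interval_def)
 obtain k \<tau> where k: "ALL B:?D. \<rho> B \<doteq> k + sum \<tau> B"
  using homogeneous_weights[OF interval_basis_family[OF assms(1)] solves_mono[OF hom sub(1)]] by blast
 define \<rho>' where "\<rho>' B = \<rho> B - (k + sum \<tau> B)" for B
 have hom': "solves (\<lambda>S a b c d. 0) ?P \<rho>'" unfolding \<rho>'_def
  by (rule solves_add_weights[OF hom]) (use finite_basis in blast)
 obtain c0 t where t: "ALL B:?C. \<rho>' B \<doteq> c0 + sum t B"
  using homogeneous_weights[OF interval_basis_family[OF assms(1)] solves_mono[OF hom' sub(2)]] by blast
 have eq: "?P = {B : \<B>. e : B --> B Int {y} = {}}" by auto
 interpret partial_solution K \<B> e "{y}" \<rho>' c0 t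
 proof
  show "solves (\<lambda>S a b c d. 0) {B : \<B>. e : B --> B Int {y} = {}} \<rho>'" using hom' by (simp only: eq)
  show "\<rho>' B \<doteq> 0" if "B : \<B>" "e ~: B" for B
   using k that cg_lin1[of "\<rho> B" "k + sum \<tau> B" "\<rho>' B" 0] by (auto simp: interval_def \<rho>'_def)
  show "\<rho>' B \<doteq> c0 + sum t B" if "B : \<B>" "e : B" "B Int {y} = {}" for B
   using t that by (auto simp: interval_def)
 qed (use assms in auto)
 have "B0 Int {y} = {}" using assms by simp
 from extends_to_weights[OF assms(4,5) this] obtain k' \<tau>'
  where *: "ALL B:\<B>. (e : B --> B Int {y} = {}) --> \<rho>' B \<doteq> k' + sum \<tau>' B" by blast
 have "\<rho> B \<doteq> (k + k') + sum (\<lambda>x. \<tau> x + \<tau>' x) B" if "B : \<B>" "~ (e : B & y : B)" for B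
  using * that cg_lin1[of "\<rho>' B" "k' + sum \<tau>' B" "\<rho> B" "(k + k') + sum (\<lambda>x. \<tau> x + \<tau>' x) B"]
  by (simp add: \<rho>'_def sum.distrib algebra_simps)
 thus ?thesis by blast
qed

end

section \<open>A pair of elements and the defects of a solution on its two deletions\<close>

lemma activeI: "x : B ==> B : \<B> ==> x ~: B' ==> B' : \<B> ==> x : active \<B>"
 by (auto simp: active_def)

text \<open>The contraction of \<open>z\<close> if \<open>v\<close> holds and the deletion
  otherwise; with \<open>v\<close> as a parameter both are treated at once.\<close>

definition slice :: "'e set set => 'e => bool => 'e set set" where
 "slice \<B> z v = {B : \<B>. (z : B) = v}"

lemma slice_interval: "slice \<B> z v = (if v then interval \<B> {z} {} else interval \<B> {} {z})"
 by (auto simp: slice_def interval_def)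

lemma slice_basis_family: "basis_family \<B> ==> basis_family (slice \<B> z v)"
 by (simp add: slice_interval interval_basis_family)

lemma square_slice:
 assumes "square \<B> S a b c d" "z ~: {a, b, c, d}" "(z : S) = v"
 shows "square (slice \<B> z v) S a b c d"
 using assms by (auto simp: square_def slice_def)

text \<open>The function \<open>g\<close> already solves the equations on the deletions of
  \<open>e\<close> and of \<open>y\<close>. What remains are the squares that involve both elements
  and the values on bases through both.\<close>

locale pair_extension = mod_subgroup K + basis_family \<B>
 for K :: "'v::ab_group_add set" and \<B> :: "'e set set" +
 fixes W :: "('e, 'v) label" and e y :: 'e and g :: "'e set => 'v"
 assumes minors: "!!z v. z : active \<B> ==> EX f. solves W (slice \<B> z v) f"
  and large: "card (active \<B>) \<ge> 6"
  and ey: "e ~= y" "e : active \<B>" "y : active \<B>"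
  and sol_e: "solves W (slice \<B> e False) g" and sol_y: "solves W (slice \<B> y False) g"
begin

text \<open>How far \<open>g\<close> is from solving the square of \<open>a\<close>,
  \<open>b\<close> against \<open>e\<close>, \<open>y\<close>. Two of its bases contain
  \<open>e\<close> and the other two contain \<open>y\<close>, so it survives in neither
  deletion.\<close>

definition defect :: "'e set => 'e => 'e => 'v" where
 "defect S a b = g (a+:e+:S) + g (b+:y+:S)
  - (W S a b e y + (g (a+:y+:S) + g (b+:e+:S)))"

abbreviation "ey_square S a b \<equiv> square \<B> S a b e y"

lemma exists_active:
 assumes "finite A" "card A <= 5" shows "EX z:active \<B>. z ~: A"
proof (rule ccontr)
 assume "~ ?thesis"
 hence "active \<B> <= A" by blast
 with card_mono[OF assms(1) this] large assms(2) show False by simp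
qed

text \<open>A slice has a full solution \<open>f\<close>. Its difference from \<open>g\<close> is
  given by weights \<open>t1\<close> on bases without \<open>e\<close> and by \<open>t2\<close> on
  bases without \<open>y\<close>, so a defect is a difference of values of \<open>t1 - t2\<close>.
  On bases without both, the two weight sums differ by a constant, which makes
  \<open>t1 - t2\<close> constant along edges.\<close>

lemma local_potential:
 assumes z: "z : active \<B>" "z ~= e" "z ~= y"
 shows "EX l. (ALL S a b. square (slice \<B> z v) S a b e y --> defect S a b \<doteq> l a - l b)
  & (ALL B r c. B : slice \<B> z v --> e ~: B --> y ~: B --> edge (slice \<B> z v) B r c --> c ~= e --> c ~= y --> l r \<doteq> l c)"
proof -
 let ?N = "slice \<B> z v"
 obtain f where f: "solves W ?N f" using minors[OF z(1)] by blast
 have weights: "EX k \<tau>. ALL B:slice ?N x False. f B - g B \<doteq> k + sum \<tau> B" if "solves W (slice \<B> x False) g" for x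
 proof (rule homogeneous_weights)
  show "basis_family (slice ?N x False)" by (intro slice_basis_family basis_family_axioms)
  have "slice ?N x False <= slice \<B> x False" "slice ?N x False <= ?N" by (auto simp: slice_def)
  from solves_diff[OF solves_mono[OF f this(2)] solves_mono[OF that this(1)]]
  show "solves (\<lambda>S a b c d. 0) (slice ?N x False) (\<lambda>B. f B - g B)" by simp
 qed
 obtain k1 t1 where t1: "!!B. B : ?N ==> e ~: B ==> f B - g B \<doteq> k1 + sum t1 B"
  using weights[OF sol_e] by (auto simp: slice_def)
 obtain k2 t2 where t2: "!!B. B : ?N ==> y ~: B ==> f B - g B \<doteq> k2 + sum t2 B"
  using weights[OF sol_y] by (auto simp: slice_def)
 have fin: "finite B" if "B : ?N" for B using that finite_basis by (simp add: slice_def)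
 define l where "l x = t1 x - t2 x" for x
 have "defect S a b \<doteq> l a - l b" if sq: "square ?N S a b e y" for S a b
 proof -
  note sq' = sq[unfolded square_def]
  have S: "finite S" by (rule square_finite[OF sq fin])
  have *: "f (a+:e+:S) - g (a+:e+:S) \<doteq> k2 + sum t2 (a+:e+:S)"
   "f (b+:e+:S) - g (b+:e+:S) \<doteq> k2 + sum t2 (b+:e+:S)"
   "f (a+:y+:S) - g (a+:y+:S) \<doteq> k1 + sum t1 (a+:y+:S)"
   "f (b+:y+:S) - g (b+:y+:S) \<doteq> k1 + sum t1 (b+:y+:S)"
   using sq' ey by (auto intro!: t1 t2)
  from f[unfolded solves_def, rule_format, OF sq]
  have "f (a+:e+:S) + f (b+:y+:S) \<doteq> W S a b e y + (f (a+:y+:S) + f (b+:e+:S))" .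
  thus ?thesis
   by (rule cg_lin5[OF _ cg_sym[OF *(1)] *(2) *(3) cg_sym[OF *(4)]])
    (use S sq' in \<open>simp add: defect_def l_def algebra_simps\<close>)
 qed
 moreover have "l r \<doteq> l c" if B: "B : ?N" "e ~: B" "y ~: B" and ed: "edge ?N B r c" and c: "c ~= e" "c ~= y" for B r c
 proof -
  let ?B = "(c+:(B - {r}))"
  have rc: "r : B" "c ~: B" "?B : ?N" using ed by (auto simp: edge_def)
  have s: "sum t ?B = t c + sum t B - t r" for t :: "'e => 'v"
   using rc fin[OF B(1)] by (simp add: sum_diff1)
  have B': "e ~: ?B" "y ~: ?B" using B c by auto
  show ?thesis
   by (rule cg_lin4[OF cg_sym[OF t1[OF B(1,2)]] t2[OF B(1,3)] t1[OF rc(3) B'(1)] cg_sym[OF t2[OF rc(3) B'(2)]]])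
    (simp add: s l_def algebra_simps)
 qed
 ultimately show ?thesis by blast
qed

text \<open>The edges along which the potential of the slice is known to be constant. Successive
  links in a chain may belong to different bases.\<close>

definition link :: "'e => bool => 'e => 'e => bool" where
 "link z v x w \<longleftrightarrow> (EX B:\<B>. (z : B) = v & e ~: B & y ~: B & x ~: {e, y, z} & w ~: {e, y, z}
  & (edge \<B> B x w \<or> edge \<B> B w x))"

lemma potential:
 assumes z: "z : active \<B>" "z ~= e" "z ~= y"
 obtains l where "!!S a b. ey_square S a b ==> z ~= a ==> z ~= b ==> (z : S) = v ==> defect S a b \<doteq> l a - l b"
  "!!x w. (link z v)\<^sup>*\<^sup>* x w ==> l x \<doteq> l w"
proof -
 obtain l where l: "!!S a b. square (slice \<B> z v) S a b e y ==> defect S a b \<doteq> l a - l b"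
  "!!B r c. B : slice \<B> z v ==> e ~: B ==> y ~: B ==> edge (slice \<B> z v) B r c ==> c ~= e ==> c ~= y ==> l r \<doteq> l c"
  using local_potential[OF z] by metis
 have step: "l x \<doteq> l w" if link: "link z v x w" for x w
 proof -
  from link obtain B where B: "B : \<B>" "(z : B) = v" "e ~: B" "y ~: B" "x ~: {e, y, z}" "w ~: {e, y, z}"
   "edge \<B> B x w \<or> edge \<B> B w x" unfolding link_def by blast
  hence "edge (slice \<B> z v) B x w \<or> edge (slice \<B> z v) B w x" by (auto simp: edge_def slice_def)
  thus ?thesis using l(2)[of B x w] l(2)[of B w x] B by (auto simp: slice_def intro: cg_sym)
 qed
 have *: "l x \<doteq> l w" if "(link z v)\<^sup>*\<^sup>* x w" for x w
  using that by (induction rule: rtranclp_induct) (auto intro: cg_trans step)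
 show ?thesis
 proof (rule that[of l])
  fix S a b assume "ey_square S a b" "z ~= a" "z ~= b" "(z : S) = v"
  thus "defect S a b \<doteq> l a - l b" using z by (intro l(1) square_slice) auto
 qed (rule *)
qed

lemma defect_zero:
 assumes "z : active \<B>" "ey_square S a b" "z ~: {a, b, e, y}" "(link z (z : S))\<^sup>*\<^sup>* a b"
 shows "defect S a b \<doteq> 0"
proof -
 obtain l where l: "!!S' a b. ey_square S' a b ==> z ~= a ==> z ~= b ==> (z : S') = (z : S) ==> defect S' a b \<doteq> l a - l b"
  "!!x w. (link z (z : S))\<^sup>*\<^sup>* x w ==> l x \<doteq> l w"
  using potential[of z "z : S"] assms by (metis insertCI)
 show ?thesis by (rule cg_lin2[OF l(1) l(2)[OF assms(4)]]) (use assms in auto)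
qed

lemma defect_add:
 assumes "z : active \<B>" "ey_square S a b" "ey_square S' b c" "ey_square S'' a c" "z ~: {a, b, c, e, y}"
  "(z : S) = v" "(z : S') = v" "(z : S'') = v"
 shows "defect S'' a c \<doteq> defect S a b + defect S' b c"
proof -
 obtain l where l: "!!S a b. ey_square S a b ==> z ~= a ==> z ~= b ==> (z : S) = v ==> defect S a b \<doteq> l a - l b"
  using potential[of z v] assms by (metis insertCI)
 have *: "defect S a b \<doteq> l a - l b" "defect S' b c \<doteq> l b - l c" "defect S'' a c \<doteq> l a - l c"
  using assms by (auto intro!: l)
 show ?thesis by (rule cg_lin3[OF *(3) cg_sym[OF *(1)] cg_sym[OF *(2)]]) simp
qed

lemma defect_eq:
 assumes "z : active \<B>" "ey_square S a b" "ey_square S' a b" "z ~: {a, b, e, y}" "(z : S) = v" "(z : S') = v"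
 shows "defect S a b \<doteq> defect S' a b"
proof -
 obtain l where l: "!!S a b. ey_square S a b ==> z ~= a ==> z ~= b ==> (z : S) = v ==> defect S a b \<doteq> l a - l b"
  using potential[of z v] assms by (metis insertCI)
 have *: "defect S a b \<doteq> l a - l b" "defect S' a b \<doteq> l a - l b"
  using assms by (auto intro!: l)
 show ?thesis by (rule cg_trans[OF *(1) cg_sym[OF *(2)]])
qed

lemma ey_square_swap: "ey_square S a b ==> ey_square S b a"
 by (auto simp: square_def)

text \<open>If \<open>a\<close> and \<open>b\<close> are parallel over \<open>S\<close>, they can be
  exchanged for each other in a basis \<open>S + a + c\<close> with \<open>c\<close> from
  \<open>B0\<close>, so they are linked on every slice at an active \<open>z\<close> outside
  \<open>{a, b, c, e, y}\<close>.\<close>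

lemma defect_parallel:
 assumes sq: "ey_square S a b" and n: "(a+:b+:S) ~: \<B>"
  and B0: "B0 : \<B>" "e ~: B0" "y ~: B0"
 shows "defect S a b \<doteq> 0"
proof -
 note sq' = sq[unfolded square_def]
 let ?Say = "(a+:y+:S)" and ?Sby = "(b+:y+:S)"
 have "y : ?Say" by simp
 from exchange1[OF _ B0(1) this B0(3)] sq' obtain c where c: "c : B0" "c ~: ?Say" "(c+:(?Say - {y})) : \<B>" by blast
 have "(c+:(?Say - {y})) = (a+:c+:S)" using sq' by auto
 with c have ac: "(a+:c+:S) : \<B>" by simp
 have cc: "c ~: S" "c ~= a" "c ~= e" "c ~= y" using c B0 by auto
 have "c ~= b" using ac n by (metis insert_commute)
 have "y : ?Sby" "y ~: (a+:c+:S)" using sq' cc by auto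
 from exchange1[OF _ ac this] sq' obtain x where x: "x : (a+:c+:S)" "x ~: ?Sby" "(x+:(?Sby - {y})) : \<B>" by blast
 have del: "?Sby - {y} = (b+:S)" using sq' by auto
 have "x ~= a" using x(3) n unfolding del by auto
 hence "x = c" using x(1,2) by auto
 hence bc: "(b+:c+:S) : \<B>" using x(3) unfolding del by (simp add: insert_commute[of c b])
 have "card {a, b, c, e, y} <= 5" by (simp add: card_insert_if)
 then obtain z where z: "z : active \<B>" "z ~: {a, b, c, e, y}"
  using exists_active[of "{a, b, c, e, y}"] by auto
 have "link z (z : S) a b"
  unfolding link_def
 proof (intro bexI conjI)
  show "(a+:c+:S) : \<B>" by fact
  have "(b+:((a+:c+:S) - {a})) = (b+:c+:S)" using sq' cc by auto
  thus "edge \<B> (a+:c+:S) a b \<or> edge \<B> (a+:c+:S) b a"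
   using bc sq' \<open>c ~= b\<close> by (auto simp: edge_def)
 qed (use z cc sq' in auto)
 thus ?thesis using z by (intro defect_zero[OF z(1) sq]) auto
qed

text \<open>Values on bases that contain both \<open>e\<close> and \<open>y\<close> are forced by squares with one such basis.\<close>

definition valid :: "'e set set => 'e set => 'e => 'e => bool" where
 "valid \<C> S a b \<longleftrightarrow> e ~: S & y ~: S & (e+:y+:S) : \<C> & a ~: S & b ~: S & distinct [a, b, e, y]
  & (a+:b+:S) : \<C> & (a+:y+:S) : \<C> & (b+:e+:S) : \<C>"

definition forced :: "'e set => 'e => 'e => 'v" where
 "forced S a b = W S a e b y + (g (a+:y+:S) + g (b+:e+:S)) - g (a+:b+:S)"

lemma valid_square: "valid \<C> S a b ==> square \<C> S a e b y"
 by (auto simp: valid_def square_def insert_commute[of e b])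

text \<open>Exchanging \<open>e\<close> and then \<open>y\<close> for elements \<open>a\<close> and
  \<open>b\<close> of \<open>B0\<close> gives all the bases required except perhaps
  \<open>S + b + e\<close>. If that is not a basis, exchange shows that the roles of
  \<open>a\<close> and \<open>b\<close> can be swapped.\<close>

lemma valid_exists:
 assumes "basis_family \<C>" and T: "(e+:y+:S) : \<C>" "e ~: S" "y ~: S"
  and B0: "B0 : \<C>" "e ~: B0" "y ~: B0"
 shows "EX a b. valid \<C> S a b"
proof -
 interpret C: basis_family \<C> by fact
 let ?T = "(e+:y+:S)"
 have ey': "e : ?T" "y : ?T" by auto
 from C.exchange1[OF T(1) B0(1) ey'(1) B0(2)] obtain a where a: "a : B0" "a ~: ?T" "(a+:(?T - {e})) : \<C>" by blast
 have "?T - {e} = (y+:S)" using T ey by auto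
 with a have ay: "(a+:y+:S) : \<C>" by simp
 have "y : (a+:y+:S)" by simp
 from C.exchange1[OF ay B0(1) this B0(3)] obtain b
  where b: "b : B0" "b ~: (a+:y+:S)" "(b+:((a+:y+:S) - {y})) : \<C>" by blast
 have "(a+:y+:S) - {y} = (a+:S)" using T a by auto
 with b have ab: "(a+:b+:S) : \<C>" by (simp add: insert_commute[of a b])
 have d: "a ~= e" "a ~= y" "b ~= e" "b ~= y" "a ~= b" "a ~: S" "b ~: S" using a b B0 by auto
 show ?thesis
 proof (cases "(b+:e+:S) : \<C>")
  case True
  thus ?thesis using T ay ab d ey by (intro exI[of _ a] exI[of _ b]) (auto simp: valid_def)
 next
  case be: False
  have "e : ?T" "e ~: (a+:b+:S)" using T d ey by auto
  have "y : ?T" "y ~: (a+:b+:S)" using T d ey by auto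
  from C.exchange1[OF T(1) ab this] obtain x where "x : (a+:b+:S)" "x ~: ?T" "(x+:(?T - {y})) : \<C>" by blast
  moreover have "?T - {y} = (e+:S)" using T ey by auto
  ultimately have ae: "(a+:e+:S) : \<C>" using be by auto
  have "(b+:y+:S) : \<C>"
  proof -
   have "b : (a+:b+:S)" "b ~: ?T" using d by auto
   from C.exchange2[OF T(1) ab this] obtain x where x: "x : ?T" "x ~: (a+:b+:S)" "(b+:(?T - {x})) : \<C>" by blast
   hence "x = e \<or> x = y" by auto
   moreover have "x ~= y" using x(3) be \<open>?T - {y} = insert e S\<close> by metis
   ultimately have "x = e" by simp
   thus ?thesis using x \<open>?T - {e} = insert y S\<close> by simp
  qed
  moreover have "(b+:a+:S) : \<C>" using ab by (simp add: insert_commute[of b a])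
  ultimately have "valid \<C> S b a" using T ae d ey unfolding valid_def by simp
  thus ?thesis by blast
 qed
qed

text \<open>Without defects, \<open>g\<close> solves all squares of bases that do not contain both
  \<open>e\<close> and \<open>y\<close>. A solution on a slice, normalized to agree with
  \<open>g\<close>, predicts the remaining values there; predictions from different slices agree
  because all of them are given by \<open>forced\<close>.\<close>

theorem extend_pair:
 assumes no_defect: "!!S a b. ey_square S a b ==> defect S a b \<doteq> 0"
  and W_sym: "!!S a b c d. square \<B> S a b c d ==> W S c d a b \<doteq> W S a b c d"
   "!!S a b c d. square \<B> S a b c d ==> W S a b d c \<doteq> - W S a b c d"
  and avoid: "!!z v. z : active \<B> ==> z ~= e ==> z ~= y ==> EX B:\<B>. (z : B) = v & e ~: B & y ~: B"
 shows "EX h. solves W \<B> h"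
proof -
 define P where "P \<C> = {B : \<C>. ~ (e : B & y : B)}" for \<C> :: "'e set set"
 have g_ey: "g (a+:e+:S) + g (b+:y+:S)
   \<doteq> W S a b e y + (g (a+:y+:S) + g (b+:e+:S))" if "ey_square S a b" for S a b
  using no_defect[OF that] by (simp add: defect_def cg_def)
 have gP: "solves W (P \<B>) g"
  unfolding solves_def
 proof (intro allI impI)
  fix S a b c d assume s: "square (P \<B>) S a b c d"
  let ?goal = "g (a+:c+:S) + g (b+:d+:S)
   \<doteq> W S a b c d + (g (a+:d+:S) + g (b+:c+:S))"
  note s' = s[unfolded square_def]
  have sq: "square \<B> S a b c d" using s by (auto simp: square_def P_def)
  have sq2: "square \<B> S c d a b" "square \<B> S a b d c" "square \<B> S d c a b" "square \<B> S c d b a"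
   using sq by (auto simp: square_def insert_commute[of c a] insert_commute[of c b] insert_commute[of d a] insert_commute[of d b])
  note comm = insert_commute[of c a] insert_commute[of c b] insert_commute[of d a] insert_commute[of d b]
  consider "e ~: S Un {a, b, c, d}" | "y ~: S Un {a, b, c, d}" | "e : S Un {a, b, c, d}" "y : S Un {a, b, c, d}" by blast
  thus ?goal
  proof cases
   case 1
   hence "square (slice \<B> e False) S a b c d" using sq by (intro square_slice) auto
   thus ?thesis using sol_e by (simp add: solves_def)
  next
   case 2
   hence "square (slice \<B> y False) S a b c d" using sq by (intro square_slice) auto
   thus ?thesis using sol_y by (simp add: solves_def)
  next
   case 3
   have n: "~ (e : (u+:v+:S) & y : (u+:v+:S))" if "u : {a, b}" "v : {c, d}" for u v
    using s' that by (auto simp: P_def)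
   have "e ~: S" "y ~: S" using 3 n[of a c] n[of b d] by blast+
   hence "e = a & y = b \<or> e = b & y = a \<or> e = c & y = d \<or> e = d & y = c"
    using 3 n[of a c] n[of b d] n[of a d] n[of b c] ey by auto
   thus ?thesis
   proof (elim disjE conjE)
    assume "e = c" "y = d"
    thus ?thesis using g_ey sq by simp
   next
    assume ey': "e = d" "y = c"
    have g1: "g (a+:d+:S) + g (b+:c+:S)
    \<doteq> W S a b d c + (g (a+:c+:S) + g (b+:d+:S))"
    using g_ey[of S a b] sq2(2) unfolding ey' by blast
    show ?thesis
    by (rule cg_lin2[OF cg_sym[OF g1] cg_sym[OF W_sym(2)[OF sq]]]) (simp add: algebra_simps)
   next
    assume ey': "e = a" "y = b"
    have g1: "g (a+:c+:S) + g (b+:d+:S)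
    \<doteq> W S c d a b + (g (b+:c+:S) + g (a+:d+:S))"
    using g_ey[of S c d] sq2(1) unfolding ey' comm[symmetric] by blast
    show ?thesis
    by (rule cg_lin2[OF g1 W_sym(1)[OF sq]]) (simp add: algebra_simps)
   next
    assume ey': "e = b" "y = a"
    have g1: "g (b+:c+:S) + g (a+:d+:S)
    \<doteq> W S c d b a + (g (a+:c+:S) + g (b+:d+:S))"
    using g_ey[of S c d] sq2(4) unfolding ey' comm[symmetric] by blast
    show ?thesis
    by (rule cg_lin3[OF cg_sym[OF g1] cg_sym[OF W_sym(2)[OF sq2(1)]] W_sym(1)[OF sq]]) (simp add: algebra_simps)
   qed
  qed
 qed
 \<comment> \<open>The normalization is possible by \<open>homogeneous_weights_pair\<close>; the
   basis avoiding both \<open>e\<close> and \<open>y\<close> that it needs in the slice comes from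
   \<open>avoid\<close>.\<close>
 define F where "F z v = (SOME f. solves W (slice \<B> z v) f & (ALL B:P (slice \<B> z v). f B \<doteq> g B))" for z v
 have F: "solves W (slice \<B> z v) (F z v)" "!!B. B : P (slice \<B> z v) ==> F z v B \<doteq> g B"
  if z: "z : active \<B>" "z ~= e" "z ~= y" for z v
 proof -
  let ?N = "slice \<B> z v"
  obtain f where f: "solves W ?N f" using minors[OF z(1)] by blast
  have sub: "P ?N <= ?N" "P ?N <= P \<B>" by (auto simp: P_def slice_def)
  obtain B0 where B0: "B0 : \<B>" "(z : B0) = v" "e ~: B0" "y ~: B0" using avoid[OF z] by blast
  have "solves (\<lambda>S a b c d. 0) (P ?N) (\<lambda>B. f B - g B)"
   using solves_diff[OF solves_mono[OF f sub(1)] solves_mono[OF gP sub(2)]] by simp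
  then obtain k \<tau> where k: "ALL B:?N. ~ (e : B & y : B) --> f B - g B \<doteq> k + sum \<tau> B"
   using homogeneous_weights_pair[OF slice_basis_family[OF basis_family_axioms], of z v e y "\<lambda>B. f B - g B" B0] ey B0
   by (auto simp: P_def slice_def)
  have "solves W ?N (\<lambda>B. f B - (k + sum \<tau> B))"
   by (rule solves_add_weights[OF f]) (use finite_basis in \<open>simp add: slice_def\<close>)
  moreover have "f B - (k + sum \<tau> B) \<doteq> g B" if "B : P ?N" for B
   by (rule cg_lin1[OF k[rule_format, of B]]) (use that in \<open>auto simp: P_def\<close>)
  ultimately have "EX f. solves W ?N f & (ALL B:P ?N. f B \<doteq> g B)" by blast
  from someI_ex[OF this] show "solves W ?N (F z v)" "!!B. B : P ?N ==> F z v B \<doteq> g B"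
   unfolding F_def by blast+
 qed
 have F_forced: "F z (z : S) (e+:y+:S) \<doteq> forced S a b"
  if z: "z : active \<B>" "z ~: {a, b, e, y}" and v: "valid \<B> S a b" for z S a b
 proof -
  have z': "z ~= e" "z ~= y" using z by auto
  let ?N = "slice \<B> z (z : S)"
  have sq: "square ?N S a e b y" by (rule square_slice[OF valid_square[OF v]]) (use z in auto)
  have *: "F z (z : S) (a+:b+:S) \<doteq> g (a+:b+:S)"
   "F z (z : S) (a+:y+:S) \<doteq> g (a+:y+:S)"
   "F z (z : S) (b+:e+:S) \<doteq> g (b+:e+:S)"
   using v z by (auto intro!: F(2)[OF z(1) z'] simp: P_def slice_def valid_def)
  show ?thesis
   by (rule cg_lin4[OF F(1)[OF z(1) z', unfolded solves_def, rule_format, OF sq] cg_sym[OF *(1)] *(2,3)])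
    (simp add: forced_def insert_commute[of e b])
 qed
 \<comment> \<open>With \<open>e\<close> and \<open>y\<close> these are at most five elements, so a
   slice at one further active element contains both squares.\<close>
 have indep0: "forced S a b \<doteq> forced S a' b'"
  if "valid \<B> S a b" "valid \<B> S a' b'" "card {a, b, a', b'} <= 3" for S a b a' b'
 proof -
  have "card ({a, b, a', b'} Un {e, y}) <= 3 + 2" using that(3) card_Un_le[of "{a, b, a', b'}" "{e, y}"]
   by (rule_tac order_trans) (auto simp: card_insert_if)
  then obtain z where z: "z : active \<B>" "z ~: {a, b, a', b'} Un {e, y}"
   using exists_active[of "{a, b, a', b'} Un {e, y}"] by auto
  show ?thesis
   by (rule cg_trans[OF cg_sym[OF F_forced[OF z(1) _ that(1)]] F_forced[OF z(1) _ that(2)]]) (use z in auto)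
 qed
 have indep: "forced S a b \<doteq> forced S a' b'" if v: "valid \<B> S a b" "valid \<B> S a' b'" for S a b a' b'
 proof (cases "card {a, b, a', b'} <= 3")
  case True
  thus ?thesis using indep0 v by blast
 next
  case False
  hence d: "distinct [a, b, a', b']" by (auto simp: card_insert_if split: if_splits)
  note v' = v[unfolded valid_def]
  have three: "card {p, q, p', q'} <= 3" if "p = p' \<or> q = q' \<or> p = q' \<or> q = p'" for p q p' q' :: 'e
   using that by (auto simp: card_insert_if)
  consider "(a'+:b+:S) : \<B>" | "(a+:b'+:S) : \<B>"
   | "(a'+:b+:S) ~: \<B>" "(a+:b'+:S) ~: \<B>" by blast
  thus ?thesis
  proof cases
   case 1
   hence vv: "valid \<B> S a' b" using v' d by (auto simp: valid_def)
   show ?thesis by (rule cg_trans[OF indep0[OF v(1) vv three] indep0[OF vv v(2) three]]) simp_all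
  next
   case 2
   hence vv: "valid \<B> S a b'" using v' d by (auto simp: valid_def)
   show ?thesis by (rule cg_trans[OF indep0[OF v(1) vv three] indep0[OF vv v(2) three]]) simp_all
  next
   \<comment> \<open>Neither \<open>a', b\<close> nor \<open>a, b'\<close> completes
     \<open>S\<close> to a basis. Then exchange yields the bases \<open>S + b' + b\<close> and
     \<open>S + b' + y\<close>, so the pair \<open>b', b\<close> is a valid intermediate.\<close>
   case 3
   have ab': "(a'+:b'+:S) : \<B>" using v' by simp
   have a': "a' : (a'+:b'+:S)" "a' ~: (a+:b+:S)" "a' ~: (a+:y+:S)"
    using v' d by auto
   have del: "(a'+:b'+:S) - {a'} = (b'+:S)" using v' d by auto
   have "(b'+:b+:S) : \<B>"
   proof -
    obtain x where x: "x : (a+:b+:S)" "x ~: (a'+:b'+:S)" "(x+:b'+:S) : \<B>"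
    using exchange1[OF ab' _ a'(1,2)] v'(1) unfolding del by blast
    moreover have "x ~= a" using x(3) 3(2) by (auto simp: insert_commute[of a b'])
    ultimately have "x = b" by auto
    thus ?thesis using x by (simp add: insert_commute[of b b'])
   qed
   moreover have "(b'+:y+:S) : \<B>"
   proof -
    obtain x where x: "x : (a+:y+:S)" "x ~: (a'+:b'+:S)" "(x+:b'+:S) : \<B>"
    using exchange1[OF ab' _ a'(1,3)] v'(1) unfolding del by blast
    moreover have "x ~= a" using x(3) 3(2) by (auto simp: insert_commute[of a b'])
    ultimately have "x = y" by auto
    thus ?thesis using x by (simp add: insert_commute[of y b'])
   qed
   ultimately have vv: "valid \<B> S b' b" using v' d by (auto simp: valid_def)
   show ?thesis by (rule cg_trans[OF indep0[OF v(1) vv three] indep0[OF vv v(2) three]]) simp_all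
  qed
 qed
 define h where "h B = (if e : B & y : B
  then (let p = SOME p. valid \<B> (B - {e, y}) (fst p) (snd p) in forced (B - {e, y}) (fst p) (snd p)) else g B)" for B
 have hF: "h B \<doteq> F z v B" if z: "z : active \<B>" "z ~= e" "z ~= y" and B: "B : slice \<B> z v" for z v B
 proof (cases "e : B & y : B")
  case False
  thus ?thesis using F(2)[OF z, of B v] B by (auto simp: h_def P_def intro: cg_sym)
 next
  case True
  define S where "S = B - {e, y}"
  have S: "e ~: S" "y ~: S" "B = (e+:y+:S)" using True by (auto simp: S_def)
  obtain B0 where B0: "B0 : \<B>" "(z : B0) = v" "e ~: B0" "y ~: B0" using avoid[OF z] by blast
  have "EX a b. valid (slice \<B> z v) S a b"
   by (rule valid_exists[OF slice_basis_family[OF basis_family_axioms] _ S(1,2), of z v B0])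
    (use B B0 S in \<open>auto simp: slice_def\<close>)
  then obtain a b where ab: "valid (slice \<B> z v) S a b" by blast
  hence ab': "valid \<B> S a b" by (auto simp: valid_def slice_def)
  have zS: "(z : S) = v" using B z by (auto simp: slice_def S_def)
  have "z ~: {a, b, e, y}" using ab z zS by (auto simp: valid_def slice_def)
  from F_forced[OF z(1) this ab'] have 1: "F z v B \<doteq> forced S a b" using zS S by simp
  have "valid \<B> S (fst (SOME p. valid \<B> S (fst p) (snd p))) (snd (SOME p. valid \<B> S (fst p) (snd p)))"
   by (rule someI[of "\<lambda>p. valid \<B> S (fst p) (snd p)" "(a, b)"]) (simp add: ab')
  from indep[OF this ab'] have "h B \<doteq> forced S a b" using True by (simp add: h_def S_def Let_def)
  thus ?thesis using 1 cg_sym cg_trans by blast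
 qed
 have "solves W \<B> h"
  unfolding solves_def
 proof (intro allI impI)
  fix S a b c d assume sq: "square \<B> S a b c d"
  let ?goal = "h (a+:c+:S) + h (b+:d+:S)
   \<doteq> W S a b c d + (h (a+:d+:S) + h (b+:c+:S))"
  have local: ?goal if z: "z : active \<B>" "z ~: {a, b, c, d, e, y}" for z
  proof -
   have z': "z ~= e" "z ~= y" using z by auto
   have "square (slice \<B> z (z : S)) S a b c d" using sq z by (intro square_slice) auto
   moreover have "solves W (slice \<B> z (z : S)) h"
    by (rule solves_cong[OF F(1)[OF z(1) z']]) (rule cg_sym[OF hF[OF z(1) z']])
   ultimately show ?thesis by (simp add: solves_def)
  qed
  show ?goal
  proof (cases "card {a, b, c, d, e, y} <= 5")
   case True
   then obtain z where "z : active \<B>" "z ~: {a, b, c, d, e, y}"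
    using exists_active[of "{a, b, c, d, e, y}"] by auto
   thus ?thesis by (rule local)
  next
   case False
   hence d: "distinct [a, b, c, d, e, y]" by (auto simp: card_insert_if split: if_splits)
   show ?thesis
   proof (cases "e : S & y : S")
    case False
    hence "square (P \<B>) S a b c d" using sq d by (auto simp: square_def P_def)
    with gP have "g (a+:c+:S) + g (b+:d+:S)
    \<doteq> W S a b c d + (g (a+:d+:S) + g (b+:c+:S))" by (simp add: solves_def)
    moreover have "h (u+:w+:S) = g (u+:w+:S)" if "u : {a, b}" "w : {c, d}" for u w
    using that d False by (auto simp: h_def)
    ultimately show ?thesis by simp
   next
    case True
    show ?thesis
    proof (cases "EX z:active \<B>. z ~: {a, b, c, d, e, y}")
    case True
    thus ?thesis using local by blast
    next
    case False
    \<comment> \<open>No further element is left, but the rank excludes this case: a basis avoiding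
      \<open>a\<close>, \<open>e\<close> and \<open>y\<close> would have to make up for these three
      with \<open>b\<close> and \<open>d\<close> alone.\<close>
    hence act: "active \<B> <= {a, b, c, d, e, y}" by blast
    let ?B = "(a+:c+:S)"
    note sq' = sq[unfolded square_def]
    have "a ~: (b+:d+:S)" using sq' by simp
    with activeI[of a "(a+:c+:S)" \<B> "(b+:d+:S)"] sq' have "a : active \<B>" by simp
    then obtain B0 where B0: "B0 : \<B>" "a ~: B0" "e ~: B0" "y ~: B0" using avoid[of a False] d by auto
    have in_both: "x : B' \<longleftrightarrow> x : B''" if "x ~: active \<B>" "B' : \<B>" "B'' : \<B>" for x B' B''
    using that by (auto simp: active_def)
    have Bin: "?B : \<B>" using sq' by simp
    have "?B - B0 \<supseteq> {a, e, y}" using B0 True by auto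
    hence 3: "card (?B - B0) \<ge> card {a, e, y}" using finite_basis[OF Bin] by (intro card_mono) auto
    have "B0 - ?B <= {b, d}"
    using act in_both[OF _ B0(1) Bin] B0 by blast
    hence "card (B0 - ?B) <= card {b, d}" by (intro card_mono) auto
    moreover have "card (B0 - ?B) = card (?B - B0)"
    using card_basis[OF Bin B0(1)] finite_basis[OF Bin] finite_basis[OF B0(1)]
    by (simp add: card_Diff_subset_Int Int_commute)
    ultimately show ?thesis using 3 d by (simp add: card_insert_if)
    qed
   qed
  qed
 qed
 thus ?thesis by blast
qed

end

section \<open>Fano patterns, shortest walks, and edges under pivots\<close>

definition Fano_lines :: "nat set set" where
 "Fano_lines = {{1,2,3}, {1,4,5}, {1,6,7}, {2,4,6}, {2,5,7}, {3,4,7}, {3,5,6}}"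

text \<open>The set \<open>Z\<close> consists of the coloops; loops leave no trace in a family of
  bases.\<close>

definition Fano_family :: "'e set set => bool" where
 "Fano_family \<B> \<longleftrightarrow> (EX Z x. inj_on x {1..7} & x ` {1..7} Int Z = {}
  & \<B> = {Z Un x ` T | T. T <= {1..7::nat} & card T = 3 & T ~: Fano_lines})"

lemma three_subsets_of_seven:
 assumes "T <= {1..7::nat}" "card T = 3"
  and P: "P {1,2,3}" "P {1,2,4}" "P {1,2,5}" "P {1,2,6}" "P {1,2,7}" "P {1,3,4}" "P {1,3,5}" "P {1,3,6}" "P {1,3,7}"
   "P {1,4,5}" "P {1,4,6}" "P {1,4,7}" "P {1,5,6}" "P {1,5,7}" "P {1,6,7}"
   "P {2,3,4}" "P {2,3,5}" "P {2,3,6}" "P {2,3,7}" "P {2,4,5}" "P {2,4,6}" "P {2,4,7}" "P {2,5,6}" "P {2,5,7}" "P {2,6,7}"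
   "P {3,4,5}" "P {3,4,6}" "P {3,4,7}" "P {3,5,6}" "P {3,5,7}" "P {3,6,7}" "P {4,5,6}" "P {4,5,7}" "P {4,6,7}" "P {5,6,7}"
 shows "P T"
proof -
 have fin: "finite T" using assms by (meson finite_atLeastAtMost finite_subset)
 hence len: "length (sorted_list_of_set T) = Suc (Suc (Suc 0))" using assms(2) by simp
 then obtain i j k where l: "sorted_list_of_set T = [i, j, k]"
  unfolding length_Suc_conv length_0_conv by blast
 hence T: "T = {i, j, k}" using set_sorted_list_of_set[OF fin] by simp
 have "sorted_wrt (<) (sorted_list_of_set T)" by simp
 hence ijk: "i < j" "j < k" using l by auto
 moreover have "1 <= i" "k <= 7" using T assms(1) by auto
 ultimately have "1 <= i" "i <= 5" "2 <= j" "j <= 6" "3 <= k" "k <= 7" by linarith+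
 hence mem: "i : {1..5}" "j : {2..6}" "k : {3..7}" by simp_all
 have eq: "{1..5::nat} = {1,2,3,4,5}" "{2..6::nat} = {2,3,4,5,6}" "{3..7::nat} = {3,4,5,6,7}" by auto
 from mem(1) have i: "i : {1,2,3,4,5}" by (simp only: eq)
 from mem(2) have j: "j : {2,3,4,5,6}" by (simp only: eq)
 from mem(3) have k: "k : {3,4,5,6,7}" by (simp only: eq)
 show ?thesis unfolding T
  by (insert i j k ijk, elim insertE emptyE; hypsubst_thin; (rule P | simp))
qed

lemma walk_rtranclp:
 assumes "!!i. i < n ==> R (p i) (p (Suc i))" shows "R\<^sup>*\<^sup>* (p 0) (p n)"
 using assms
proof (induction n)
 case (Suc n)
 hence "R\<^sup>*\<^sup>* (p 0) (p n)" "R (p n) (p (Suc n))" by auto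
 thus ?case by (rule rtranclp.rtrancl_into_rtrancl)
qed simp

lemma shortest_walk:
 assumes "R\<^sup>*\<^sup>* a b"
 obtains n p where "p 0 = a" "p n = b" "!!i. i < n ==> R (p i) (p (Suc i))"
  "!!i j. i + 1 < j ==> j <= n ==> ~ R (p i) (p j)" "inj_on p {..n::nat}"
proof -
 let ?P = "\<lambda>n. (R ^^ n) a b"
 have "EX n. ?P n" using assms by (simp add: rtranclp_power)
 define n where "n = (LEAST n. ?P n)"
 have n: "?P n" using \<open>EX n. ?P n\<close> unfolding n_def by (rule LeastI_ex)
 have least: "n <= m" if "?P m" for m using that unfolding n_def by (rule Least_le)
 from n obtain p where p: "p 0 = a" "p n = b" "!!i. i < n ==> R (p i) (p (Suc i))"
  unfolding relpowp_fun_conv by blast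
 have shortcut: False if "i + d < j" "j <= n" and q: "d = 0 & p i = p j \<or> d = 1 & R (p i) (p j)" for i j d
 proof -
  have 1: "(R ^^ i) a (p i)" unfolding relpowp_fun_conv using p that by (intro exI[of _ p]) auto
  have 2: "(R ^^ d) (p i) (p j)" using q by auto
  have 3: "(R ^^ (n - j)) (p j) b"
   unfolding relpowp_fun_conv using p that by (intro exI[of _ "\<lambda>m. p (j + m)"]) auto
  from relpowp_trans[OF relpowp_trans[OF 1 2] 3] have "n <= i + d + (n - j)" by (rule least)
  thus False using that by simp
 qed
 show ?thesis
 proof (rule that[OF p])
  show "~ R (p i) (p j)" if "i + 1 < j" "j <= n" for i j using shortcut[of i 1 j] that by blast
  show "inj_on p {..n}"
  proof (rule inj_onI)
   fix i j assume "i : {..n}" "j : {..n}" "p i = p j"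
   thus "i = j" using shortcut[of i 0 j] shortcut[of j 0 i] by (cases i j rule: linorder_cases) auto
  qed
 qed
qed

context basis_family
begin

lemma edge_memD: "edge \<B> B r c ==> r : B" "edge \<B> B r c ==> c ~: B" "edge \<B> B r c ==> (c+:(B - {r})) : \<B>"
 by (auto simp: edge_def)

lemma edge_activeD:
 assumes "B : \<B>" "edge \<B> B r c" shows "r : active \<B>" "c : active \<B>"
proof -
 have *: "(c+:(B - {r})) : \<B>" "r : B" "c ~: B" using assms by (auto simp: edge_def)
 show "c : active \<B>" using activeI[of c "(c+:(B - {r}))" \<B> B] * assms by simp
 have "r ~: (c+:(B - {r}))" using * by auto
 thus "r : active \<B>" using activeI[of r B \<B> "(c+:(B - {r}))"] * assms by simp
qed

lemma pivot_two:
 assumes "B : \<B>" "edge \<B> B r1 c1" "edge \<B> B r2 c2" "r1 ~= r2" "~ edge \<B> B r1 c2 \<or> ~ edge \<B> B r2 c1"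
 shows "(c1+:c2+:(B - {r1, r2})) : \<B>"
 using double_exchange[OF assms(1-3) _ assms(4)] double_exchange'[OF assms(1-3) _ assms(4)] assms(5) by blast

text \<open>In matrix terms, a pivot at \<open>r1, c1\<close> replaces the entry at
  \<open>r2, c2\<close> by a Schur complement. The correction vanishes if one of the two other
  entries does; in \<open>pivot_new\<close> the correction is all there is.\<close>

lemma pivot_keeps:
 assumes "B : \<B>" "edge \<B> B r1 c1" "edge \<B> B r2 c2" "r1 ~= r2" "c1 ~= c2" "~ edge \<B> B r1 c2 \<or> ~ edge \<B> B r2 c1"
 shows "edge \<B> (c1+:(B - {r1})) r2 c2"
proof -
 note * = pivot_two[OF assms(1-4,6)]
 have "(c2+:((c1+:(B - {r1})) - {r2})) = (c1+:c2+:(B - {r1, r2}))"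
  using assms edge_memD[OF assms(2)] edge_memD[OF assms(3)] by auto
 with * show ?thesis using assms edge_memD[OF assms(2)] edge_memD[OF assms(3)] by (simp add: edge_def)
qed

lemma pivot_new:
 assumes "B : \<B>" "edge \<B> B r1 c1" "edge \<B> B r1 c2" "edge \<B> B r2 c1" "~ edge \<B> B r2 c2"
 shows "edge \<B> (c1+:(B - {r1})) r2 c2"
proof -
 have ne: "r1 ~= r2" "c1 ~= c2" using assms by auto
 note * = pivot_two[OF assms(1,3,4) ne(1)]
 have "(c2+:((c1+:(B - {r1})) - {r2})) = (c2+:c1+:(B - {r1, r2}))"
  using assms ne edge_memD[OF assms(2)] edge_memD[OF assms(4)] by auto
 with * show ?thesis using assms ne edge_memD[OF assms(2)] edge_memD[OF assms(3)] edge_memD[OF assms(4)] by (simp add: edge_def)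
qed

text \<open>By \<open>pivot_edge\<close> a pivot joins only elements that were already in one
  component. With \<open>t\<close> read as a component label: the components of the fundamental
  graph are the same for every basis.\<close>

lemma edge_invariant:
 assumes B: "B : \<B>" and B': "B' : \<B>" and t: "!!r c. edge \<B> B r c ==> t r = t c"
 shows "edge \<B> B' r c ==> t r = t c"
 using B t
proof (induction "card (B - B')" arbitrary: B rule: less_induct)
 case less
 have fin: "finite B" "finite B'" using finite_basis less.prems B' by auto
 show ?case
 proof (cases "B <= B'")
  case True
  hence "B = B'" using card_basis[OF less.prems(2) B'] fin by (simp add: card_subset_eq)
  thus ?thesis using less.prems by blast
 next
  case False
  then obtain x where x: "x : B" "x ~: B'" by blast
  then obtain y where y: "y : B'" "y ~: B" "(y+:(B - {x})) : \<B>" using exchange1 less.prems B' by meson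
  let ?C = "(y+:(B - {x}))"
  have xy: "edge \<B> B x y" using x y by (simp add: edge_def)
  have "?C - B' \<subset> B - B'" using x y by auto
  hence "card (?C - B') < card (B - B')" using fin by (simp add: psubset_card_mono)
  moreover have "t r \<equiv> t c" if "edge \<B> ?C r c" for r c
   using pivot_edge[OF less.prems(2) xy that] less.prems(3) xy by (smt (verit))
  ultimately show ?thesis using less.hyps[of ?C] y(3) less.prems(1) by auto
 qed
qed

end

definition adj :: "'e set set => 'e set => 'e => 'e => bool" where
 "adj \<B> B x w \<longleftrightarrow> edge \<B> B x w \<or> edge \<B> B w x"

lemma adj_sym: "adj \<B> B x w \<longleftrightarrow> adj \<B> B w x" by (auto simp: adj_def)

definition joined :: "'e set set => 'e set => 'e set => 'e => 'e => bool" where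
 "joined \<B> B A x w = (\<lambda>x w. adj \<B> B x w & x : A & w : A)\<^sup>*\<^sup>* x w"

lemma joined_sym: "joined \<B> B A x w ==> joined \<B> B A w x"
proof -
 have "symp (\<lambda>x w. adj \<B> B x w & x : A & w : A)" by (auto intro!: sympI simp: adj_def)
 hence "symp (\<lambda>x w. adj \<B> B x w & x : A & w : A)\<^sup>*\<^sup>*" by (rule symp_rtranclp)
 thus "joined \<B> B A x w ==> joined \<B> B A w x" unfolding joined_def by (rule sympD)
qed

lemma joined_trans: "joined \<B> B A x w ==> joined \<B> B A w z ==> joined \<B> B A x z"
 unfolding joined_def by (rule rtranclp_trans)

lemma joined_adj: "adj \<B> B x w ==> x : A ==> w : A ==> joined \<B> B A x w"
 unfolding joined_def by (rule r_into_rtranclp) simp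

text \<open>This is \<open>edge_invariant\<close> in the minor without \<open>D\<close>, the label
  of an element being whether \<open>x\<close> is joined to it at \<open>B'\<close>.\<close>

lemma (in basis_family) joined_all_bases:
 assumes B: "B : \<B>" "B Int D = {}" and B': "B' : \<B>" "B' Int D = {}"
  and conn: "!!x w. x : A ==> w : A ==> joined \<B> B A x w" and A: "A Int D = {}" "active \<B> <= A Un D"
  and xw: "x : A" "w : A"
 shows "joined \<B> B' A x w"
proof -
 let ?D = "interval \<B> {} D"
 interpret D: basis_family ?D by (rule interval_basis_family[OF basis_family_axioms])
 have e: "edge ?D B r c \<longleftrightarrow> edge \<B> B r c & r : A & c : A" if "B : \<B>" "B Int D = {}" for B r c
  using that A edge_activeD[OF that(1), of r c] by (auto simp: edge_def interval_def)
 define t where "t z = joined \<B> B' A x z" for z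
 have tB': "t r = t c" if "edge ?D B' r c" for r c
 proof -
  have "joined \<B> B' A r c" "joined \<B> B' A c r"
   using that e[OF B'] by (auto intro!: joined_adj simp: adj_def)
  thus ?thesis unfolding t_def using joined_trans by metis
 qed
 have "B' : ?D" "B : ?D" using B B' by (auto simp: interval_def)
 hence t: "t r = t c" if "edge ?D B r c" for r c
  by (rule D.edge_invariant[of B' B t r c, OF _ _ tB' that])
 have "t z" if "joined \<B> B A x z" for z
  using that unfolding joined_def
 proof (induction rule: rtranclp_induct)
  case base
  thus ?case by (simp add: t_def joined_def)
 next
  case (step y z)
  thus ?case using t e[OF B] by (auto simp: adj_def)
 qed
 thus ?thesis using conn[OF xw] by (simp add: t_def)
qed

section \<open>Analysis of a nonzero defect\<close>

context pair_extension
begin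

abbreviation "others \<equiv> active \<B> - {e, y}"

text \<open>By \<open>defect_parallel\<close> a square with a nonzero defect has \<open>a\<close>,
  \<open>b\<close> and \<open>S\<close> forming a basis. Seen from that basis, the square is a
  4-cycle of the fundamental graph.\<close>

definition four_edges :: "'e set => 'e => 'e => bool" where
 "four_edges B a b \<longleftrightarrow> B : \<B> & e ~: B & y ~: B & a ~= b
  & edge \<B> B a e & edge \<B> B a y & edge \<B> B b e & edge \<B> B b y"

definition bad :: "'e set => 'e => 'e => bool" where
 "bad B a b \<longleftrightarrow> four_edges B a b & ~ defect (B - {a, b}) a b \<doteq> 0"

lemma four_edges_square: "four_edges B a b ==> ey_square (B - {a, b}) a b"
proof -
 assume f: "four_edges B a b"
 have eq: "(a+:x+:(B - {a, b})) = (x+:(B - {b}))" "(b+:x+:(B - {a, b})) = (x+:(B - {a}))" for x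
  using f by (auto simp: four_edges_def edge_def)
 show ?thesis using f ey unfolding square_def eq by (auto simp: four_edges_def edge_def)
qed

lemma square_four_edges:
 assumes "ey_square S a b" "(a+:b+:S) : \<B>"
 shows "four_edges (a+:b+:S) a b" "(a+:b+:S) - {a, b} = S"
proof -
 note sq = assms(1)[unfolded square_def]
 have eq: "(x+:((a+:b+:S) - {a})) = (b+:x+:S)"
  "(x+:((a+:b+:S) - {b})) = (a+:x+:S)" for x
  using sq by auto
 show "four_edges (a+:b+:S) a b"
  unfolding four_edges_def edge_def eq using sq assms(2) by auto
 show "(a+:b+:S) - {a, b} = S" using sq by auto
qed

lemma four_edges_swap: "four_edges B a b ==> four_edges B b a"
 by (auto simp: four_edges_def)

lemma four_edges_others: "four_edges B a b ==> a : others" "four_edges B a b ==> b : others"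
 using edge_activeD(1) by (auto simp: four_edges_def edge_def)

text \<open>A path from \<open>a\<close> to \<open>b\<close> that misses \<open>z\<close> is a chain
  of links, all at the basis \<open>B\<close>.\<close>

lemma defect_walk:
 assumes f: "four_edges B a b" and z: "z : others" "z ~= a" "z ~= b" and j: "joined \<B> B (others - {z}) a b"
 shows "defect (B - {a, b}) a b \<doteq> 0"
proof (rule defect_zero)
 show "z : active \<B>" "z ~: {a, b, e, y}" using z by auto
 show "ey_square (B - {a, b}) a b" using f by (rule four_edges_square)
 have "link z (z : B - {a, b}) x w" if "adj \<B> B x w & x : others - {z} & w : others - {z}" for x w
  unfolding link_def using that f z by (intro bexI[of _ B]) (auto simp: adj_def four_edges_def)
 thus "(link z (z : B - {a, b}))\<^sup>*\<^sup>* a b"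
  using j unfolding joined_def by (auto intro: rtranclp_mono[THEN predicate2D, rotated])
qed

text \<open>Both defects are the same difference of values of one potential, that of the slice at
  \<open>z\<close> containing both squares.\<close>

lemma bad_transfer:
 assumes "bad B a b" "four_edges B' a b" "z : others" "z ~= a" "z ~= b" "z : B \<longleftrightarrow> z : B'"
 shows "bad B' a b"
proof -
 have "defect (B - {a, b}) a b \<doteq> defect (B' - {a, b}) a b"
  by (rule defect_eq[of z _ _ _ _ "z : B"]) (use assms four_edges_square in \<open>auto simp: bad_def\<close>)
 thus ?thesis using assms cg_trans unfolding bad_def by blast
qed

lemma defect_swap: "ey_square S a b ==> defect S b a \<doteq> - defect S a b"
proof -
 assume sq: "ey_square S a b"
 have "card {a, b, e, y} <= 5" by (simp add: card_insert_if)
 then obtain z where z: "z : active \<B>" "z ~: {a, b, e, y}" using exists_active[of "{a, b, e, y}"] by auto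
 obtain l where l: "!!S' a b. ey_square S' a b ==> z ~= a ==> z ~= b ==> (z : S') = (z : S) ==> defect S' a b \<doteq> l a - l b"
  using potential[of z "z : S"] z by (metis insertCI)
 have *: "defect S a b \<doteq> l a - l b" "defect S b a \<doteq> l b - l a"
  using z sq ey_square_swap[OF sq] by (auto intro!: l)
 show ?thesis by (rule cg_lin2[OF *]) simp
qed

lemma bad_swap: "bad B a b ==> bad B b a"
proof -
 assume b: "bad B a b"
 hence f: "four_edges B a b" by (simp add: bad_def)
 have eq: "B - {b, a} = B - {a, b}" by auto
 have "defect (B - {a, b}) a b \<doteq> 0" if "defect (B - {a, b}) b a \<doteq> 0"
  by (rule cg_lin2[OF defect_swap[OF four_edges_square[OF f]] cg_sym[OF that]]) simp
 thus ?thesis using b four_edges_swap[OF f] unfolding bad_def eq by blast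
qed

text \<open>An induced path through all active elements other than \<open>e\<close> and
  \<open>y\<close>, so there are seven in all. Its edges to \<open>e\<close> and \<open>y\<close>
  will determine all but one of the triples of the Fano plane.\<close>

definition config :: "'e set => 'e => 'e => 'e => 'e => 'e => bool" where
 "config B a c1 r c2 b \<longleftrightarrow> bad B a b & distinct [a, c1, r, c2, b] & others = {a, c1, r, c2, b}
  & edge \<B> B a c1 & edge \<B> B r c1 & edge \<B> B r c2 & edge \<B> B b c2 & ~ edge \<B> B a c2 & ~ edge \<B> B b c1"

lemma config_rev: "config B a c1 r c2 b ==> config B b c2 r c1 a"
 using bad_swap by (auto simp: config_def)

text \<open>A shortest path from \<open>a\<close> to \<open>b\<close> visits all other elements,
  since otherwise \<open>defect_walk\<close> applies. Its length is even because the graph is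
  bipartite, and at least 4 because there are at least four others. From length 6 on, a pivot inside
  the path keeps the pair bad and lets a shorter path skip an element.\<close>

lemma bad_config:
 assumes bad: "bad B a b" and conn: "!!x w. x : others ==> w : others ==> joined \<B> B others x w"
 shows "EX c1 r c2. config B a c1 r c2 b"
proof -
 have f: "four_edges B a b" using bad by (simp add: bad_def)
 hence B: "B : \<B>" "e ~: B" "y ~: B" "a : B" "b : B" by (auto simp: four_edges_def edge_def)
 have ab: "a : others" "b : others" using four_edges_others[OF f] .
 let ?R = "\<lambda>x w. adj \<B> B x w & x : others & w : others"
 have "?R\<^sup>*\<^sup>* a b" using conn[OF ab] by (simp add: joined_def)
 then obtain n p where p: "p 0 = a" "p n = b" and step: "!!i. i < n ==> ?R (p i) (p (Suc i))"
  and chord: "!!i j. i + 1 < j ==> j <= n ==> ~ ?R (p i) (p j)" and inj: "inj_on p {..n::nat}"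
  by (rule shortest_walk) blast
 have in_others: "p i : others" if "i <= n" for i
 proof (cases i)
  case 0
  thus ?thesis using p ab by simp
 next
  case (Suc j)
  thus ?thesis using step[of j] that by auto
 qed
 have cover: "others <= p ` {..n}"
 proof
  fix z assume z: "z : others"
  show "z : p ` {..n}"
  proof (rule ccontr)
   assume n: "z ~: p ` {..n}"
   have "joined \<B> B (others - {z}) (p 0) (p n)"
    unfolding joined_def
   proof (rule walk_rtranclp)
    fix i assume "i < n"
    hence "p i ~= z" "p (Suc i) ~= z" using n by (auto simp: image_iff)
    thus "adj \<B> B (p i) (p (Suc i)) & p i : others - {z} & p (Suc i) : others - {z}"
    using step[OF \<open>i < n\<close>] by auto
   qed
   moreover have "z ~= a" "z ~= b" using n p by auto
   ultimately have "defect (B - {a, b}) a b \<doteq> 0" using defect_walk[OF f z] p by simp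
   thus False using bad by (simp add: bad_def)
  qed
 qed
 have "card others = card (active \<B>) - 2"
  using ey active_finite[OF basis_family_axioms] by (simp add: card_Diff_subset)
 hence "4 <= card others" using large by simp
 also have "card others <= card (p ` {..n})" using cover by (intro card_mono) auto
 also have "\<dots> = n + 1" using inj by (simp add: card_image)
 finally have n3: "n \<ge> 3" by simp
 have parity: "p i : B \<longleftrightarrow> even i" if "i <= n" for i
  using that
 proof (induction i)
  case 0
  thus ?case using p B by simp
 next
  case (Suc i)
  hence "adj \<B> B (p i) (p (Suc i))" using step[of i] by simp
  thus ?case using Suc by (auto simp: adj_def edge_def)
 qed
 have "even n" using parity[of n] p B by simp
 hence n4: "n \<ge> 4" using n3 by presburger
 have E: "edge \<B> B (p i) (p j) \<longleftrightarrow> j = Suc i \<or> i = Suc j" if "even i" "odd j" "i <= n" "j <= n" for i j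
 proof -
  have nadj: "~ edge \<B> B (p j) (p i)" if "even i" "odd j" "i <= n" "j <= n" for i j
   using parity[of i] that by (auto simp: edge_def)
  have "i ~= j" using that by blast
  then consider "j = Suc i" | "i = Suc j" | "Suc i < j" | "Suc j < i" by linarith
  thus ?thesis
  proof cases
   case 1
   thus ?thesis using step[of i] nadj[OF that] that by (auto simp: adj_def)
  next
   case 2
   thus ?thesis using step[of j] nadj[OF that] that by (auto simp: adj_def)
  next
   case 3
   thus ?thesis using chord[of i j] in_others that by (auto simp: adj_def)
  next
   case 4
   thus ?thesis using chord[of j i] in_others that by (auto simp: adj_def)
  qed
 qed
 have neq: "p i ~= p j" if "i ~= j" "i <= n" "j <= n" for i j
  using inj that by (auto simp: inj_on_def)
 have "n < 6"
 proof (rule ccontr)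
  assume "~ n < 6"
  hence n6: "n \<ge> 6" by simp
  \<comment> \<open>The pivot joins \<open>p 2\<close> to \<open>p 5\<close>, so that
    \<open>p 3\<close> and \<open>p 4\<close> can be skipped. The edges from the two ends to
    \<open>e\<close> and \<open>y\<close> stay, as neither end is adjacent to
    \<open>p 3\<close>.\<close>
  let ?B = "((p 3)+:(B - {p 4}))"
  have e43: "edge \<B> B (p 4) (p 3)" using E[of 4 3] n6 by simp
  have B': "?B : \<B>" "e ~: ?B" "y ~: ?B" using edge_memD[OF e43] B in_others[of 3] n6 by auto
  have ends: "edge \<B> ?B (p i) x" if "x = e \<or> x = y" "i = 0 \<or> i = n" for i x
  proof (rule pivot_keeps[OF B(1) e43])
   show "edge \<B> B (p i) x" using that p f by (auto simp: four_edges_def)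
   show "p 4 ~= p i" using that n6 neq[of 4 i] by auto
   show "p 3 ~= x" using that in_others[of 3] n6 by auto
   have "~ edge \<B> B (p i) (p 3)" using that n6 E[of i 3] \<open>even n\<close> by auto
   thus "~ edge \<B> B (p 4) x \<or> ~ edge \<B> B (p i) (p 3)" ..
  qed
  have f': "four_edges ?B a b"
   using ends[of _ 0] ends[of _ n] p B' f by (auto simp: four_edges_def)
  have p2: "p 2 : others" "p 2 ~= a" "p 2 ~= b" "p 2 : B \<longleftrightarrow> p 2 : ?B"
   using in_others[of 2] neq[of 2 0] neq[of 2 n] neq[of 2 3] neq[of 2 4] parity[of 2] n6 p by auto
  have bad': "bad ?B a b" by (rule bad_transfer[OF bad f' p2])
  define q where "q i = (if i <= 2 then p i else p (i + 2))" for i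
  have q_edge: "adj \<B> ?B (q i) (q (Suc i)) & q i : others - {p 3} & q (Suc i) : others - {p 3}" if i: "i < n - 2" for i
  proof -
   have keep: "edge \<B> ?B (p k) (p l)" if "even k" "odd l" "k <= n" "l <= n" "k ~= 4" "l ~= 3" "l = Suc k \<or> k = Suc l"
    "k ~: {2, 4} \<or> l ~: {3, 5}" for k l
   proof (rule pivot_keeps[OF B(1) e43])
    show "edge \<B> B (p k) (p l)" using E[of k l] that by simp
    show "p 4 ~= p k" "p 3 ~= p l" using neq[of 4 k] neq[of 3 l] that n6 by auto
    show "~ edge \<B> B (p 4) (p l) \<or> ~ edge \<B> B (p k) (p 3)"
    using E[of 4 l] E[of k 3] that n6 by auto
   qed
   have new: "edge \<B> ?B (p 2) (p 5)"
    by (rule pivot_new[OF B(1) e43]) (use E[of 4 5] E[of 2 3] E[of 2 5] n6 in auto)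
   have "adj \<B> ?B (q i) (q (Suc i))"
   proof -
    consider "i = 0" | "i = 1" | "i = 2" | "i > 2" by linarith
    thus ?thesis
    proof cases
    case 1
    thus ?thesis using keep[of 0 1] n6 by (simp add: q_def adj_def)
    next
    case 2
    thus ?thesis using keep[of 2 1] n6 by (simp add: q_def adj_def numeral_2_eq_2)
    next
    case 3
    thus ?thesis using new by (simp add: q_def adj_def numeral_eq_Suc)
    next
    case 4
    hence q: "q i = p (i + 2)" "q (Suc i) = p (i + 3)" by (auto simp: q_def numeral_eq_Suc)
    show ?thesis
    proof (cases "even i")
    case True
    thus ?thesis using keep[of "i + 2" "i + 3"] 4 i unfolding q by (auto simp: adj_def)
    next
    case False
    hence "edge \<B> ?B (p (i + 3)) (p (i + 2))" using 4 i by (intro keep) auto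
    thus ?thesis unfolding q by (simp add: adj_def)
    qed
    qed
   qed
   moreover have "q k : others - {p 3}" if "k <= n - 2" for k
    using that in_others[of k] in_others[of "k + 2"] neq[of k 3] neq[of "k + 2" 3] n6 by (auto simp: q_def)
   ultimately show ?thesis using i by simp
  qed
  have "joined \<B> ?B (others - {p 3}) (q 0) (q (n - 2))"
   unfolding joined_def by (rule walk_rtranclp) (rule q_edge)
  moreover have "n - 2 + 2 = n" using n6 by simp
  hence "q 0 = a" "q (n - 2) = b" using p n6 unfolding q_def by auto
  moreover have "p 3 : others" "p 3 ~= a" "p 3 ~= b" using in_others[of 3] neq[of 3 0] neq[of 3 n] p n6 by auto
  ultimately have "defect (?B - {a, b}) a b \<doteq> 0" using defect_walk[OF f'] by simp
  thus False using bad' by (simp add: bad_def)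
 qed
 hence n: "n = 4" using n4 \<open>even n\<close> by presburger
 have "{..4::nat} = {0, 1, 2, 3, 4}" by auto
 hence "p ` {..n} = {p 0, p 1, p 2, p 3, p 4}" unfolding n by simp
 moreover have "p ` {..n} <= others" using in_others by auto
 ultimately have "others = {a, p 1, p 2, p 3, b}" using cover p n by auto
 moreover have "distinct [a, p 1, p 2, p 3, b]"
  using neq[of 0 1] neq[of 0 2] neq[of 0 3] neq[of 0 4] neq[of 1 2] neq[of 1 3] neq[of 1 4] neq[of 2 3] neq[of 2 4] neq[of 3 4]
   p n by auto
 ultimately have "config B a (p 1) (p 2) (p 3) b"
  using bad E[of 0 1] E[of 2 1] E[of 2 3] E[of 4 3] E[of 0 3] E[of 4 1] p n by (simp add: config_def)
 thus ?thesis by blast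
qed

lemma config_others:
 assumes "config B a c1 r c2 b"
 shows "B : \<B>" "e ~: B" "y ~: B" "a : B" "b : B" "r : B" "c1 ~: B" "c2 ~: B"
  "distinct [a, c1, r, c2, b, e, y]" "edge \<B> B a e" "edge \<B> B a y" "edge \<B> B b e" "edge \<B> B b y"
  "edge \<B> B a c1" "edge \<B> B r c1" "edge \<B> B r c2" "edge \<B> B b c2" "~ edge \<B> B a c2" "~ edge \<B> B b c1"
  "four_edges B a b" "~ defect (B - {a, b}) a b \<doteq> 0"
proof -
 note c = assms[unfolded config_def bad_def four_edges_def]
 have "{a, c1, r, c2, b} = others" using c by simp
 hence "a ~: {e, y}" "c1 ~: {e, y}" "r ~: {e, y}" "c2 ~: {e, y}" "b ~: {e, y}" by blast+
 thus "distinct [a, c1, r, c2, b, e, y]" using c ey by auto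
 show "four_edges B a b" "~ defect (B - {a, b}) a b \<doteq> 0" using assms by (simp_all add: config_def bad_def)
qed (use assms in \<open>auto simp: config_def bad_def four_edges_def edge_def\<close>)

lemma config_in_others:
 assumes "config B a c1 r c2 b"
 shows "a : others" "c1 : others" "r : others" "c2 : others" "b : others"
proof -
 have "{a, c1, r, c2, b} = others" using assms by (simp add: config_def)
 thus "a : others" "c1 : others" "r : others" "c2 : others" "b : others" by blast+
qed

text \<open>After the pivot both \<open>a\<close> and \<open>b\<close> are adjacent to
  \<open>c2\<close>, so they are joined without \<open>r\<close>.\<close>

lemma config_pivot_not_bad:
 assumes c: "config B a c1 r c2 b" shows "~ bad (c1+:(B - {r})) a b"
proof
 let ?B = "(c1+:(B - {r}))"
 note c' = config_others[OF c]
 assume bad: "bad ?B a b"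
 have 1: "edge \<B> ?B a c2" by (rule pivot_new[OF c'(1,15,16,14,18)])
 have 2: "edge \<B> ?B b c2" by (rule pivot_keeps[OF c'(1,15,17)]) (use c' in auto)
 have "adj \<B> ?B a c2" "adj \<B> ?B c2 b" using 1 2 by (simp_all add: adj_def)
 moreover have mem: "a : others - {r}" "c2 : others - {r}" "b : others - {r}"
  using config_in_others[OF c] c'(9) by auto
 ultimately have j: "joined \<B> ?B (others - {r}) a b"
  by (intro joined_trans[of \<B> ?B _ a c2 b] joined_adj)
 have f: "four_edges ?B a b" using bad by (simp add: bad_def)
 have "defect (?B - {a, b}) a b \<doteq> 0"
  by (rule defect_walk[OF f config_in_others(3)[OF c] _ _ j]) (use c'(9) in auto)
 thus False using bad by (simp add: bad_def)
qed

text \<open>Otherwise the defect at \<open>a, b\<close> is the sum of those at \<open>a, r\<close>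
  and at \<open>r, b\<close>. Each of these vanishes along one half of the path, the first half
  missing \<open>c2\<close> and the second missing \<open>c1\<close>.\<close>

lemma config_not_both:
 assumes c: "config B a c1 r c2 b" shows "~ (edge \<B> B r e & edge \<B> B r y)"
proof
 note c' = config_others[OF c]
 assume r: "edge \<B> B r e & edge \<B> B r y"
 note mem = config_in_others[OF c]
 have f: "four_edges B a r" "four_edges B r b" using c' r by (auto simp: four_edges_def)
 have adj: "adj \<B> B a c1" "adj \<B> B c1 r" "adj \<B> B r c2" "adj \<B> B c2 b"
  using c'(14-17) by (simp_all add: adj_def)
 have "a : others - {c2}" "c1 : others - {c2}" "r : others - {c2}" using mem c'(9) by auto
 hence j1: "joined \<B> B (others - {c2}) a r"
  by (intro joined_trans[of \<B> B _ a c1 r] joined_adj adj)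
 have "r : others - {c1}" "c2 : others - {c1}" "b : others - {c1}" using mem c'(9) by auto
 hence j2: "joined \<B> B (others - {c1}) r b"
  by (intro joined_trans[of \<B> B _ r c2 b] joined_adj adj)
 have z1: "defect (B - {a, r}) a r \<doteq> 0"
  by (rule defect_walk[OF f(1) mem(4) _ _ j1]) (use c'(9) in auto)
 have z2: "defect (B - {r, b}) r b \<doteq> 0"
  by (rule defect_walk[OF f(2) mem(2) _ _ j2]) (use c'(9) in auto)
 have "c1 : active \<B>" using edge_activeD[OF c'(1,15)] by simp
 have "defect (B - {a, b}) a b \<doteq> defect (B - {a, r}) a r + defect (B - {r, b}) r b"
  by (rule defect_add[OF \<open>c1 : active \<B>\<close> four_edges_square[OF f(1)] four_edges_square[OF f(2)] four_edges_square[OF c'(20)], of False])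
   (use c' in auto)
 hence "defect (B - {a, b}) a b \<doteq> 0"
  by (rule cg_lin3[OF _ z1 z2]) simp
 thus False using c' by simp
qed

lemma config_pivot_edges:
 assumes c: "config B a c1 r c2 b" and u: "u : {e, y}"
 shows "edge \<B> (c1+:(B - {r})) b u" "~ edge \<B> B r u ==> edge \<B> (c1+:(B - {r})) a u"
proof -
 note c' = config_others[OF c]
 show "edge \<B> (c1+:(B - {r})) b u"
  by (rule pivot_keeps[OF c'(1,15)]) (use u c' in auto)
 show "edge \<B> (c1+:(B - {r})) a u" if "~ edge \<B> B r u"
  by (rule pivot_keeps[OF c'(1,15)]) (use u c' that in auto)
qed

text \<open>If \<open>a\<close> were adjacent to both \<open>e\<close> and \<open>y\<close> after
  the pivot, the pair \<open>a, b\<close> would still be bad, by \<open>bad_transfer\<close> at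
  \<open>c2\<close>, contrary to \<open>config_pivot_not_bad\<close>.\<close>

lemma config_pivot_bad:
 assumes c: "config B a c1 r c2 b" and a: "edge \<B> (c1+:(B - {r})) a e" "edge \<B> (c1+:(B - {r})) a y"
 shows False
proof -
 note c' = config_others[OF c]
 have f: "four_edges (c1+:(B - {r})) a b"
  using a config_pivot_edges(1)[OF c] c' edge_memD(3)[OF c'(15)] by (auto simp: four_edges_def)
 have "bad (c1+:(B - {r})) a b"
  by (rule bad_transfer[of B, OF _ f config_in_others(4)[OF c]]) (use c' in \<open>auto simp: bad_def\<close>)
 thus False using config_pivot_not_bad[OF c] by simp
qed

lemma config_one: "config B a c1 r c2 b ==> edge \<B> B r e \<or> edge \<B> B r y"
 using config_pivot_bad config_pivot_edges(2) by blast

text \<open>The edge from \<open>a\<close> to \<open>v\<close> survives the pivot, so the one to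
  \<open>u\<close> must not. In terms of bases, \<open>c1, b, u\<close> is a dependent triple over
  \<open>B - {a, r, b}\<close>.\<close>

lemma config_line:
 assumes c: "config B a c1 r c2 b" and u: "{u, v} = {e, y}" and r: "edge \<B> B r u" "~ edge \<B> B r v"
 shows "~ edge \<B> (c1+:(B - {r})) a u"
proof
 assume "edge \<B> (c1+:(B - {r})) a u"
 moreover have "edge \<B> (c1+:(B - {r})) a v" using config_pivot_edges(2)[OF c _ r(2)] u by blast
 ultimately show False using config_pivot_bad[OF c] u by (auto simp: doubleton_eq_iff)
qed

text \<open>Pivoting on both end edges turns the path inside out, with \<open>c1\<close> and
  \<open>c2\<close> as new ends. The nonzero defect passes to them by additivity, since
  \<open>a, c1\<close> and \<open>c2, b\<close> are parallel over \<open>B - {a, b}\<close>.\<close>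

lemma config_next:
 assumes c: "config B a c1 r c2 b"
 shows "config (c1+:c2+:(B - {a, b})) c1 a r b c2"
proof -
 let ?B = "(c1+:c2+:(B - {a, b}))" and ?S = "B - {a, b}"
 note c' = config_others[OF c]
 have oth: "others = {a, c1, r, c2, b}" using c by (simp add: config_def)
 have ne: "a ~= b" using c' by simp
 have B': "?B : \<B>" by (rule pivot_two[OF c'(1,14,17) ne]) (use c' in simp)
 have Sa: "(a+:?S) = B - {b}" "(b+:?S) = B - {a}" using c' by auto
 have S1: "(c1+:u+:?S) : \<B>" if "u : {e, y}" for u
  by (rule pivot_two[OF c'(1,14) _ ne]) (use that c' in auto)
 have S2: "(c2+:u+:?S) : \<B>" if "u : {e, y}" for u
  using pivot_two[OF c'(1,17), of a u] that c' by (auto simp: insert_commute[of b a])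
 have S3: "(a+:u+:?S) = (u+:(B - {b}))" "(b+:u+:?S) = (u+:(B - {a}))" for u
  using c' by auto
 have sq_a: "ey_square ?S a c1" unfolding square_def S3 using S1 c' by (auto simp: edge_def)
 have sq_b: "ey_square ?S c2 b" unfolding square_def S3 using S2 c' by (auto simp: edge_def)
 have sq_1b: "ey_square ?S c1 b" unfolding square_def S3 using S1 c' by (auto simp: edge_def)
 have sq_12: "ey_square ?S c1 c2" unfolding square_def S3 using S1 S2 c' by auto
 note sq_ab = four_edges_square[OF c'(20)]
 have "(a+:c1+:?S) ~: \<B>" unfolding S3 using c' by (auto simp: edge_def)
 from defect_parallel[OF sq_a this c'(1-3)] have z1: "defect ?S a c1 \<doteq> 0" .
 have "(c2+:b+:?S) ~: \<B>" unfolding insert_commute[of c2 b] S3 using c' by (auto simp: edge_def)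
 from defect_parallel[OF sq_b this c'(1-3)] have z2: "defect ?S c2 b \<doteq> 0" .
 have act: "c2 : active \<B>" "a : active \<B>" using config_in_others[OF c] by auto
 have "defect ?S a b \<doteq> defect ?S a c1 + defect ?S c1 b"
  by (rule defect_add[OF act(1) sq_a sq_1b sq_ab, of False]) (use c' in auto)
 moreover have "defect ?S c1 b \<doteq> defect ?S c1 c2 + defect ?S c2 b"
  by (rule defect_add[OF act(2) sq_12 sq_b sq_1b, of False]) (use c' in auto)
 ultimately have "defect ?S a b \<doteq> 0" if "defect ?S c1 c2 \<doteq> 0"
  by (rule cg_lin5[OF _ _ z1 z2 that]) simp
 hence nz: "~ defect ?S c1 c2 \<doteq> 0" using c' by blast
 have B_eq: "(c1+:c2+:?S) = ?B" by simp
 have "bad ?B c1 c2"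
  using square_four_edges[OF sq_12] B' nz by (simp add: bad_def)
 moreover have "edge \<B> ?B c1 a" "edge \<B> ?B c2 b" "~ edge \<B> ?B c1 b" "~ edge \<B> ?B c2 a"
 proof -
  have "(x+:(?B - {c1})) = (c2+:x+:?S)" "(x+:(?B - {c2})) = (c1+:x+:?S)" if "x : {a, b}" for x
   using c' that by auto
  hence *: "(a+:(?B - {c1})) = (c2+:(B - {b}))" "(b+:(?B - {c2})) = (c1+:(B - {a}))"
   "(b+:(?B - {c1})) = (c2+:(B - {a}))" "(a+:(?B - {c2})) = (c1+:(B - {b}))"
   using Sa by auto
  show "edge \<B> ?B c1 a" "edge \<B> ?B c2 b" "~ edge \<B> ?B c1 b" "~ edge \<B> ?B c2 a"
   unfolding edge_def * using c' by (auto simp: edge_def)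
 qed
 moreover have "edge \<B> ?B r a" "edge \<B> ?B r b"
 proof -
  have *: "(a+:(?B - {r})) = (c1+:c2+:(B - {r, b}))" "(b+:(?B - {r})) = (c1+:c2+:(B - {a, r}))"
   using c' by auto
  have "(c1+:c2+:(B - {r, b})) : \<B>" by (rule pivot_two[OF c'(1,15,17)]) (use c' in auto)
  moreover have "(c1+:c2+:(B - {a, r})) : \<B>" by (rule pivot_two[OF c'(1,14,16)]) (use c' in auto)
  ultimately show "edge \<B> ?B r a" "edge \<B> ?B r b" unfolding edge_def * using c' by auto
 qed
 moreover have "others = {c1, a, r, b, c2}" unfolding oth by blast
 moreover have "distinct [c1, a, r, b, c2]" using c'(9) by auto
 ultimately show ?thesis unfolding config_def by simp
qed

text \<open>In the new configuration \<open>r\<close> is again adjacent to exactly one of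
  \<open>u\<close> and \<open>v\<close>. If that were \<open>v\<close>, then
  \<open>config_line\<close> would rule out a basis that is obtained from \<open>B\<close> by two
  exchanges.\<close>

lemma config_next_apex:
 assumes c: "config B a c1 r c2 b" and u: "{u, v} = {e, y}" and r: "edge \<B> B r u" "~ edge \<B> B r v"
 defines "B' \<equiv> (c1+:c2+:(B - {a, b}))"
 shows "edge \<B> B' r u" "~ edge \<B> B' r v"
proof -
 note c' = config_others[OF c]
 have c2: "config B' c1 a r b c2" unfolding B'_def by (rule config_next[OF c])
 have v: "v = e \<or> v = y" using u by auto
 show nv: "~ edge \<B> B' r v"
 proof
  assume rv: "edge \<B> B' r v"
  with config_not_both[OF c2] u have ru: "~ edge \<B> B' r u" by (auto simp: doubleton_eq_iff)
  have "{v, u} = {e, y}" using u by auto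
  from config_line[OF config_rev[OF c2] this rv ru] have n: "~ edge \<B> (b+:(B' - {r})) c2 v" .
  have eq: "(v+:((b+:(B' - {r})) - {c2})) = (c1+:v+:(B - {a, r}))"
   using c' v unfolding B'_def by auto
  have "edge \<B> B a v" using v c' by blast
  from pivot_two[OF c'(1,15) this] have "(c1+:v+:(B - {a, r})) : \<B>"
   using c'(9) r by (auto simp: insert_commute[of r a])
  hence "edge \<B> (b+:(B' - {r})) c2 v" unfolding edge_def eq using c' v unfolding B'_def by auto
  thus False using n by simp
 qed
 with config_one[OF c2] u show "edge \<B> B' r u" by (auto simp: doubleton_eq_iff)
qed

end

text \<open>The elements \<open>a, r, c1, b, v, c2, u\<close> are numbered 1 to 7, and
  \<open>t123\<close> and the like decide the corresponding triples. Only 257 stays open; the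
  dependent triples found are the other six lines of the Fano plane. If 257 is independent, the
  matroid is the non-Fano matroid, and the second alternative offers the pair \<open>a, b\<close> in
  place of \<open>e, y\<close>.\<close>

lemma (in pair_extension) config_conclusion:
 assumes c: "config B a c1 r c2 b" and uv: "{u, v} = {e, y}" and ru: "edge \<B> B r u" "~ edge \<B> B r v"
 shows "Fano_family \<B> \<or> (ALL x:others. EX B':\<B>. {x, e, y} <= B') &
  (EX p q w B3. p ~= q & p : active \<B> & q : active \<B> & w : active \<B> - {p, q} & (ALL B':\<B>. ~ {p, q, w} <= B')
   & B3 : \<B> & p ~: B3 & q ~: B3
   & (ALL x:active \<B> - {p, q}. ALL w:active \<B> - {p, q}. joined \<B> B3 (active \<B> - {p, q}) x w))"
proof -
 note c' = config_others[OF c]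
 define Z where "Z = B - {a, r, b}"
 have d: "distinct [a, r, c1, b, v, c2, u]" using c'(9) uv by (auto simp: doubleton_eq_iff)
 have uvB: "u ~: B" "v ~: B" using c'(2,3) uv by (auto simp: doubleton_eq_iff)
 have B_eq: "B = Z Un {a, r, b}" using c' by (auto simp: Z_def)
 have Z: "Z Int {a, r, c1, b, v, c2, u} = {}" using c' uvB by (auto simp: Z_def)
 have E: "edge \<B> B a c1" "edge \<B> B a u" "edge \<B> B a v" "~ edge \<B> B a c2" "edge \<B> B r c1" "edge \<B> B r c2"
  "edge \<B> B r u" "~ edge \<B> B r v" "edge \<B> B b c2" "edge \<B> B b u" "edge \<B> B b v" "~ edge \<B> B b c1"
  using c' uv ru by (auto simp: doubleton_eq_iff)
 have one: "edge \<B> B x p \<longleftrightarrow> Z Un {x', x'', p} : \<B>" if "{x, x', x''} = {a, r, b}" "x ~= x'" "x ~= x''" "p ~: B" for x x' x'' p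
 proof -
  have "{x, x', x''} <= B" unfolding that(1) using c'(4-6) by simp
  hence "(p+:(B - {x})) = Z Un {x', x'', p}" "x : B"
   using that(2,3) unfolding Z_def that(1)[symmetric] by auto
  thus ?thesis using that by (simp add: edge_def)
 qed
 have two: "Z Un {x, p, q} : \<B>"
  if "edge \<B> B r1 p" "edge \<B> B r2 q" "{r1, r2, x} = {a, r, b}" "r1 ~= r2" "x ~= r1" "x ~= r2"
   "~ edge \<B> B r1 q \<or> ~ edge \<B> B r2 p" for r1 p r2 q x
 proof -
  have "{r1, r2, x} <= B" unfolding that(3) using c'(4-6) by simp
  hence "(p+:q+:(B - {r1, r2})) = Z Un {x, p, q}"
   using that(5,6) unfolding Z_def that(3)[symmetric] by auto
  thus ?thesis using pivot_two[OF c'(1) that(1,2,4,7)] by simp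
 qed
 have e_a_c1: "edge \<B> B a c1" and e_a_u: "edge \<B> B a u" and e_a_v: "edge \<B> B a v" and e_r_c1: "edge \<B> B r c1" and e_r_c2: "edge \<B> B r c2" and e_r_u: "edge \<B> B r u" and e_b_c2: "edge \<B> B b c2" and e_b_u: "edge \<B> B b u" and e_b_v: "edge \<B> B b v"
  and e_a_c2: "~ edge \<B> B a c2" and e_r_v: "~ edge \<B> B r v" and e_b_c1: "~ edge \<B> B b c1"
  by (fact E)+
 have p_arb: "{a, r, b} = {a, r, b}" and p_abr: "{a, b, r} = {a, r, b}" and p_rab: "{r, a, b} = {a, r, b}" and p_rba: "{r, b, a} = {a, r, b}" and p_bar: "{b, a, r} = {a, r, b}" and p_bra: "{b, r, a} = {a, r, b}" by auto
 have n_ar: "a ~= r" and n_ab: "a ~= b" and n_ra: "r ~= a" and n_rb: "r ~= b" and n_ba: "b ~= a" and n_br: "b ~= r" using d by auto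
 have k_c1: "c1 ~: B" and k_c2: "c2 ~: B" and k_u: "u ~: B" and k_v: "v ~: B" using c'(7,8) uvB by auto
 have t123: "Z Un {a, r, c1} ~: \<B>" unfolding one[OF p_bar n_ba n_br k_c1, symmetric] by (rule e_b_c1)
 have t124: "Z Un {a, r, b} : \<B>" using c'(1) B_eq by simp
 have t125: "Z Un {a, r, v} : \<B>" unfolding one[OF p_bar n_ba n_br k_v, symmetric] by (rule e_b_v)
 have t126: "Z Un {a, r, c2} : \<B>" unfolding one[OF p_bar n_ba n_br k_c2, symmetric] by (rule e_b_c2)
 have t127: "Z Un {a, r, u} : \<B>" unfolding one[OF p_bar n_ba n_br k_u, symmetric] by (rule e_b_u)
 have t134: "Z Un {a, c1, b} : \<B>"
 proof -
  have "{a, c1, b} = {a, b, c1}" by auto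
  moreover have "Z Un {a, b, c1} : \<B>" unfolding one[OF p_rab n_ra n_rb k_c1, symmetric] by (rule e_r_c1)
  ultimately show ?thesis by simp
 qed
 have t135: "Z Un {a, c1, v} : \<B>" by (rule two[OF e_r_c1 e_b_v p_rba n_rb n_ar n_ab disjI1[OF e_r_v]])
 have t136: "Z Un {a, c1, c2} : \<B>" by (rule two[OF e_r_c1 e_b_c2 p_rba n_rb n_ar n_ab disjI2[OF e_b_c1]])
 have t137: "Z Un {a, c1, u} : \<B>" by (rule two[OF e_r_c1 e_b_u p_rba n_rb n_ar n_ab disjI2[OF e_b_c1]])
 have t145: "Z Un {a, b, v} ~: \<B>" unfolding one[OF p_rab n_ra n_rb k_v, symmetric] by (rule e_r_v)
 have t146: "Z Un {a, b, c2} : \<B>" unfolding one[OF p_rab n_ra n_rb k_c2, symmetric] by (rule e_r_c2)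
 have t147: "Z Un {a, b, u} : \<B>" unfolding one[OF p_rab n_ra n_rb k_u, symmetric] by (rule e_r_u)
 have t156: "Z Un {a, v, c2} : \<B>" by (rule two[OF e_b_v e_r_c2 p_bra n_br n_ab n_ar disjI2[OF e_r_v]])
 have t157: "Z Un {a, v, u} : \<B>" by (rule two[OF e_b_v e_r_u p_bra n_br n_ab n_ar disjI2[OF e_r_v]])
 have t234: "Z Un {r, c1, b} : \<B>"
 proof -
  have "{r, c1, b} = {r, b, c1}" by auto
  moreover have "Z Un {r, b, c1} : \<B>" unfolding one[OF p_arb n_ar n_ab k_c1, symmetric] by (rule e_a_c1)
  ultimately show ?thesis by simp
 qed
 have t235: "Z Un {r, c1, v} : \<B>" by (rule two[OF e_a_c1 e_b_v p_abr n_ab n_ra n_rb disjI2[OF e_b_c1]])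
 have t236: "Z Un {r, c1, c2} : \<B>" by (rule two[OF e_a_c1 e_b_c2 p_abr n_ab n_ra n_rb disjI1[OF e_a_c2]])
 have t237: "Z Un {r, c1, u} : \<B>" by (rule two[OF e_a_c1 e_b_u p_abr n_ab n_ra n_rb disjI2[OF e_b_c1]])
 have t245: "Z Un {r, b, v} : \<B>" unfolding one[OF p_arb n_ar n_ab k_v, symmetric] by (rule e_a_v)
 have t246: "Z Un {r, b, c2} ~: \<B>" unfolding one[OF p_arb n_ar n_ab k_c2, symmetric] by (rule e_a_c2)
 have t247: "Z Un {r, b, u} : \<B>" unfolding one[OF p_arb n_ar n_ab k_u, symmetric] by (rule e_a_u)
 have t256: "Z Un {r, v, c2} : \<B>" by (rule two[OF e_a_v e_b_c2 p_abr n_ab n_ra n_rb disjI1[OF e_a_c2]])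
 have t267: "Z Un {r, c2, u} : \<B>" by (rule two[OF e_b_c2 e_a_u p_bar n_ba n_rb n_ra disjI2[OF e_a_c2]])
 have t345: "Z Un {c1, b, v} : \<B>"
 proof -
  have "{c1, b, v} = {b, c1, v}" by auto
  moreover have "Z Un {b, c1, v} : \<B>" by (rule two[OF e_r_c1 e_a_v p_rab n_ra n_br n_ba disjI1[OF e_r_v]])
  ultimately show ?thesis by simp
 qed
 have t346: "Z Un {c1, b, c2} : \<B>"
 proof -
  have "{c1, b, c2} = {b, c1, c2}" by auto
  moreover have "Z Un {b, c1, c2} : \<B>" by (rule two[OF e_a_c1 e_r_c2 p_arb n_ar n_ba n_br disjI1[OF e_a_c2]])
  ultimately show ?thesis by simp
 qed
 have t456: "Z Un {b, v, c2} : \<B>" by (rule two[OF e_a_v e_r_c2 p_arb n_ar n_ba n_br disjI1[OF e_a_c2]])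
 have t457: "Z Un {b, v, u} : \<B>" by (rule two[OF e_a_v e_r_u p_arb n_ar n_ba n_br disjI2[OF e_r_v]])
 have t467: "Z Un {b, c2, u} : \<B>" by (rule two[OF e_r_c2 e_a_u p_rab n_ra n_br n_ba disjI2[OF e_a_c2]])
 \<comment> \<open>The remaining dependent triples do not show in the fundamental graph of
   \<open>B\<close>: two come from \<open>config_line\<close> and its mirror image, the third from
   \<open>config_next_apex\<close>.\<close>
 have t347: "Z Un {c1, b, u} ~: \<B>"
 proof -
  have "(u+:((c1+:(B - {r})) - {a})) = Z Un {c1, b, u}" using d c' unfolding Z_def by auto
  thus ?thesis using config_line[OF c uv ru] d c' uvB by (auto simp: edge_def)
 qed
 have t167: "Z Un {a, c2, u} ~: \<B>"
 proof -
  have "(u+:((c2+:(B - {r})) - {b})) = Z Un {a, c2, u}" using d c' unfolding Z_def by auto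
  thus ?thesis using config_line[OF config_rev[OF c] uv ru] d c' uvB by (auto simp: edge_def)
 qed
 have B2_eq: "(x+:((c1+:c2+:(B - {a, b})) - {r})) = Z Un {c1, c2, x}" for x using d c' unfolding Z_def by auto
 have t367: "Z Un {c1, c2, u} : \<B>"
  using config_next_apex(1)[OF c uv ru] unfolding edge_def B2_eq by simp
 have t356: "Z Un {c1, v, c2} ~: \<B>"
  using config_next_apex(2)[OF c uv ru] d c' uvB unfolding edge_def B2_eq by (auto simp: insert_commute)
 have t357: "Z Un {c1, v, u} : \<B>"
 proof -
  have "r : Z Un {r, c1, u}" "r ~: Z Un {b, v, u}" using Z d by auto
  from exchange1[OF t237 t457 this] obtain x where x: "x : Z Un {b, v, u}" "x ~: Z Un {r, c1, u}" "(x+:(Z Un {r, c1, u} - {r})) : \<B>" by blast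
  have "(x+:(Z Un {r, c1, u} - {r})) = Z Un {c1, x, u}" using Z d by auto
  with x t347 show ?thesis by auto
 qed
 have t567: "Z Un {v, c2, u} : \<B>"
 proof -
  have "r : Z Un {r, c2, u}" "r ~: Z Un {a, v, u}" using Z d by auto
  from exchange1[OF t267 t157 this] obtain x where x: "x : Z Un {a, v, u}" "x ~: Z Un {r, c2, u}" "(x+:(Z Un {r, c2, u} - {r})) : \<B>" by blast
  have "(x+:(Z Un {r, c2, u} - {r})) = Z Un {x, c2, u}" using Z d by auto
  with x t167 show ?thesis by auto
 qed
 have act: "active \<B> = {a, r, c1, b, v, c2, u}"
 proof -
  have "others = {a, c1, r, c2, b}" using c by (simp add: config_def)
  moreover have "{u, v} <= active \<B>" "active \<B> = others Un {u, v}" unfolding uv using ey by auto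
  ultimately have "active \<B> = {a, c1, r, c2, b} Un {u, v}" by simp
  also have "\<dots> = {a, r, c1, b, v, c2, u}" by auto
  finally show ?thesis .
 qed
 have bases: "Z <= B' & B' - Z <= {a, r, c1, b, v, c2, u} & card (B' - Z) = 3" if B': "B' : \<B>" for B'
 proof -
  have inact: "z : B' \<longleftrightarrow> z : B" if "z ~: {a, r, c1, b, v, c2, u}" for z
   using activeI[of z B' \<B> B] activeI[of z B \<B> B'] that B' c'(1) unfolding act by blast
  have ZB: "Z <= B'" using inact Z unfolding Z_def by blast
  moreover have "B' - Z <= {a, r, c1, b, v, c2, u}" using inact unfolding Z_def by blast
  moreover have "card (B' - Z) = card B' - card Z"
   using ZB finite_basis[OF c'(1)] by (intro card_Diff_subset) (auto simp: Z_def)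
  moreover have "card B' = card B" by (rule card_basis[OF B' c'(1)])
  moreover have "card B = card Z + 3"
   using d Z finite_basis[OF c'(1)] unfolding B_eq by (subst card_Un_disjoint) (auto simp: Z_def)
  ultimately show ?thesis by simp
 qed
 show ?thesis
 proof (cases "Z Un {r, v, u} : \<B>")
  case False
  define x where "x i = [a, r, c1, b, v, c2, u] ! (i - 1)" for i :: nat
  have seven: "{1..7::nat} = {1,2,3,4,5,6,7}" by auto
  have x: "x 1 = a" "x 2 = r" "x 3 = c1" "x 4 = b" "x 5 = v" "x 6 = c2" "x 7 = u"
   by (simp_all add: x_def)
  have img: "x ` {1..7} = {a, r, c1, b, v, c2, u}" unfolding seven image_insert image_empty x by simp
  have inj: "inj_on x {1..7}"
  proof (rule eq_card_imp_inj_on)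
   show "card (x ` {1..7}) = card {1..7::nat}" unfolding img using d by simp
  qed simp
  have P: "Z Un x ` T : \<B> \<longleftrightarrow> T ~: Fano_lines" if "T <= {1..7}" "card T = 3" for T
   using that
   by (rule three_subsets_of_seven; (simp only: image_insert image_empty x t123 t124 t125 t126 t127 t134 t135 t136 t137 t145 t146 t147 t156 t157 t167 t234 t235 t236 t237 t245 t246 t247 t256 t267 t345 t346 t347 t356 t357 t367 t456 t457 t467 t567 False)?; simp add: Fano_lines_def set_eq_subset)
  have "\<B> = {Z Un x ` T | T. T <= {1..7::nat} & card T = 3 & T ~: Fano_lines}"
  proof (intro equalityI subsetI)
   fix B' assume B': "B' : \<B>"
   from bases[OF B'] have *: "Z <= B'" "B' - Z <= x ` {1..7}" "card (B' - Z) = 3" unfolding img by auto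
   from *(2) obtain T where T: "T <= {1..7}" "B' - Z = x ` T" by (meson subset_imageE)
   have T3: "card T = 3" using *(3) card_image[OF inj_on_subset[OF inj T(1)]] unfolding T(2) by simp
   have eq: "B' = Z Un x ` T" using *(1) T(2) by auto
   with P[OF T(1) T3] B' have "T ~: Fano_lines" by simp
   with eq T(1) T3 show "B' : {Z Un x ` T | T. T <= {1..7::nat} & card T = 3 & T ~: Fano_lines}"
    by (intro CollectI exI[of _ T] conjI)
  next
   fix B' assume "B' : {Z Un x ` T | T. T <= {1..7::nat} & card T = 3 & T ~: Fano_lines}"
   then obtain T where "B' = Z Un x ` T" "T <= {1..7}" "card T = 3" "T ~: Fano_lines" by (elim CollectE exE conjE)
   thus "B' : \<B>" using P[of T] by simp
  qed
  moreover have "x ` {1..7} Int Z = {}" unfolding img using Z by blast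
  ultimately show ?thesis using inj unfolding Fano_family_def by (intro disjI1 exI[of _ Z] exI[of _ x] conjI)
 next
  \<comment> \<open>The non-Fano matroid. Every other element lies in a common basis with
    \<open>e\<close> and \<open>y\<close>, whereas \<open>a\<close>, \<open>b\<close>,
    \<open>v\<close> lie in no common basis. This asymmetry is what makes a second attempt with the
    pair \<open>a, b\<close> succeed.\<close>
  case True
  have all: "EX B':\<B>. {x, e, y} <= B'" if "x : others" for x
  proof -
   have "x : {a, r, c1, b, c2}" using that c by (auto simp: config_def)
   hence "Z Un {x, v, u} : \<B>" using t157 t357 t457 t567 True by (auto simp: insert_commute)
   moreover have "{x, e, y} <= Z Un {x, v, u}" using uv by blast
   ultimately show ?thesis by blast
  qed
  have abv: "~ {a, b, v} <= B'" if B': "B' : \<B>" for B'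
  proof
   assume "{a, b, v} <= B'"
   hence "{a, b, v} <= B' - Z" using Z by blast
   moreover have "card {a, b, v} = 3" using d by simp
   moreover have "finite (B' - Z)" using finite_basis[OF B'] by simp
   ultimately have "B' - Z = {a, b, v}" using bases[OF B'] card_subset_eq by metis
   hence "B' = Z Un {a, b, v}" using bases[OF B'] by blast
   thus False using t145 B' by simp
  qed
  let ?B3 = "Z Un {r, c1, c2}"
  have B3: "?B3 : \<B>" "a ~: ?B3" "b ~: ?B3" using t236 Z d by auto
  have rest: "active \<B> - {a, b} = {r, c1, v, c2, u}" using act d by auto
  have adj: "adj \<B> ?B3 r u" "adj \<B> ?B3 c1 u" "adj \<B> ?B3 c2 u" "adj \<B> ?B3 c1 v"
  proof -
   have eq: "(u+:(?B3 - {r})) = Z Un {c1, c2, u}" "(u+:(?B3 - {c1})) = Z Un {r, c2, u}"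
    "(u+:(?B3 - {c2})) = Z Un {r, c1, u}" "(v+:(?B3 - {c1})) = Z Un {r, v, c2}"
    using Z d by auto
   show "adj \<B> ?B3 r u" "adj \<B> ?B3 c1 u" "adj \<B> ?B3 c2 u" "adj \<B> ?B3 c1 v"
    unfolding adj_def edge_def eq using t367 t267 t237 t256 Z d by auto
  qed
  let ?j = "joined \<B> ?B3 {r, c1, v, c2, u}"
  have j: "?j r u" "?j c1 u" "?j c2 u" "?j c1 v" using adj by (auto intro!: joined_adj)
  have "?j x u" if "x : {r, c1, v, c2, u}" for x
  proof -
   have "?j u u" by (simp add: joined_def)
   moreover have "?j v u" using joined_trans[OF joined_sym[OF j(4)] j(2)] .
   ultimately show ?thesis using that j by auto
  qed
  hence conn: "?j x w" if "x : {r, c1, v, c2, u}" "w : {r, c1, v, c2, u}" for x w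
   using joined_trans joined_sym that by metis
  have "a ~= b & a : active \<B> & b : active \<B> & v : active \<B> - {a, b} & (ALL B':\<B>. ~ {a, b, v} <= B')
   & ?B3 : \<B> & a ~: ?B3 & b ~: ?B3
   & (ALL x:active \<B> - {a, b}. ALL w:active \<B> - {a, b}. joined \<B> ?B3 (active \<B> - {a, b}) x w)"
  proof (intro conjI ballI)
   show "a : active \<B>" "b : active \<B>" "v : active \<B> - {a, b}" "a ~= b" using act d by auto
   show "~ {a, b, v} <= B'" if "B' : \<B>" for B' using abv[OF that] .
   show "?B3 : \<B>" "a ~: ?B3" "b ~: ?B3" using B3 .
   show "joined \<B> ?B3 (active \<B> - {a, b}) x w" if "x : active \<B> - {a, b}" "w : active \<B> - {a, b}" for x w
    using that unfolding rest by (rule conn)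
  qed
  thus ?thesis using all by blast
 qed
qed

section \<open>Solvability from a pair whose removal keeps a fundamental graph connected\<close>

lemma rtranclp_crossing:
 assumes "R\<^sup>*\<^sup>* x w" "x : C" "w ~: C" shows "EX p q. R p q & p : C & q ~: C"
 using assms by (induction rule: rtranclp_induct) blast+

context mod_subgroup
begin

text \<open>On the bases without \<open>e\<close> and \<open>y\<close> the two solutions differ by
  weights. Subtracting these from one of them on all its bases preserves the equations.\<close>

lemma glue_pair:
 assumes bf: "basis_family \<B>" and f1: "solves W (slice \<B> e False) f1" and f2: "solves W (slice \<B> y False) f2"
 shows "EX g. solves W (slice \<B> e False) g & solves W (slice \<B> y False) g"
proof -
 interpret basis_family \<B> by fact
 let ?N = "slice (slice \<B> e False) y False"
 have sub: "?N <= slice \<B> e False" "?N <= slice \<B> y False" by (auto simp: slice_def)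
 have "solves (\<lambda>S a b c d. 0) ?N (\<lambda>B. f1 B - f2 B)"
  using solves_diff[OF solves_mono[OF f1 sub(1)] solves_mono[OF f2 sub(2)]] by simp
 from homogeneous_weights[OF slice_basis_family[OF slice_basis_family[OF bf]] this]
 obtain k \<tau> where k: "ALL B:?N. f1 B - f2 B \<doteq> k + sum \<tau> B" by blast
 define f1' where "f1' B = f1 B - (k + sum \<tau> B)" for B
 have f1': "solves W (slice \<B> e False) f1'" unfolding f1'_def
  by (rule solves_add_weights[OF f1]) (use finite_basis in \<open>simp add: slice_def\<close>)
 define g where "g B = (if e : B then f2 B else f1' B)" for B
 have "solves W (slice \<B> e False) g"
  by (rule solves_cong[OF f1']) (simp add: g_def slice_def)
 moreover have "solves W (slice \<B> y False) g"
 proof (rule solves_cong[OF f2])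
  fix B assume B: "B : slice \<B> y False"
  show "f2 B \<doteq> g B"
  proof (cases "e : B")
   case False
   hence "B : ?N" using B by (simp add: slice_def)
   with k have "f1 B - f2 B \<doteq> k + sum \<tau> B" by blast
   from cg_lin1[OF cg_sym[OF this]] show ?thesis using False by (simp add: g_def f1'_def algebra_simps)
  qed (simp add: g_def)
 qed
 ultimately show ?thesis by blast
qed

text \<open>The equation of a square and that of its rearrangement involve the same four values of
  \<open>f\<close>, so solvability forces these symmetries on \<open>W\<close>.\<close>

lemma label_symmetries:
 assumes sol: "solves W \<C> f" and sq: "square \<C> S a b c d"
 shows "W S c d a b \<doteq> W S a b c d" "W S a b d c \<doteq> - W S a b c d"
proof -
 have sq2: "square \<C> S c d a b" "square \<C> S a b d c"
  using sq by (auto simp: square_def insert_commute[of c a] insert_commute[of c b] insert_commute[of d a] insert_commute[of d b])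
 note e = sol[unfolded solves_def, rule_format]
 show "W S c d a b \<doteq> W S a b c d"
  by (rule cg_lin2[OF cg_sym[OF e[OF sq2(1)]] e[OF sq]])
   (simp add: insert_commute[of c a] insert_commute[of c b] insert_commute[of d a] insert_commute[of d b])
 show "W S a b d c \<doteq> - W S a b c d"
  by (rule cg_lin2[OF cg_sym[OF e[OF sq2(2)]] cg_sym[OF e[OF sq]]]) simp
qed

text \<open>The third alternative is the non-Fano case: it records a property of the pair
  \<open>e, y\<close> together with a second pair \<open>p, q\<close> that lacks this
  property.\<close>

lemma connected_pair_cases:
 assumes bf: "basis_family \<B>" and minors: "!!z v. z : active \<B> ==> EX f. solves W (slice \<B> z v) f"
  and large: "card (active \<B>) \<ge> 6" and ey: "e ~= y" "e : active \<B>" "y : active \<B>"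
  and B0: "B0 : \<B>" "e ~: B0" "y ~: B0"
  and conn: "!!x w. x : active \<B> - {e, y} ==> w : active \<B> - {e, y} ==> joined \<B> B0 (active \<B> - {e, y}) x w"
 shows "(EX h. solves W \<B> h) \<or> Fano_family \<B> \<or> (ALL x:active \<B> - {e, y}. EX B':\<B>. {x, e, y} <= B') &
  (EX p q w B3. p ~= q & p : active \<B> & q : active \<B> & w : active \<B> - {p, q} & (ALL B':\<B>. ~ {p, q, w} <= B')
   & B3 : \<B> & p ~: B3 & q ~: B3
   & (ALL x:active \<B> - {p, q}. ALL w:active \<B> - {p, q}. joined \<B> B3 (active \<B> - {p, q}) x w))"
  (is "_ \<or> ?other")
proof -
 interpret basis_family \<B> by fact
 obtain f1 f2 where "solves W (slice \<B> e False) f1" "solves W (slice \<B> y False) f2" using minors ey by metis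
 from glue_pair[OF bf this] obtain g where g: "solves W (slice \<B> e False) g" "solves W (slice \<B> y False) g" by blast
 interpret pair_extension K \<B> W e y g by unfold_locales (use minors large ey g in auto)
 show ?thesis
 proof (cases "EX B a b. bad B a b")
  case True
  then obtain B a b where bad: "bad B a b" by blast
  hence B: "B : \<B>" "B Int {e, y} = {}" by (auto simp: bad_def four_edges_def)
  have B0': "B0 Int {e, y} = {}" using B0 by simp
  have "joined \<B> B (active \<B> - {e, y}) x w" if "x : active \<B> - {e, y}" "w : active \<B> - {e, y}" for x w
   by (rule joined_all_bases[OF B0(1) B0' B conn]) (use that in auto)
  from bad_config[OF bad this] obtain c1 r c2 where c: "config B a c1 r c2 b" by blast
  have "?other"
  proof (cases "edge \<B> B r e")
   case True
   hence "~ edge \<B> B r y" using config_not_both[OF c] by blast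
   from config_conclusion[OF c refl True this] show ?thesis .
  next
   case False
   hence "edge \<B> B r y" using config_one[OF c] by blast
   from config_conclusion[OF c insert_commute this False] show ?thesis .
  qed
  thus ?thesis by blast
 next
  case False
  have no_defect: "defect S a b \<doteq> 0" if sq: "square \<B> S a b e y" for S a b
  proof (cases "(a+:b+:S) : \<B>")
   case True
   have "~ bad (a+:b+:S) a b" using False by blast
   thus ?thesis using square_four_edges[OF sq True] by (simp add: bad_def)
  qed (rule defect_parallel[OF sq _ B0])
  have "EX h. solves W \<B> h"
  proof (rule extend_pair[OF no_defect])
   fix S a b c d assume sq: "square \<B> S a b c d"
   have "card {a, b, c, d} <= 5" by (simp add: card_insert_if)
   then obtain z where z: "z : active \<B>" "z ~: {a, b, c, d}" using exists_active[of "{a, b, c, d}"] by auto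
   obtain f where f: "solves W (slice \<B> z (z : S)) f" using minors z by blast
   have "square (slice \<B> z (z : S)) S a b c d" using square_slice[OF sq z(2)] by simp
   from label_symmetries[OF f this] show "W S c d a b \<doteq> W S a b c d" "W S a b d c \<doteq> - W S a b c d" .
  next
   fix z v assume z: "z : active \<B>" "z ~= e" "z ~= y"
   have "card {e, y, z} <= 5" by (simp add: card_insert_if)
   then obtain w where w: "w : active \<B>" "w ~: {e, y, z}" using exists_active[of "{e, y, z}"] by auto
   \<comment> \<open>Connectivity gives \<open>z\<close> a neighbour at \<open>B0\<close> other than
     \<open>e\<close> and \<open>y\<close>. Exchanging \<open>z\<close> with it changes whether
     \<open>z\<close> is in the basis, so both values of \<open>v\<close> occur.\<close>
   have "joined \<B> B0 (active \<B> - {e, y}) z w" using z w by (intro conn) auto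
   from rtranclp_crossing[OF this[unfolded joined_def], of "{z}"] w
   obtain q where q: "adj \<B> B0 z q" "q ~= z" "q ~= e" "q ~= y" by auto
   then consider "edge \<B> B0 z q" | "edge \<B> B0 q z" by (auto simp: adj_def)
   hence "EX B1:\<B>. (z : B1) ~= (z : B0) & e ~: B1 & y ~: B1"
   proof cases
    case 1
    thus ?thesis using q B0 by (intro bexI[of _ "(q+:(B0 - {z}))"]) (auto simp: edge_def)
   next
    case 2
    thus ?thesis using z B0 by (intro bexI[of _ "(z+:(B0 - {q}))"]) (auto simp: edge_def)
   qed
   thus "EX B:\<B>. (z : B) = v & e ~: B & y ~: B" using B0 by (cases "(z : B0) = v") blast+
  qed
  thus ?thesis ..
 qed
qed

text \<open>In the third case the argument is repeated with the pair \<open>p, q\<close>. It cannot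
  end in the third case again, because no basis contains \<open>p\<close>, \<open>q\<close> and
  \<open>w\<close>.\<close>

theorem connected_pair_solvable:
 assumes bf: "basis_family \<B>" and minors: "!!z v. z : active \<B> ==> EX f. solves W (slice \<B> z v) f"
  and large: "card (active \<B>) \<ge> 6" and ey: "e ~= y" "e : active \<B>" "y : active \<B>"
  and B0: "B0 : \<B>" "e ~: B0" "y ~: B0"
  and conn: "!!x w. x : active \<B> - {e, y} ==> w : active \<B> - {e, y} ==> joined \<B> B0 (active \<B> - {e, y}) x w"
 shows "(EX h. solves W \<B> h) \<or> Fano_family \<B>"
proof (rule ccontr)
 assume n: "~ ?thesis"
 with connected_pair_cases[OF assms] obtain p q w B3
  where *: "p ~= q" "p : active \<B>" "q : active \<B>" "w : active \<B> - {p, q}" "ALL B':\<B>. ~ {p, q, w} <= B'"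
   "B3 : \<B>" "p ~: B3" "q ~: B3"
   "ALL x:active \<B> - {p, q}. ALL w:active \<B> - {p, q}. joined \<B> B3 (active \<B> - {p, q}) x w" by metis
 have "ALL x:active \<B> - {p, q}. EX B':\<B>. {x, p, q} <= B'"
  using connected_pair_cases[OF bf minors large *(1-3,6-8)] *(9) n by blast
 with *(4) obtain B' where "B' : \<B>" "{w, p, q} <= B'" by blast
 thus False using *(5) by blast
qed

end

section \<open>Two removable vertices of a fundamental graph\<close>

definition conn :: "'e set set => 'e set => 'e set => bool" where
 "conn \<B> B A \<longleftrightarrow> (ALL x:A. ALL w:A. joined \<B> B A x w)"

lemma joined_mono: "joined \<B> B A x w ==> A <= A' ==> joined \<B> B A' x w"
 unfolding joined_def by (rule rtranclp_mono[THEN predicate2D, rotated]) auto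

lemma conn_insert:
 assumes "conn \<B> B A" "a : A" "adj \<B> B a q" shows "conn \<B> B (q+:A)"
proof -
 let ?J = "joined \<B> B (q+:A)"
 have "?J x a" if "x : (q+:A)" for x
 proof (cases "x = q")
  case True
  thus ?thesis using assms(2,3) by (intro joined_adj) (auto simp: adj_sym)
 next
  case False
  hence "joined \<B> B A x a" using that assms by (auto simp: conn_def)
  thus ?thesis by (rule joined_mono) auto
 qed
 thus ?thesis unfolding conn_def using joined_trans joined_sym by metis
qed

lemma adj_crossing:
 assumes "conn \<B> B V" "a : V" "a : C" "~ V <= C"
 obtains p q where "adj \<B> B p q" "p : V" "q : V" "p : C" "q ~: C"
proof -
 obtain z where z: "z : V" "z ~: C" using assms by blast
 hence "joined \<B> B V a z" using assms by (simp add: conn_def)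
 from rtranclp_crossing[OF this[unfolded joined_def] assms(3) z(2)] that show ?thesis by blast
qed

text \<open>With the core as large as possible, core and pendant vertices cover \<open>V\<close>: a
  vertex next to the core could join it, and a vertex next to a pendant one could replace that one,
  which then joins the core. Two of the three pendant vertices lie on the same side of the
  bipartition; what remains without them is connected.\<close>

lemma star_pair:
 assumes fin: "finite V" and conn: "conn \<B> B V" and v: "v : V"
  and n: "distinct [n1, n2, n3]" "{n1, n2, n3} <= V" "adj \<B> B v n1" "adj \<B> B v n2" "adj \<B> B v n3"
 shows "EX e y. e ~= y & e : V & y : V & (e : B \<longleftrightarrow> y : B) & conn \<B> B (V - {e, y})"
proof -
 \<comment> \<open>a connected core \<open>A\<close> with three pendant vertices, as in a spanning tree with three leaves\<close>
 define Q where "Q A L \<longleftrightarrow> A <= V & L <= V & A Int L = {} & card L = 3 & A ~= {} & conn \<B> B A & (ALL l:L. EX a:A. adj \<B> B a l)" for A L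
 have nv: "v ~= n1" "v ~= n2" "v ~= n3" using n by (auto simp: adj_def edge_def)
 have Q0: "Q {v} {n1, n2, n3}"
  unfolding Q_def using v n nv by (auto simp: conn_def joined_def)
 let ?N = "{card A | A L. Q A L}"
 have bounded: "?N <= {..card V}" using fin by (auto simp: Q_def intro: card_mono)
 have ne: "?N ~= {}" using Q0 by blast
 have finN: "finite ?N" by (rule finite_subset[OF bounded]) simp
 from Max_in[OF finN ne] obtain A L where AL: "Q A L" "card A = Max ?N" by auto
 have maximal: "card A' <= card A" if "Q A' L'" for A' L'
  unfolding AL(2) using that by (intro Max_ge[OF finN]) blast
 note q = AL(1)[unfolded Q_def]
 have finA: "finite A" using q fin finite_subset by metis
 have "V <= A Un L"
 proof (rule ccontr)
  assume no: "~ V <= A Un L"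
  obtain a where "a : A" using q by blast
  hence "a : V" "a : A Un L" using q by auto
  from adj_crossing[OF conn this no] obtain p w
   where pw: "adj \<B> B p w" "p : V" "w : V" "p : A Un L" "w ~: A Un L" by blast
  show False
  proof (cases "p : A")
   case True
   have "Q (w+:A) L" unfolding Q_def using q pw conn_insert[of \<B> B A p w] True by auto
   from maximal[OF this] show False using finA pw by simp
  next
   case False
   hence p: "p : L" using pw by blast
   then obtain a where a: "a : A" "adj \<B> B a p" using q by blast
   have finL: "finite L" using q fin finite_subset by metis
   have "card (w+:(L - {p})) = 3" using q p pw finL by (simp add: card_Suc_Diff1)
   moreover have "conn \<B> B (p+:A)" using q a by (intro conn_insert) auto
   moreover have "ALL l:(w+:(L - {p})). EX a:(p+:A). adj \<B> B a l" using q pw by blast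
   ultimately have "Q (p+:A) (w+:(L - {p}))" unfolding Q_def using q p pw by blast
   from maximal[OF this] show False using finA False by simp
  qed
 qed
 hence V: "V = A Un L" using q by blast
 obtain l1 l2 l3 where L: "L = {l1, l2, l3}" "distinct [l1, l2, l3]"
 proof -
  have "card L = 3" using q by blast
  thus ?thesis using that unfolding card_3_iff by auto
 qed
 have main: "?thesis" if "L = {x, y, z}" "distinct [x, y, z]" "x : B \<longleftrightarrow> y : B" for x y z
 proof -
  have zL: "z : L" using that(1) by simp
  have pend: "ALL l:L. EX a:A. adj \<B> B a l" and disj: "A Int L = {}" and cA: "conn \<B> B A" using q by simp_all
  obtain a where a: "a : A" "adj \<B> B a z" using pend zL by blast
  have "x ~: A" "y ~: A" using disj unfolding that(1) by auto
  hence "V - {x, y} = (z+:A)" unfolding V that(1) using that(2) by auto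
  hence "conn \<B> B (V - {x, y})" using conn_insert[OF cA a] by simp
  moreover have "x ~= y" "x : V" "y : V" using that(2) unfolding V that(1) by auto
  ultimately show ?thesis using that(3) by blast
 qed
 consider "l1 : B \<longleftrightarrow> l2 : B" | "l1 : B \<longleftrightarrow> l3 : B" | "l2 : B \<longleftrightarrow> l3 : B" by blast
 thus ?thesis
 proof cases
  case 1
  thus ?thesis using main[of l1 l2 l3] L by simp
 next
  case 2
  have "L = {l1, l3, l2}" using L by auto
  thus ?thesis using main[of l1 l3 l2] L 2 by auto
 next
  case 3
  have "L = {l2, l3, l1}" using L by auto
  thus ?thesis using main[of l2 l3 l1] L 3 by auto
 qed
qed

lemma adj_edge: "adj \<B> B x w ==> x : B ==> edge \<B> B x w" by (auto simp: adj_def edge_def)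

lemma adj_edge': "adj \<B> B x w ==> w : B ==> edge \<B> B w x" by (auto simp: adj_def edge_def)

text \<open>If all degrees are at most two, pivoting in the middle of a path creates a vertex of degree three.\<close>

lemma (in basis_family) exists_branching:
 assumes B: "B : \<B>" and conn: "conn \<B> B (active \<B>)" and large: "card (active \<B>) \<ge> 6"
 shows "EX B':\<B>. EX v:active \<B>. EX n1 n2 n3. distinct [n1, n2, n3] & {n1, n2, n3} <= active \<B>
  & adj \<B> B' v n1 & adj \<B> B' v n2 & adj \<B> B' v n3"
proof (rule ccontr)
 assume no: "~ ?thesis"
 have adj_active: "x : active \<B>" "w : active \<B>" if "adj \<B> B' x w" "B' : \<B>" for B' x w
  using that edge_activeD[OF that(2)] by (auto simp: adj_def)
 have deg: False if "adj \<B> B' v n1" "adj \<B> B' v n2" "adj \<B> B' v n3" "distinct [n1, n2, n3]" "B' : \<B>" for B' v n1 n2 n3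
 proof -
  have "{n1, n2, n3} <= active \<B>" "v : active \<B>" using adj_active that by auto
  thus False using no that by blast
 qed
 have fin: "finite (active \<B>)" using active_finite basis_family_axioms by blast
 have irr: "x ~= w" if "adj \<B> B' x w" for B' x w using that by (auto simp: adj_def edge_def)
 have cross: "EX p q. adj \<B> B p q & p : C & q ~: C" if "C <= active \<B>" "x : C" "finite C" "card C <= 5" for C x
 proof -
  have "~ active \<B> <= C"
  proof
   assume "active \<B> <= C"
   from card_mono[OF that(3) this] that(4) large show False by linarith
  qed
  moreover have "x : active \<B>" using that by blast
  moreover note xC = that(2)
  ultimately obtain p q where "adj \<B> B p q" "p : C" "q ~: C"
   using adj_crossing[OF conn _ xC] by metis
  thus ?thesis by blast
 qed
 obtain x where x: "x : active \<B>" using large by fastforce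
 from cross[of "{x}" x] x obtain w where xw: "adj \<B> B x w" by auto
 have xw': "x ~= w" "w : active \<B>" using irr[OF xw] adj_active(2)[OF xw B] by auto
 obtain p q s where pqs: "adj \<B> B p q" "adj \<B> B q s" "distinct [p, q, s]"
 proof -
  have "card {x, w} <= 5" by (simp add: card_insert_if)
  with cross[of "{x, w}" x] x xw' obtain p q where pq: "adj \<B> B p q" "p : {x, w}" "q ~: {x, w}" by auto
  show ?thesis
  proof (cases "p = x")
   case True
   thus ?thesis using that[of q x w] pq xw xw' irr[OF pq(1)] adj_sym[of \<B> B] by auto
  next
   case False
   thus ?thesis using that[of x w q] pq xw xw' irr[OF pq(1)] by auto
  qed
 qed
 obtain x1 x2 x3 x4 where x4: "adj \<B> B x1 x2" "adj \<B> B x2 x3" "adj \<B> B x3 x4" "distinct [x1, x2, x3, x4]"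
 proof -
  have sub: "{p, q, s} <= active \<B>" using adj_active pqs B by auto
  have "card {p, q, s} <= 5" by (simp add: card_insert_if)
  with cross[of "{p, q, s}" p] sub obtain u z where uz: "adj \<B> B u z" "u : {p, q, s}" "z ~: {p, q, s}" by auto
  have "u ~= q"
  proof
   assume "u = q"
   thus False using deg[of B q p s z] pqs uz B adj_sym[of \<B> B p q] by auto
  qed
  then consider "u = p" | "u = s" using uz by blast
  thus ?thesis
  proof cases
   case 1
   thus ?thesis using that[of z p q s] uz pqs adj_sym[of \<B> B p z] by auto
  next
   case 2
   thus ?thesis using that[of p q s z] uz pqs by auto
  qed
 qed
 obtain x0 x1 x2 x3 x4 where path: "adj \<B> B x0 x1" "adj \<B> B x1 x2" "adj \<B> B x2 x3" "adj \<B> B x3 x4" "distinct [x0, x1, x2, x3, x4]"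
 proof -
  have sub: "{x1, x2, x3, x4} <= active \<B>" using adj_active x4 B by auto
  have "card {x1, x2, x3, x4} <= 5" by (simp add: card_insert_if)
  with cross[of "{x1, x2, x3, x4}" x1] sub obtain u z where uz: "adj \<B> B u z" "u : {x1, x2, x3, x4}" "z ~: {x1, x2, x3, x4}" by auto
  have "u ~= x2"
  proof
   assume "u = x2"
   thus False using deg[of B x2 x1 x3 z] x4 uz B adj_sym[of \<B> B x1 x2] by auto
  qed
  moreover have "u ~= x3"
  proof
   assume "u = x3"
   thus False using deg[of B x3 x2 x4 z] x4 uz B adj_sym[of \<B> B x2 x3] by auto
  qed
  ultimately consider "u = x1" | "u = x4" using uz by blast
  thus ?thesis
  proof cases
   case 1
   thus ?thesis using that[of z x1 x2 x3 x4] uz x4 adj_sym[of \<B> B x1 z] by auto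
  next
   case 2
   thus ?thesis using that[of x1 x2 x3 x4 z] uz x4 by auto
  qed
 qed
 have n03: "~ adj \<B> B x0 x3" using deg[of B x3 x2 x4 x0] path B adj_sym[of \<B> B x2 x3] adj_sym[of \<B> B x0 x3] by auto
 have n14: "~ adj \<B> B x1 x4" using deg[of B x1 x0 x2 x4] path B adj_sym[of \<B> B x0 x1] by auto
 have side: "x : B \<longleftrightarrow> w ~: B" if "adj \<B> B x w" for x w using that by (auto simp: adj_def edge_def)
 show False
 proof (cases "x2 : B")
  case True
  have "x4 : B" "x0 : B" using True side[OF path(1)] side[OF path(2)] side[OF path(3)] side[OF path(4)] by simp_all
  with True have e: "edge \<B> B x2 x3" "edge \<B> B x2 x1" "edge \<B> B x4 x3" "edge \<B> B x0 x1"
   using adj_edge[OF path(3)] adj_edge'[OF path(2)] adj_edge'[OF path(4)] adj_edge[OF path(1)] by simp_all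
  \<comment> \<open>Now \<open>x1\<close> has three neighbours: \<open>x4\<close> is new,
    \<open>x0\<close> is kept, and \<open>x3\<close> has taken the place of
    \<open>x2\<close>.\<close>
  let ?B = "(x3+:(B - {x2}))"
  have "edge \<B> ?B x4 x1" by (rule pivot_new[OF B e(1-3)]) (use n14 in \<open>auto simp: adj_def\<close>)
  moreover have "edge \<B> ?B x0 x1" by (rule pivot_keeps[OF B e(1,4)]) (use n03 path(5) in \<open>auto simp: adj_def\<close>)
  moreover have "edge \<B> ?B x3 x1"
  proof -
   have "(x1+:(?B - {x3})) = (x1+:(B - {x2}))" using e by (auto simp: edge_def)
   thus ?thesis using e path(5) by (auto simp: edge_def)
  qed
  moreover have "?B : \<B>" using edge_memD(3)[OF e(1)] .
  ultimately show False using deg[of ?B x1 x4 x0 x3] path(5) by (auto simp: adj_def)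
 next
  case False
  have "x3 : B" "x1 : B" using False side[OF path(2)] side[OF path(3)] by simp_all
  hence e: "edge \<B> B x3 x2" "edge \<B> B x3 x4" "edge \<B> B x1 x2" "edge \<B> B x1 x0"
   using adj_edge'[OF path(3)] adj_edge[OF path(4)] adj_edge[OF path(2)] adj_edge'[OF path(1)] by simp_all
  let ?B = "(x2+:(B - {x3}))"
  have "edge \<B> ?B x1 x4" by (rule pivot_new[OF B e(1-3)]) (use n14 in \<open>auto simp: adj_def\<close>)
  moreover have "edge \<B> ?B x1 x0" by (rule pivot_keeps[OF B e(1,4)]) (use n03 path(5) in \<open>auto simp: adj_def\<close>)
  moreover have "edge \<B> ?B x1 x3"
  proof -
   have "(x3+:(?B - {x1})) = (x2+:(B - {x1}))" using e path(5) by (auto simp: edge_def)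
   thus ?thesis using e path(5) by (auto simp: edge_def)
  qed
  moreover have "?B : \<B>" using edge_memD(3)[OF e(1)] .
  ultimately show False using deg[of ?B x1 x4 x0 x3] path(5) by (auto simp: adj_def)
 qed
qed

section \<open>Duality\<close>

definition dual_family :: "'e set => 'e set set => 'e set set" where
 "dual_family E \<B> = (\<lambda>B. E - B) ` \<B>"

lemma dual_dual: "\<Union>\<B> <= E ==> dual_family E (dual_family E \<B>) = \<B>"
 unfolding dual_family_def image_image by (rule trans[OF image_cong[OF refl] image_ident]) (auto simp: double_diff)

lemma dual_mem: "\<Union>\<B> <= E ==> X <= E ==> X : dual_family E \<B> \<longleftrightarrow> E - X : \<B>"
 unfolding dual_family_def by (metis (no_types, lifting) Union_upper double_diff image_iff order_refl order_trans)

lemma dual_basis_family: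
 assumes bf: "basis_family \<B>" and E: "finite E" "\<Union>\<B> <= E"
 shows "basis_family (dual_family E \<B>)"
proof -
 interpret basis_family \<B> by fact
 show ?thesis
 proof
  show "finite (\<Union> (dual_family E \<B>))" by (rule finite_subset[OF _ E(1)]) (auto simp: dual_family_def)
 next
  fix X X' x assume X: "X : dual_family E \<B>" "X' : dual_family E \<B>" "x : X" "x ~: X'"
  then obtain B B' where B: "B : \<B>" "X = E - B" "B' : \<B>" "X' = E - B'" by (auto simp: dual_family_def)
  with X have "x : B'" "x ~: B" by auto
  from exchange2[OF B(1,3) this] obtain z where z: "z : B" "z ~: B'" "(x+:(B - {z})) : \<B>" by blast
  have "(z+:(X - {x})) = E - (x+:(B - {z}))" using z B X E by auto
  hence "(z+:(X - {x})) : dual_family E \<B>" using z by (auto simp: dual_family_def)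
  moreover have "z : X'" "z ~: X" using z B E by auto
  ultimately show "EX y. y : X' & y ~: X & (y+:(X - {x})) : dual_family E \<B>" by blast
 next
  fix X X' x assume X: "X : dual_family E \<B>" "X' : dual_family E \<B>" "x : X'" "x ~: X"
  then obtain B B' where B: "B : \<B>" "X = E - B" "B' : \<B>" "X' = E - B'" by (auto simp: dual_family_def)
  with X have "x : B" "x ~: B'" by auto
  from exchange1[OF B(1,3) this] obtain z where z: "z : B'" "z ~: B" "(z+:(B - {x})) : \<B>" by blast
  have "(x+:(X - {z})) = E - (z+:(B - {x}))" using z B X E by auto
  hence "(x+:(X - {z})) : dual_family E \<B>" using z by (auto simp: dual_family_def)
  moreover have "z ~: X'" "z : X" using z B E by auto
  ultimately show "EX z. z : X & z ~: X' & (x+:(X - {z})) : dual_family E \<B>" by blast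
 qed
qed

lemma active_dual: "\<Union>\<B> <= E ==> active (dual_family E \<B>) = active \<B>"
 by (auto simp: active_def dual_family_def)

lemma edge_dual:
 assumes "\<Union>\<B> <= E" "B : \<B>" "r : E" "c : E"
 shows "edge (dual_family E \<B>) (E - B) c r \<longleftrightarrow> edge \<B> B r c"
proof (cases "r : B & c ~: B")
 case True
 hence "(r+:(E - B - {c})) = E - (c+:(B - {r}))" using assms by auto
 moreover have "E - (c+:(B - {r})) : dual_family E \<B> \<longleftrightarrow> (c+:(B - {r})) : \<B>"
 proof -
  have "E - (E - (c+:(B - {r}))) = (c+:(B - {r}))" using assms by auto
  thus ?thesis using dual_mem[OF assms(1), of "E - (c+:(B - {r}))"] by simp
 qed
 ultimately show ?thesis using True assms by (simp add: edge_def)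
qed (use assms in \<open>auto simp: edge_def\<close>)

lemma adj_dual:
 assumes "\<Union>\<B> <= E" "B : \<B>" "r : E" "c : E"
 shows "adj (dual_family E \<B>) (E - B) r c \<longleftrightarrow> adj \<B> B r c"
 using edge_dual[OF assms] edge_dual[OF assms(1,2,4,3)] by (auto simp: adj_def)

lemma conn_dual:
 assumes "\<Union>\<B> <= E" "B : \<B>" "A <= E"
 shows "conn (dual_family E \<B>) (E - B) A \<longleftrightarrow> conn \<B> B A"
proof -
 have "(\<lambda>x w. adj (dual_family E \<B>) (E - B) x w & x : A & w : A) = (\<lambda>x w. adj \<B> B x w & x : A & w : A)"
  using adj_dual[OF assms(1,2)] assms(3) by (intro ext) blast
 thus ?thesis by (simp add: conn_def joined_def)
qed

lemma slice_dual: "z : E ==> slice (dual_family E \<B>) z v = dual_family E (slice \<B> z (~ v))"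
 by (auto simp: slice_def dual_family_def)

text \<open>Complements turn the square at \<open>S\<close> into the square of the same four
  elements at the complement of \<open>S + a + b + c + d\<close>; the two bases on either side of
  the equation are interchanged.\<close>

lemma (in mod_subgroup) solves_dual:
 assumes sol: "solves W' (dual_family E \<B>) f" and E: "\<Union>\<B> <= E"
  and W: "!!S a b c d. square \<B> S a b c d ==> W' (E - S - {a, b, c, d}) a b c d = W S a b c d"
 shows "solves W \<B> (\<lambda>B. f (E - B))"
 unfolding solves_def
proof (intro allI impI)
 fix S a b c d assume sq: "square \<B> S a b c d"
 let ?S = "E - S - {a, b, c, d}"
 note s = sq[unfolded square_def]
 have inE: "a : E" "b : E" "c : E" "d : E" using s E by blast+
 have eq: "(a+:c+:?S) = E - (b+:d+:S)" "(b+:d+:?S) = E - (a+:c+:S)"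
  "(a+:d+:?S) = E - (b+:c+:S)" "(b+:c+:?S) = E - (a+:d+:S)"
  using s inE by auto
 have "square (dual_family E \<B>) ?S a b c d"
  unfolding square_def eq using s by (auto simp: dual_family_def)
 from sol[unfolded solves_def, rule_format, OF this]
 show "f (E - (a+:c+:S)) + f (E - (b+:d+:S)) \<doteq>
   W S a b c d + (f (E - (a+:d+:S)) + f (E - (b+:c+:S)))"
  unfolding eq W[OF sq] by (simp add: add.commute)
qed

lemma interval_interval: "interval (interval \<B> I J) I' J' = interval \<B> (I Un I') (J Un J')"
 by (auto simp: interval_def)

lemma slice_of_interval: "EX I' J'. slice (interval \<B> I J) z v = interval \<B> I' J'"
 unfolding slice_interval by (auto simp: interval_interval intro: exI)

lemma card_active_slice:
 assumes "basis_family \<B>" "z : active \<B>" shows "card (active (slice \<B> z v)) < card (active \<B>)"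
 using active_interval_less[OF assms, of "{z}" "{}"] active_interval_less[OF assms, of "{}" "{z}"]
 by (auto simp: slice_interval)

section \<open>Gluing solutions on small minors\<close>

text \<open>Duality enters because \<open>star_pair\<close> may find its pair inside the basis,
  whereas \<open>connected_pair_solvable\<close> wants it outside. In the dual family the complement
  of the basis serves.\<close>

theorem (in mod_subgroup) solvable_of_small_minors:
 assumes bf: "basis_family \<B>" and E: "finite E" "\<Union>\<B> <= E"
  and small: "!!I J. card (active (interval \<B> I J)) <= 5 ==> EX f. solves W (interval \<B> I J) f"
  and Fano: "!!I J. Fano_family (interval \<B> I J) ==> EX f. solves W (interval \<B> I J) f"
  and dual_Fano: "!!I J. Fano_family (dual_family E (interval \<B> I J)) ==> EX f. solves W (interval \<B> I J) f"
  and disconnected: "!!I J C. [|C Int active (interval \<B> I J) ~= {}; ~ active (interval \<B> I J) <= C;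
   !!B r c. B : interval \<B> I J ==> edge (interval \<B> I J) B r c ==> r : C \<longleftrightarrow> c : C;
   !!z v. z : active (interval \<B> I J) ==> EX f. solves W (slice (interval \<B> I J) z v) f|]
   ==> EX f. solves W (interval \<B> I J) f"
 shows "EX f. solves W \<B> f"
proof -
 have "EX f. solves W (interval \<B> I J) f" for I J
 proof (induction "card (active (interval \<B> I J))" arbitrary: I J rule: less_induct)
  case less
  let ?N = "interval \<B> I J"
  have bfN: "basis_family ?N" by (rule interval_basis_family[OF bf])
  interpret N: basis_family ?N by fact
  have EN: "\<Union>?N <= E" using E by (auto simp: interval_def)
  have minors: "EX f. solves W (slice ?N z v) f" if z: "z : active ?N" for z v
  proof -
   obtain I' J' where eq: "slice ?N z v = interval \<B> I' J'" using slice_of_interval by metis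
   show ?thesis using less.hyps[of I' J'] card_active_slice[OF bfN z, of v] unfolding eq by blast
  qed
  show ?case
  proof (cases "card (active ?N) <= 5")
   case True
   thus ?thesis by (rule small)
  next
   case False
   hence large: "card (active ?N) \<ge> 6" by simp
   then obtain x where x: "x : active ?N" by fastforce
   then obtain B where B: "B : ?N" by (auto simp: active_def)
   define C where "C = {w. joined ?N B (active ?N) x w}"
   show ?thesis
   proof (cases "active ?N <= C")
    case False
    show ?thesis
    proof (rule disconnected[OF _ False _ minors])
    show "C Int active ?N ~= {}" using x by (auto simp: C_def joined_def)
    fix B' r c assume B': "B' : ?N" "edge ?N B' r c"
    have "r : C \<longleftrightarrow> c : C" if "edge ?N B r c" for r c
    proof -
    have "joined ?N B (active ?N) r c"
    using N.edge_activeD[OF B that] that by (intro joined_adj) (auto simp: adj_def)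
    thus ?thesis unfolding C_def using joined_trans joined_sym by (metis mem_Collect_eq)
    qed
    thus "r : C \<longleftrightarrow> c : C" by (rule N.edge_invariant[OF B B'(1) _ B'(2)])
    qed
   next
    case True
    hence connB: "conn ?N B (active ?N)"
    unfolding conn_def C_def using joined_trans joined_sym by (metis mem_Collect_eq subsetD)
    from N.exists_branching[OF B this large] obtain B1 v n1 n2 n3
    where *: "B1 : ?N" "v : active ?N" "distinct [n1, n2, n3]" "{n1, n2, n3} <= active ?N"
    "adj ?N B1 v n1" "adj ?N B1 v n2" "adj ?N B1 v n3" by blast
    have "conn ?N B1 (active ?N)"
    unfolding conn_def using N.joined_all_bases[OF B, of "{}" B1 "active ?N"] connB *(1) by (auto simp: conn_def)
    from star_pair[OF active_finite[OF bfN] this *(2-7)] obtain e y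
    where ey: "e ~= y" "e : active ?N" "y : active ?N" "e : B1 \<longleftrightarrow> y : B1" "conn ?N B1 (active ?N - {e, y})" by blast
    show ?thesis
    proof (cases "e : B1")
    case False
    hence "e ~: B1" "y ~: B1" using ey by auto
    from connected_pair_solvable[OF bfN minors large ey(1-3) *(1) this] ey(5) Fano show ?thesis
    unfolding conn_def by blast
    next
    case True
    let ?D = "dual_family E ?N"
    let ?W = "\<lambda>S a b c d. W (E - S - {a, b, c, d}) a b c d"
    have bfD: "basis_family ?D" by (rule dual_basis_family[OF bfN E(1) EN])
    have actD: "active ?D = active ?N" by (rule active_dual[OF EN])
    have actE: "active ?N <= E" using EN by (auto simp: active_def)
    have W: "?W (E - S - {a, b, c, d}) a b c d = W S a b c d" if "square \<C> S a b c d" "\<Union>\<C> <= E" for \<C> S a b c d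
    proof -
    have "(a+:c+:S) : \<C>" "a ~: S" "b ~: S" "c ~: S" "d ~: S" using that by (auto simp: square_def)
    hence "E - (E - S - {a, b, c, d}) - {a, b, c, d} = S" using that(2) by auto
    thus ?thesis by simp
    qed
    have minorsD: "EX f. solves ?W (slice ?D z v) f" if z: "z : active ?D" for z v
    proof -
    have zN: "z : active ?N" "z : E" using z actD actE by auto
    obtain f where f: "solves W (slice ?N z (~ v)) f" using minors zN by blast
    have sub: "\<Union>(slice ?N z (~ v)) <= E" using EN by (auto simp: slice_def)
    have dual_sub: "\<Union>(dual_family E (slice ?N z (~ v))) <= E" by (auto simp: dual_family_def)
    have "solves ?W (dual_family E (slice ?N z (~ v))) (\<lambda>B. f (E - B))"
    by (rule solves_dual[of W _ _ f]) (use f dual_dual[OF sub] dual_sub in simp_all)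
    thus ?thesis unfolding slice_dual[OF zN(2)] by blast
    qed
    have B1E: "B1 <= E" using EN *(1) by blast
    have "E - B1 : ?D" "e ~: E - B1" "y ~: E - B1" using *(1) True ey(4) by (auto simp: dual_family_def)
    moreover have "conn ?D (E - B1) (active ?D - {e, y})"
    unfolding actD using conn_dual[OF EN *(1), of "active ?N - {e, y}"] actE ey(5) by blast
    ultimately have "(EX h. solves ?W ?D h) \<or> Fano_family ?D"
    using connected_pair_solvable[OF bfD minorsD] large ey(1-3) unfolding actD conn_def by blast
    thus ?thesis
    proof
    assume "EX h. solves ?W ?D h"
    then obtain h where "solves ?W ?D h" by blast
    hence "solves W ?N (\<lambda>B. h (E - B))"
    by (rule solves_dual[OF _ EN]) (use W EN in blast)
    thus ?thesis by blast
    qed (rule dual_Fano)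
    qed
   qed
  qed
 qed
 hence "EX f. solves W (interval \<B> {} {}) f" .
 thus ?thesis by (simp add: interval_def)
qed

text \<open>The family of bases of a matroid on \<open>{1..n}\<close>, up to relabelling and coloops.\<close>

definition pattern :: "nat set set => nat => 'e set set => bool" where
 "pattern T n \<B> \<longleftrightarrow> (EX Z x. inj_on x {1..n} & x ` {1..n} Int Z = {} & \<B> = {Z Un x ` X | X. X : T})"

section \<open>Families of the special types, and labels that behave like cross ratios\<close>

definition uniform_bases :: "nat => nat => nat set set" where
 "uniform_bases r n = {X. X <= {1..n} & card X = r}"

definition Fano_bases :: "nat set set" where
 "Fano_bases = uniform_bases 3 7 - Fano_lines"

definition special_bases :: "(nat set set \<times> nat) set" where
 "special_bases = {(uniform_bases 2 4, 4), (uniform_bases 2 5, 5), (uniform_bases 3 5, 5),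
  (uniform_bases 3 5 - {{1,2,3}}, 5), (Fano_bases, 7), (dual_family {1..7} Fano_bases, 7)}"

text \<open>What the gluing needs to know about the logarithms \<open>w\<close> of cross ratios:
  their symmetries, their vanishing when two hyperplanes of a pair coincide (\<open>w_deg\<close>),
  and that they depend only on the hyperplanes spanned (\<open>w_par\<close>, \<open>w_cl\<close>).
  Here \<open>\<epsilon>\<close> plays the role of the logarithm of -1, and \<open>s\<close> that of
  the sign of an ordered pair.\<close>

locale cross_labels = mod_subgroup K + basis_family \<B>
 for K :: "'v::ab_group_add set" and \<B> :: "'e set set" +
 fixes E :: "'e set" and s :: "'e => 'e => 'v" and \<epsilon> :: 'v and w :: "('e, 'v) label"
 assumes finite_E: "finite E" and in_E: "\<Union>\<B> <= E"
  and sign: "!!x z. x : E ==> z : E ==> x ~= z ==> s x z - s z x \<doteq> \<epsilon>"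
  and w_sym1: "!!S a b c d. square \<B> S a b c d ==> w S c d a b \<doteq> w S a b c d"
  and w_sym2: "!!S a b c d. square \<B> S a b c d ==> w S a b d c \<doteq> - w S a b c d"
  and w_deg: "!!S a b c d. square \<B> S a b c d ==> (c+:d+:S) ~: \<B> ==> w S a b c d \<doteq> 0"
  and w_par: "!!S a b c d d'. [|square \<B> S a b c d; square \<B> S a b c d'; (d+:d'+:S) ~: \<B>|]
   ==> w S a b c d \<doteq> w S a b c d'"
  and w_cl: "!!S z z' a b c d. [|square \<B> (z+:S) a b c d; square \<B> (z'+:S) a b c d; z ~: S; z' ~: S;
   !!x. x : {a, b, c, d} ==> (x+:z+:z'+:S) ~: \<B>|]
   ==> w (z+:S) a b c d \<doteq> w (z'+:S) a b c d"
  and special: "!!I J T n. (T, n) : special_bases ==> pattern T n (interval \<B> I J) ==>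
   EX f. solves (\<lambda>S a b c d. w S a b c d + (s a c + s b d - s a d - s b c)) (interval \<B> I J) f"
begin

text \<open>If an alternating function is turned into one on sets by fixing an order, the signs that
  involve \<open>S\<close> cancel in the equation of a square, and this is what is left.\<close>

abbreviation "sgn4 a b c d \<equiv> s a c + s b d - s a d - s b c"

abbreviation "W \<equiv> \<lambda>S a b c d. w S a b c d + sgn4 a b c d"

lemma square_in_E:
 assumes "square \<B> S a b c d" shows "a : E" "b : E" "c : E" "d : E"
 using assms in_E unfolding square_def by blast+

lemma sgn4_sym:
 assumes "square \<B> S a b c d"
 shows "sgn4 c d a b \<doteq> sgn4 a b c d"
proof -
 have E: "a : E" "b : E" "c : E" "d : E" using square_in_E[OF assms] .
 have d: "a ~= c" "b ~= d" "a ~= d" "b ~= c" using assms by (auto simp: square_def)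
 note * = sign[OF E(3,1) d(1)[symmetric]] sign[OF E(4,2) d(2)[symmetric]] cg_sym[OF sign[OF E(4,1) d(3)[symmetric]]]
  cg_sym[OF sign[OF E(3,2) d(4)[symmetric]]]
 show ?thesis by (rule cg_lin4[OF *]) simp
qed

lemma W_sym1: "square \<B> S a b c d ==> W S c d a b \<doteq> W S a b c d"
 by (rule cg_add[OF w_sym1 sgn4_sym])

lemma W_sym2: "square \<B> S a b c d ==> W S a b d c \<doteq> - W S a b c d"
 by (rule cg_lin1[OF w_sym2]) (simp_all add: algebra_simps)

definition holds :: "('e set => 'v) => 'e set => 'e => 'e => 'e => 'e => bool" where
 "holds f S a b c d \<longleftrightarrow> f (a+:c+:S) + f (b+:d+:S)
  \<doteq> W S a b c d + (f (a+:d+:S) + f (b+:c+:S))"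

lemma holds_swap:
 assumes sq: "square \<B> S a b c d" and h: "holds f S a b d c" shows "holds f S a b c d"
 unfolding holds_def
 by (rule cg_lin2[OF cg_sym[OF h[unfolded holds_def]] cg_sym[OF W_sym2[OF sq]]]) (simp add: algebra_simps)

lemma holds_flip:
 assumes sq: "square \<B> S a b c d" and h: "holds f S c d a b" shows "holds f S a b c d"
 unfolding holds_def
 by (rule cg_lin2[OF h[unfolded holds_def insert_commute[of c a] insert_commute[of c b] insert_commute[of d a]
   insert_commute[of d b]] W_sym1[OF sq]]) (simp add: algebra_simps)

lemma square_swap: "square \<C> S a b c d ==> square \<C> S a b d c"
 by (auto simp: square_def)

lemma square_flip: "square \<C> S a b c d ==> square \<C> S c d a b"
 by (auto simp: square_def insert_commute[of c a] insert_commute[of c b] insert_commute[of d a] insert_commute[of d b])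

lemma solves_holds: "solves W \<C> f \<longleftrightarrow> (ALL S a b c d. square \<C> S a b c d --> holds f S a b c d)"
 by (simp add: solves_def holds_def)

lemma square_mono: "square \<C> S a b c d ==> \<C> <= \<C>' ==> square \<C>' S a b c d"
 unfolding square_def by blast

text \<open>The value on a basis through \<open>e\<close> is copied from the basis with
  \<open>y\<close> instead, and the sum of \<open>g\<close> corrects the signs. Replacing
  \<open>e\<close> by its parallel \<open>y\<close> does not change a label: by \<open>w_cl\<close>
  if \<open>e\<close> is in \<open>S\<close>, by \<open>w_par\<close> if it is a corner of the
  square. If \<open>y\<close> is the partner of \<open>e\<close> in the square, the label vanishes
  by \<open>w_deg\<close>.\<close>

lemma parallel_extension:
 assumes N_def: "N = interval \<B> I J" and ey: "e ~= y" and no: "!!B. B : N ==> ~ (e : B & y : B)"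
  and swap: "!!A. e ~: A ==> y ~: A ==> (e+:A) : N ==> (y+:A) : N"
  and f0: "solves W (slice N e False) f0"
 shows "EX f. solves W N f"
proof -
 have N: "N <= \<B>" by (auto simp: N_def interval_def)
 have no': "(e+:y+:X) ~: \<B>" if "I <= (e+:y+:X)" "(e+:y+:X) Int J = {}" for X
  using no[of "(e+:y+:X)"] that by (auto simp: N_def interval_def)
 have IS: "I <= S" "(u+:v+:S) Int J = {}"
  if "square N S a b c d" "u : {a, b, c, d}" "v : {a, b, c, d}" for S a b c d u v
 proof -
  have "I <= (a+:c+:S)" "I <= (b+:d+:S)" "(a+:c+:S) Int J = {}" "(b+:d+:S) Int J = {}"
   "distinct [a, b, c, d]" using that(1) by (auto simp: square_def N_def interval_def)
  thus "I <= S" "(u+:v+:S) Int J = {}" using that(2,3) by auto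
 qed
 define g where "g x = s x e - s x y" for x
 define f where "f B = (if e : B then f0 (y+:(B - {e})) + sum g (B - {e}) else f0 B)" for B
 have finN: "finite B" if "B : N" for B using that N finite_basis by blast
 have main: "holds f S a b c e" if sq: "square N S a b c e" for S a b c
 proof -
  note s' = sq[unfolded square_def]
  have fin: "finite S" using square_finite[OF sq finN] .
  have fe: "f (x+:e+:S) = f0 (x+:y+:S) + (g x + sum g S)" if "x = a \<or> x = b" for x
  proof -
   have "(x+:e+:S) - {e} = (x+:S)" using s' that by auto
   moreover have "(y+:x+:S) = (x+:y+:S)" by auto
   moreover have "sum g (x+:S) = g x + sum g S" using s' that fin by auto
   ultimately show ?thesis by (simp add: f_def)
  qed
  have fc: "f (x+:c+:S) = f0 (x+:c+:S)" if "x = a \<or> x = b" for x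
   using s' that by (auto simp: f_def)
  have yS: "y ~: S" "y ~= a" "y ~= b" using no[of "(a+:e+:S)"] no[of "(b+:e+:S)"] s' by auto
  show ?thesis
  proof (cases "y = c")
   case True
   have "(c+:e+:S) ~: \<B>"
    using no'[of S] IS[OF sq, of e c] unfolding True insert_commute[of c e] by auto
   from w_deg[OF square_mono[OF sq N] this] have w0: "w S a b c e \<doteq> 0" .
   show ?thesis
    unfolding holds_def fe[OF disjI1[OF refl]] fe[OF disjI2[OF refl]] fc[OF disjI1[OF refl]] fc[OF disjI2[OF refl]]
    by (rule cg_lin1[OF cg_sym[OF w0]]) (simp add: g_def True algebra_simps)
  next
   case False
   have "(a+:y+:S) : N" "(b+:y+:S) : N"
    using swap[of "(a+:S)"] swap[of "(b+:S)"] s' yS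
    by (auto simp: insert_commute[of e a] insert_commute[of e b] insert_commute[of y a] insert_commute[of y b])
   hence sq': "square N S a b c y" using s' yS False by (auto simp: square_def)
   hence "square (slice N e False) S a b c y" by (rule square_slice) (use s' ey in auto)
   with f0 have h: "holds f0 S a b c y" by (simp add: solves_holds)
   have w1: "w S a b c e \<doteq> w S a b c y"
   proof (rule w_par[OF square_mono[OF sq N] square_mono[OF sq' N] no'])
    show "I <= (e+:y+:S)" "(e+:y+:S) Int J = {}"
    using IS[OF sq, of a e] IS[OF sq', of a y] by auto
   qed
   show ?thesis
    unfolding holds_def fe[OF disjI1[OF refl]] fe[OF disjI2[OF refl]] fc[OF disjI1[OF refl]] fc[OF disjI2[OF refl]]
    by (rule cg_lin2[OF h[unfolded holds_def] cg_sym[OF w1]]) (simp add: g_def algebra_simps)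
  qed
 qed
 have "holds f S a b c d" if sq: "square N S a b c d" for S a b c d
 proof -
  have sqB: "square \<B> S a b c d" by (rule square_mono[OF sq N])
  note s' = sq[unfolded square_def]
  consider "e : S" | "e = d" | "e = c" | "e = b" | "e = a" | "e ~: S Un {a, b, c, d}" by blast
  thus ?thesis
  proof cases
   case 1
   define T where "T = S - {e}"
   have S: "S = (e+:T)" "e ~: T" using 1 by (auto simp: T_def)
   have yT: "y ~: S" "y ~= a" "y ~= b" "y ~= c" "y ~= d"
    using no[of "(a+:c+:S)"] no[of "(b+:d+:S)"] s' 1 by auto
   have ne: "e ~: {a, b, c, d}" using s' 1 by auto
   have fin: "finite T" using square_finite[OF sq finN] by (simp add: T_def)
   have sw: "(u+:v+:y+:T) : N" if "(u+:v+:S) : N" "u : {a, b}" "v : {c, d}" for u v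
   proof -
    have "(e+:u+:v+:T) = (u+:v+:S)" using S by auto
    moreover have "(y+:u+:v+:T) = (u+:v+:y+:T)" by auto
    ultimately show ?thesis using swap[of "(u+:v+:T)"] that yT ne S by auto
   qed
   have sq': "square N (y+:T) a b c d" unfolding square_def using s' yT S(1) by (auto intro!: sw)
   hence "square (slice N e False) (y+:T) a b c d" by (rule square_slice) (use ne ey S(2) in auto)
   with f0 have h: "holds f0 (y+:T) a b c d" by (simp add: solves_holds)
   have wS: "w S a b c d \<doteq> w (y+:T) a b c d"
    unfolding S(1)
   proof (rule w_cl)
    show "square \<B> (e+:T) a b c d" using sqB S(1) by simp
    show "square \<B> (y+:T) a b c d" by (rule square_mono[OF sq' N])
    show "(x+:e+:y+:T) ~: \<B>" if x: "x : {a, b, c, d}" for x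
    proof -
    have "(x+:e+:y+:T) = (e+:y+:x+:T)" by auto
    moreover have "I <= (x+:e+:y+:T)" "(x+:e+:y+:T) Int J = {}"
    using IS[OF sq x x] IS[OF sq' x x] S(1) by auto
    ultimately show ?thesis using no'[of "(x+:T)"] by simp
    qed
   qed (use yT S in auto)
   have "f (u+:v+:S) = f0 (u+:v+:y+:T) + (g u + g v + sum g T)"
    if "u : {a, b}" "v : {c, d}" for u v
   proof -
    have "u ~= v" "u ~: S" "v ~: S" "u ~= e" "v ~= e" using that s' ne by auto
    moreover from this have "(u+:v+:S) - {e} = (u+:v+:T)" by (auto simp: T_def)
    moreover have "(y+:u+:v+:T) = (u+:v+:y+:T)" by auto
    moreover have "sum g (u+:v+:T) = g u + g v + sum g T"
    using calculation(1-3) fin S(1) by (simp add: algebra_simps)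
    ultimately show ?thesis using 1 by (simp add: f_def)
   qed
   hence fs: "f (a+:c+:S) = f0 (a+:c+:y+:T) + (g a + g c + sum g T)"
    "f (b+:d+:S) = f0 (b+:d+:y+:T) + (g b + g d + sum g T)"
    "f (a+:d+:S) = f0 (a+:d+:y+:T) + (g a + g d + sum g T)"
    "f (b+:c+:S) = f0 (b+:c+:y+:T) + (g b + g c + sum g T)" by simp_all
   show ?thesis unfolding holds_def fs
    by (rule cg_lin2[OF h[unfolded holds_def] cg_sym[OF wS]]) (simp add: algebra_simps)
  next
   case 2
   thus ?thesis using main sq by simp
  next
   case 3
   show ?thesis by (rule holds_swap[OF sqB]) (use main square_swap[OF sq] 3 in simp)
  next
   case 4
   show ?thesis by (rule holds_flip[OF sqB]) (use main square_flip[OF sq] 4 in simp)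
  next
   case 5
   show ?thesis
    by (rule holds_flip[OF sqB], rule holds_swap[OF square_flip[OF sqB]])
    (use main square_swap[OF square_flip[OF sq]] 5 in simp)
  next
   case 6
   hence "square (slice N e False) S a b c d" by (intro square_slice[OF sq]) auto
   hence "holds f0 S a b c d" using f0 by (simp add: solves_holds)
   thus ?thesis using 6 by (simp add: holds_def f_def)
  qed
 qed
 thus ?thesis unfolding solves_holds by blast
qed

end

section \<open>Direct sums, series pairs, and minors with at most five active elements\<close>

lemma (in basis_family) separator_exchange:
 assumes sep: "!!B r c. B : \<B> ==> edge \<B> B r c ==> r : C \<longleftrightarrow> c : C"
  and B: "B : \<B>" "B0 : \<B>"
 shows "(B Int C) Un (B0 - C) : \<B>"
 using B(2)
proof (induction "card ((B0 Int C) - B)" arbitrary: B0 rule: less_induct)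
 case less
 have fin: "finite B0" using less.prems finite_basis by blast
 show ?case
 proof (cases "B0 Int C <= B")
  case True
  have "B Int C <= B0"
  proof (rule ccontr)
   assume "~ ?thesis"
   then obtain y where y: "y : B" "y : C" "y ~: B0" by blast
   from exchange2[OF less.prems B(1) y(1,3)] obtain x where x: "x : B0" "x ~: B" "(y+:(B0 - {x})) : \<B>" by blast
   hence "edge \<B> B0 x y" using y by (simp add: edge_def)
   hence "x : C" using sep[OF less.prems] y by blast
   thus False using True x by blast
  qed
  hence "(B Int C) Un (B0 - C) = B0" using True by blast
  thus ?thesis using less.prems by simp
 next
  case False
  then obtain x where x: "x : B0" "x : C" "x ~: B" by blast
  from exchange1[OF less.prems B(1) x(1,3)] obtain y where y: "y : B" "y ~: B0" "(y+:(B0 - {x})) : \<B>" by blast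
  hence "edge \<B> B0 x y" using x by (simp add: edge_def)
  hence yC: "y : C" using sep[OF less.prems] x by blast
  let ?B1 = "(y+:(B0 - {x}))"
  have "(?B1 Int C) - B <= (B0 Int C) - B" using y(1) by blast
  moreover have "x : (B0 Int C) - B" "x ~: (?B1 Int C) - B" using x y(1) by auto
  ultimately have "(?B1 Int C) - B \<subset> (B0 Int C) - B" by blast
  hence "card ((?B1 Int C) - B) < card ((B0 Int C) - B)" using fin by (simp add: psubset_card_mono)
  from less.hyps[OF this y(3)] have "(B Int C) Un (?B1 - C) : \<B>" .
  moreover have "?B1 - C = B0 - C" using x yC by auto
  ultimately show ?thesis by simp
 qed
qed

context cross_labels
begin

text \<open>By \<open>separator_exchange\<close> the two sides of a basis can be varied
  independently. So each side is solved in a minor where one element of the other side is fixed as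
  in \<open>B0\<close>, and the two solutions are added; \<open>cross\<close> collects the signs
  between the sides.\<close>

lemma direct_sum_solvable:
 assumes N: "N = interval \<B> I J" and C: "C Int active N ~= {}" "~ active N <= C"
  and sep: "!!B r c. B : N ==> edge N B r c ==> r : C \<longleftrightarrow> c : C"
  and minors: "!!z v. z : active N ==> EX f. solves W (slice N z v) f"
 shows "EX f. solves W N f"
proof -
 have NB: "N <= \<B>" by (auto simp: N interval_def)
 interpret N: basis_family N unfolding N by (rule interval_basis_family[OF basis_family_axioms])
 from C obtain z1 z2 where z1: "z1 : C" "z1 : active N" and z2: "z2 ~: C" "z2 : active N" by blast
 then obtain B0 where B0: "B0 : N" by (auto simp: active_def)
 have sepC: "r : - C \<longleftrightarrow> c : - C" if "B : N" "edge N B r c" for B r c using sep[OF that] by blast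
 have mixC: "(B Int C) Un (B' - C) : N" if "B : N" "B' : N" for B B'
  by (rule N.separator_exchange[OF sep that])
 obtain fC where fC: "solves W (slice N z2 (z2 : B0)) fC" using minors[OF z2(2)] by blast
 obtain fD where fD: "solves W (slice N z1 (z1 : B0)) fD" using minors[OF z1(2)] by blast
 define pC where "pC B = (B Int C) Un (B0 - C)" for B
 define pD where "pD B = (B0 Int C) Un (B - C)" for B
 define cross where "cross B = (\<Sum>x\<in>B Int C. \<Sum>z\<in>B - C. s x z)" for B
 define f where "f B = fC (pC B) + fD (pD B) + cross B" for B
 have finN: "finite B" if "B : N" for B using that by (rule N.finite_basis)
 \<comment> \<open>The label depends on \<open>S\<close> only through the side \<open>D\<close> that
   contains \<open>a\<close>, \<open>b\<close>, \<open>c\<close>, \<open>d\<close>. The other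
   elements of \<open>S\<close> are exchanged one at a time, and since no exchange crosses the
   separation, the hypothesis of \<open>w_cl\<close> holds at each step.\<close>
 have flat: "w S a b c d \<doteq> w S' a b c d"
  if sq: "square N S a b c d" and sq': "square N S' a b c d" and in_D: "a : D & b : D & c : D & d : D"
   and D: "D = C \<or> D = - C" and SS: "S Int D = S' Int D" for S S' a b c d D
  using sq SS
 proof (induction "card (S - S')" arbitrary: S rule: less_induct)
  case less
  have sepD: "r : D \<longleftrightarrow> c : D" if "B : N" "edge N B r c" for B r c using sep[OF that] D by blast
  have fin: "finite S" "finite S'" using square_finite[OF less.prems(1) finN] square_finite[OF sq' finN] by blast+
  note s1 = less.prems(1)[unfolded square_def] and s2 = sq'[unfolded square_def]
  have cards: "card S = card S'"
   using N.card_basis[of "(a+:c+:S)" "(a+:c+:S')"] s1 s2 fin by auto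
  show ?case
  proof (cases "S <= S'")
   case True
   hence "S = S'" using cards fin by (simp add: card_subset_eq)
   thus ?thesis by simp
  next
   case False
   then obtain z where z: "z : S" "z ~: S'" by blast
   hence zD: "z ~: D" using less.prems(2) by blast
   have zne: "z ~: {a, b, c, d}" using z s1 by auto
   let ?B = "(a+:c+:S)" and ?B' = "(a+:c+:S')"
   have "z : ?B" "z ~: ?B'" using z zne by auto
   from N.exchange1[OF _ _ this] s1 s2 obtain z' where z': "z' : ?B'" "z' ~: ?B" "(z'+:(?B - {z})) : N" by blast
   hence z'S: "z' : S'" "z' ~: S" by auto
   have "edge N ?B z z'" using z z' by (simp add: edge_def)
   hence z'D: "z' ~: D" using sepD[of ?B z z'] s1 zD by blast
   have z'ne: "z' ~: {a, b, c, d}" using z'S s2 by auto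
   define R where "R = S - {z}"
   have S: "S = (z+:R)" "z ~: R" using z by (auto simp: R_def)
   have zz': "z' ~: R" "z ~= z'" using z'S z by (auto simp: R_def)
   have dep: "(x+:z+:z'+:R) ~: N" if "x : {a, b, c, d}" for x
   proof
    assume X: "(x+:z+:z'+:R) : N"
    define x' where "x' = (if x : {a, b} then c else a)"
    have x': "(x+:x'+:S) : N" "x' ~: S" "x' ~= x" "x' : D" "x' ~= z'" "x ~= z'" "x ~: S"
    using that s1 in_D z'ne by (auto simp: x'_def insert_commute[of _ a])
    have "(z'+:((x+:x'+:S) - {x'})) = (x+:z+:z'+:R)" using x' S by auto
    hence "edge N (x+:x'+:S) x' z'" using X x' z'S by (simp add: edge_def)
    from sepD[OF x'(1) this] x' z'D show False by blast
   qed
   have new: "(u+:v+:z'+:R) : N" if uv: "u : {a, b}" "v : {c, d}" for u v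
   proof -
    have uvS: "(u+:v+:S) : N" "u ~= v" "u ~: S" "v ~: S" using uv s1 by auto
    have uvS': "(u+:v+:S') : N" using uv s2 by auto
    have "z' : (u+:v+:S')" "z' ~: (u+:v+:S)" using z'S z'ne uv by auto
    from N.exchange2[OF uvS(1) uvS' this] obtain q
    where q: "q : (u+:v+:S)" "q ~: (u+:v+:S')" "(z'+:((u+:v+:S) - {q})) : N" by blast
    have "q ~= u" "q ~= v" using q by auto
    hence qS: "q : S" using q by blast
    show ?thesis
    proof (cases "q = z")
    case True
    have "(z'+:((u+:v+:S) - {z})) = (u+:v+:z'+:R)"
    using S uvS zne uv by auto
    thus ?thesis using q True by simp
    next
    case False
    \<comment> \<open>the exchange at \<open>?B\<close> shows that \<open>z'\<close> depends on \<open>S\<close> through \<open>z\<close>\<close>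
    let ?X = "(u+:v+:z'+:R)"
    have "(z'+:(?B - {z})) : N" using z' by simp
    moreover have "(z'+:(?B - {z})) = (a+:c+:z'+:R)" using S zne by auto
    ultimately have acR: "(a+:c+:z'+:R) : N" by simp
    have "z : (u+:v+:S)" "z ~: (a+:c+:z'+:R)" using z S zz' zne by auto
    from N.exchange1[OF uvS(1) acR this] obtain p
    where p: "p : (a+:c+:z'+:R)" "p ~: (u+:v+:S)" "(p+:((u+:v+:S) - {z})) : N" by blast
    have uvR: "(u+:v+:S) - {z} = (u+:v+:R)" using S uv zne by auto
    have "p = a \<or> p = c \<or> p = z'" using p S by auto
    moreover have "p ~: D"
    proof -
    have "edge N (u+:v+:S) z p" using p z by (simp add: edge_def)
    thus ?thesis using sepD[OF uvS(1)] zD by blast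
    qed
    ultimately have "p = z'" using in_D by blast
    thus ?thesis using p(3) unfolding uvR by (simp add: insert_commute[of z' u] insert_commute[of z' v])
    qed
   qed
   have sqR: "square N (z'+:R) a b c d"
    unfolding square_def using s1 z'ne S(1) by (auto intro!: new)
   have w1: "w S a b c d \<doteq> w (z'+:R) a b c d"
    unfolding S(1)
   proof (rule w_cl)
    show "square \<B> (z+:R) a b c d" using square_mono[OF less.prems(1) NB] S(1) by simp
    show "square \<B> (z'+:R) a b c d" by (rule square_mono[OF sqR NB])
    fix x assume x: "x : {a, b, c, d}"
    show "(x+:z+:z'+:R) ~: \<B>"
    proof
    assume "(x+:z+:z'+:R) : \<B>"
    moreover have "I <= (x+:z+:z'+:R)"
    proof -
    have "I <= (a+:c+:S)" "I <= (b+:d+:S)" using s1 by (auto simp: N interval_def)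
    hence "I <= S" using s1 by auto
    thus ?thesis using S by auto
    qed
    moreover have "(x+:z+:z'+:R) Int J = {}"
    proof -
    have "(a+:c+:S) Int J = {}" "(b+:d+:S) Int J = {}" "S' Int J = {}"
    using s1 s2 by (auto simp: N interval_def)
    thus ?thesis using S z'S x by auto
    qed
    ultimately have "(x+:z+:z'+:R) : N" by (simp add: N interval_def)
    thus False using dep[OF x] by simp
    qed
   qed (use S zz' in auto)
   have "(z'+:R) - S' \<subset> S - S'" using z z'S S by auto
   hence "card ((z'+:R) - S') < card (S - S')" using fin by (simp add: psubset_card_mono)
   moreover have "(z'+:R) Int D = S' Int D" using less.prems(2) z'D zD S by auto
   ultimately have "w (z'+:R) a b c d \<doteq> w S' a b c d" using less.hyps[OF _ sqR] by blast
   with w1 show ?thesis by (rule cg_trans)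
  qed
 qed
 have "holds f S a b c d" if sq: "square N S a b c d" for S a b c d
 proof -
  note s' = sq[unfolded square_def]
  have fin: "finite S" using square_finite[OF sq finN] by blast
  have sqB: "square \<B> S a b c d" by (rule square_mono[OF sq NB])
  have ab: "a : C \<longleftrightarrow> b : C"
  proof (rule sep[of "(a+:c+:S)" a b])
   have "(b+:((a+:c+:S) - {a})) = (b+:c+:S)" using s' by auto
   thus "edge N (a+:c+:S) a b" using s' by (auto simp: edge_def)
  qed (use s' in auto)
  have cd: "c : C \<longleftrightarrow> d : C"
  proof (rule sep[of "(a+:c+:S)" c d])
   have "(d+:((a+:c+:S) - {c})) = (a+:d+:S)" using s' by auto
   thus "edge N (a+:c+:S) c d" using s' by (auto simp: edge_def)
  qed (use s' in auto)
  have one_side: "holds f S a b c d" if D: "D = C \<or> D = - C" and inD: "a : D" "b : D" "c : D" "d : D"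
   and h: "!!S'. square N S' a b c d ==> S' - D = B0 - D ==> holds h S' a b c d"
   and f: "!!u v. u : {a, b} ==> v : {c, d} ==> f (u+:v+:S) = h (u+:(v+:((S Int D) Un (B0 - D)))) + k + (l u + l v)" for D h k l
  proof -
   let ?S = "(S Int D) Un (B0 - D)"
   have mixD: "(B Int D) Un (B0 - D) : N" if "B : N" for B
    using D mixC[OF that B0] mixC[OF B0 that] by (auto simp: Diff_eq Un_commute)
   have "(u+:v+:?S) : N" if "u : {a, b}" "v : {c, d}" for u v
   proof -
    have "(u+:v+:S) : N" using that s' by auto
    from mixD[OF this] have "(u+:v+:S) Int D Un (B0 - D) : N" .
    moreover have "(u+:v+:S) Int D Un (B0 - D) = (u+:v+:?S)" using that inD by auto
    ultimately show ?thesis by simp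
   qed
   hence sqS: "square N ?S a b c d" using s' inD by (auto simp: square_def)
   have hS: "holds h ?S a b c d" by (rule h[OF sqS]) auto
   have wS: "w S a b c d \<doteq> w ?S a b c d"
    by (rule flat[OF sq sqS _ D]) (use inD in auto)
   have fs: "f (u+:v+:S) = h (u+:v+:?S) + k + (l u + l v)" if "u = a \<or> u = b" "v = c \<or> v = d" for u v
    using f[of u v] that by blast
   show ?thesis
    unfolding holds_def fs[OF disjI1[OF refl] disjI1[OF refl]] fs[OF disjI1[OF refl] disjI2[OF refl]]
    fs[OF disjI2[OF refl] disjI1[OF refl]] fs[OF disjI2[OF refl] disjI2[OF refl]]
    by (rule cg_lin2[OF hS[unfolded holds_def] cg_sym[OF wS]]) (simp add: algebra_simps)
  qed
  \<comment> \<open>A square with one pair on either side is degenerate. The values of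
    \<open>fC\<close> and \<open>fD\<close> cancel in its equation, and \<open>cross\<close>
    produces exactly its signs.\<close>
  have mixed: "holds f S a b c d" if sq: "square N S a b c d" and inC: "a : C" "b : C" "c ~: C" "d ~: C" for a b c d
  proof -
   note s' = sq[unfolded square_def]
   have "(c+:d+:S) ~: N"
   proof
    assume X: "(c+:d+:S) : N"
    have "(d+:((a+:c+:S) - {a})) = (c+:d+:S)" using s' by auto
    hence "edge N (a+:c+:S) a d" using X s' by (auto simp: edge_def)
    thus False using sep[of "(a+:c+:S)" a d] s' inC by blast
   qed
   moreover have "(c+:d+:S) : N" if X: "(c+:d+:S) : \<B>"
   proof -
    have "I <= (a+:c+:S)" "I <= (b+:d+:S)" "(a+:c+:S) Int J = {}" "(b+:d+:S) Int J = {}"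
    using s' by (auto simp: N interval_def)
    hence "I <= (c+:d+:S)" "(c+:d+:S) Int J = {}" using s' by auto
    thus ?thesis using X by (simp add: N interval_def)
   qed
   ultimately have w0: "w S a b c d \<doteq> 0" using w_deg[OF square_mono[OF sq NB]] by blast
   have f: "f (u+:v+:S) = fC (u+:((S Int C) Un (B0 - C))) + fD (v+:((B0 Int C) Un (S - C)))
    + (s u v + (\<Sum>z\<in>S - C. s u z) + (\<Sum>x\<in>S Int C. s x v) + (\<Sum>x\<in>S Int C. \<Sum>z\<in>S - C. s x z))"
    if "u : C" "v ~: C" "u ~: S" "v ~: S" for u v
   proof -
    have "pC (u+:v+:S) = (u+:((S Int C) Un (B0 - C)))" "pD (u+:v+:S) = (v+:((B0 Int C) Un (S - C)))"
    using that by (auto simp: pC_def pD_def)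
    moreover have "(u+:v+:S) Int C = (u+:(S Int C))" "(u+:v+:S) - C = (v+:(S - C))" using that by auto
    ultimately show ?thesis using that fin by (simp add: f_def cross_def sum.distrib algebra_simps)
   qed
   have fs: "f (a+:c+:S) + f (b+:d+:S) - (f (a+:d+:S) + f (b+:c+:S)) = sgn4 a b c d"
    using f[of a c] f[of b d] f[of a d] f[of b c] inC s' by (simp add: algebra_simps)
   show ?thesis unfolding holds_def
    by (rule cg_lin1[OF cg_sym[OF w0]]) (use fs in \<open>simp add: algebra_simps\<close>)
  qed
  consider "a : C" "c : C" | "a ~: C" "c ~: C" | "a : C" "c ~: C" | "a ~: C" "c : C" by blast
  thus ?thesis
  proof cases
   case 1
   hence inC: "a : C" "b : C" "c : C" "d : C" using ab cd by auto
   show ?thesis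
   proof (rule one_side[of C fC])
    fix S' assume S': "square N S' a b c d" "S' - C = B0 - C"
    hence "z2 : S' \<longleftrightarrow> z2 : B0" using z2 by blast
    hence "square (slice N z2 (z2 : B0)) S' a b c d" using S' z2 inC by (intro square_slice) auto
    thus "holds fC S' a b c d" using fC by (simp add: solves_holds)
   next
    fix u v assume uv: "u : {a, b}" "v : {c, d}"
    hence uv': "u : C" "v : C" "u ~: S" "v ~: S" "u ~= v" using inC s' by auto
    have "pC (u+:v+:S) = (u+:(v+:((S Int C) Un (B0 - C))))" "pD (u+:v+:S) = (B0 Int C) Un (S - C)"
    using uv' by (auto simp: pC_def pD_def)
    moreover have "(u+:v+:S) Int C = (u+:v+:(S Int C))" "(u+:v+:S) - C = S - C" using uv' by auto
    ultimately show "f (u+:v+:S) = fC (u+:(v+:((S Int C) Un (B0 - C))))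
    + (fD ((B0 Int C) Un (S - C)) + (\<Sum>x\<in>S Int C. \<Sum>z\<in>S - C. s x z)) + ((\<Sum>z\<in>S - C. s u z) + (\<Sum>z\<in>S - C. s v z))"
    using uv' fin by (simp add: f_def cross_def algebra_simps)
   qed (use inC in auto)
  next
   case 2
   hence inC: "a ~: C" "b ~: C" "c ~: C" "d ~: C" using ab cd by auto
   show ?thesis
   proof (rule one_side[of "- C" fD])
    fix S' assume S': "square N S' a b c d" "S' - - C = B0 - - C"
    hence "z1 : S' \<longleftrightarrow> z1 : B0" using z1 by blast
    hence "square (slice N z1 (z1 : B0)) S' a b c d" using S' z1 inC by (intro square_slice) auto
    thus "holds fD S' a b c d" using fD by (simp add: solves_holds)
   next
    fix u v assume uv: "u : {a, b}" "v : {c, d}"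
    hence uv': "u ~: C" "v ~: C" "u ~: S" "v ~: S" "u ~= v" using inC s' by auto
    have "pC (u+:v+:S) = (S Int C) Un (B0 - C)"
    "pD (u+:v+:S) = (u+:(v+:((S Int - C) Un (B0 - - C))))"
    using uv' by (auto simp: pC_def pD_def)
    moreover have "(u+:v+:S) Int C = S Int C" "(u+:v+:S) - C = (u+:v+:(S - C))" using uv' by auto
    ultimately show "f (u+:v+:S) = fD (u+:(v+:((S Int - C) Un (B0 - - C))))
    + (fC ((S Int C) Un (B0 - C)) + (\<Sum>x\<in>S Int C. \<Sum>z\<in>S - C. s x z)) + ((\<Sum>x\<in>S Int C. s x u) + (\<Sum>x\<in>S Int C. s x v))"
    using uv' fin by (simp add: f_def cross_def sum.distrib algebra_simps)
   qed (use inC in auto)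
  next
   case 3
   thus ?thesis using mixed[OF sq] ab cd by blast
  next
   case 4
   thus ?thesis using mixed[OF square_flip[OF sq]] ab cd holds_flip[OF sqB] by blast
  qed
 qed
 thus ?thesis unfolding solves_holds by blast
qed

end

context cross_labels
begin

text \<open>Values on bases without \<open>y\<close> are copied from those with \<open>y\<close> in
  place of \<open>e\<close>. The properties of \<open>w\<close> compare labels of parallel elements
  but not of elements in series, so the lemma asks for vanishing labels, which is the situation in
  \<open>small_solvable\<close>.\<close>

lemma series_extension:
 assumes N: "N <= \<B>" and ey: "e ~= y" and w0: "!!S a b c d. square N S a b c d ==> w S a b c d \<doteq> 0"
  and series: "!!B. B : N ==> y ~: B ==> e : B & (y+:(B - {e})) : N"
  and f0: "solves W (slice N y True) f0"
 shows "EX f. solves W N f"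
proof -
 define g where "g x = s x e - s x y" for x
 define f where "f B = (if y : B then f0 B else f0 (y+:(B - {e})) + sum g (B - {e}))" for B
 have finN: "finite B" if "B : N" for B using that N finite_basis by blast
 have f_y: "f (u+:y+:S) = f0 (u+:y+:S)" for u S by (simp add: f_def)
 have f_e: "f (u+:e+:S) = f0 (u+:y+:S) + (g u + sum g S)"
  if "y ~= u" "y ~: S" "e ~: S" "u ~= e" "u ~: S" "finite S" for u S
 proof -
  have "(u+:e+:S) - {e} = (u+:S)" "(y+:u+:S) = (u+:y+:S)" using that by auto
  thus ?thesis using that ey by (simp add: f_def)
 qed
 have main: "holds f S a b c y" if sq: "square N S a b c y" for S a b c
 proof -
  have sqB: "square \<B> S a b c y" by (rule square_mono[OF sq N])
  note s' = sq[unfolded square_def]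
  have fin: "finite S" using square_finite[OF sq finN] by blast
  have e: "e : (a+:c+:S)" "e : (b+:c+:S)"
   using series[of "(a+:c+:S)"] series[of "(b+:c+:S)"] s' by auto
  consider "e = c" | "e : S" using e s' by auto
  thus ?thesis
  proof cases
   case 1
   have fs: "f (a+:c+:S) = f0 (a+:y+:S) + (g a + sum g S)"
    "f (b+:c+:S) = f0 (b+:y+:S) + (g b + sum g S)"
    using f_e[of a S] f_e[of b S] s' fin 1 by auto
   show ?thesis unfolding holds_def fs f_y
    by (rule cg_lin1[OF cg_sym[OF w0[OF sq]]]) (simp add: g_def 1 algebra_simps)
  next
   case 2
   define T where "T = S - {e}"
   have S: "S = (e+:T)" "e ~: T" using 2 by (auto simp: T_def)
   have ne: "e ~: {a, b, c, y}" using 2 s' by auto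
   have t: "(u+:c+:y+:T) : N" if "u : {a, b}" for u
   proof -
    have "(y+:((u+:c+:S) - {e})) = (u+:c+:y+:T)" using S ne that by auto
    thus ?thesis using series[of "(u+:c+:S)"] that s' by auto
   qed
   have t': "(u+:e+:y+:T) : N" if "u : {a, b}" for u
   proof -
    have "(y+:S) = (e+:y+:T)" using S(1) by blast
    moreover have "(a+:y+:S) : N" "(b+:y+:S) : N" using s' by blast+
    ultimately show ?thesis using that by auto
   qed
   have "square N (y+:T) a b c e" using t t' s' S ne by (auto simp: square_def)
   hence "square (slice N y True) (y+:T) a b c e" by (rule square_slice) (use s' S in auto)
   hence h: "holds f0 (y+:T) a b c e" using f0 by (simp add: solves_holds)
   have w1: "w (y+:T) a b c e \<doteq> 0" by (rule w0) fact
   have fs: "f (u+:c+:S) = f0 (u+:c+:y+:T) + (g u + g c + sum g T)" if "u = a \<or> u = b" for u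
   proof -
    have "(u+:c+:S) = (u+:e+:c+:T)" using S by auto
    moreover have "f (u+:e+:c+:T) = f0 (u+:y+:c+:T) + (g u + sum g (c+:T))"
    using s' S ne that fin by (intro f_e) auto
    moreover have "sum g (c+:T) = g c + sum g T" using s' S fin by simp
    ultimately show ?thesis by (simp add: insert_commute[of y c] algebra_simps)
   qed
   have fy: "f (u+:y+:S) = f0 (u+:e+:y+:T)" for u
    unfolding f_y by (rule arg_cong[where f = f0]) (use S in auto)
   show ?thesis unfolding holds_def fs[OF disjI1[OF refl]] fs[OF disjI2[OF refl]] fy
    by (rule cg_lin3[OF h[unfolded holds_def] w1 cg_sym[OF w0[OF sq]]]) (simp add: g_def algebra_simps)
  qed
 qed
 have "holds f S a b c d" if sq: "square N S a b c d" for S a b c d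
 proof -
  have sqB: "square \<B> S a b c d" by (rule square_mono[OF sq N])
  note s' = sq[unfolded square_def]
  have fin: "finite S" using square_finite[OF sq finN] by blast
  consider "y : S" | "y = d" | "y = c" | "y = b" | "y = a" | "y ~: S Un {a, b, c, d}" by blast
  thus ?thesis
  proof cases
   case 1
   hence "square (slice N y True) S a b c d" using s' by (intro square_slice[OF sq]) auto
   hence "holds f0 S a b c d" using f0 by (simp add: solves_holds)
   thus ?thesis using 1 by (simp add: holds_def f_def)
  next
   case 2
   thus ?thesis using main sq by simp
  next
   case 3
   show ?thesis by (rule holds_swap[OF sqB]) (use main square_swap[OF sq] 3 in simp)
  next
   case 4
   show ?thesis by (rule holds_flip[OF sqB]) (use main square_flip[OF sq] 4 in simp)
  next
   case 5
   show ?thesis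
    by (rule holds_flip[OF sqB], rule holds_swap[OF square_flip[OF sqB]])
    (use main square_swap[OF square_flip[OF sq]] 5 in simp)
  next
   case 6
   have "e : (a+:c+:S)" "e : (b+:d+:S)" using series s' 6 by auto
   hence eS: "e : S" using s' by auto
   define T where "T = S - {e}"
   have S: "S = (e+:T)" "e ~: T" using eS by (auto simp: T_def)
   have ne: "e ~: {a, b, c, d}" using eS s' by auto
   have t: "(u+:v+:y+:T) : N" if "u : {a, b}" "v : {c, d}" for u v
   proof -
    have "(y+:((u+:v+:S) - {e})) = (u+:v+:y+:T)" using S ne that by auto
    moreover have "y ~: (u+:v+:S)" "(u+:v+:S) : N" using 6 that s' by auto
    ultimately show ?thesis using series[of "(u+:v+:S)"] by auto
   qed
   have sqT: "square N (y+:T) a b c d" using t s' S 6 by (auto simp: square_def)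
   hence "square (slice N y True) (y+:T) a b c d" by (rule square_slice) (use 6 in auto)
   hence h: "holds f0 (y+:T) a b c d" using f0 by (simp add: solves_holds)
   have fs: "f (u+:v+:S) = f0 (u+:v+:y+:T) + (g u + g v + sum g T)"
    if "u = a \<or> u = b" "v = c \<or> v = d" for u v
   proof -
    have "(u+:v+:S) = (u+:e+:v+:T)" using S by auto
    moreover have "f (u+:e+:v+:T) = f0 (u+:y+:v+:T) + (g u + sum g (v+:T))"
    using s' S ne that fin 6 by (intro f_e) auto
    moreover have "sum g (v+:T) = g v + sum g T" using s' S fin that by auto
    ultimately show ?thesis by (simp add: insert_commute[of y v] algebra_simps)
   qed
   show ?thesis
    unfolding holds_def fs[OF disjI1[OF refl] disjI1[OF refl]] fs[OF disjI1[OF refl] disjI2[OF refl]]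
    fs[OF disjI2[OF refl] disjI1[OF refl]] fs[OF disjI2[OF refl] disjI2[OF refl]]
    by (rule cg_lin3[OF h[unfolded holds_def] w0[OF sqT] cg_sym[OF w0[OF sq]]]) (simp add: algebra_simps)
  qed
 qed
 thus ?thesis unfolding solves_holds by blast
qed

text \<open>A minor of this size with any square at all has 4 or 5 active elements and rank 2 or 3
  on them. Without parallel pairs it has one of the special types, except in rank 3 with at least
  two dependent triples. In that case all squares are degenerate and there is a series pair.\<close>

lemma small_solvable:
 "card (active (interval \<B> I J)) <= 5 ==> EX f. solves W (interval \<B> I J) f"
proof (induction "card (active (interval \<B> I J))" arbitrary: I J rule: less_induct)
 case less
 define N where "N = interval \<B> I J"
 have NB: "N <= \<B>" by (auto simp: N_def interval_def)
 have bfN: "basis_family N" unfolding N_def by (rule interval_basis_family[OF basis_family_axioms])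
 interpret N: basis_family N by (rule bfN)
 define A where "A = active N"
 have finA: "finite A" unfolding A_def by (rule active_finite[OF bfN])
 have minors: "EX f. solves W (slice N z v) f" if z: "z : A" for z v
 proof -
  obtain I' J' where eq: "slice N z v = interval \<B> I' J'" using slice_of_interval unfolding N_def by metis
  have "card (active (slice N z v)) < card (active N)" by (rule card_active_slice[OF bfN]) (use z in \<open>simp add: A_def\<close>)
  hence *: "card (active (interval \<B> I' J')) < card (active (interval \<B> I J))" unfolding eq unfolding N_def .
  hence "card (active (interval \<B> I' J')) <= 5" using less.prems by simp
  from less.hyps[OF * this] show ?thesis unfolding eq .
 qed
 show ?case
 proof (cases "EX S a b c d. square N S a b c d")
  case False
  thus ?thesis unfolding N_def[symmetric] solves_def by blast
 next
  case True
  then obtain S a b c d where sq: "square N S a b c d" by blast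
  note s' = sq[unfolded square_def]
  define Z where "Z = (a+:c+:S) - A"
  define \<rho> where "\<rho> = card ((a+:c+:S) Int A)"
  have form: "B = Z Un (B Int A)" "card (B Int A) = \<rho>" if B: "B : N" for B
  proof -
   let ?B = "(a+:c+:S)"
   have BN: "?B : N" using s' by simp
   have "z : B \<longleftrightarrow> z : ?B" if "z ~: A" for z
    using activeI[of z B N ?B] activeI[of z ?B N B] that B BN unfolding A_def by blast
   hence diff: "B - A = Z" unfolding Z_def by blast
   thus "B = Z Un (B Int A)" by blast
   have "card B = card (B - A) + card (B Int A)" if "B : N" for B
    using N.finite_basis[OF that] by (metis card_Diff_subset_Int card_mono finite_Int inf_le1 le_add_diff_inverse2)
   from this[OF B] this[OF BN] show "card (B Int A) = \<rho>"
    using N.card_basis[OF B BN] diff unfolding Z_def \<rho>_def by simp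
  qed
  have ZA: "Z Int A = {}" by (auto simp: Z_def)
  have abcd: "{a, b, c, d} <= A"
  proof -
   have "a ~: (b+:d+:S)" "b ~: (a+:c+:S)" "c ~: (b+:d+:S)" "d ~: (a+:c+:S)"
    using s' by auto
   thus ?thesis unfolding A_def
    using s' activeI[of a "(a+:c+:S)" N "(b+:d+:S)"] activeI[of b "(b+:d+:S)" N "(a+:c+:S)"]
    activeI[of c "(a+:c+:S)" N "(b+:d+:S)"] activeI[of d "(b+:d+:S)" N "(a+:c+:S)"]
    by auto
  qed
  have d4: "distinct [a, b, c, d]" using s' by simp
  have card4: "card {a, b, c, d} = 4" using d4 by simp
  have cardA: "card A <= 5" using less.prems by (simp add: A_def N_def)
  have A4: "card A \<ge> 4" using card_mono[OF finA abcd] card4 by simp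
  show ?thesis
  proof (cases "EX e y. e : A & y : A & e ~= y & (ALL B:N. ~ (e : B & y : B))")
   case True
   then obtain e y where ey: "e : A" "y : A" "e ~= y" and no: "!!B. B : N ==> ~ (e : B & y : B)" by blast
   obtain B1 where B1: "B1 : N" "y : B1" using ey by (auto simp: A_def active_def)
   have swap: "(y+:X) : N" if X: "e ~: X" "y ~: X" "(e+:X) : N" for X
   proof -
    have "y ~: (e+:X)" using X ey by simp
    from N.exchange2[OF X(3) B1(1,2) this] obtain x where x: "x : (e+:X)" "(y+:((e+:X) - {x})) : N" by blast
    have "x = e" using no[OF x(2)] ey by auto
    thus ?thesis using x X by simp
   qed
   obtain f0 where "solves W (slice N e False) f0" using minors[OF ey(1)] by blast
   from parallel_extension[OF N_def ey(3) no swap this] show ?thesis unfolding N_def .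
  next
   case no_par: False
   have pair: "EX B:N. e : B & y : B" if "e : A" "y : A" "e ~= y" for e y using no_par that by blast
   have uniform: "EX f. solves W N f" if all: "!!X. X <= A ==> card X = \<rho> ==> Z Un X : N"
    and sp: "(uniform_bases \<rho> (card A), card A) : special_bases"
   proof -
    obtain x where x: "bij_betw x {1..card A} A" using ex_bij_betw_nat_finite_1[OF finA] by blast
    hence inj: "inj_on x {1..card A}" and img: "x ` {1..card A} = A" by (auto simp: bij_betw_def)
    have "N = {Z Un x ` X | X. X : uniform_bases \<rho> (card A)}"
    proof (intro equalityI subsetI)
    fix B assume B: "B : N"
    have "B Int A <= x ` {1..card A}" unfolding img by simp
    then obtain X where X: "X <= {1..card A}" "B Int A = x ` X" by (meson subset_imageE)
    have "card X = \<rho>" using form(2)[OF B] card_image[OF inj_on_subset[OF inj X(1)]] unfolding X(2) by simp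
    moreover have "B = Z Un x ` X" using form(1)[OF B] unfolding X(2) .
    ultimately show "B : {Z Un x ` X | X. X : uniform_bases \<rho> (card A)}" using X(1) unfolding uniform_bases_def by blast
    next
    fix B assume "B : {Z Un x ` X | X. X : uniform_bases \<rho> (card A)}"
    then obtain X where X: "B = Z Un x ` X" "X <= {1..card A}" "card X = \<rho>" by (auto simp: uniform_bases_def)
    have "x ` X <= A" using X(2) img by auto
    moreover have "card (x ` X) = \<rho>" using card_image[OF inj_on_subset[OF inj X(2)]] X(3) by simp
    ultimately show "B : N" using all X(1) by simp
    qed
    hence "pattern (uniform_bases \<rho> (card A)) (card A) N"
    unfolding pattern_def using inj img ZA by (intro exI[of _ Z] exI[of _ x]) auto
    thus ?thesis using special[OF sp] unfolding N_def by blast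
   qed
   have Sab: "(a+:c+:S) Int A = {a, c} Un (S Int A)" using abcd by auto
   show ?thesis
   proof (cases "S Int A = {}")
    case True
    hence "(a+:c+:S) Int A = {a, c}" using Sab by simp
    hence rho: "\<rho> = 2" using d4 by (simp add: \<rho>_def)
    have "card A = 4 \<or> card A = 5" using A4 cardA by auto
    hence sp: "(uniform_bases \<rho> (card A), card A) : special_bases"
    by (elim disjE) (simp_all only: rho special_bases_def insert_iff simp_thms)
    have "Z Un X : N" if X: "X <= A" "card X = \<rho>" for X
    proof -
    obtain e y where ey: "X = {e, y}" "e ~= y" using X(2) unfolding rho card_2_iff by blast
    then obtain B where B: "B : N" "e : B" "y : B" using pair X by blast
    have "X <= B Int A" using B X ey by auto
    moreover have "card (B Int A) = card X" using form(2)[OF B(1)] X by simp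
    moreover have "finite (B Int A)" using finA by simp
    ultimately have "X = B Int A" using card_subset_eq by metis
    thus ?thesis using form(1)[OF B(1)] B(1) by simp
    qed
    from uniform[OF this sp] show ?thesis unfolding N_def .
   next
    case False
    then obtain q where q: "q : S" "q : A" by blast
    have qd: "q ~: {a, b, c, d}" using q s' by auto
    hence card5: "card {q, a, b, c, d} = 5" using d4 by simp
    have "{q, a, b, c, d} <= A" using abcd q by auto
    hence A_eq: "A = {q, a, b, c, d}" using card_subset_eq[OF finA] card_mono[OF finA] card5 cardA by (metis le_antisym)
    have "S Int A = {q}" unfolding A_eq using s' q by auto
    hence rho: "\<rho> = 3" using Sab d4 qd by (simp add: \<rho>_def card_insert_if)
    have A5: "card A = 5" using A_eq card5 by simp
    show ?thesis
    proof (cases "EX X0. X0 <= A & card X0 = 3 & Z Un X0 ~: N")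
    case False
    have "Z Un X : N" if "X <= A" "card X = \<rho>" for X using False that rho by blast
    moreover have "(uniform_bases \<rho> (card A), card A) : special_bases"
    by (simp only: rho A5 special_bases_def insert_iff simp_thms)
    ultimately show ?thesis using uniform unfolding N_def by blast
    next
    case True
    then obtain X0 where X0: "X0 <= A" "card X0 = 3" "Z Un X0 ~: N" by blast
    have finX0: "finite X0" using X0 finA finite_subset by blast
    obtain p1 p2 p3 where p: "X0 = {p1, p2, p3}" "distinct [p1, p2, p3]" using X0(2) unfolding card_3_iff by auto
    have "card (A - X0) = 2" using X0 A5 finX0 by (simp add: card_Diff_subset)
    then obtain u v where uv: "A - X0 = {u, v}" "u ~= v" unfolding card_2_iff by blast
    have A_eq': "A = {p1, p2, p3, u, v}" using uv X0 p by auto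
    show ?thesis
    proof (cases "EX X1. X1 <= A & card X1 = 3 & Z Un X1 ~: N & X1 ~= X0")
    case False
    define x where "x i = [p1, p2, p3, u, v] ! (i - 1)" for i :: nat
    have five: "{1..5::nat} = {1,2,3,4,5}" by auto
    have x: "x 1 = p1" "x 2 = p2" "x 3 = p3" "x 4 = u" "x 5 = v" by (simp_all add: x_def)
    have img: "x ` {1..5} = A" unfolding five image_insert image_empty x A_eq' by simp
    have inj: "inj_on x {1..5}"
    proof (rule eq_card_imp_inj_on)
    show "card (x ` {1..5}) = card {1..5::nat}" unfolding img A5 by simp
    qed simp
    have img0: "x ` {1,2,3} = X0" unfolding image_insert image_empty x p(1) ..
    let ?T = "uniform_bases 3 5 - {{1,2,3}}"
    have "N = {Z Un x ` X | X. X : ?T}"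
    proof (intro equalityI subsetI)
    fix B assume B: "B : N"
    have "B Int A <= x ` {1..5}" unfolding img by simp
    then obtain X where X: "X <= {1..5}" "B Int A = x ` X" by (meson subset_imageE)
    have "card X = 3" using form(2)[OF B] card_image[OF inj_on_subset[OF inj X(1)]] rho unfolding X(2) by simp
    moreover have BX: "B = Z Un x ` X" using form(1)[OF B] unfolding X(2) .
    moreover have "X ~= {1,2,3}" using X0(3) B BX img0 by metis
    ultimately show "B : {Z Un x ` X | X. X : ?T}" using X(1) unfolding uniform_bases_def by blast
    next
    fix B assume "B : {Z Un x ` X | X. X : ?T}"
    then obtain X where X: "B = Z Un x ` X" "X <= {1..5}" "card X = 3" "X ~= {1,2,3}" by (auto simp: uniform_bases_def)
    have "x ` X <= A" using X(2) img by auto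
    moreover have "card (x ` X) = 3" using card_image[OF inj_on_subset[OF inj X(2)]] X(3) by simp
    moreover have "x ` X ~= X0"
    proof
    assume "x ` X = X0"
    hence "x ` X = x ` {1,2,3}" using img0 by simp
    moreover have "{1,2,3} <= {1..5::nat}" by auto
    ultimately show False using inj_on_image_eq_iff[OF inj X(2)] X(4) by blast
    qed
    ultimately show "B : N" using False X(1) by blast
    qed
    hence "pattern ?T 5 N"
    unfolding pattern_def using inj img ZA by (intro exI[of _ Z] exI[of _ x]) auto
    moreover have "(?T, 5) : special_bases" by (simp add: special_bases_def)
    ultimately show ?thesis using special unfolding N_def by blast
    next
    case True
    then obtain X1 where X1: "X1 <= A" "card X1 = 3" "Z Un X1 ~: N" "X1 ~= X0" by blast
    have replace: "EX t. t : A & t ~: Z Un {z, x, x'} & Z Un {t, x, x'} : N"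
    if z: "z : A" "Z Un {z, x, x'} : N" "z ~: {x, x'}" for z x x'
    proof -
    obtain B where B: "B : N" "z ~: B" using z by (auto simp: A_def active_def)
    have "z : Z Un {z, x, x'}" by simp
    from N.exchange1[OF z(2) B(1) this B(2)] obtain t
    where t: "t : B" "t ~: Z Un {z, x, x'}" "(t+:(Z Un {z, x, x'} - {z})) : N" by blast
    have "z ~: Z" using z ZA by blast
    hence "(t+:(Z Un {z, x, x'} - {z})) = Z Un {t, x, x'}" using z by auto
    moreover have "t : A" using t form(1)[OF B(1)] by blast
    ultimately show ?thesis using t by auto
    qed
    \<comment> \<open>If both \<open>c, d\<close> and \<open>a, b\<close> completed \<open>S\<close>
      to a basis, all six pairs would, and the fifth element \<open>q\<close> would be in no
      dependent triple. Two dependent triples among the other four elements share a pair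
      \<open>x, x'\<close>. As \<open>q\<close> is no coloop, some \<open>t\<close> can replace it
      in the basis with \<open>x, x'\<close>; but \<open>t, x, x'\<close> is one of the two
      triples.\<close>
    have w0: "w S a b c d \<doteq> 0" if sq: "square N S a b c d" for S a b c d
    proof (cases "(c+:d+:S) : \<B> & (a+:b+:S) : \<B>")
    case False
    have sqB: "square \<B> S a b c d" by (rule square_mono[OF sq NB])
    show ?thesis
    proof (cases "(c+:d+:S) : \<B>")
    case True
    hence "(a+:b+:S) ~: \<B>" using False by blast
    from w_deg[OF square_flip[OF sqB] this] have "w S c d a b \<doteq> 0" .
    thus ?thesis using w_sym1[OF sqB] cg_sym cg_trans by blast
    qed (rule w_deg[OF sqB])
    next
    case True
    note s' = sq[unfolded square_def]
    have IJ: "I <= S" "(u+:v+:S) Int J = {}" if "u : {a, b, c, d}" "v : {a, b, c, d}" for u v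
    proof -
    have "I <= (a+:c+:S)" "I <= (b+:d+:S)" "(a+:c+:S) Int J = {}" "(b+:d+:S) Int J = {}"
    "distinct [a, b, c, d]" using s' by (auto simp: N_def interval_def)
    thus "I <= S" "(u+:v+:S) Int J = {}" using that by auto
    qed
    have six: "(u+:v+:S) : N" if "u : {a, b, c, d}" "v : {a, b, c, d}" "u ~= v" for u v
    proof -
    have "(u+:v+:S) : \<B>" using that True square_mono[OF sq NB, unfolded square_def]
    by (auto simp: insert_commute[of b a] insert_commute[of c a] insert_commute[of c b] insert_commute[of d a] insert_commute[of d b] insert_commute[of d c])
    thus ?thesis using IJ[OF that(1,2)] by (auto simp: N_def interval_def)
    qed
    have act: "{a, b, c, d} <= A"
    proof -
    have "a ~: (b+:d+:S)" "b ~: (a+:c+:S)" "c ~: (b+:d+:S)" "d ~: (a+:c+:S)"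
    using s' by auto
    thus ?thesis unfolding A_def
    using s' activeI[of a "(a+:c+:S)" N "(b+:d+:S)"] activeI[of b "(b+:d+:S)" N "(a+:c+:S)"]
    activeI[of c "(a+:c+:S)" N "(b+:d+:S)"] activeI[of d "(b+:d+:S)" N "(a+:c+:S)"]
    by auto
    qed
    have dd: "distinct [a, b, c, d]" using s' by simp
    have inS: "(a+:c+:S) = Z Un ((a+:c+:S) Int A)" "card ((a+:c+:S) Int A) = 3"
    using form[of "(a+:c+:S)"] s' rho by auto
    have "(a+:c+:S) Int A = {a, c} Un (S Int A)" using act by auto
    moreover have "{a, c} Int (S Int A) = {}" using s' by auto
    ultimately have "card {a, c} + card (S Int A) = 3" using inS(2) finA by (metis card_Un_disjoint finite.emptyI finite.insertI finite_Int)
    hence "card (S Int A) = 1" using dd by simp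
    then obtain q where q: "S Int A = {q}" using card_1_singletonE by blast
    have S_eq: "S = Z Un {q}"
    proof -
    have "S - A = Z" using inS(1) act ZA by blast
    thus ?thesis using q by blast
    qed
    have q': "q : A" "q ~: {a, b, c, d}" using q s' by auto
    have "card {q, a, b, c, d} = 5" using dd q' by simp
    hence Aq: "A = {q, a, b, c, d}" using card_subset_eq[OF finA, of "{q, a, b, c, d}"] q' act A5 by simp
    have six': "Z Un {q, x, x'} : N" if "x : A - {q}" "x' : A - {q}" "x ~= x'" for x x'
    proof -
    have "(x+:x'+:S) = Z Un {q, x, x'}" unfolding S_eq by auto
    thus ?thesis using six[of x x'] that Aq by auto
    qed
    have sub: "X <= A - {q}" if X: "X <= A" "card X = 3" "Z Un X ~: N" for X
    proof -
    have "q ~: X"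
    proof
    assume qX: "q : X"
    have "card (X - {q}) = 2" using qX X(2) finite_subset[OF X(1) finA] by simp
    then obtain x x' where "X - {q} = {x, x'}" "x ~= x'" unfolding card_2_iff by blast
    hence "X = {q, x, x'}" "x : A - {q}" "x' : A - {q}" using qX X(1) by auto
    thus False using six'[of x x'] X(3) \<open>x ~= x'\<close> by simp
    qed
    thus ?thesis using X by blast
    qed
    have cardq: "card (A - {q}) = 4" using q' A5 finA by simp
    have 4: "card (X0 Int X1) = 2"
    proof -
    have "card (X0 Un X1) <= 4" using card_mono[of "A - {q}" "X0 Un X1"] sub[OF X0] sub[OF X1(1-3)] finA cardq by auto
    moreover have "card (X0 Un X1) + card (X0 Int X1) = 6"
    using card_Un_Int[of X0 X1] X0 X1 finX0 finite_subset[OF X1(1) finA] by simp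
    moreover have "card (X0 Int X1) ~= 3"
    proof
    assume "card (X0 Int X1) = 3"
    hence "X0 Int X1 = X0" "X0 Int X1 = X1"
    using card_subset_eq[OF finX0, of "X0 Int X1"] card_subset_eq[OF finite_subset[OF X1(1) finA], of "X0 Int X1"] X0(2) X1(2) by auto
    thus False using X1(4) by simp
    qed
    moreover have "card (X0 Int X1) <= 3" using card_mono[OF finX0, of "X0 Int X1"] X0(2) by simp
    ultimately show ?thesis by linarith
    qed
    then obtain x x' where x: "X0 Int X1 = {x, x'}" "x ~= x'" unfolding card_2_iff by blast
    have X01: "X0 <= A - {q}" "X1 <= A - {q}" using sub[OF X0] sub[OF X1(1-3)] .
    have "Z Un {q, x, x'} : N" using six'[of x x'] x X01 by blast
    from replace[OF q'(1) this] x X01 obtain t where t: "t : A" "t ~: Z Un {q, x, x'}" "Z Un {t, x, x'} : N" by blast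
    have "X0 Un X1 = A - {q}"
    proof (rule card_subset_eq)
    show "card (X0 Un X1) = card (A - {q})"
    using card_Un_Int[of X0 X1] X0 X1 finX0 finite_subset[OF X1(1) finA] 4 cardq by simp
    qed (use X01 finA in auto)
    hence "t : X0 \<or> t : X1" using t by blast
    moreover have "X = {t, x, x'}" if "t : X" "{x, x'} <= X" "card X = 3" for X
    proof -
    have "card {t, x, x'} = card X" using t(2) x(2) that(3) by auto
    moreover have "finite X" using that(3) card.infinite by fastforce
    ultimately show ?thesis using card_subset_eq[of X "{t, x, x'}"] that by auto
    qed
    ultimately have "X0 = {t, x, x'} \<or> X1 = {t, x, x'}" using x(1) X0(2) X1(2) by (metis inf.cobounded1 inf.cobounded2)
    thus ?thesis using t(3) X0(3) X1(3) by auto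
    qed
    \<comment> \<open>The elements \<open>u\<close> and \<open>v\<close> are those outside
      \<open>X0\<close>. A basis missing both would meet \<open>A\<close> in the dependent triple
      \<open>X0\<close>, so they are in series.\<close>
    have series: "u : B & (v+:(B - {u})) : N" if B: "B : N" "v ~: B" for B
    proof -
    have BA: "B = Z Un (B Int A)" "card (B Int A) = 3" using form[OF B(1)] rho by auto
    have sub: "B Int A <= (u+:X0)" using B(2) A_eq' p by auto
    have uB: "u : B"
    proof (rule ccontr)
    assume "u ~: B"
    hence "B Int A <= X0" using sub by auto
    hence "B Int A = X0" using card_subset_eq[OF finX0] BA(2) X0(2) by metis
    thus False using BA(1) B(1) X0(3) by simp
    qed
    have uA: "u : A" "v : A" using A_eq' by auto
    have "card (B Int A - {u}) = 2" using BA(2) uB uA by simp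
    then obtain x x' where x: "B Int A - {u} = {x, x'}" "x ~= x'" unfolding card_2_iff by blast
    hence xX: "x : X0" "x' : X0" "u ~: {x, x'}" using sub by auto
    have BAu: "B Int A = {u, x, x'}" using x(1) uB uA by auto
    hence B_eq: "B = Z Un {u, x, x'}" using BA(1) by metis
    have "Z Un {u, x, x'} : N" using B(1) B_eq by simp
    from replace[OF uA(1) this xX(3)] obtain t where t: "t : A" "t ~: Z Un {u, x, x'}" "Z Un {t, x, x'} : N" by blast
    have "t ~: X0"
    proof
    assume "t : X0"
    hence "{t, x, x'} <= X0" using xX by auto
    moreover have "card {t, x, x'} = card X0" using t(2) x(2) X0(2) by auto
    ultimately have "{t, x, x'} = X0" using card_subset_eq[OF finX0] by blast
    thus False using t(3) X0(3) by simp
    qed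
    hence "t = v" using t A_eq' p by auto
    moreover have "(v+:(B - {u})) = Z Un {v, x, x'}" using B_eq xX ZA uA by auto
    ultimately show ?thesis using uB t by simp
    qed
    have "v : A" using A_eq' by auto
    then obtain f0 where f0: "solves W (slice N v True) f0" using minors by blast
    from series_extension[OF NB uv(2) w0 series f0] show ?thesis unfolding N_def .
    qed
    qed
   qed
  qed
 qed
qed

theorem cross_labels_solvable: "EX f. solves W \<B> f"
proof (rule solvable_of_small_minors[OF basis_family_axioms finite_E in_E])
 show "EX f. solves W (interval \<B> I J) f" if "card (active (interval \<B> I J)) <= 5" for I J
  using that by (rule small_solvable)
 show "EX f. solves W (interval \<B> I J) f" if "Fano_family (interval \<B> I J)" for I J
 proof -
  have "pattern Fano_bases 7 (interval \<B> I J)"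
   using that unfolding Fano_family_def pattern_def Fano_bases_def uniform_bases_def by auto
  thus ?thesis using special[of Fano_bases 7] by (simp add: special_bases_def)
 qed
 show "EX f. solves W (interval \<B> I J) f" if F: "Fano_family (dual_family E (interval \<B> I J))" for I J
 proof -
  let ?N = "interval \<B> I J"
  have sub: "\<Union>?N <= E" using in_E by (auto simp: interval_def)
  from F obtain Z x where inj: "inj_on x {1..7}" and Z: "x ` {1..7} Int Z = {}"
   and D: "dual_family E ?N = {Z Un x ` T | T. T <= {1..7::nat} & card T = 3 & T ~: Fano_lines}"
   unfolding Fano_family_def by blast
  have D': "dual_family E ?N = {Z Un x ` T | T. T : Fano_bases}"
   unfolding D Fano_bases_def uniform_bases_def by blast
  have "Z Un x ` T <= E" if "T : Fano_bases" for T
  proof -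
   have "Z Un x ` T : dual_family E ?N" unfolding D' using that by blast
   then obtain B where "Z Un x ` T = E - B" unfolding dual_family_def by blast
   thus ?thesis by simp
  qed
  moreover have "EX T:Fano_bases. i : T" if "i : {1..7}" for i :: nat
  proof -
   have "{1,2,4} : Fano_bases" "{3,5,7} : Fano_bases" "{4,5,6} : Fano_bases"
   proof -
    \<comment> \<open>The three sets have sums 7, 15 and 15, which no line attains.\<close>
    have "\<Sum>X \<in> {6, 10, 12, 14}" if "X : Fano_lines" for X
    using that unfolding Fano_lines_def by (elim insertE emptyE) simp_all
    from this[of "{1,2,4}"] this[of "{3,5,7}"] this[of "{4,5,6}"]
    have "{1,2,4} ~: Fano_lines" "{3,5,7} ~: Fano_lines" "{4,5,6} ~: Fano_lines" by auto
    thus "{1,2,4} : Fano_bases" "{3,5,7} : Fano_bases" "{4,5,6} : Fano_bases"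
    unfolding Fano_bases_def uniform_bases_def by simp_all
   qed
   moreover have "i : {1,2,4} Un {3,5,7} Un {4,5,6}" using that by auto
   ultimately show ?thesis by (meson UnE)
  qed
  ultimately have "Z <= E & x i : E" if "i : {1..7}" for i using that by (meson Un_subset_iff image_subset_iff)
  note inE' = this
  have inE: "Z Un x ` {1..7} <= E" using inE' inE'[of 1] by (simp add: image_subset_iff)
  \<comment> \<open>Elements of \<open>E\<close> outside the pattern lie in no basis of the dual
    family, hence in every basis of \<open>?N\<close>: loops have become coloops.\<close>
  define Z' where "Z' = E - Z - x ` {1..7}"
  have compl: "E - (Z Un x ` T) = Z' Un x ` ({1..7} - T)" if "T <= {1..7}" for T
  proof -
   have "x ` ({1..7} - T) = x ` {1..7} - x ` T" by (rule inj_on_image_set_diff[OF inj _ that]) simp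
   moreover have "x ` T <= x ` {1..7}" using that by blast
   ultimately show ?thesis unfolding Z'_def using Z inE by blast
  qed
  have "?N = {Z' Un x ` X | X. X : dual_family {1..7} Fano_bases}"
  proof -
   have "?N = dual_family E (dual_family E ?N)" using dual_dual[OF sub] by simp
   also have "\<dots> = (\<lambda>T. E - (Z Un x ` T)) ` Fano_bases"
    unfolding D' unfolding dual_family_def image_def by blast
   also have "\<dots> = (\<lambda>T. Z' Un x ` ({1..7} - T)) ` Fano_bases"
    by (rule image_cong[OF refl], rule compl) (auto simp: Fano_bases_def uniform_bases_def)
   also have "\<dots> = {Z' Un x ` X | X. X : dual_family {1..7} Fano_bases}"
    unfolding dual_family_def image_def by blast
   finally show ?thesis .
  qed
  hence "pattern (dual_family {1..7} Fano_bases) 7 ?N"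
   unfolding pattern_def using inj by (intro exI[of _ Z'] exI[of _ x]) (auto simp: Z'_def)
  thus ?thesis using special[of "dual_family {1..7} Fano_bases" 7] by (simp add: special_bases_def)
 qed
 show "EX f. solves W (interval \<B> I J) f"
  if "C Int active (interval \<B> I J) ~= {}" "~ active (interval \<B> I J) <= C"
   "!!B r c. B : interval \<B> I J ==> edge (interval \<B> I J) B r c ==> r : C \<longleftrightarrow> c : C"
   "!!z v. z : active (interval \<B> I J) ==> EX f. solves W (slice (interval \<B> I J) z v) f" for I J C
  by (rule direct_sum_solvable[OF refl that])
qed

end

section \<open>Closure, hyperplanes and flats of corank 2 of a matroid\<close>

context matroid
begin

abbreviation "\<rho> \<equiv> rk M (ground M)"

lemma indep_finite: "indep M X ==> finite X"
 using indep_subset_ground finite_ground finite_subset by blast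

lemma rk_finite: "finite {X. X <= S & indep M X}"
proof -
 have "{X. X <= S & indep M X} <= Pow (ground M)" using indep_subset_ground by blast
 thus ?thesis using finite_ground finite_subset by blast
qed

lemma card_le_rk: "indep M Y ==> Y <= X ==> card Y <= rk M X"
 unfolding rk_def using rk_finite by (intro Max_ge) auto

lemma rk_attained: "EX B. B <= X & indep M B & card B = rk M X"
proof -
 have "rk M X : card ` {Y. Y <= X & indep M Y}"
  unfolding rk_def using rk_finite indep_empty by (intro Max_in) auto
 thus ?thesis by (auto simp del: finite_imageI)
qed

lemma extend_indep:
 assumes "indep M I" "I <= X"
 obtains B where "I <= B" "B <= X" "indep M B" "card B = rk M X"
proof -
 have "EX B. I <= B & B <= X & indep M B & card B = rk M X" using assms
 proof (induction "rk M X - card I" arbitrary: I rule: less_induct)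
  case less
  show ?case
  proof (cases "card I = rk M X")
   case False
   hence lt: "card I < rk M X" using card_le_rk[OF less.prems] by simp
   obtain B where "B <= X" "indep M B" "card B = rk M X" using rk_attained by blast
   then obtain y where y: "y : X - I" "indep M (y+:I)" using indep_augment[OF less.prems(1), of B] lt by auto
   have "card (y+:I) = Suc (card I)" using y indep_finite[OF less.prems(1)] by simp
   hence "rk M X - card (y+:I) < rk M X - card I" using lt by simp
   from less.hyps[OF this y(2)] show ?thesis using y less.prems by blast
  qed (use less.prems in blast)
 qed
 thus thesis using that by blast
qed

lemma rk_indep: assumes "indep M B" shows "rk M B = card B"
proof -
 obtain B' where "B' <= B" "indep M B'" "card B' = rk M B" using rk_attained by blast
 hence "rk M B <= card B" using card_mono[OF indep_finite[OF assms]] by metis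
 thus ?thesis using card_le_rk[OF assms, of B] by simp
qed

lemma rk_mono: "X <= Y ==> rk M X <= rk M Y"
 using rk_attained[of X] card_le_rk[of _ Y] by force

lemma cl_iff:
 assumes B: "indep M B" "B <= X" "card B = rk M X"
 shows "e : cl M X \<longleftrightarrow> e : ground M & (e : B \<or> ~ indep M (e+:B))"
proof
 assume e: "e : cl M X"
 show "e : ground M & (e : B \<or> ~ indep M (e+:B))"
 proof (rule conjI, use e in \<open>simp add: cl_def\<close>, rule ccontr)
  assume *: "~ (e : B \<or> ~ indep M (e+:B))"
  hence "card (e+:B) <= rk M (e+:X)" using B by (intro card_le_rk) auto
  thus False using * B e indep_finite[OF B(1)] by (simp add: cl_def)
 qed
next
 assume e: "e : ground M & (e : B \<or> ~ indep M (e+:B))"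
 obtain B' where B': "B <= B'" "B' <= (e+:X)" "indep M B'" "card B' = rk M (e+:X)"
  using extend_indep[OF B(1), of "(e+:X)"] B(2) by blast
 have "B' = B"
 proof (rule ccontr)
  assume "B' ~= B"
  then obtain x where x: "x : B'" "x ~: B" using B' by blast
  have i: "indep M (x+:B)" by (rule indep_subset[OF B'(3)]) (use x B' in blast)
  hence "x ~= e" using e x by blast
  hence "card (x+:B) <= rk M X" using i x B B' by (intro card_le_rk) auto
  thus False using x B indep_finite[OF B(1)] by simp
 qed
 thus "e : cl M X" using e B B' by (simp add: cl_def)
qed

lemma cl_indep: "indep M B ==> e : cl M B \<longleftrightarrow> e : ground M & (e : B \<or> ~ indep M (e+:B))"
 by (rule cl_iff) (simp_all add: rk_indep)

lemma cl_basis: "indep M B ==> B <= X ==> card B = rk M X ==> cl M X = cl M B"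
 using cl_iff[of B X] cl_indep[of B] by blast

lemma cl_sub: "cl M X <= ground M"
 by (auto simp: cl_def)

lemma cl_ext: "e : ground M ==> e : X ==> e : cl M X"
 by (simp add: cl_def insert_absorb)

lemma cl_superset: "X <= ground M ==> X <= cl M X"
 using cl_ext by blast

lemma cl_mono: assumes "X <= Y" shows "cl M X <= cl M Y"
proof
 fix e assume e: "e : cl M X"
 obtain B where B: "B <= X" "indep M B" "card B = rk M X" using rk_attained by blast
 then obtain C where C: "B <= C" "C <= Y" "indep M C" "card C = rk M Y" using extend_indep[of B Y] assms by blast
 have "e : C" if "indep M (e+:C)"
  using e cl_iff[OF B(2,1,3)] indep_subset[OF that, of "(e+:B)"] C by blast
 thus "e : cl M Y" using e cl_sub cl_iff[OF C(3,2,4)] by blast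
qed

lemma basis_of_cl:
 assumes B: "B <= X" "indep M B" "card B = rk M X"
 shows "cl M X = cl M B" "B <= cl M X" "rk M (cl M X) = rk M X" "cl M (cl M X) = cl M X"
proof -
 show c: "cl M X = cl M B" using cl_basis B by blast
 show s: "B <= cl M X" using c cl_superset[OF indep_subset_ground[OF B(2)]] by simp
 obtain B' where B': "B <= B'" "B' <= cl M X" "indep M B'" "card B' = rk M (cl M X)"
  by (rule extend_indep[OF B(2) s])
 have "B' = B"
 proof (rule ccontr)
  assume "B' ~= B"
  then obtain x where x: "x : B'" "x ~: B" using B' by blast
  hence "~ indep M (x+:B)" using cl_indep[OF B(2), of x] c B' by blast
  thus False using indep_subset[OF B'(3), of "(x+:B)"] x B' by blast
 qed
 thus r: "rk M (cl M X) = rk M X" using B' B by simp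
 show "cl M (cl M X) = cl M X" using cl_basis[OF B(2) s] r B c by simp
qed

lemma cl_cl: "cl M (cl M X) = cl M X" and rk_cl: "rk M (cl M X) = rk M X"
proof -
 obtain B where B: "B <= X" "indep M B" "card B = rk M X" using rk_attained by blast
 show "cl M (cl M X) = cl M X" "rk M (cl M X) = rk M X" by (rule basis_of_cl[OF B])+
qed

lemma cl_le: "X <= cl M Y ==> cl M X <= cl M Y"
 using cl_mono cl_cl by metis

lemma cl_insert_in: "X <= ground M ==> x : cl M X ==> cl M (x+:X) = cl M X"
 using cl_le[of "(x+:X)" X] cl_superset[of X] cl_mono[of X "(x+:X)"] by blast

lemma flat_basis: "flat M F ==> indep M B ==> B <= F ==> card B = rk M F ==> F = cl M B"
 using cl_basis unfolding flat_def by metis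

lemma corank_iff: "flat_of_corank M k F \<longleftrightarrow> (EX S. indep M S & card S + k = \<rho> & F = cl M S)"
proof
 assume F: "flat_of_corank M k F"
 obtain B where "B <= F" "indep M B" "card B = rk M F" using rk_attained by blast
 thus "EX S. indep M S & card S + k = \<rho> & F = cl M S"
  using F flat_basis unfolding flat_of_corank_def by metis
next
 assume "EX S. indep M S & card S + k = \<rho> & F = cl M S"
 thus "flat_of_corank M k F"
  unfolding flat_of_corank_def flat_def using cl_sub cl_cl rk_cl rk_indep by auto
qed

lemma hyperplanes_iff: "H : hyperplanes M \<longleftrightarrow> (EX S. indep M S & Suc (card S) = \<rho> & H = cl M S)"
 unfolding hyperplanes_def by (simp add: corank_iff)

lemma basis_iff: "basis M B \<longleftrightarrow> indep M B & card B = \<rho>"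
proof
 assume B: "basis M B"
 hence i: "indep M B" "!!X. indep M X ==> B <= X ==> X = B" by (auto simp: basis_def)
 obtain C where C: "B <= C" "C <= ground M" "indep M C" "card C = \<rho>" by (rule extend_indep[OF i(1) indep_subset_ground[OF i(1)]])
 show "indep M B & card B = \<rho>" using i(1) i(2)[OF C(3,1)] C(4) by simp
next
 assume B: "indep M B & card B = \<rho>"
 have "X = B" if "indep M X" "B <= X" for X
  using card_subset_eq[OF indep_finite[OF that(1)] that(2)] card_le_rk[OF that(1) indep_subset_ground[OF that(1)]]
   card_mono[OF indep_finite[OF that(1)] that(2)] B by simp
 thus "basis M B" using B by (auto simp: basis_def)
qed

lemma bases_family: "basis_family (Collect (basis M))"
proof
 show "finite (\<Union> (Collect (basis M)))"
  by (rule finite_subset[OF _ finite_ground]) (use basis_iff indep_subset_ground in blast)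
next
 fix B B' x assume *: "B : Collect (basis M)" "B' : Collect (basis M)" "x : B" "x ~: B'"
 hence b: "indep M B" "indep M B'" "card B = \<rho>" "card B' = \<rho>" by (auto simp: basis_iff)
 have fin: "finite B" using indep_finite b by blast
 have i: "indep M (B - {x})" by (rule indep_subset[OF b(1)]) auto
 have "card (B - {x}) < card B'" using b * fin card_Diff1_less by metis
 from indep_augment[OF i b(2) this] obtain y where y: "y : B' - (B - {x})" "indep M (y+:(B - {x}))" by blast
 moreover have "card (y+:(B - {x})) = card B"
  using y(1) card_Suc_Diff1[OF fin *(3)] fin by simp
 ultimately show "EX y. y : B' & y ~: B & (y+:(B - {x})) : Collect (basis M)" using b * by (auto simp: basis_iff)
next
 fix B B' y assume *: "B : Collect (basis M)" "B' : Collect (basis M)" "y : B'" "y ~: B"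
 hence b: "indep M B" "indep M B'" "card B = \<rho>" "card B' = \<rho>" by (auto simp: basis_iff)
 have fin: "finite B" using indep_finite b by blast
 have i: "indep M (y+:(B Int B'))" by (rule indep_subset[OF b(2)]) (use * in auto)
 have "rk M (y+:B) <= \<rho>" using rk_mono[of "(y+:B)" "ground M"] b * indep_subset_ground by blast
 hence r: "rk M (y+:B) = \<rho>" using card_le_rk[OF b(1) subset_insertI[of B y]] b by simp
 obtain C where C: "(y+:(B Int B')) <= C" "C <= (y+:B)" "indep M C" "card C = \<rho>"
 proof (rule extend_indep[OF i, of "(y+:B)"])
 qed (use r that in auto)
 have "~ B <= C"
 proof
  assume "B <= C"
  hence "B = C" using card_subset_eq[OF indep_finite[OF C(3)]] b C by simp
  thus False using C * by blast
 qed
 then obtain x where x: "x : B" "x ~: C" by blast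
 have sub: "C <= (y+:(B - {x}))" using C x by auto
 have "card (y+:(B - {x})) = card B" using *(4) card_Suc_Diff1[OF fin x(1)] fin by simp
 hence "C = (y+:(B - {x}))" using card_subset_eq[OF _ sub] fin C b by simp
 thus "EX x. x : B & x ~: B' & (y+:(B - {x})) : Collect (basis M)"
  using x C by (auto simp: basis_iff)
qed

text \<open>A basis of a flat of corank 2. Over such a flat the matroid has rank 2, so the
  hyperplanes above it behave like points on a line, whence the name.\<close>

definition line :: "'a set => bool" where
 "line T \<longleftrightarrow> indep M T & card T + 2 = \<rho>"

lemma corank2_iff: "flat_of_corank M 2 F \<longleftrightarrow> (EX T. line T & F = cl M T)"
 by (auto simp: corank_iff line_def)

lemma line_insert:
 assumes "line T" "a : ground M" "a ~: cl M T"
 shows "indep M (a+:T)" "Suc (card (a+:T)) = \<rho>" "a ~: T" "cl M (a+:T) : hyperplanes M"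
proof -
 have T: "indep M T" "card T + 2 = \<rho>" using assms by (auto simp: line_def)
 show 1: "indep M (a+:T)" "a ~: T" using cl_indep[OF T(1)] assms by blast+
 show 2: "Suc (card (a+:T)) = \<rho>" using 1 T indep_finite[OF T(1)] by simp
 show "cl M (a+:T) : hyperplanes M" using 1 2 hyperplanes_iff by blast
qed

lemma basis_insert:
 assumes S: "indep M S" "Suc (card S) = \<rho>" and b: "b : ground M"
 shows "basis M (b+:S) \<longleftrightarrow> b ~: cl M S"
proof -
 have "b : cl M S \<longleftrightarrow> b : S \<or> ~ indep M (b+:S)" using cl_indep[OF S(1)] b by blast
 moreover have "b : S ==> ~ basis M (b+:S)" using S by (simp add: basis_iff insert_absorb)
 moreover have "b ~: S ==> card (b+:S) = \<rho>" using S indep_finite by simp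
 ultimately show ?thesis by (auto simp: basis_iff)
qed

lemma line_basis:
 assumes "line T" "a : ground M" "a ~: cl M T" "b : ground M"
 shows "basis M (a+:b+:T) \<longleftrightarrow> b ~: cl M (a+:T)"
 using basis_insert[OF line_insert(1,2)[OF assms(1-3)] assms(4)] by (simp add: insert_commute)

lemma hyperplane_flat: "H : hyperplanes M ==> flat M H" "H : hyperplanes M ==> Suc (rk M H) = \<rho>"
 by (auto simp: hyperplanes_def flat_of_corank_def)

lemma hyperplane_over:
 assumes "line T" "H : hyperplanes M" "cl M T <= H" "a : H" "a ~: cl M T"
 shows "H = cl M (a+:T)"
proof -
 have a: "a : ground M" using assms hyperplane_flat(1) unfolding flat_def by blast
 have "T <= H" using assms cl_superset indep_subset_ground unfolding line_def by blast
 thus ?thesis using flat_basis[OF hyperplane_flat(1)[OF assms(2)] line_insert(1)[OF assms(1) a assms(5)]]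
   line_insert(2)[OF assms(1) a assms(5)] hyperplane_flat(2)[OF assms(2)] assms(4) by simp
qed

lemma line_hyperplane:
 assumes T: "line T" and H: "H : hyperplanes M" "cl M T <= H"
 obtains a where "a : ground M" "a ~: cl M T" "a : H" "H = cl M (a+:T)"
proof -
 have "H ~= cl M T" using hyperplane_flat(2)[OF H(1)] T rk_cl rk_indep unfolding line_def by fastforce
 then obtain a where a: "a : H" "a ~: cl M T" using H by blast
 thus thesis using that hyperplane_over[OF T H] hyperplane_flat(1)[OF H(1)] unfolding flat_def by blast
qed

lemma hyperplanes_meet:
 assumes "line T" "H1 : hyperplanes M" "H2 : hyperplanes M" "cl M T <= H1" "cl M T <= H2" "H1 ~= H2"
 shows "H1 Int H2 = cl M T"
 using hyperplane_over[OF assms(1,2,4)] hyperplane_over[OF assms(1,3,5)] assms(4-6) by blast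

lemma line_cl_eq:
 assumes "line T" "a : ground M" "a ~: cl M T" "b : ground M" "b ~: cl M T"
 shows "b : cl M (a+:T) \<longleftrightarrow> cl M (a+:T) = cl M (b+:T)"
proof -
 have "cl M T <= cl M (a+:T)" by (rule cl_mono) blast
 thus ?thesis
  using hyperplane_over[OF assms(1) line_insert(4)[OF assms(1-3)]] cl_ext[OF assms(4), of "(b+:T)"] assms(5) by blast
qed

end

lemma square_line:
 assumes "matroid M" and sq: "square (Collect (basis M)) T a b c d"
 shows "matroid.line M T"
  "!!x. x : {a, b, c, d} ==> x : ground M & x ~: cl M T"
  "!!x y. x : {a, b} ==> y : {c, d} ==> x ~: cl M (y+:T) & y ~: cl M (x+:T)"
proof -
 interpret matroid M by fact
 have b: "basis M (x+:y+:T)" if "x : {a, b}" "y : {c, d}" for x y using sq that by (auto simp: square_def)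
 have n: "x ~= y" "x ~: T" "y ~: T" if "x : {a, b}" "y : {c, d}" for x y using sq that by (auto simp: square_def)
 have i: "indep M (x+:y+:T)" "card (x+:y+:T) = \<rho>" if "x : {a, b}" "y : {c, d}" for x y
  using b[OF that] by (auto simp: basis_iff)
 have T: "indep M T" using indep_subset[OF i(1)[of a c], of T] by auto
 thus l: "line T" using i(2)[of a c] n[of a c] indep_finite[OF T] by (simp add: line_def)
 have nin: "x : ground M & x ~: cl M T & y : ground M & y ~: cl M T" if "x : {a, b}" "y : {c, d}" for x y
 proof -
  have "indep M (x+:T)" "indep M (y+:T)"
   using indep_subset[OF i(1)[OF that]] by (blast, blast)
  thus ?thesis using cl_indep[OF T] n[OF that] indep_subset_ground[OF i(1)[OF that]] by blast
 qed
 show g: "x : ground M & x ~: cl M T" if "x : {a, b, c, d}" for x using nin[of a c] nin[of b d] that by blast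
 show "x ~: cl M (y+:T) & y ~: cl M (x+:T)" if xy: "x : {a, b}" "y : {c, d}" for x y
  using line_basis[OF l, of x y] line_basis[OF l, of y x] b[OF xy] nin[OF xy] by (simp add: insert_commute[of y x])
qed

text \<open>A section of an epimorphism from a free abelian group onto the units of \<open>P\<close> serves as a
 logarithm: \<open>ev P\<close> is the epimorphism and \<open>frag_of\<close> the section.\<close>

definition ev :: "'u pasture => ('u \<Rightarrow>\<^sub>0 int) => 'u" where
 "ev P = (SOME h. h : hom (free_Abelian_group UNIV) (units_of P) & (ALL p:Units P. h (frag_of p) = p))"

definition ev_kernel :: "'u pasture => ('u \<Rightarrow>\<^sub>0 int) set" where
 "ev_kernel P = {v. ev P v = \<one>\<^bsub>P\<^esub>}"

definition neg1 :: "'u pasture => 'u" where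
 "neg1 P = (THE b. b : carrier P & {#\<one>\<^bsub>P\<^esub>, b, pzero P#} : nullset P)"

section \<open>Units and null relations in logarithmic form\<close>

context pasture
begin

lemma nonzeros_Units: "nonzeros P = Units P"
proof -
 have "pzero P ~: Units P" using zero_absorbing zero_neq_one by (metis Units_closed Units_r_inv_ex)
 thus ?thesis using nonzero_invertible Units_closed by (auto simp: nonzeros_def)
qed

lemma ev_props: "ev P : hom (free_Abelian_group UNIV) (units_of P)" "p : nonzeros P ==> ev P (frag_of p) = p"
proof -
 interpret U: comm_group "units_of P" by (rule units_comm_group)
 have one: "\<one> : Units P" by simp
 have "(\<lambda>p. if p : Units P then p else \<one>) ` UNIV <= carrier (units_of P)" using one by (auto simp: units_of_carrier)
 from U.free_Abelian_group_universal[OF this] obtain h where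
  "h : hom (free_Abelian_group UNIV) (units_of P)" "!!x. h (frag_of x) = (if x : Units P then x else \<one>)" by auto
 hence "EX h. h : hom (free_Abelian_group UNIV) (units_of P) & (ALL p:Units P. h (frag_of p) = p)" by auto
 from someI_ex[OF this] show "ev P : hom (free_Abelian_group UNIV) (units_of P)" "p : nonzeros P ==> ev P (frag_of p) = p"
  unfolding ev_def nonzeros_Units by blast+
qed

lemma ev_nonzero: "ev P v : nonzeros P"
 using ev_props(1) by (auto simp: hom_def nonzeros_Units units_of_carrier free_Abelian_group_def)

lemma ev_closed: "ev P v : carrier P" and ev_neq: "ev P v ~= pzero P"
 using ev_nonzero by (auto simp: nonzeros_def)

lemma ev_add: "ev P (u + v) = ev P u \<otimes> ev P v"
 using ev_props(1) by (auto simp: hom_def units_of_mult free_Abelian_group_def)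

lemma ev_0: "ev P 0 = \<one>"
proof -
 have "ev P 0 \<otimes> ev P 0 = ev P 0 \<otimes> \<one>" using ev_add[of 0 0] ev_closed by simp
 thus ?thesis using Units_l_cancel[of "ev P 0" "ev P 0" \<one>] ev_nonzero ev_closed by (simp add: nonzeros_Units)
qed

lemma ev_cancel: "ev P (u - v) = \<one> \<longleftrightarrow> ev P u = ev P v"
proof -
 have "ev P v \<otimes> ev P (u - v) = ev P u" using ev_add[of v "u - v"] by simp
 moreover have "ev P v \<otimes> ev P (u - v) = ev P v \<otimes> \<one> \<longleftrightarrow> ev P (u - v) = \<one>"
  by (rule Units_l_cancel) (use ev_nonzero ev_closed in \<open>auto simp: nonzeros_Units\<close>)
 ultimately show ?thesis using ev_closed by (metis r_one)
qed

sublocale mod_subgroup "ev_kernel P"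
proof
 show "0 : ev_kernel P" by (simp add: ev_kernel_def ev_0)
 show "x - y : ev_kernel P" if "x : ev_kernel P" "y : ev_kernel P" for x y
  using that by (simp add: ev_kernel_def ev_cancel)
qed

notation cg (infix "\<doteq>" 50)

lemma cg_iff: "u \<doteq> v \<longleftrightarrow> ev P u = ev P v"
 unfolding cg_def ev_cancel[symmetric] by (simp add: ev_kernel_def)

abbreviation "lg \<equiv> frag_of"

abbreviation "\<epsilon> \<equiv> lg (neg1 P)"

lemma ev_lg: "p : nonzeros P ==> ev P (lg p) = p"
 by (rule ev_props)

lemma nonzeros_mult: "p : nonzeros P ==> q : nonzeros P ==> p \<otimes> q : nonzeros P"
 by (simp add: nonzeros_Units)

lemma lg_ev: "lg (ev P v) \<doteq> v"
 by (simp add: cg_iff ev_lg ev_nonzero)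

lemma mult_zero_iff: "p : carrier P ==> q : carrier P ==> p \<otimes> q = pzero P \<longleftrightarrow> p = pzero P \<or> q = pzero P"
 using nonzeros_mult[of p q] zero_absorbing m_comm zero_closed unfolding nonzeros_def by auto

lemma mult_zero: "p : carrier P ==> p \<otimes> pzero P = pzero P"
 using mult_zero_iff zero_closed by blast

lemma neg1_null: "neg1 P : carrier P" "{#\<one>, neg1 P, pzero P#} : nullset P"
 using theI'[OF ex1_negative[OF one_closed]] by (auto simp: neg1_def)

lemma null_zero: "{#pzero P, pzero P, pzero P#} : nullset P"
 using nullset_scale[OF zero_closed neg1_null(2)] neg1_null(1) zero_closed by (simp add: zero_absorbing)

lemma null_single: "p : carrier P ==> {#p, pzero P, pzero P#} : nullset P ==> p = pzero P"
 using ex1_negative[OF zero_closed] null_zero zero_closed by (metis add_mset_commute)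

lemma null_pair_iff:
 assumes "p : carrier P" "q : carrier P"
 shows "{#p, q, pzero P#} : nullset P \<longleftrightarrow> q = p \<otimes> neg1 P"
proof -
 have "{#p, p \<otimes> neg1 P, pzero P#} : nullset P"
  using nullset_scale[OF assms(1) neg1_null(2)] assms neg1_null(1) by (simp add: mult_zero)
 moreover have "p \<otimes> neg1 P : carrier P" using assms neg1_null by simp
 ultimately show ?thesis using ex1_negative[OF assms(1)] assms(2) by blast
qed

lemma neg1_nonzero: "neg1 P : nonzeros P"
 using neg1_null null_single[OF one_closed] zero_neq_one by (auto simp: nonzeros_def)

lemma null_ev: "{#ev P u, ev P v, pzero P#} : nullset P \<longleftrightarrow> v \<doteq> \<epsilon> + u"
 using null_pair_iff[OF ev_closed ev_closed, of u v] by (simp add: cg_iff ev_add ev_lg neg1_nonzero m_comm ev_closed neg1_null)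

text \<open>The sums \<open>1 + (-1)\<close> and \<open>(-1) + 1\<close> are the same multiset, so 1
  is the negative of -1.\<close>

lemma eps_double: "\<epsilon> + \<epsilon> \<doteq> 0"
proof -
 have "{#ev P 0, ev P \<epsilon>, pzero P#} : nullset P" using neg1_null by (simp add: ev_0 ev_lg neg1_nonzero)
 hence "{#ev P \<epsilon>, ev P 0, pzero P#} : nullset P" by (simp add: add_mset_commute)
 thus ?thesis unfolding null_ev by (rule cg_sym)
qed

lemma null_shift:
 assumes "{#ev P u, ev P v, ev P w#} : nullset P" "u' - u \<doteq> v' - v" "u' - u \<doteq> w' - w"
 shows "{#ev P u', ev P v', ev P w'#} : nullset P"
proof -
 let ?t = "u' - u"
 have "{#ev P ?t \<otimes> ev P u, ev P ?t \<otimes> ev P v, ev P ?t \<otimes> ev P w#} : nullset P"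
  using nullset_scale[OF ev_closed assms(1), of ?t] by simp
 moreover have "?t + v \<doteq> v'" "?t + w \<doteq> w'"
  by (rule cg_lin1[OF assms(2)], simp) (rule cg_lin1[OF assms(3)], simp)
 ultimately show ?thesis by (simp add: ev_add[symmetric] cg_iff)
qed

end

section \<open>Representations described on pencils, without coefficients\<close>

definition pencil :: "'a matroid => 'a set => 'a set => 'a set => 'a set => bool" where
 "pencil M F H1 H2 H3 \<longleftrightarrow> flat_of_corank M 2 F & H1 : hyperplanes M & H2 : hyperplanes M & H3 : hyperplanes M
  & distinct [H1, H2, H3] & F <= H1 & F <= H2 & F <= H3"

abbreviation "null_triple M P \<phi> H1 H2 H3 \<equiv> EX a:carrier P. EX b:carrier P. EX c:carrier P.
 (a, b, c) ~= (pzero P, pzero P, pzero P) &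
 (ALL e:ground M. {#a \<otimes>\<^bsub>P\<^esub> \<phi> H1 e, b \<otimes>\<^bsub>P\<^esub> \<phi> H2 e, c \<otimes>\<^bsub>P\<^esub> \<phi> H3 e#} : nullset P)"

lemma pencil_perm: "pencil M F H1 H2 H3 ==> pencil M F H2 H1 H3" "pencil M F H1 H2 H3 ==> pencil M F H2 H3 H1"
 by (auto simp: pencil_def)

lemma (in matroid) pencil_meet:
 assumes "pencil M F H1 H2 H3"
 shows "H1 Int H2 = F" "H1 Int H3 = F" "H2 Int H3 = F" "H1 ~= F" "H2 ~= F" "H3 ~= F"
  "H1 <= ground M" "H2 <= ground M" "H3 <= ground M"
proof -
 note p = assms[unfolded pencil_def]
 obtain T where T: "line T" "F = cl M T" using p unfolding corank2_iff by blast
 show "H1 Int H2 = F" "H1 Int H3 = F" "H2 Int H3 = F"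
  using hyperplanes_meet[OF T(1)] p unfolding T(2) by auto
 have "H ~= F" if "H : hyperplanes M" for H
  using hyperplane_flat(2)[OF that] p unfolding flat_of_corank_def by auto
 thus "H1 ~= F" "H2 ~= F" "H3 ~= F" using p by blast+
 show "H1 <= ground M" "H2 <= ground M" "H3 <= ground M"
  using hyperplane_flat(1) p unfolding flat_def by blast+
qed

locale matroid_over = matroid M + pasture P for M :: "'a matroid" and P :: "'u pasture" (structure)
begin

notation cg (infix "\<doteq>" 50)

abbreviation Y :: "('a, 'u) rep => 'a set => 'a => 'u \<Rightarrow>\<^sub>0 int" where
 "Y \<phi> H x \<equiv> lg (\<phi> H x)"

definition supported :: "('a, 'u) rep => bool" where
 "supported \<phi> \<longleftrightarrow> (ALL H:hyperplanes M. ALL e:ground M. \<phi> H e : carrier P & (\<phi> H e = pzero P \<longleftrightarrow> e : H))"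

lemma reps_supported: "\<phi> : reps M P ==> supported \<phi>"
 by (simp add: reps_def supported_def)

lemma supported_nonzero: "supported \<phi> ==> H : hyperplanes M ==> e : ground M ==> e ~: H ==> \<phi> H e : nonzeros P"
 by (simp add: supported_def nonzeros_def)

lemma null_mult:
 assumes "p : nonzeros P" "q : nonzeros P" "a : nonzeros P" "b : nonzeros P"
 shows "{#a \<otimes> p, b \<otimes> q, pzero P#} : nullset P \<longleftrightarrow> lg b + lg q \<doteq> \<epsilon> + lg a + lg p"
 using null_ev[of "lg a + lg p" "lg b + lg q"] assms by (simp add: ev_add ev_lg add.assoc)

text \<open>At a point of one hyperplane outside \<open>F\<close> only two terms of the relation
  survive, which ties two coefficients together. Each of the three hyperplanes has such points, so
  no coefficient is zero and all three have logarithms.\<close>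

lemma rep_coefficients:
 assumes \<phi>: "\<phi> : reps M P" and p: "pencil M F H1 H2 H3"
 obtains \<alpha> \<beta> \<gamma> where
  "!!e. e : H1 - F ==> \<gamma> + Y \<phi> H3 e \<doteq> \<epsilon> + \<beta> + Y \<phi> H2 e"
  "!!e. e : H2 - F ==> \<gamma> + Y \<phi> H3 e \<doteq> \<epsilon> + \<alpha> + Y \<phi> H1 e"
  "!!e. e : H3 - F ==> \<beta> + Y \<phi> H2 e \<doteq> \<epsilon> + \<alpha> + Y \<phi> H1 e"
  "!!e. e : ground M - (H1 Un H2 Un H3) ==> {#ev P (\<alpha> + Y \<phi> H1 e), ev P (\<beta> + Y \<phi> H2 e), ev P (\<gamma> + Y \<phi> H3 e)#} : nullset P"
proof -
 note m = pencil_meet[OF p] and p' = p[unfolded pencil_def]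
 have F: "H1 Int H2 Int H3 = F" using m by blast
 have "flat_of_corank M 2 (H1 Int H2 Int H3)" unfolding F using p' by blast
 hence "null_triple M P \<phi> H1 H2 H3"
  using \<phi> p' unfolding reps_def by auto
 then obtain a b c where abc: "a : carrier P" "b : carrier P" "c : carrier P"
  and nz: "~ (a = pzero P & b = pzero P & c = pzero P)"
  and null: "!!e. e : ground M ==> {#a \<otimes> \<phi> H1 e, b \<otimes> \<phi> H2 e, c \<otimes> \<phi> H3 e#} : nullset P" by auto
 have H: "H1 : hyperplanes M" "H2 : hyperplanes M" "H3 : hyperplanes M" using p' by auto
 note sup = reps_supported[OF \<phi>]
 note nonz = supported_nonzero[OF sup]
 have zero: "\<phi> H e = pzero P" if "H : hyperplanes M" "e : H" "e : ground M" for H e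
  using sup that by (auto simp: supported_def)
 have n1: "{#b \<otimes> \<phi> H2 e, c \<otimes> \<phi> H3 e, pzero P#} : nullset P" and nn1: "\<phi> H2 e : nonzeros P" "\<phi> H3 e : nonzeros P"
  if "e : H1 - F" for e
 proof -
  have e: "e : ground M" "e : H1" "e ~: H2" "e ~: H3" using that m by auto
  thus "{#b \<otimes> \<phi> H2 e, c \<otimes> \<phi> H3 e, pzero P#} : nullset P"
   using null[OF e(1)] zero[OF H(1)] abc by (simp add: mult_zero add_mset_commute)
  show "\<phi> H2 e : nonzeros P" "\<phi> H3 e : nonzeros P" using nonz H e by auto
 qed
 have n2: "{#a \<otimes> \<phi> H1 e, c \<otimes> \<phi> H3 e, pzero P#} : nullset P" and nn2: "\<phi> H1 e : nonzeros P" "\<phi> H3 e : nonzeros P"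
  if "e : H2 - F" for e
 proof -
  have e: "e : ground M" "e ~: H1" "e : H2" "e ~: H3" using that m by auto
  thus "{#a \<otimes> \<phi> H1 e, c \<otimes> \<phi> H3 e, pzero P#} : nullset P"
   using null[OF e(1)] zero[OF H(2)] abc by (simp add: mult_zero add_mset_commute)
  show "\<phi> H1 e : nonzeros P" "\<phi> H3 e : nonzeros P" using nonz H e by auto
 qed
 have n3: "{#a \<otimes> \<phi> H1 e, b \<otimes> \<phi> H2 e, pzero P#} : nullset P" and nn3: "\<phi> H1 e : nonzeros P" "\<phi> H2 e : nonzeros P"
  if "e : H3 - F" for e
 proof -
  have e: "e : ground M" "e ~: H1" "e ~: H2" "e : H3" using that m by auto
  thus "{#a \<otimes> \<phi> H1 e, b \<otimes> \<phi> H2 e, pzero P#} : nullset P"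
   using null[OF e(1)] zero[OF H(3)] abc by (simp add: mult_zero add_mset_commute)
  show "\<phi> H1 e : nonzeros P" "\<phi> H2 e : nonzeros P" using nonz H e by auto
 qed
 obtain e1 e2 e3 where e: "e1 : H1 - F" "e2 : H2 - F" "e3 : H3 - F" using p' m(4-6) by blast
 have both: "x = pzero P \<longleftrightarrow> y = pzero P"
  if "{#x \<otimes> p, y \<otimes> q, pzero P#} : nullset P" "p : nonzeros P" "q : nonzeros P" "x : carrier P" "y : carrier P" for x y p q
 proof -
  have "p : carrier P" "q : carrier P" "p ~= pzero P" "q ~= pzero P" using that by (auto simp: nonzeros_def)
  moreover from this have "y \<otimes> q = x \<otimes> p \<otimes> neg1 P" using null_pair_iff that by simp
  ultimately show ?thesis using mult_zero_iff neg1_null(1) neg1_nonzero that(4,5) by (metis DiffE m_closed nonzeros_def singletonI)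
 qed
 have "b = pzero P \<longleftrightarrow> c = pzero P" "a = pzero P \<longleftrightarrow> c = pzero P"
  using both[OF n1[OF e(1)] nn1[OF e(1)]] both[OF n2[OF e(2)] nn2[OF e(2)]] abc by auto
 hence abc': "a : nonzeros P" "b : nonzeros P" "c : nonzeros P" using nz abc by (auto simp: nonzeros_def)
 show thesis
 proof
  show "lg c + Y \<phi> H3 e \<doteq> \<epsilon> + lg b + Y \<phi> H2 e" if "e : H1 - F" for e
   using n1[OF that] null_mult[OF nn1[OF that] abc'(2,3)] by simp
  show "lg c + Y \<phi> H3 e \<doteq> \<epsilon> + lg a + Y \<phi> H1 e" if "e : H2 - F" for e
   using n2[OF that] null_mult[OF nn2[OF that] abc'(1,3)] by simp
  show "lg b + Y \<phi> H2 e \<doteq> \<epsilon> + lg a + Y \<phi> H1 e" if "e : H3 - F" for e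
   using n3[OF that] null_mult[OF nn3[OF that] abc'(1,2)] by simp
  show "{#ev P (lg a + Y \<phi> H1 e), ev P (lg b + Y \<phi> H2 e), ev P (lg c + Y \<phi> H3 e)#} : nullset P"
   if e: "e : ground M - (H1 Un H2 Un H3)" for e
  proof -
   have "\<phi> H1 e : nonzeros P" "\<phi> H2 e : nonzeros P" "\<phi> H3 e : nonzeros P" using nonz H e by auto
   thus ?thesis using null[of e] e abc' by (simp add: ev_add ev_lg)
  qed
 qed
qed

text \<open>This lemma and the two after it eliminate the coefficients from the three-term
  condition; \<open>repsI\<close> shows that for functions with the right zeros they are together
  equivalent to it.\<close>

lemma rep_par:
 assumes \<phi>: "\<phi> : reps M P" and p: "pencil M F H1 H2 H3" and x: "x : H1 - F" "x' : H1 - F"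
 shows "Y \<phi> H2 x + Y \<phi> H3 x' \<doteq> Y \<phi> H2 x' + Y \<phi> H3 x"
proof -
 obtain \<beta> \<gamma> where *: "!!e. e : H1 - F ==> \<gamma> + Y \<phi> H3 e \<doteq> \<epsilon> + \<beta> + Y \<phi> H2 e"
  using rep_coefficients[OF \<phi> p] by metis
 show ?thesis by (rule cg_lin2[OF *[OF x(2)] cg_sym[OF *[OF x(1)]]]) simp
qed

lemma rep_tri:
 assumes \<phi>: "\<phi> : reps M P" and p: "pencil M F H1 H2 H3" and x: "a : H1 - F" "b : H2 - F" "c : H3 - F"
 shows "Y \<phi> H2 a + Y \<phi> H3 b + Y \<phi> H1 c \<doteq> \<epsilon> + Y \<phi> H3 a + Y \<phi> H1 b + Y \<phi> H2 c"
proof -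
 obtain \<alpha> \<beta> \<gamma> where *: "\<gamma> + Y \<phi> H3 a \<doteq> \<epsilon> + \<beta> + Y \<phi> H2 a" "\<gamma> + Y \<phi> H3 b \<doteq> \<epsilon> + \<alpha> + Y \<phi> H1 b"
  "\<beta> + Y \<phi> H2 c \<doteq> \<epsilon> + \<alpha> + Y \<phi> H1 c"
  using rep_coefficients[OF \<phi> p] x by metis
 show ?thesis by (rule cg_lin4[OF cg_sym[OF *(1)] *(2) cg_sym[OF *(3)] cg_sym[OF eps_double]]) simp
qed

lemma rep_null:
 assumes \<phi>: "\<phi> : reps M P" and p: "pencil M F H1 H2 H3" and x: "a : H1 - F" "c : H3 - F" "e : ground M - (H1 Un H2 Un H3)"
 shows "{#ev P (Y \<phi> H1 e + Y \<phi> H2 c + Y \<phi> H3 a), ev P (\<epsilon> + Y \<phi> H1 c + Y \<phi> H3 a + Y \<phi> H2 e), ev P (Y \<phi> H1 c + Y \<phi> H2 a + Y \<phi> H3 e)#} : nullset P"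
proof -
 obtain \<alpha> \<beta> \<gamma> where *: "\<gamma> + Y \<phi> H3 a \<doteq> \<epsilon> + \<beta> + Y \<phi> H2 a" "\<beta> + Y \<phi> H2 c \<doteq> \<epsilon> + \<alpha> + Y \<phi> H1 c"
  "{#ev P (\<alpha> + Y \<phi> H1 e), ev P (\<beta> + Y \<phi> H2 e), ev P (\<gamma> + Y \<phi> H3 e)#} : nullset P"
  using rep_coefficients[OF \<phi> p] x by metis
 show ?thesis
 proof (rule null_shift[OF *(3)])
  show "Y \<phi> H1 e + Y \<phi> H2 c + Y \<phi> H3 a - (\<alpha> + Y \<phi> H1 e) \<doteq> \<epsilon> + Y \<phi> H1 c + Y \<phi> H3 a + Y \<phi> H2 e - (\<beta> + Y \<phi> H2 e)"
   by (rule cg_lin1[OF *(2)]) simp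
  show "Y \<phi> H1 e + Y \<phi> H2 c + Y \<phi> H3 a - (\<alpha> + Y \<phi> H1 e) \<doteq> Y \<phi> H1 c + Y \<phi> H2 a + Y \<phi> H3 e - (\<gamma> + Y \<phi> H3 e)"
   by (rule cg_lin3[OF *(1) *(2) eps_double]) simp
 qed
qed

lemma repsI:
 assumes sup: "supported \<phi>"
  and par: "!!F H1 H2 H3 x x'. pencil M F H1 H2 H3 ==> x : H1 - F ==> x' : H1 - F ==>
   Y \<phi> H2 x + Y \<phi> H3 x' \<doteq> Y \<phi> H2 x' + Y \<phi> H3 x"
  and tri: "!!F H1 H2 H3 a b c. pencil M F H1 H2 H3 ==> a : H1 - F ==> b : H2 - F ==> c : H3 - F ==>
   Y \<phi> H2 a + Y \<phi> H3 b + Y \<phi> H1 c \<doteq> \<epsilon> + Y \<phi> H3 a + Y \<phi> H1 b + Y \<phi> H2 c"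
  and null: "!!F H1 H2 H3 a c e. pencil M F H1 H2 H3 ==> a : H1 - F ==> c : H3 - F ==> e : ground M - (H1 Un H2 Un H3) ==>
   {#ev P (Y \<phi> H1 e + Y \<phi> H2 c + Y \<phi> H3 a), ev P (\<epsilon> + Y \<phi> H1 c + Y \<phi> H3 a + Y \<phi> H2 e), ev P (Y \<phi> H1 c + Y \<phi> H2 a + Y \<phi> H3 e)#} : nullset P"
 shows "\<phi> : reps M P"
 unfolding reps_def
proof (intro CollectI conjI ballI impI)
 fix H e assume "H : hyperplanes M" "e : ground M"
 thus "\<phi> H e : carrier P" "\<phi> H e = pzero P \<longleftrightarrow> e : H" using sup by (auto simp: supported_def)
next
 fix H1 H2 H3 assume H: "H1 : hyperplanes M" "H2 : hyperplanes M" "H3 : hyperplanes M" "H1 ~= H2" "H1 ~= H3" "H2 ~= H3"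
  "flat_of_corank M 2 (H1 Int H2 Int H3)"
 define F where "F = H1 Int H2 Int H3"
 have p: "pencil M F H1 H2 H3" using H by (auto simp: pencil_def F_def)
 note m = pencil_meet[OF p]
 obtain a b c where abc: "a : H1 - F" "b : H2 - F" "c : H3 - F" using p m(4-6) unfolding pencil_def by blast
 \<comment> \<open>Up to a common factor, the relations at the points \<open>a\<close> and
   \<open>c\<close> dictate these coefficients.\<close>
 define \<alpha> where "\<alpha> = Y \<phi> H2 c + Y \<phi> H3 a"
 define \<beta> where "\<beta> = \<epsilon> + Y \<phi> H1 c + Y \<phi> H3 a"
 define \<gamma> where "\<gamma> = Y \<phi> H1 c + Y \<phi> H2 a"
 note nonz = supported_nonzero[OF sup]
 have zero: "\<phi> H e = pzero P" if "H : hyperplanes M" "e : H" "e : ground M" for H e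
  using sup that by (auto simp: supported_def)
 have "{#ev P \<alpha> \<otimes> \<phi> H1 e, ev P \<beta> \<otimes> \<phi> H2 e, ev P \<gamma> \<otimes> \<phi> H3 e#} : nullset P" if e: "e : ground M" for e
 proof -
  have nm: "{#ev P u \<otimes> \<phi> H e, ev P v \<otimes> \<phi> H' e, pzero P#} : nullset P"
   if "v + Y \<phi> H' e \<doteq> \<epsilon> + u + Y \<phi> H e" "H : hyperplanes M" "H' : hyperplanes M" "e ~: H" "e ~: H'" for u v H H'
  proof -
   have "lg (ev P v) + Y \<phi> H' e \<doteq> \<epsilon> + lg (ev P u) + Y \<phi> H e"
    by (rule cg_lin3[OF that(1) lg_ev[of v] cg_sym[OF lg_ev[of u]]]) simp
   thus ?thesis using null_mult[OF nonz nonz ev_nonzero ev_nonzero] e that by blast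
  qed
  note mz = mult_zero[OF ev_closed]
  consider "e : F" | "e : H1 - F" | "e : H2 - F" | "e : H3 - F" | "e : ground M - (H1 Un H2 Un H3)" using e by blast
  thus ?thesis
  proof cases
   case 1
   hence "\<phi> H1 e = pzero P" "\<phi> H2 e = pzero P" "\<phi> H3 e = pzero P" using zero H e unfolding F_def by auto
   thus ?thesis using null_zero by (simp add: mz)
  next
   case 2
   have "{#ev P \<beta> \<otimes> \<phi> H2 e, ev P \<gamma> \<otimes> \<phi> H3 e, pzero P#} : nullset P"
    by (rule nm) (use H m 2 in \<open>auto intro: cg_lin2[OF par[OF p abc(1) 2] cg_sym[OF eps_double]] simp: \<beta>_def \<gamma>_def\<close>)
   thus ?thesis using zero[OF H(1), of e] 2 e by (simp add: mz add_mset_commute)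
  next
   case 3
   have "{#ev P \<alpha> \<otimes> \<phi> H1 e, ev P \<gamma> \<otimes> \<phi> H3 e, pzero P#} : nullset P"
    by (rule nm) (use H m 3 in \<open>auto intro: cg_lin1[OF tri[OF p abc(1) 3 abc(3)]] simp: \<alpha>_def \<gamma>_def\<close>)
   thus ?thesis using zero[OF H(2), of e] 3 e by (simp add: mz add_mset_commute)
  next
   case 4
   have p': "pencil M F H3 H1 H2" using p by (auto simp: pencil_def)
   have "{#ev P \<alpha> \<otimes> \<phi> H1 e, ev P \<beta> \<otimes> \<phi> H2 e, pzero P#} : nullset P"
    by (rule nm) (use H m 4 in \<open>auto intro: cg_lin1[OF par[OF p' abc(3) 4]] simp: \<alpha>_def \<beta>_def\<close>)
   thus ?thesis using zero[OF H(3), of e] 4 e by (simp add: mz add_mset_commute)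
  next
   case 5
   hence "\<phi> H1 e : nonzeros P" "\<phi> H2 e : nonzeros P" "\<phi> H3 e : nonzeros P" using nonz H by auto
   moreover have "{#ev P (\<alpha> + Y \<phi> H1 e), ev P (\<beta> + Y \<phi> H2 e), ev P (\<gamma> + Y \<phi> H3 e)#} : nullset P"
    using null[OF p abc(1,3) 5] unfolding \<alpha>_def \<beta>_def \<gamma>_def by (simp add: add.assoc add.commute add.left_commute)
   ultimately show ?thesis by (simp add: ev_add ev_lg)
  qed
 qed
 moreover have "ev P \<alpha> ~= pzero P" by (rule ev_neq)
 ultimately show "null_triple M P \<phi> H1 H2 H3"
  using ev_closed by (intro bexI[of _ "ev P \<alpha>"] bexI[of _ "ev P \<beta>"] bexI[of _ "ev P \<gamma>"]) auto
qed

end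

section \<open>From hyperplane functions to functions on bases\<close>

context mod_subgroup
begin

text \<open>The passage to Pluecker coordinates: \<open>q S\<close> stands for the logarithm of the
  function of the hyperplane spanned by \<open>S\<close>, and the ratio of the coordinates of two
  adjacent bases is a ratio of its values.\<close>

definition potential :: "'e set set => ('e set => 'e => 'v) => ('e set => 'v) => bool" where
 "potential \<B> q f \<longleftrightarrow> (ALL S a b. a ~: S --> b ~: S --> (a+:S) : \<B> --> (b+:S) : \<B> -->
  f (b+:S) - f (a+:S) \<doteq> q S b - q S a)"

lemma potentialD:
 "potential \<B> q f ==> a ~: S ==> b ~: S ==> (a+:S) : \<B> ==> (b+:S) : \<B> ==>
  f (b+:S) - f (a+:S) \<doteq> q S b - q S a"
 by (simp add: potential_def)

text \<open>The increments of \<open>q\<close> are a cochain on the graph of adjacent bases, and the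
  hypotheses say that it vanishes around certain triangles and squares. In the induction there are
  potentials \<open>f1\<close> and \<open>f0\<close> on the deletion and the contraction of
  \<open>e\<close>; what has to be shown is that the offset between them is the same at all pairs of
  adjacent bases on different sides.\<close>

lemma potential_exists:
 assumes "basis_family \<B>"
  and "!!T a b c. [|distinct [a, b, c]; a ~: T; b ~: T; c ~: T; (a+:b+:T) : \<B>; (a+:c+:T) : \<B>; (b+:c+:T) : \<B>|]
   ==> q (a+:T) b - q (a+:T) c + (q (b+:T) c - q (b+:T) a) + (q (c+:T) a - q (c+:T) b) \<doteq> 0"
  and "!!R a b x e. [|distinct [a, b, x, e]; a ~: R; b ~: R; x ~: R; e ~: R; (a+:x+:R) : \<B>; (b+:x+:R) : \<B>;
   (a+:e+:R) : \<B>; (b+:e+:R) : \<B>; (a+:b+:R) ~: \<B>|]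
   ==> (q (x+:R) a - q (x+:R) b) + (q (e+:R) b - q (e+:R) a)
    - (q (a+:R) x - q (a+:R) e) + (q (b+:R) x - q (b+:R) e) \<doteq> 0"
 shows "EX f. potential \<B> q f"
 using assms
proof (induction "card (active \<B>)" arbitrary: \<B> rule: less_induct)
 case less
 interpret basis_family \<B> by (rule less.prems)
 note tri = less.prems(2) and sq = less.prems(3)
 show ?case
 proof (cases "active \<B> = {}")
  case True
  have "a = b" if "a ~: S" "b ~: S" "(a+:S) : \<B>" "(b+:S) : \<B>" for S a b
   using activeI[of a "(a+:S)" \<B> "(b+:S)"] that True by auto
  hence "potential \<B> q (\<lambda>_. 0)" unfolding potential_def by (metis cg_refl diff_self)
  thus ?thesis by blast
 next
  case False
  then obtain e where e: "e : active \<B>" by blast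
  have "EX f. potential (slice \<B> e v) q f" for v
  proof (rule less.hyps[OF card_active_slice[OF less.prems(1) e] slice_basis_family[OF less.prems(1)]])
   fix T a b c assume "distinct [a, b, c]" "a ~: T" "b ~: T" "c ~: T" "(a+:b+:T) : slice \<B> e v"
    "(a+:c+:T) : slice \<B> e v" "(b+:c+:T) : slice \<B> e v"
   thus "q (a+:T) b - q (a+:T) c + (q (b+:T) c - q (b+:T) a) + (q (c+:T) a - q (c+:T) b) \<doteq> 0"
    by (intro tri) (simp_all add: slice_def)
  next
   fix R a b x e' assume *: "distinct [a, b, x, e']" "a ~: R" "b ~: R" "x ~: R" "e' ~: R" "(a+:x+:R) : slice \<B> e v"
    "(b+:x+:R) : slice \<B> e v" "(a+:e'+:R) : slice \<B> e v" "(b+:e'+:R) : slice \<B> e v"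
    "(a+:b+:R) ~: slice \<B> e v"
   hence s: "(a+:x+:R) : \<B>" "(b+:x+:R) : \<B>" "(a+:e'+:R) : \<B>" "(b+:e'+:R) : \<B>"
    "(e : (a+:x+:R)) = v" "(e : (b+:x+:R)) = v" "(e : (a+:e'+:R)) = v" "(e : (b+:e'+:R)) = v"
    by (simp_all add: slice_def)
   have "(e : (a+:b+:R)) = v" using s(5-8) *(1-5) by auto
   hence "(a+:b+:R) ~: \<B>" using *(10) by (simp add: slice_def)
   with *(1-5) s(1-4) show "(q (x+:R) a - q (x+:R) b) + (q (e'+:R) b - q (e'+:R) a)
    - (q (a+:R) x - q (a+:R) e') + (q (b+:R) x - q (b+:R) e') \<doteq> 0"
    by (intro sq) simp_all
  qed
  then obtain f1 f0 where f1: "potential (slice \<B> e False) q f1" and f0: "potential (slice \<B> e True) q f0" by metis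
  \<comment> \<open>The amount by which \<open>f0\<close> has to be shifted to match
    \<open>f1\<close> at the adjacent bases \<open>S + x\<close> and \<open>S + e\<close>.\<close>
  define \<delta> where "\<delta> S x = f1 (x+:S) - f0 (e+:S) + q S e - q S x" for S x
  define valid where "valid S x \<longleftrightarrow> e ~: S & x ~= e & x ~: S & (x+:S) : \<B> & (e+:S) : \<B>" for S x
  have edge1: "f1 (b+:S) - f1 (a+:S) \<doteq> q S b - q S a"
   if "a ~: S" "b ~: S" "(a+:S) : \<B>" "(b+:S) : \<B>" "e ~: (a+:S)" "e ~: (b+:S)" for S a b
   by (rule potentialD[OF f1]) (use that in \<open>simp_all add: slice_def\<close>)
  have edge0: "f0 (b+:S) - f0 (a+:S) \<doteq> q S b - q S a"
   if "a ~: S" "b ~: S" "(a+:S) : \<B>" "(b+:S) : \<B>" "e : S" for S a b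
   by (rule potentialD[OF f0]) (use that in \<open>simp_all add: slice_def\<close>)
  have same: "\<delta> S x \<doteq> \<delta> S y" if "valid S x" "valid S y" for S x y
   unfolding \<delta>_def by (rule cg_lin1[OF edge1[of y S x]]) (use that in \<open>auto simp: valid_def\<close>)
  obtain B1 B0 where B: "B1 : \<B>" "e : B1" "B0 : \<B>" "e ~: B0" using e by (auto simp: active_def)
  define S0 where "S0 = B1 - {e}"
  have S0: "(e+:S0) = B1" "e ~: S0" using B by (auto simp: S0_def)
  obtain x0 where "x0 : B0" "x0 ~: B1" "(x0+:(B1 - {e})) : \<B>" using exchange1[OF B(1,3,2,4)] by blast
  hence v0: "valid S0 x0" using B S0 by (auto simp: valid_def S0_def)
  \<comment> \<open>The set \<open>S\<close> is moved towards \<open>S0\<close> by exchanges of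
    \<open>a\<close> for \<open>b\<close>. If \<open>R + a + b\<close> is a basis, a triangle
    compares the two offsets; otherwise a square does.\<close>
  have all: "\<delta> S x \<doteq> \<delta> S0 x0" if "valid S x" for S x
   using that
  proof (induction "card (S - S0)" arbitrary: S x rule: less_induct)
   case (less S x)
   have v: "e ~: S" "x ~= e" "x ~: S" "(x+:S) : \<B>" "(e+:S) : \<B>" using less.prems by (auto simp: valid_def)
   have fin: "finite S" using finite_basis[OF v(5)] by simp
   show ?case
   proof (cases "S <= S0")
    case True
    have "card (e+:S) = card (e+:S0)" using card_basis[OF v(5), of B1] B S0 by simp
    hence "(e+:S) = (e+:S0)" using card_subset_eq[of "(e+:S0)" "(e+:S)"] finite_basis[OF B(1)] S0(1) True by auto
    hence "(e+:S) - {e} = (e+:S0) - {e}" by simp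
    hence "S = S0" using v(1) S0(2) by simp
    thus ?thesis using same less.prems v0 by simp
   next
    case False
    then obtain a where a: "a : S" "a ~: S0" by blast
    have "a : (e+:S)" "a ~: (e+:S0)" using a v by auto
    from exchange1[OF v(5) _ this] obtain b where b: "b : (e+:S0)" "b ~: (e+:S)" "(b+:((e+:S) - {a})) : \<B>"
    using B S0 by auto
    define R where "R = S - {a}"
    have R: "S = (a+:R)" "a ~: R" "e ~: R" "x ~: R" "b ~: R" "a ~= b" "a ~= e" "b ~= e" "a ~= x"
    using a b v by (auto simp: R_def)
    have "(b+:((e+:S) - {a})) = (b+:e+:R)" using R by auto
    hence bs: "(a+:e+:R) : \<B>" "(b+:e+:R) : \<B>" "(a+:x+:R) : \<B>"
    using b v R(1) by (simp_all add: insert_commute[of e a] insert_commute[of x a])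
    have bs': "(e+:a+:R) : \<B>" "(e+:b+:R) : \<B>" "(x+:a+:R) : \<B>"
    using bs by (simp_all add: insert_commute[of e a] insert_commute[of x a] insert_commute[of e b])
    have less: "card ((b+:R) - S0) < card (S - S0)"
    proof (rule psubset_card_mono)
    show "(b+:R) - S0 \<subset> S - S0" using a b R by auto
    qed (use fin in simp)
    show ?thesis
    proof (cases "(a+:b+:R) : \<B>")
    case True
    hence ab: "(b+:a+:R) : \<B>" by (simp add: insert_commute)
    have v1: "valid S b" "valid (b+:R) a" using R bs' True ab by (auto simp: valid_def)
    have t: "q (a+:R) b - q (a+:R) e + (q (b+:R) e - q (b+:R) a) + (q (e+:R) a - q (e+:R) b) \<doteq> 0"
    by (rule tri) (use R bs True in auto)
    have "\<delta> S b \<doteq> \<delta> (b+:R) a"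
    unfolding \<delta>_def R(1) insert_commute[of b a] insert_commute[of e a] insert_commute[of e b]
    by (rule cg_lin2[OF edge0[of a "(e+:R)" b] cg_sym[OF t]]) (use R bs in auto)
    thus ?thesis using same[OF less.prems v1(1)] less.hyps[OF less v1(2)] cg_trans by blast
    next
    case ab: False
    hence xb: "x ~= b" using bs by auto
    have "b : (b+:e+:R)" "b ~: (a+:x+:R)" using R xb by auto
    from exchange2[OF bs(3,2) this] obtain z where z: "z : (a+:x+:R)" "z ~: (b+:e+:R)"
    "(b+:((a+:x+:R) - {z})) : \<B>" by blast
    have "z ~= x"
    proof
    assume "z = x"
    hence "(b+:((a+:x+:R) - {z})) = (a+:b+:R)" using R by auto
    thus False using z ab by simp
    qed
    hence "z = a" using z by auto
    hence "(b+:((a+:x+:R) - {z})) = (b+:x+:R)" using R by auto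
    hence bx: "(b+:x+:R) : \<B>" using z by simp
    hence v1: "valid (b+:R) x" using R bs' v xb by (auto simp: valid_def insert_commute)
    have t: "(q (x+:R) a - q (x+:R) b) + (q (e+:R) b - q (e+:R) a)
    - (q (a+:R) x - q (a+:R) e) + (q (b+:R) x - q (b+:R) e) \<doteq> 0"
    by (rule sq) (use R bs bx ab xb v in auto)
    have e1: "f1 (a+:x+:R) - f1 (b+:x+:R) \<doteq> q (x+:R) a - q (x+:R) b"
    by (rule edge1) (use R bs bx v xb in auto)
    have e0: "f0 (b+:e+:R) - f0 (a+:e+:R) \<doteq> q (e+:R) b - q (e+:R) a"
    by (rule edge0) (use R bs in auto)
    have "\<delta> S x \<doteq> \<delta> (b+:R) x"
    unfolding \<delta>_def R(1) insert_commute[of x a] insert_commute[of x b] insert_commute[of e a] insert_commute[of e b]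
    by (rule cg_lin3[OF e1 e0 t]) simp
    thus ?thesis using less.hyps[OF less v1] cg_trans by blast
    qed
   qed
  qed
  define f where "f B = (if e : B then f0 B + \<delta> S0 x0 else f1 B)" for B
  have mixed: "f (e+:S) - f (a+:S) \<doteq> q S e - q S a"
   if "a ~: S" "e ~: S" "(a+:S) : \<B>" "(e+:S) : \<B>" "a ~= e" for S a
  proof -
   have "valid S a" using that by (auto simp: valid_def)
   from all[OF this] show ?thesis
    using that by (intro cg_lin1[OF cg_sym[OF all[OF \<open>valid S a\<close>]]]) (simp add: f_def \<delta>_def)
  qed
  have "f (b+:S) - f (a+:S) \<doteq> q S b - q S a"
   if ab: "a ~: S" "b ~: S" "(a+:S) : \<B>" "(b+:S) : \<B>" for S a b
  proof -
   consider "a = b" | "e : S" | "e ~: (a+:b+:S)" | "e ~: S" "a ~= b" "e = b" | "e ~: S" "a ~= b" "e = a" by blast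
   thus ?thesis
   proof cases
    case 2
    thus ?thesis using edge0[OF ab] by (simp add: f_def)
   next
    case 3
    thus ?thesis using edge1[OF ab] by (simp add: f_def)
   next
    case 4
    thus ?thesis using mixed[of a S] ab by simp
   next
    case 5
    have "f (a+:S) - f (b+:S) \<doteq> q S a - q S b" using mixed[of b S] ab 5 by auto
    from cg_minus[OF this] show ?thesis by simp
   qed simp
  qed
  thus ?thesis unfolding potential_def by blast
 qed
qed

end

lemma (in matroid) line_pencil:
 assumes T: "line T" and abc: "a : ground M - cl M T" "b : ground M - cl M T" "c : ground M - cl M T"
  and bases: "basis M (a+:b+:T)" "basis M (a+:c+:T)" "basis M (b+:c+:T)"
 shows "pencil M (cl M T) (cl M (a+:T)) (cl M (b+:T)) (cl M (c+:T))"
proof -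
 have sub: "cl M T <= cl M (x+:T)" for x by (rule cl_mono) blast
 have "cl M (x+:T) ~= cl M (y+:T)"
  if "basis M (x+:y+:T)" "x : ground M - cl M T" "y : ground M - cl M T" for x y
  using line_basis[OF T, of x y] cl_ext[of y "(y+:T)"] that by auto
 from this[OF bases(1)] this[OF bases(2)] this[OF bases(3)] show ?thesis
  unfolding pencil_def corank2_iff using T line_insert(4)[OF T] abc sub by auto
qed

context matroid_over
begin

text \<open>Stated for general labels \<open>Z\<close> because it is used twice: with the logarithm
  of one representation and genuine signs in \<open>rep_solution\<close>, and with the difference of
  two logarithms, \<open>\<kappa> = 0\<close> and no signs, in \<open>rescaling_iff\<close>. The sum
  over \<open>S\<close> is the sign for inserting \<open>e\<close> into an ordered basis.\<close>

lemma label_potential: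
 fixes Z :: "'a set => 'a => 'u \<Rightarrow>\<^sub>0 int"
 assumes par: "!!F H1 H2 H3 x x'. pencil M F H1 H2 H3 ==> x : H1 - F ==> x' : H1 - F ==> Z H2 x + Z H3 x' \<doteq> Z H2 x' + Z H3 x"
  and tri: "!!F H1 H2 H3 a b c. pencil M F H1 H2 H3 ==> a : H1 - F ==> b : H2 - F ==> c : H3 - F ==>
   Z H2 a + Z H3 b + Z H1 c \<doteq> \<kappa> + Z H3 a + Z H1 b + Z H2 c"
  and sign: "!!x z. x : ground M ==> z : ground M ==> x ~= z ==> s x z - s z x \<doteq> \<kappa>" and \<kappa>: "\<kappa> + \<kappa> \<doteq> 0"
 shows "EX f. potential (Collect (basis M)) (\<lambda>S e. Z (cl M S) e + (\<Sum>z\<in>S. s z e)) f"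
proof (rule potential_exists[OF bases_family])
 fix T a b c assume d: "distinct [a, b, c]" "a ~: T" "b ~: T" "c ~: T" and "(a+:b+:T) : Collect (basis M)"
  "(a+:c+:T) : Collect (basis M)" "(b+:c+:T) : Collect (basis M)"
 hence bs: "basis M (a+:b+:T)" "basis M (a+:c+:T)" "basis M (b+:c+:T)" by auto
 have T: "indep M T" using bs(1) indep_subset[of "(a+:b+:T)" T] by (auto simp: basis_iff)
 have fin: "finite T" using indep_finite[OF T] .
 have l: "line T" using bs(1) T d fin by (simp add: line_def basis_iff)
 have i: "indep M (a+:T)" "indep M (b+:T)" "indep M (c+:T)"
  using bs(1,3) indep_subset[of "(a+:b+:T)" "(a+:T)"] indep_subset[of "(a+:b+:T)" "(b+:T)"]
   indep_subset[of "(b+:c+:T)" "(c+:T)"] by (auto simp: basis_iff)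
 hence g: "a : ground M - cl M T" "b : ground M - cl M T" "c : ground M - cl M T"
  using cl_indep[OF T] d indep_subset_ground by blast+
 have p: "pencil M (cl M T) (cl M (a+:T)) (cl M (b+:T)) (cl M (c+:T))" by (rule line_pencil[OF l g bs])
 have m: "x : cl M (x+:T) - cl M T" if "x : ground M - cl M T" for x using that cl_ext[of x "(x+:T)"] by blast
 have gd: "a : ground M" "b : ground M" "c : ground M" "a ~= b" "b ~= c" "c ~= a" using g d by auto
 show "Z (cl M (a+:T)) b + (\<Sum>z\<in>(a+:T). s z b) - (Z (cl M (a+:T)) c + (\<Sum>z\<in>(a+:T). s z c)) +
  (Z (cl M (b+:T)) c + (\<Sum>z\<in>(b+:T). s z c) - (Z (cl M (b+:T)) a + (\<Sum>z\<in>(b+:T). s z a))) +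
  (Z (cl M (c+:T)) a + (\<Sum>z\<in>(c+:T). s z a) - (Z (cl M (c+:T)) b + (\<Sum>z\<in>(c+:T). s z b))) \<doteq> 0"
  by (rule cg_lin5[OF cg_sym[OF tri[OF p m[OF g(1)] m[OF g(2)] m[OF g(3)]]] sign[OF gd(1,2,4)] sign[OF gd(2,3,5)] sign[OF gd(3,1,6)] \<kappa>])
   (simp add: fin d algebra_simps)
next
 fix R a b x e
 assume d: "distinct [a, b, x, e]" "a ~: R" "b ~: R" "x ~: R" "e ~: R" and bs: "(a+:x+:R) : Collect (basis M)"
  "(b+:x+:R) : Collect (basis M)" "(a+:e+:R) : Collect (basis M)" "(b+:e+:R) : Collect (basis M)"
  and nb: "(a+:b+:R) ~: Collect (basis M)"
 have sq: "square (Collect (basis M)) R a b x e" using d bs by (auto simp: square_def)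
 note l = square_line[OF matroid_axioms sq]
 have fin: "finite R" using l(1) indep_finite by (auto simp: line_def)
 have H: "cl M (a+:R) = cl M (b+:R)"
  using line_basis[OF l(1), of a b] line_cl_eq[OF l(1), of a b] l(2)[of a] l(2)[of b] nb by simp
 have gd: "a : ground M" "b : ground M" "x : ground M" "e : ground M" "x ~= a" "x ~= b" "e ~= a" "e ~= b" using l(2) d by auto
 have par': "Z (cl M (x+:R)) a + Z (cl M (e+:R)) b \<doteq> Z (cl M (x+:R)) b + Z (cl M (e+:R)) a"
 proof (cases "cl M (x+:R) = cl M (e+:R)")
  case True
  thus ?thesis by (simp add: add.commute)
 next
  case False
  hence "basis M (x+:e+:R)"
   using line_basis[OF l(1), of x e] line_cl_eq[OF l(1), of x e] l(2)[of x] l(2)[of e] by simp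
  hence p: "pencil M (cl M R) (cl M (a+:R)) (cl M (x+:R)) (cl M (e+:R))"
   using line_pencil[OF l(1), of a x e] l(2) bs by auto
  have "a : cl M (a+:R) - cl M R" "b : cl M (a+:R) - cl M R"
   using cl_ext[of a "(a+:R)"] cl_ext[of b "(b+:R)"] l(2) H by auto
  from par[OF p this] show ?thesis .
 qed
 show "Z (cl M (x+:R)) a + (\<Sum>z\<in>(x+:R). s z a) - (Z (cl M (x+:R)) b + (\<Sum>z\<in>(x+:R). s z b)) +
  (Z (cl M (e+:R)) b + (\<Sum>z\<in>(e+:R). s z b) - (Z (cl M (e+:R)) a + (\<Sum>z\<in>(e+:R). s z a))) -
  (Z (cl M (a+:R)) x + (\<Sum>z\<in>(a+:R). s z x) - (Z (cl M (a+:R)) e + (\<Sum>z\<in>(a+:R). s z e))) +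
  (Z (cl M (b+:R)) x + (\<Sum>z\<in>(b+:R). s z x) - (Z (cl M (b+:R)) e + (\<Sum>z\<in>(b+:R). s z e))) \<doteq> 0"
  by (rule cg_lin5[OF par' sign[OF gd(3,1,5)] cg_sym[OF sign[OF gd(3,2,6)]] sign[OF gd(4,2,8)] cg_sym[OF sign[OF gd(4,1,7)]]])
   (simp add: fin d H algebra_simps)
qed

end

section \<open>Cross ratios and rescaling classes\<close>

definition quad :: "'a matroid => 'a set => 'a set => 'a set => 'a set => bool" where
 "quad M H1 H2 H3 H4 \<longleftrightarrow> (EX F. pencil M F H1 H2 H3 & pencil M F H1 H2 H4 & H3 ~= H4)"

text \<open>The quotient of \<open>\<phi> H1 x\<close> times \<open>\<phi> H2 y\<close> by
  \<open>\<phi> H1 y\<close> times \<open>\<phi> H2 x\<close>. By \<open>cr_eq\<close> the points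
  chosen in \<open>H3\<close> and \<open>H4\<close> do not matter. Going through \<open>ev\<close>
  supplies inverses and makes the value a unit in every case.\<close>

definition cr :: "'u pasture => ('a, 'u) rep => 'a set => 'a set => 'a set => 'a set => 'u" where
 "cr P \<phi> H1 H2 H3 H4 = (let x = (SOME x. x : H3 - H1); y = (SOME y. y : H4 - H1) in
  ev P (frag_of (\<phi> H1 x) + frag_of (\<phi> H2 y) - frag_of (\<phi> H1 y) - frag_of (\<phi> H2 x)))"

definition same_cross :: "'a matroid => 'u pasture => ('a, 'u) rep => ('a, 'u) rep => bool" where
 "same_cross M P \<phi> \<phi>' \<longleftrightarrow> (ALL H1 H2 H3 H4. quad M H1 H2 H3 H4 --> cr P \<phi> H1 H2 H3 H4 = cr P \<phi>' H1 H2 H3 H4)"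

definition cross_class :: "'a matroid => 'u pasture => ('a, 'u) rep => ('a, 'u) rep set" where
 "cross_class M P \<phi> = {\<phi>' : reps M P. same_cross M P \<phi> \<phi>'}"

text \<open>A degenerate square has cross ratio 1. The other squares give a \<open>quad\<close>, and
  only there is \<open>\<chi>\<close> meaningful.\<close>

definition cross_label :: "'a matroid => ('a set => 'a set => 'a set => 'a set => 'u) => ('a, 'u \<Rightarrow>\<^sub>0 int) label" where
 "cross_label M \<chi> S a b c d =
  (if cl M (a+:S) = cl M (b+:S) \<or> cl M (c+:S) = cl M (d+:S) then 0
   else frag_of (\<chi> (cl M (a+:S)) (cl M (b+:S)) (cl M (c+:S)) (cl M (d+:S))))"

lemma (in matroid) square_quad:
 assumes "square (Collect (basis M)) S a b c d" "cl M (a+:S) ~= cl M (b+:S)" "cl M (c+:S) ~= cl M (d+:S)"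
 shows "quad M (cl M (a+:S)) (cl M (b+:S)) (cl M (c+:S)) (cl M (d+:S))"
proof -
 note l = square_line[OF matroid_axioms assms(1)]
 have p: "basis M (x+:y+:S)" if "cl M (x+:S) ~= cl M (y+:S)" "x : {a, b, c, d}" "y : {a, b, c, d}" for x y
  using line_basis[OF l(1), of x y] line_cl_eq[OF l(1), of x y] l(2)[OF that(2)] l(2)[OF that(3)] that(1) by simp
 have g: "x : ground M - cl M S" if "x : {a, b, c, d}" for x using l(2) that by blast
 have b: "basis M (a+:c+:S)" "basis M (a+:d+:S)" "basis M (b+:c+:S)" "basis M (b+:d+:S)"
  using assms(1) by (auto simp: square_def)
 have ab: "basis M (a+:b+:S)" using p assms(2) by simp
 show ?thesis unfolding quad_def
  using line_pencil[OF l(1) g g g ab b(1,3)] line_pencil[OF l(1) g g g ab b(2,4)] assms(3) by auto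
qed

lemma (in matroid) pencil_third:
 assumes "pencil M F H1 H2 H3" shows "H3 - H1 = H3 - F" "H3 - H2 = H3 - F" "EX x. x : H3 - H1"
proof -
 note m = pencil_meet[OF assms]
 have s: "F <= H1" "F <= H2" "F <= H3" using assms by (auto simp: pencil_def)
 show *: "H3 - H1 = H3 - F" "H3 - H2 = H3 - F" using m s by blast+
 show "EX x. x : H3 - H1" unfolding * using m(6) s by blast
qed

lemma (in matroid) pencil_out:
 assumes "pencil M F H1 H2 H3" "x : H3 - F"
 shows "H1 : hyperplanes M & H2 : hyperplanes M & x : ground M & x ~: H1 & x ~: H2"
 using pencil_third(1,2)[OF assms(1)] pencil_meet(9)[OF assms(1)] assms unfolding pencil_def by blast

context matroid_over
begin

lemma supported_in: "supported \<phi> ==> pencil M F H1 H2 H3 ==> x : H3 - F ==>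
  x : ground M & \<phi> H1 x : nonzeros P & \<phi> H2 x : nonzeros P"
 using pencil_out[of F H1 H2 H3 x] supported_nonzero by blast

lemma cr_eq:
 assumes \<phi>: "\<phi> : reps M P" and p: "pencil M F H1 H2 H3" "pencil M F H1 H2 H4" and x: "x : H3 - F" and y: "y : H4 - F"
 shows "lg (cr P \<phi> H1 H2 H3 H4) \<doteq> Y \<phi> H1 x - Y \<phi> H1 y + Y \<phi> H2 y - Y \<phi> H2 x"
proof -
 define x' where "x' = (SOME x. x : H3 - H1)"
 define y' where "y' = (SOME y. y : H4 - H1)"
 have x': "x' : H3 - F" using someI_ex[OF pencil_third(3)[OF p(1)]] pencil_third(1)[OF p(1)] unfolding x'_def by simp
 have y': "y' : H4 - F" using someI_ex[OF pencil_third(3)[OF p(2)]] pencil_third(1)[OF p(2)] unfolding y'_def by simp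
 have q: "pencil M F H3 H1 H2" "pencil M F H4 H1 H2" using p by (auto simp: pencil_def)
 have "lg (cr P \<phi> H1 H2 H3 H4) \<doteq> Y \<phi> H1 x' + Y \<phi> H2 y' - Y \<phi> H1 y' - Y \<phi> H2 x'"
  unfolding cr_def Let_def x'_def[symmetric] y'_def[symmetric] by (rule lg_ev)
 from this rep_par[OF \<phi> q(1) x' x] rep_par[OF \<phi> q(2) y y'] show ?thesis
  by (rule cg_lin3) simp
qed

lemma cr_nonzero: "cr P \<phi> H1 H2 H3 H4 : nonzeros P"
 by (simp add: cr_def Let_def ev_nonzero)

lemma rep_cross_label:
 assumes \<phi>: "\<phi> : reps M P" and sq: "square (Collect (basis M)) S a b c d"
 shows "cross_label M (cr P \<phi>) S a b c d \<doteq> Y \<phi> (cl M (a+:S)) c - Y \<phi> (cl M (a+:S)) d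
  + Y \<phi> (cl M (b+:S)) d - Y \<phi> (cl M (b+:S)) c"
proof -
 note l = square_line[OF matroid_axioms sq]
 have b: "basis M (a+:c+:S)" "basis M (a+:d+:S)" "basis M (b+:c+:S)" "basis M (b+:d+:S)"
  using sq by (auto simp: square_def)
 have g: "x : ground M - cl M S" if "x : {a, b, c, d}" for x using l(2) that by blast
 have m: "x : cl M (x+:S) - cl M S" if "x : {a, b, c, d}" for x using g[OF that] cl_ext[of x "(x+:S)"] by blast
 have ab: "basis M (a+:b+:S)" if "cl M (a+:S) ~= cl M (b+:S)"
  using line_basis[OF l(1), of a b] line_cl_eq[OF l(1), of a b] l(2)[of a] l(2)[of b] that by simp
 consider "cl M (a+:S) = cl M (b+:S)" | "cl M (a+:S) ~= cl M (b+:S)" "cl M (c+:S) = cl M (d+:S)"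
  | "cl M (a+:S) ~= cl M (b+:S)" "cl M (c+:S) ~= cl M (d+:S)" by blast
 thus ?thesis
 proof cases
  case 1
  thus ?thesis by (simp add: cross_label_def)
 next
  case 2
  have "pencil M (cl M S) (cl M (c+:S)) (cl M (a+:S)) (cl M (b+:S))"
   using line_pencil[OF l(1) g g g ab[OF 2(1)] b(1,3)] by (auto simp: pencil_def)
  moreover have "c : cl M (c+:S) - cl M S" "d : cl M (c+:S) - cl M S" using m[of c] m[of d] 2(2) by auto
  ultimately have par: "Y \<phi> (cl M (a+:S)) c + Y \<phi> (cl M (b+:S)) d \<doteq> Y \<phi> (cl M (a+:S)) d + Y \<phi> (cl M (b+:S)) c"
   by (rule rep_par[OF \<phi>])
  show ?thesis using 2 by (simp add: cross_label_def) (rule cg_lin1[OF cg_sym[OF par]], simp)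
 next
  case 3
  have p: "pencil M (cl M S) (cl M (a+:S)) (cl M (b+:S)) (cl M (c+:S))"
   "pencil M (cl M S) (cl M (a+:S)) (cl M (b+:S)) (cl M (d+:S))"
   using line_pencil[OF l(1) g g g ab[OF 3(1)] b(1,3)] line_pencil[OF l(1) g g g ab[OF 3(1)] b(2,4)] by auto
  show ?thesis using 3 cr_eq[OF \<phi> p m[of c] m[of d]] by (simp add: cross_label_def)
 qed
qed

lemma potential_square:
 assumes f: "potential (Collect (basis M)) (\<lambda>S e. Z (cl M S) e + (\<Sum>z\<in>S. s z e)) f" and sq: "square (Collect (basis M)) S a b c d"
 shows "f (a+:c+:S) + f (b+:d+:S) \<doteq>
  (Z (cl M (a+:S)) c - Z (cl M (a+:S)) d + Z (cl M (b+:S)) d - Z (cl M (b+:S)) c)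
  + (s a c + s b d - s a d - s b c) + (f (a+:d+:S) + f (b+:c+:S))"
proof -
 note s' = sq[unfolded square_def]
 have fin: "finite S" using square_line(1)[OF matroid_axioms sq] indep_finite by (auto simp: line_def)
 have 1: "f (c+:a+:S) - f (d+:a+:S) \<doteq>
  Z (cl M (a+:S)) c + (\<Sum>z\<in>(a+:S). s z c) - (Z (cl M (a+:S)) d + (\<Sum>z\<in>(a+:S). s z d))"
  by (rule potentialD[OF f]) (use s' in \<open>auto simp: insert_commute[of c a] insert_commute[of d a]\<close>)
 have 2: "f (d+:b+:S) - f (c+:b+:S) \<doteq>
  Z (cl M (b+:S)) d + (\<Sum>z\<in>(b+:S). s z d) - (Z (cl M (b+:S)) c + (\<Sum>z\<in>(b+:S). s z c))"
  by (rule potentialD[OF f]) (use s' in \<open>auto simp: insert_commute[of c b] insert_commute[of d b]\<close>)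
 show ?thesis
  by (rule cg_lin2[OF 1 2]) (use s' fin in \<open>simp add: insert_commute[of c a] insert_commute[of d a] insert_commute[of c b] insert_commute[of d b]\<close>)
qed

text \<open>The easy direction: a given representation solves the equations for its own cross
  ratios. Applied to the special sublattices, it supplies the hypothesis \<open>special\<close> of
  \<open>cross_labels\<close>.\<close>

lemma rep_solution:
 assumes \<phi>: "\<phi> : reps M P" and sign: "!!x z. x : ground M ==> z : ground M ==> x ~= z ==> s x z - s z x \<doteq> \<epsilon>"
 shows "EX f. solves (\<lambda>S a b c d. cross_label M (cr P \<phi>) S a b c d + (s a c + s b d - s a d - s b c)) (Collect (basis M)) f"
proof -
 have "EX f. potential (Collect (basis M)) (\<lambda>S e. Y \<phi> (cl M S) e + (\<Sum>z\<in>S. s z e)) f"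
  by (rule label_potential[where Z = "Y \<phi>" and s = s and \<kappa> = \<epsilon>]) (fact rep_par[OF \<phi>] rep_tri[OF \<phi>] sign eps_double)+
 then obtain f where f: "potential (Collect (basis M)) (\<lambda>S e. Y \<phi> (cl M S) e + (\<Sum>z\<in>S. s z e)) f" by blast
 have "f (a+:c+:S) + f (b+:d+:S) \<doteq> cross_label M (cr P \<phi>) S a b c d + (s a c + s b d - s a d - s b c)
  + (f (a+:d+:S) + f (b+:c+:S))" if sq: "square (Collect (basis M)) S a b c d" for S a b c d
  by (rule cg_lin2[OF potential_square[OF f sq] cg_sym[OF rep_cross_label[OF \<phi> sq]]]) simp
 thus ?thesis unfolding solves_def by blast
qed

lemma hyperplane_proper: "H : hyperplanes M ==> EX x. x : ground M - H"
 using hyperplane_flat[of H] by (metis DiffI flat_def n_not_Suc_n subsetI subset_antisym)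

text \<open>If the cross ratios agree, the potential of the logarithmic quotient \<open>Z\<close> is
  a homogeneous solution, hence given by weights \<open>\<tau>\<close>. Then \<open>Z H\<close> and
  \<open>\<tau>\<close> differ by a constant outside \<open>H\<close>; this constant is the factor
  of the hyperplane, and \<open>\<tau>\<close> gives the factors of the elements.\<close>

theorem rescaling_iff:
 assumes \<phi>: "\<phi> : reps M P" and \<phi>': "\<phi>' : reps M P"
 shows "(\<phi>, \<phi>') : rescaling M P \<longleftrightarrow> same_cross M P \<phi> \<phi>'"
proof
 assume "(\<phi>, \<phi>') : rescaling M P"
 then obtain a t where a: "!!H. H : hyperplanes M ==> a H : nonzeros P" and t: "!!e. e : ground M ==> t e : nonzeros P"
  and eq: "!!H e. H : hyperplanes M ==> e : ground M ==> \<phi>' H e = a H \<otimes> t e \<otimes> \<phi> H e"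
  unfolding rescaling_def by blast
 have Y: "Y \<phi>' H e \<doteq> lg (a H) + lg (t e) + Y \<phi> H e" if "H : hyperplanes M" "e : ground M" "e ~: H" for H e
  using a[OF that(1)] t[OF that(2)] supported_nonzero[OF reps_supported[OF \<phi>] that]
  by (simp add: eq[OF that(1,2)] cg_iff ev_add ev_lg nonzeros_mult)
 show "same_cross M P \<phi> \<phi>'" unfolding same_cross_def
 proof (intro allI impI)
  fix H1 H2 H3 H4 assume "quad M H1 H2 H3 H4"
  then obtain F where p: "pencil M F H1 H2 H3" "pencil M F H1 H2 H4" by (auto simp: quad_def)
  obtain x y where x: "x : H3 - F" and y: "y : H4 - F"
   using pencil_third[OF p(1)] pencil_third[OF p(2)] by auto
  have g: "H1 : hyperplanes M" "H2 : hyperplanes M" "x : ground M" "y : ground M" "x ~: H1" "x ~: H2" "y ~: H1" "y ~: H2"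
   using pencil_out[OF p(1) x] pencil_out[OF p(2) y] by blast+
  have d: "Y \<phi>' H1 x - Y \<phi>' H1 y + Y \<phi>' H2 y - Y \<phi>' H2 x \<doteq> Y \<phi> H1 x - Y \<phi> H1 y + Y \<phi> H2 y - Y \<phi> H2 x"
   by (rule cg_lin4[OF Y[OF g(1,3,5)] cg_sym[OF Y[OF g(1,4,7)]] Y[OF g(2,4,8)] cg_sym[OF Y[OF g(2,3,6)]]]) simp
  have "lg (cr P \<phi> H1 H2 H3 H4) \<doteq> lg (cr P \<phi>' H1 H2 H3 H4)"
   by (rule cg_lin3[OF cr_eq[OF \<phi> p x y] cg_sym[OF d] cg_sym[OF cr_eq[OF \<phi>' p x y]]]) simp
  thus "cr P \<phi> H1 H2 H3 H4 = cr P \<phi>' H1 H2 H3 H4" by (simp add: cg_iff ev_lg cr_nonzero)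
 qed
next
 assume same: "same_cross M P \<phi> \<phi>'"
 define Z where "Z H x = Y \<phi>' H x - Y \<phi> H x" for H x
 have "EX f. potential (Collect (basis M)) (\<lambda>S e. Z (cl M S) e + (\<Sum>z\<in>S. (\<lambda>_ _. 0) z e)) f"
 proof (rule label_potential[where \<kappa> = 0])
  fix F H1 H2 H3 x x' assume "pencil M F H1 H2 H3" "x : H1 - F" "x' : H1 - F"
  note * = rep_par[OF \<phi> this] rep_par[OF \<phi>' this]
  show "Z H2 x + Z H3 x' \<doteq> Z H2 x' + Z H3 x" unfolding Z_def by (rule cg_lin2[OF *(2) cg_sym[OF *(1)]]) simp
 next
  fix F H1 H2 H3 a b c assume "pencil M F H1 H2 H3" "a : H1 - F" "b : H2 - F" "c : H3 - F"
  note * = rep_tri[OF \<phi> this] rep_tri[OF \<phi>' this]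
  show "Z H2 a + Z H3 b + Z H1 c \<doteq> 0 + Z H3 a + Z H1 b + Z H2 c" unfolding Z_def by (rule cg_lin2[OF *(2) cg_sym[OF *(1)]]) simp
 qed simp_all
 then obtain f where f: "potential (Collect (basis M)) (\<lambda>S e. Z (cl M S) e + (\<Sum>z\<in>S. (\<lambda>_ _. 0) z e)) f" by blast
 have "solves (\<lambda>S a b c d. 0) (Collect (basis M)) f" unfolding solves_def
 proof (intro allI impI)
  fix S a b c d assume sq: "square (Collect (basis M)) S a b c d"
  have "cross_label M (cr P \<phi>) S a b c d = cross_label M (cr P \<phi>') S a b c d"
   using square_quad[OF sq] same unfolding cross_label_def same_cross_def by auto
  hence *: "cross_label M (cr P \<phi>') S a b c d \<doteq> cross_label M (cr P \<phi>) S a b c d" by simp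
  show "f (a+:c+:S) + f (b+:d+:S) \<doteq> 0 + (f (a+:d+:S) + f (b+:c+:S))"
   by (rule cg_lin4[OF potential_square[OF f sq] * rep_cross_label[OF \<phi> sq] cg_sym[OF rep_cross_label[OF \<phi>' sq]]]) (simp add: Z_def)
 qed
 from homogeneous_weights[OF bases_family this] obtain k \<tau> where \<tau>: "!!B. basis M B ==> f B \<doteq> k + sum \<tau> B" by auto
 define a where "a H = (let x = (SOME x. x : ground M - H) in ev P (Z H x - \<tau> x))" for H
 have main: "Z H e - Z H x \<doteq> \<tau> e - \<tau> x" if H: "H : hyperplanes M" and ex: "e : ground M - H" "x : ground M - H" for H e x
 proof -
  obtain S where S: "indep M S" "Suc (card S) = \<rho>" "H = cl M S" using H hyperplanes_iff by blast
  have b: "basis M (e+:S)" "basis M (x+:S)" using basis_insert[OF S(1,2)] ex S(3) by auto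
  have n: "e ~: S" "x ~: S" using ex S(3) cl_ext by blast+
  have fin: "finite S" using S indep_finite by blast
  have "f (e+:S) - f (x+:S) \<doteq> Z (cl M S) e + (\<Sum>z\<in>S. (\<lambda>_ _. 0) z e) - (Z (cl M S) x + (\<Sum>z\<in>S. (\<lambda>_ _. 0) z x))"
   by (rule potentialD[OF f]) (use n b in auto)
  from cg_sym[OF this] \<tau>[OF b(1)] cg_sym[OF \<tau>[OF b(2)]] show ?thesis
   by (rule cg_lin3) (simp add: S(3) fin n)
 qed
 have "\<phi>' H e = a H \<otimes> ev P (\<tau> e) \<otimes> \<phi> H e" if H: "H : hyperplanes M" and e: "e : ground M" for H e
 proof (cases "e : H")
  case True
  hence "\<phi> H e = pzero P" "\<phi>' H e = pzero P" using reps_supported[OF \<phi>] reps_supported[OF \<phi>'] H e by (auto simp: supported_def)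
  thus ?thesis by (simp add: a_def Let_def mult_zero ev_closed)
 next
  case False
  define x where "x = (SOME x. x : ground M - H)"
  have x: "x : ground M - H" unfolding x_def by (rule someI_ex[OF hyperplane_proper[OF H]])
  have n: "\<phi> H e : nonzeros P" "\<phi>' H e : nonzeros P" using supported_nonzero[OF reps_supported H e False] \<phi> \<phi>' by auto
  have "Y \<phi>' H e \<doteq> (Z H x - \<tau> x) + \<tau> e + Y \<phi> H e"
   by (rule cg_lin1[OF main[OF H _ x, of e]]) (use e False in \<open>simp_all add: Z_def\<close>)
  thus ?thesis using n by (simp add: cg_iff ev_add ev_lg a_def x_def Let_def)
 qed
 thus "(\<phi>, \<phi>') : rescaling M P" unfolding rescaling_def
  using \<phi> \<phi>' by (auto intro!: exI[of _ a] exI[of _ "\<lambda>e. ev P (\<tau> e)"] simp: a_def Let_def ev_nonzero)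
qed

lemma rescaling_class: "\<phi> : reps M P ==> rescaling M P `` {\<phi>} = cross_class M P \<phi>"
 using rescaling_iff unfolding cross_class_def by (auto simp: rescaling_def)

lemma same_cross_refl: "same_cross M P \<phi> \<phi>" and same_cross_sym: "same_cross M P \<phi> \<psi> ==> same_cross M P \<psi> \<phi>"
 and same_cross_trans: "same_cross M P \<phi> \<psi> ==> same_cross M P \<psi> \<chi> ==> same_cross M P \<phi> \<chi>"
 by (auto simp: same_cross_def)

lemma rep_classes_eq: "rep_classes M P = cross_class M P ` reps M P"
 using rescaling_class unfolding rep_classes_def quotient_def by blast

lemma cross_class_eq: "same_cross M P \<phi> \<phi>' ==> cross_class M P \<phi> = cross_class M P \<phi>'"
 unfolding cross_class_def using same_cross_sym same_cross_trans by blast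

lemma in_cross_class: "\<phi> : reps M P ==> \<phi> : cross_class M P \<phi>"
 by (simp add: cross_class_def same_cross_refl)

lemma rep_class_member: "X : rep_classes M P ==> \<phi> : X ==> \<phi> : reps M P & X = cross_class M P \<phi>"
 unfolding rep_classes_eq using cross_class_eq by (auto simp: cross_class_def[of M P])

lemma rep_class_obtain: "X : rep_classes M P ==> EX \<phi>. \<phi> : X"
 unfolding rep_classes_eq using in_cross_class by blast

lemma map_rep:
 assumes Q: "pasture Q" and k: "k : pasture_hom P Q" and \<phi>: "\<phi> : reps M P"
 shows "(\<lambda>H e. k (\<phi> H e)) : reps M Q"
  "quad M H1 H2 H3 H4 ==> cr Q (\<lambda>H e. k (\<phi> H e)) H1 H2 H3 H4 = k (cr P \<phi> H1 H2 H3 H4)"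
proof -
 interpret Q: pasture Q by fact
 interpret MQ: matroid_over M Q by unfold_locales
 have kc: "!!a. a : carrier P ==> k a : carrier Q" and km: "!!a b. a : carrier P ==> b : carrier P ==> k (a \<otimes> b) = k a \<otimes>\<^bsub>Q\<^esub> k b"
  and k0: "k (pzero P) = pzero Q" and k1: "k \<one> = \<one>\<^bsub>Q\<^esub>" and kn: "!!s. s : nullset P ==> image_mset k s : nullset Q"
  using k unfolding pasture_hom_def by auto
 have nz: "k p : nonzeros Q" if "p : nonzeros P" for p
 proof -
  have p: "p : carrier P" "p : Units P" using that nonzeros_Units by (auto simp: nonzeros_def)
  then obtain q where q: "q : carrier P" "p \<otimes> q = \<one>" using Units_r_inv_ex by blast
  hence "k p \<otimes>\<^bsub>Q\<^esub> k q = \<one>\<^bsub>Q\<^esub>" using km[OF p(1) q(1)] k1 by simp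
  thus ?thesis using Q.zero_absorbing Q.zero_neq_one kc p q by (metis DiffI nonzeros_def singletonD)
 qed
 have k0': "k p = pzero Q \<longleftrightarrow> p = pzero P" if "p : carrier P" for p using nz[of p] k0 that by (auto simp: nonzeros_def)
 note sup = reps_supported[OF \<phi>]
 show k\<phi>: "(\<lambda>H e. k (\<phi> H e)) : reps M Q"
  unfolding reps_def
 proof (intro CollectI conjI ballI impI)
  fix H e assume "H : hyperplanes M" "e : ground M"
  thus "k (\<phi> H e) : carrier Q" "k (\<phi> H e) = pzero Q \<longleftrightarrow> e : H" using sup kc k0' by (auto simp: supported_def)
 next
  fix H1 H2 H3 assume H: "H1 : hyperplanes M" "H2 : hyperplanes M" "H3 : hyperplanes M" "H1 ~= H2" "H1 ~= H3" "H2 ~= H3"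
   "flat_of_corank M 2 (H1 Int H2 Int H3)"
  hence "null_triple M P \<phi> H1 H2 H3" using \<phi> unfolding reps_def by auto
  then obtain a b c where abc: "a : carrier P" "b : carrier P" "c : carrier P" "(a, b, c) ~= (pzero P, pzero P, pzero P)"
   and null: "!!e. e : ground M ==> {#a \<otimes> \<phi> H1 e, b \<otimes> \<phi> H2 e, c \<otimes> \<phi> H3 e#} : nullset P" by auto
  have "{#k a \<otimes>\<^bsub>Q\<^esub> k (\<phi> H1 e), k b \<otimes>\<^bsub>Q\<^esub> k (\<phi> H2 e), k c \<otimes>\<^bsub>Q\<^esub> k (\<phi> H3 e)#} : nullset Q" if e: "e : ground M" for e
  proof -
   have "\<phi> H1 e : carrier P" "\<phi> H2 e : carrier P" "\<phi> H3 e : carrier P" using sup H e by (auto simp: supported_def)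
   thus ?thesis using kn[OF null[OF e]] abc by (simp add: km)
  qed
  moreover have "(k a, k b, k c) ~= (pzero Q, pzero Q, pzero Q)" using abc k0' by auto
  ultimately show "EX a:carrier Q. EX b:carrier Q. EX c:carrier Q. (a, b, c) ~= (pzero Q, pzero Q, pzero Q) &
   (ALL e:ground M. {#a \<otimes>\<^bsub>Q\<^esub> k (\<phi> H1 e), b \<otimes>\<^bsub>Q\<^esub> k (\<phi> H2 e), c \<otimes>\<^bsub>Q\<^esub> k (\<phi> H3 e)#} : nullset Q)" using abc kc by blast
 qed
 assume "quad M H1 H2 H3 H4"
 then obtain F where p: "pencil M F H1 H2 H3" "pencil M F H1 H2 H4" by (auto simp: quad_def)
 obtain x y where x: "x : H3 - F" and y: "y : H4 - F"
  using pencil_third[OF p(1)] pencil_third[OF p(2)] by auto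
 let ?c = "cr P \<phi> H1 H2 H3 H4"
 have n: "\<phi> H1 x : nonzeros P" "\<phi> H2 x : nonzeros P" "\<phi> H1 y : nonzeros P" "\<phi> H2 y : nonzeros P"
  using supported_in[OF sup p(1) x] supported_in[OF sup p(2) y] by auto
 hence nc: "\<phi> H1 x : carrier P" "\<phi> H2 x : carrier P" "\<phi> H1 y : carrier P" "\<phi> H2 y : carrier P" "?c : carrier P"
  using cr_nonzero[of \<phi> H1 H2 H3 H4] by (auto simp: nonzeros_def)
 have "lg ?c + Y \<phi> H1 y + Y \<phi> H2 x \<doteq> Y \<phi> H1 x + Y \<phi> H2 y"
  by (rule cg_lin1[OF cr_eq[OF \<phi> p x y]]) simp
 hence "?c \<otimes> \<phi> H1 y \<otimes> \<phi> H2 x = \<phi> H1 x \<otimes> \<phi> H2 y" using n cr_nonzero[of \<phi> H1 H2 H3 H4] by (simp add: cg_iff ev_add ev_lg)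
 hence "k (?c \<otimes> \<phi> H1 y \<otimes> \<phi> H2 x) = k (\<phi> H1 x \<otimes> \<phi> H2 y)" by simp
 hence "k ?c \<otimes>\<^bsub>Q\<^esub> k (\<phi> H1 y) \<otimes>\<^bsub>Q\<^esub> k (\<phi> H2 x) = k (\<phi> H1 x) \<otimes>\<^bsub>Q\<^esub> k (\<phi> H2 y)" using nc by (simp add: km)
 hence "Q.cg (frag_of (k ?c) + frag_of (k (\<phi> H1 y)) + frag_of (k (\<phi> H2 x))) (frag_of (k (\<phi> H1 x)) + frag_of (k (\<phi> H2 y)))"
  using nz n cr_nonzero[of \<phi> H1 H2 H3 H4] by (simp add: Q.cg_iff Q.ev_add Q.ev_lg)
 hence "Q.cg (frag_of (cr Q (\<lambda>H e. k (\<phi> H e)) H1 H2 H3 H4)) (frag_of (k ?c))"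
  by (rule Q.cg_lin2[OF MQ.cr_eq[OF k\<phi> p x y] Q.cg_sym]) simp
 thus "cr Q (\<lambda>H e. k (\<phi> H e)) H1 H2 H3 H4 = k ?c"
  using nz[OF cr_nonzero[of \<phi> H1 H2 H3 H4]] MQ.cr_nonzero[of "\<lambda>H e. k (\<phi> H e)" H1 H2 H3 H4] by (simp add: Q.cg_iff Q.ev_lg)
qed

lemma rep_classes_map_class:
 assumes Q: "pasture Q" and k: "k : pasture_hom P Q" and \<phi>: "\<phi> : reps M P"
 shows "rep_classes_map M Q k (cross_class M P \<phi>) = cross_class M Q (\<lambda>H e. k (\<phi> H e))"
proof -
 interpret Q: pasture Q by fact
 interpret MQ: matroid_over M Q by unfold_locales
 have "rescaling M Q `` {\<lambda>H e. k (\<phi>' H e)} = cross_class M Q (\<lambda>H e. k (\<phi> H e))" if "\<phi>' : cross_class M P \<phi>" for \<phi>'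
 proof -
  have \<phi>': "\<phi>' : reps M P" "same_cross M P \<phi> \<phi>'" using that by (auto simp: cross_class_def)
  have "same_cross M Q (\<lambda>H e. k (\<phi>' H e)) (\<lambda>H e. k (\<phi> H e))"
   using \<phi>'(2) map_rep(2)[OF Q k \<phi>] map_rep(2)[OF Q k \<phi>'(1)] unfolding same_cross_def by simp
  thus ?thesis using MQ.rescaling_class[OF map_rep(1)[OF Q k \<phi>'(1)]] MQ.cross_class_eq by simp
 qed
 moreover have "\<phi> : cross_class M P \<phi>" by (rule in_cross_class[OF \<phi>])
 ultimately show ?thesis unfolding rep_classes_map_def by blast
qed

end

section \<open>Restriction of representations to minors and their simplifications\<close>

locale matroid_embedding = N: matroid N for N :: "'a matroid" +
 fixes S :: "'b matroid" and I :: "'a set" and e :: "'b => 'a"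
 assumes indep_I: "indep N I" and inj: "inj_on e (ground S)" and image: "e ` ground S <= ground N - I"
  and indep_iff: "indep S X \<longleftrightarrow> X <= ground S & indep N (I Un e ` X)"
  and spanning: "cl N (I Un e ` ground S) = ground N"
begin

lemma card_union: "X <= ground S ==> card (I Un e ` X) = card I + card X"
proof -
 assume X: "X <= ground S"
 have f: "finite I" by (rule N.indep_finite[OF indep_I])
 have fX: "finite (e ` X)" using image X N.finite_ground by (meson finite_Diff finite_subset image_mono)
 have "card (I Un e ` X) = card I + card (e ` X)" by (rule card_Un_disjoint[OF f fX]) (use X image in blast)
 thus ?thesis using card_image[OF inj_on_subset[OF inj X]] by simp
qed

sublocale S: matroid S
proof
 show "finite (ground S)" using finite_imageD[OF _ inj] image N.finite_ground by (meson finite_Diff finite_subset)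
 show "X <= ground S" if "indep S X" for X using that indep_iff by blast
 show "indep S {}" using indep_iff[of "{}"] indep_I by simp
 show "indep S Y" if "indep S X" "Y <= X" for X Y
  using that indep_iff N.indep_subset[of "I Un e ` X" "I Un e ` Y"] by blast
 show "EX y:Y - X. indep S (y+:X)" if h: "indep S X" "indep S Y" "card X < card Y" for X Y
 proof -
  have X: "X <= ground S" "indep N (I Un e ` X)" and Y: "Y <= ground S" "indep N (I Un e ` Y)" using h indep_iff by auto
  obtain z where z: "z : (I Un e ` Y) - (I Un e ` X)" "indep N (z+:(I Un e ` X))"
   using N.indep_augment[OF X(2) Y(2)] card_union[OF X(1)] card_union[OF Y(1)] h(3) by auto
  then obtain y where y: "y : Y" "z = e y" by blast
  have "(z+:(I Un e ` X)) = I Un e ` (y+:X)" using y by auto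
  hence "indep S (y+:X)" using z(2) X Y y indep_iff by auto
  thus ?thesis using y z by blast
 qed
qed

lemma rk_eq: assumes X: "X <= ground S" shows "rk S X + card I = rk N (I Un e ` X)"
proof -
 obtain B where B: "B <= X" "indep S B" "card B = rk S X" using S.rk_attained by blast
 have BS: "B <= ground S" using B X by blast
 have "indep N (I Un e ` B)" using B indep_iff by blast
 from N.card_le_rk[OF this, of "I Un e ` X"] have le: "card I + card B <= rk N (I Un e ` X)"
  using card_union[OF BS] B(1) by auto
 obtain C where C: "I <= C" "C <= I Un e ` X" "indep N C" "card C = rk N (I Un e ` X)"
  by (rule N.extend_indep[OF indep_I, of "I Un e ` X"]) auto
 define B' where "B' = {x : X. e x : C}"
 have C_eq: "C = I Un e ` B'" using C(1,2) by (auto simp: B'_def)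
 hence "indep S B'" using C(3) X indep_iff[of B'] by (auto simp: B'_def)
 hence "card B' <= rk S X" by (rule S.card_le_rk) (auto simp: B'_def)
 moreover have "card C = card I + card B'" unfolding C_eq by (rule card_union) (use X in \<open>auto simp: B'_def\<close>)
 ultimately show ?thesis using le B(3) C(4) by linarith
qed

lemma rank_eq: "rk S (ground S) + card I = rk N (ground N)"
 using rk_eq[OF order_refl] N.rk_cl[of "I Un e ` ground S"] spanning by simp

lemma cl_eq: assumes X: "X <= ground S" shows "x : cl S X \<longleftrightarrow> x : ground S & e x : cl N (I Un e ` X)"
proof (cases "x : ground S")
 case True
 hence "(x+:X) <= ground S" "e x : ground N" using X image by auto
 thus ?thesis using rk_eq[OF X, symmetric] rk_eq[of "(x+:X)", symmetric] True by (simp add: cl_def)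
qed (simp add: cl_def)

text \<open>On flats, this embeds the lattice of \<open>S\<close> into that of \<open>N\<close>. It
  preserves corank because the image of \<open>S\<close> spans \<open>N\<close> over
  \<open>I\<close>.\<close>

definition j :: "'b set => 'a set" where
 "j H = cl N (I Un e ` H)"

lemma I_ground: "I <= ground N" by (rule N.indep_subset_ground[OF indep_I])

lemma j_corank: assumes "flat_of_corank S k H" shows "flat_of_corank N k (j H)"
proof -
 obtain B where B: "indep S B" "card B + k = rk S (ground S)" "H = cl S B" using assms S.corank_iff by blast
 have B': "B <= ground S" "indep N (I Un e ` B)" using B indep_iff by auto
 have "I Un e ` H <= cl N (I Un e ` B)"
  using cl_eq[OF B'(1)] B(3) N.cl_superset[of "I Un e ` B"] N.indep_subset_ground[OF B'(2)] by auto
 moreover have "e ` B <= e ` H" using S.cl_superset[OF B'(1)] B(3) by blast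
 ultimately have "j H = cl N (I Un e ` B)"
  unfolding j_def using N.cl_le N.cl_mono[of "I Un e ` B" "I Un e ` H"] by blast
 thus ?thesis using B'(2) card_union[OF B'(1)] B(2) rank_eq N.corank_iff by (metis add.assoc add.commute)
qed

lemma j_mem: "flat S H ==> x : ground S ==> e x : j H \<longleftrightarrow> x : H"
 using cl_eq[of H x] by (auto simp: flat_def j_def)

lemma j_hyperplane: "H : hyperplanes S ==> j H : hyperplanes N"
 using j_corank by (simp add: hyperplanes_def)

lemma j_inj: "flat S H ==> flat S H' ==> j H = j H' ==> H = H'"
 using j_mem unfolding flat_def by blast

lemma j_mono: "H <= H' ==> j H <= j H'"
 unfolding j_def by (rule N.cl_mono) blast

lemma j_pencil: assumes p: "pencil S F H1 H2 H3" shows "pencil N (j F) (j H1) (j H2) (j H3)"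
proof -
 note p' = p[unfolded pencil_def]
 have "flat S H1" "flat S H2" "flat S H3" using p' S.hyperplane_flat(1) by blast+
 hence "distinct [j H1, j H2, j H3]" using p' j_inj by (metis distinct_length_2_or_more distinct_singleton)
 thus ?thesis using p' j_corank[of 2 F] j_hyperplane j_mono unfolding pencil_def by blast
qed

lemma j_quad: "quad S H1 H2 H3 H4 ==> quad N (j H1) (j H2) (j H3) (j H4)"
 unfolding quad_def using j_pencil j_inj S.hyperplane_flat(1) by (metis pencil_def)

definition restricted :: "('a, 'u) rep => ('b, 'u) rep" where
 "restricted \<phi> = (\<lambda>H x. \<phi> (j H) (e x))"

lemma restricted_rep:
 assumes "pasture P" "\<phi> : reps N P" shows "restricted \<phi> : reps S P"
proof -
 interpret P: pasture P by fact
 interpret NP: matroid_over N P by unfold_locales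
 show ?thesis unfolding reps_def
 proof (intro CollectI conjI ballI impI)
  fix H x assume "H : hyperplanes S" "x : ground S"
  thus "restricted \<phi> H x : carrier P" "restricted \<phi> H x = pzero P \<longleftrightarrow> x : H"
   using NP.reps_supported[OF assms(2)] j_hyperplane image j_mem[OF S.hyperplane_flat(1)]
   by (auto simp: restricted_def NP.supported_def image_subset_iff)
 next
  fix H1 H2 H3 assume H: "H1 : hyperplanes S" "H2 : hyperplanes S" "H3 : hyperplanes S" "H1 ~= H2" "H1 ~= H3" "H2 ~= H3"
   "flat_of_corank S 2 (H1 Int H2 Int H3)"
  hence "pencil S (H1 Int H2 Int H3) H1 H2 H3" by (auto simp: pencil_def)
  note p = j_pencil[OF this]
  note m = N.pencil_meet[OF p] and p' = p[unfolded pencil_def]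
  have "j H1 Int j H2 Int j H3 = j (H1 Int H2 Int H3)" using m by blast
  hence "null_triple N P \<phi> (j H1) (j H2) (j H3)"
   using assms(2) p' unfolding reps_def by simp
  thus "null_triple S P (restricted \<phi>) H1 H2 H3"
   unfolding restricted_def using image by blast
 qed
qed

text \<open>The relation between the two representations is stated pointwise, so that the lemma
  applies to \<open>pullback_rep\<close> as well as to \<open>restricted\<close>.\<close>

lemma cr_transfer:
 assumes "pasture P" "\<phi> : reps N P" "\<psi> : reps S P" "quad S H1 H2 H3 H4"
  and eq: "!!H x. H : hyperplanes S ==> x : ground S ==> \<psi> H x = \<phi> (j H) (e x)"
 shows "cr P \<psi> H1 H2 H3 H4 = cr P \<phi> (j H1) (j H2) (j H3) (j H4)"
proof -
 interpret P: pasture P by fact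
 interpret NP: matroid_over N P by unfold_locales
 interpret SP: matroid_over S P by unfold_locales
 obtain F where p: "pencil S F H1 H2 H3" "pencil S F H1 H2 H4" using assms(4) by (auto simp: quad_def)
 obtain x y where x: "x : H3 - F" and y: "y : H4 - F"
  using S.pencil_third[OF p(1)] S.pencil_third[OF p(2)] by auto
 have H: "H1 : hyperplanes S" "H2 : hyperplanes S" "x : ground S" "y : ground S"
  using S.pencil_out[OF p(1) x] S.pencil_out[OF p(2) y] by auto
 have fl: "flat S F" "flat S H3" "flat S H4" using p S.hyperplane_flat(1) by (auto simp: pencil_def flat_of_corank_def)
 have "e x : j H3 - j F" "e y : j H4 - j F" using j_mem[OF fl(1)] j_mem[OF fl(2)] j_mem[OF fl(3)] H x y by auto
 from NP.cr_eq[OF assms(2) j_pencil[OF p(1)] j_pencil[OF p(2)] this] SP.cr_eq[OF assms(3) p x y]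
 have "P.cg (frag_of (cr P \<psi> H1 H2 H3 H4)) (frag_of (cr P \<phi> (j H1) (j H2) (j H3) (j H4)))"
  unfolding eq[OF H(1,3)] eq[OF H(1,4)] eq[OF H(2,3)] eq[OF H(2,4)] using P.cg_trans P.cg_sym by blast
 thus ?thesis
  using NP.cr_nonzero[of \<phi> "j H1" "j H2" "j H3" "j H4"] SP.cr_nonzero[of \<psi> H1 H2 H3 H4] by (simp add: P.cg_iff P.ev_lg)
qed

lemma cr_restricted:
 "pasture P ==> \<phi> : reps N P ==> quad S H1 H2 H3 H4 ==>
  cr P (restricted \<phi>) H1 H2 H3 H4 = cr P \<phi> (j H1) (j H2) (j H3) (j H4)"
 by (rule cr_transfer[OF _ _ restricted_rep]) (simp_all add: restricted_def)

end

text \<open>The map \<open>e\<close> picks representatives in \<open>K\<close>, and \<open>f\<close>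
  sends each non-loop to an element whose representative is parallel to it. The case of interest is
  the simplification of \<open>K\<close>, with \<open>f\<close> as in
  \<open>pullback_rep\<close>.\<close>

locale matroid_retraction = matroid_embedding K S "{}" e
 for K :: "'a matroid" and S :: "'b matroid" and e :: "'b => 'a" +
 fixes f :: "'a => 'b"
 assumes loopless: "y : ground S ==> indep S {y}"
  and retract: "x : ground K ==> x ~: loops K ==> f x : ground S & cl K {e (f x)} = cl K {x}"
  and f_e: "y : ground S ==> f (e y) = y"
begin

lemma loops_flat: "flat K H ==> loops K <= H"
 using N.cl_mono[of "{}" H] by (simp add: flat_def loops_def)

lemma image_nonloop: "y : ground S ==> e y : ground K & e y ~: loops K"
 using image loopless[of y] indep_iff[of "{y}"] N.cl_indep[OF N.indep_empty, of "e y"] by (auto simp: loops_def)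

lemma retract_mem: assumes "flat K H" "x : ground K" "x ~: loops K" shows "e (f x) : H \<longleftrightarrow> x : H"
proof -
 have m: "e (f x) : cl K {e (f x)}" "x : cl K {x}"
  using retract[OF assms(2,3)] image assms(2) N.cl_ext[of _ "{e (f x)}"] N.cl_ext[of x "{x}"] by auto
 have "cl K {z} <= H" if "z : H" for z using N.cl_mono[of "{z}" H] that assms(1) by (simp add: flat_def)
 thus ?thesis using m retract[OF assms(2,3)] by blast
qed

lemma trace:
 assumes H: "flat_of_corank K k H"
 shows "flat_of_corank S k (f ` (H - loops K))" "j (f ` (H - loops K)) = H" "!!y. y : ground S ==> y : f ` (H - loops K) \<longleftrightarrow> e y : H"
proof -
 have fl: "flat K H" "H <= ground K" "cl K H = H" using H by (auto simp: flat_of_corank_def flat_def)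
 define H' where "H' = f ` (H - loops K)"
 have sub: "H' <= ground S" using retract fl by (auto simp: H'_def)
 have mem: "y : H' \<longleftrightarrow> e y : H" if y: "y : ground S" for y
 proof
  assume "y : H'"
  then obtain x where "x : H" "x ~: loops K" "y = f x" by (auto simp: H'_def)
  thus "e y : H" using retract_mem[OF fl(1)] fl by auto
 next
  assume "e y : H"
  hence "f (e y) : H'" using image_nonloop[OF y] by (auto simp: H'_def)
  thus "y : H'" using f_e[OF y] by simp
 qed
 thus "!!y. y : ground S ==> y : f ` (H - loops K) \<longleftrightarrow> e y : H" unfolding H'_def .
 have "e ` H' <= H" using mem sub by blast
 hence "j H' <= H" unfolding j_def using N.cl_mono[of "e ` H'" H] fl by simp
 moreover have "x : j H'" if x: "x : H" for x
 proof (cases "x : loops K")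
  case True
  thus ?thesis unfolding j_def loops_def using N.cl_mono[of "{}" "{} Un e ` H'"] by blast
 next
  case False
  hence "f x : H'" using x by (auto simp: H'_def)
  hence "cl K {e (f x)} <= j H'" unfolding j_def by (intro N.cl_mono) auto
  moreover have "x : cl K {e (f x)}" using retract[of x] False x fl N.cl_ext[of x "{x}"] by auto
  ultimately show ?thesis by blast
 qed
 ultimately show j: "j (f ` (H - loops K)) = H" unfolding H'_def by blast
 have "cl S H' = H'"
  using cl_eq[OF sub] mem sub j unfolding j_def H'_def by auto
 moreover have "rk S H' = rk K H"
  using rk_eq[OF sub] j N.rk_cl[of "{} Un e ` H'"] unfolding j_def H'_def by simp
 ultimately show "flat_of_corank S k (f ` (H - loops K))"
  using H sub rank_eq unfolding flat_of_corank_def flat_def H'_def by simp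
qed

lemma pencil_trace:
 assumes p: "pencil K F H1 H2 H3"
 shows "pencil S (f ` (F - loops K)) (f ` (H1 - loops K)) (f ` (H2 - loops K)) (f ` (H3 - loops K))"
proof -
 have c: "flat_of_corank K 2 F" "flat_of_corank K 1 H1" "flat_of_corank K 1 H2" "flat_of_corank K 1 H3"
  using p by (auto simp: pencil_def hyperplanes_def)
 have "H1 ~= H2" "H1 ~= H3" "H2 ~= H3" using p by (auto simp: pencil_def)
 hence "distinct [f ` (H1 - loops K), f ` (H2 - loops K), f ` (H3 - loops K)]"
  using trace(2)[OF c(2)] trace(2)[OF c(3)] trace(2)[OF c(4)] by (metis distinct_length_2_or_more distinct_singleton)
 moreover have "f ` (F - loops K) <= f ` (H - loops K)" if "F <= H" for H using that by blast
 ultimately show ?thesis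
  using trace(1)[OF c(1)] trace(1)[OF c(2)] trace(1)[OF c(3)] trace(1)[OF c(4)] p
  unfolding pencil_def hyperplanes_def mem_Collect_eq by meson
qed

lemma pullback_transfer:
 assumes "H : hyperplanes S" "x : ground S" shows "\<psi> H x = pullback_rep K P f \<psi> (j H) (e x)"
proof -
 have c: "flat_of_corank K 1 (j H)" using j_hyperplane[OF assms(1)] by (simp add: hyperplanes_def)
 have "flat S H" "flat S (f ` (j H - loops K))"
  using S.hyperplane_flat(1)[OF assms(1)] trace(1)[OF c] by (auto simp: flat_of_corank_def)
 from j_inj[OF this(2,1) trace(2)[OF c]] show ?thesis
  using image_nonloop[OF assms(2)] f_e[OF assms(2)] by (simp add: pullback_rep_def)
qed

lemma pullback_in_reps:
 assumes "pasture P" "\<psi> : reps S P" shows "pullback_rep K P f \<psi> : reps K P"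
proof -
 interpret P: pasture P by fact
 interpret SP: matroid_over S P by unfold_locales
 note sup = SP.reps_supported[OF assms(2), unfolded SP.supported_def]
 show ?thesis unfolding reps_def
 proof (intro CollectI conjI ballI impI)
  fix H x assume H: "H : hyperplanes K" "x : ground K"
  hence c: "flat_of_corank K 1 H" "flat K H" by (auto simp: hyperplanes_def flat_of_corank_def)
  have h: "f ` (H - loops K) : hyperplanes S" using trace(1)[OF c(1)] by (simp add: hyperplanes_def)
  have "\<psi> (f ` (H - loops K)) (f x) : carrier P & (\<psi> (f ` (H - loops K)) (f x) = pzero P \<longleftrightarrow> x : H)" if "x ~: loops K"
   using sup h retract[OF H(2) that] trace(3)[OF c(1), of "f x"] retract_mem[OF c(2) H(2) that] by blast
  thus "pullback_rep K P f \<psi> H x : carrier P" "pullback_rep K P f \<psi> H x = pzero P \<longleftrightarrow> x : H"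
   using loops_flat[OF c(2)] P.zero_closed by (auto simp: pullback_rep_def)
 next
  fix H1 H2 H3 assume H: "H1 : hyperplanes K" "H2 : hyperplanes K" "H3 : hyperplanes K" "H1 ~= H2" "H1 ~= H3" "H2 ~= H3"
   "flat_of_corank K 2 (H1 Int H2 Int H3)"
  hence "pencil K (H1 Int H2 Int H3) H1 H2 H3" by (auto simp: pencil_def)
  note p = pencil_trace[OF this]
  note m = S.pencil_meet[OF p]
  let ?F = "f ` ((H1 Int H2 Int H3) - loops K)" and ?H = "\<lambda>H. f ` (H - loops K)"
  have "?H H1 Int ?H H2 Int ?H H3 = ?F" using m by blast
  hence "null_triple S P \<psi> (?H H1) (?H H2) (?H H3)"
   using assms(2) p unfolding reps_def pencil_def by simp
  then obtain a b c where abc: "a : carrier P" "b : carrier P" "c : carrier P" "(a, b, c) ~= (pzero P, pzero P, pzero P)"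
   and null: "!!x. x : ground S ==> {#a \<otimes>\<^bsub>P\<^esub> \<psi> (?H H1) x, b \<otimes>\<^bsub>P\<^esub> \<psi> (?H H2) x, c \<otimes>\<^bsub>P\<^esub> \<psi> (?H H3) x#} : nullset P" by blast
  have "{#a \<otimes>\<^bsub>P\<^esub> pullback_rep K P f \<psi> H1 x, b \<otimes>\<^bsub>P\<^esub> pullback_rep K P f \<psi> H2 x, c \<otimes>\<^bsub>P\<^esub> pullback_rep K P f \<psi> H3 x#} : nullset P"
   if x: "x : ground K" for x
   using null[of "f x"] retract[OF x] P.null_zero abc by (simp add: pullback_rep_def P.mult_zero)
  thus "null_triple K P (pullback_rep K P f \<psi>) H1 H2 H3"
   using abc by blast
 qed
qed

end

text \<open>The two passages inside \<open>restrict_class\<close>: from \<open>N\<close> to its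
  minor, and from the minor to \<open>S\<close>. The sublocales \<open>K\<close> and
  \<open>KS\<close> treat both of them as embeddings.\<close>

locale minor_retraction = matroid_embedding N S I e
 for N :: "'a matroid" and S :: "'b matroid" and I :: "'a set" and e :: "'b => 'a" +
 fixes J :: "'a set" and f :: "'a => 'b"
 assumes IJ: "I Int J = {}" "cl N (ground N - J) = ground N" "e ` ground S Int J = {}"
  and loopless': "y : ground S ==> indep S {y}"
  and retract': "x : ground N - J ==> x ~: cl N I ==> f x : ground S & cl N ((e (f x))+:I) = cl N (x+:I)"
  and f_e': "y : ground S ==> f (e y) = y"
begin

abbreviation "K \<equiv> minor N J I"

sublocale K: matroid_embedding N K I id
proof
 show "cl N (I Un id ` ground (minor N J I)) = ground N"
 proof -
  have "I Un id ` ground (minor N J I) = ground N - J" using IJ I_ground by (auto simp: minor_def)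
  thus ?thesis using IJ by simp
 qed
qed (auto simp: minor_def indep_I Un_commute)

lemma K_cl: "X <= ground K ==> cl K X = cl N (I Un X) Int ground K"
 using K.cl_eq[of X] by auto

lemma K_ground: "ground K = ground N - (I Un J)"
 by (simp add: minor_def)

sublocale KS: matroid_retraction K S e f
proof
 have gS: "e ` ground S <= ground K" using image IJ by (auto simp: K_ground)
 show "e ` ground S <= ground K - {}" using gS by simp
 show "indep K {}" by (rule K.S.indep_empty)
 show "inj_on e (ground S)" by (rule inj)
 show "indep S X \<longleftrightarrow> X <= ground S & indep K ({} Un e ` X)" for X
  using indep_iff[of X] K.indep_iff[of "e ` X"] gS by auto
 show "cl K ({} Un e ` ground S) = ground K"
  using K_cl[OF gS] spanning by (auto simp: K_ground)
 show "indep S {x}" if "x : ground S" for x by (rule loopless'[OF that])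
 show "f (e y) = y" if "y : ground S" for y by (rule f_e'[OF that])
 fix x assume x: "x : ground K" "x ~: loops K"
 have "x ~: cl N I" using x K_cl[of "{}"] by (auto simp: loops_def)
 hence *: "f x : ground S" "cl N ((e (f x))+:I) = cl N (x+:I)" using retract'[of x] x by (auto simp: K_ground)
 hence "e (f x) : ground K" using gS by auto
 thus "f x : ground S & cl K {e (f x)} = cl K {x}" using * K_cl[of "{x}"] K_cl[of "{e (f x)}"] x by simp
qed

lemma j_comp: assumes "H <= ground S" shows "K.j (KS.j H) = j H"
proof -
 have gS: "e ` H <= ground K" using image IJ assms unfolding K_ground by blast
 have "KS.j H <= j H" unfolding KS.j_def j_def using K_cl[OF gS] by auto
 moreover have sub: "I Un e ` H <= ground N" using I_ground image assms by blast
 moreover have "I <= j H" using N.cl_superset[OF sub] unfolding j_def by (rule le_supE)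
 ultimately have "I Un id ` KS.j H <= cl N (I Un e ` H)" unfolding j_def[symmetric] image_id by simp
 hence 1: "K.j (KS.j H) <= j H" unfolding K.j_def[of "KS.j H"] j_def by (rule N.cl_le)
 have "e ` H <= KS.j H" using K.S.cl_superset[OF gS] unfolding KS.j_def by simp
 from Un_mono[OF order_refl this, of I] have "I Un e ` H <= I Un id ` KS.j H" by simp
 hence "j H <= K.j (KS.j H)" unfolding K.j_def[of "KS.j H"] j_def by (rule N.cl_mono)
 with 1 show ?thesis by (rule subset_antisym)
qed

text \<open>By \<open>rescaling_iff\<close> only cross ratios have to be compared. They agree along
  both passages, and every \<open>quad\<close> of the minor is the image of one of \<open>S\<close>.
  The result no longer refers to the minor or to \<open>f\<close>.\<close>

lemma restrict_class_eq:
 assumes P: "pasture P" and \<phi>: "\<phi> : reps N P"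
 shows "restrict_class N J I f S P (cross_class N P \<phi>) = cross_class S P (restricted \<phi>)"
proof -
 interpret P: pasture P by fact
 interpret NP: matroid_over N P by unfold_locales
 interpret SP: matroid_over S P by unfold_locales
 interpret KP: matroid_over K P by unfold_locales
 have r: "restrict_rep N I \<phi>' = K.restricted \<phi>'" for \<phi>' :: "('a, 'u) rep"
  by (rule ext)+ (simp add: restrict_rep_def K.restricted_def K.j_def Un_commute)
 have iff: "(restrict_rep N I \<phi>', pullback_rep K P f \<psi>) : rescaling K P \<longleftrightarrow> same_cross S P (restricted \<phi>) \<psi>"
  if \<phi>': "\<phi>' : cross_class N P \<phi>" and \<psi>: "\<psi> : reps S P" for \<phi>' \<psi>
 proof -
  have \<phi>'r: "\<phi>' : reps N P" and same: "same_cross N P \<phi> \<phi>'" using \<phi>' by (auto simp: cross_class_def)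
  have kr: "K.restricted \<phi>' : reps K P" "pullback_rep K P f \<psi> : reps K P"
   by (rule K.restricted_rep[OF P \<phi>'r], rule KS.pullback_in_reps[OF P \<psi>])
  have S_to_K: "cr P (pullback_rep K P f \<psi>) (KS.j H1) (KS.j H2) (KS.j H3) (KS.j H4) = cr P \<psi> H1 H2 H3 H4"
   "cr P (K.restricted \<phi>') (KS.j H1) (KS.j H2) (KS.j H3) (KS.j H4) = cr P (restricted \<phi>) H1 H2 H3 H4"
   if q: "quad S H1 H2 H3 H4" for H1 H2 H3 H4
  proof -
   show "cr P (pullback_rep K P f \<psi>) (KS.j H1) (KS.j H2) (KS.j H3) (KS.j H4) = cr P \<psi> H1 H2 H3 H4"
    by (rule KS.cr_transfer[OF P kr(2) \<psi> q KS.pullback_transfer, symmetric])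
   have sub: "H1 <= ground S" "H2 <= ground S" "H3 <= ground S" "H4 <= ground S"
    using q S.hyperplane_flat(1) by (auto simp: quad_def pencil_def flat_def)
   have "quad N (j H1) (j H2) (j H3) (j H4)" by (rule j_quad[OF q])
   thus "cr P (K.restricted \<phi>') (KS.j H1) (KS.j H2) (KS.j H3) (KS.j H4) = cr P (restricted \<phi>) H1 H2 H3 H4"
    using K.cr_restricted[OF P \<phi>'r KS.j_quad[OF q]] cr_restricted[OF P \<phi> q] same
    unfolding j_comp[OF sub(1)] j_comp[OF sub(2)] j_comp[OF sub(3)] j_comp[OF sub(4)] same_cross_def by simp
  qed
  have lift: "EX G1 G2 G3 G4. quad S G1 G2 G3 G4 & H1 = KS.j G1 & H2 = KS.j G2 & H3 = KS.j G3 & H4 = KS.j G4"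
   if q: "quad K H1 H2 H3 H4" for H1 H2 H3 H4
  proof -
   obtain F where p: "pencil K F H1 H2 H3" "pencil K F H1 H2 H4" "H3 ~= H4" using q by (auto simp: quad_def)
   let ?H = "\<lambda>H. f ` (H - loops K)"
   have j: "KS.j (?H H) = H" if "H : hyperplanes K" for H
    using KS.trace(2)[of 1 H] that by (simp add: hyperplanes_def)
   have h: "H1 : hyperplanes K" "H2 : hyperplanes K" "H3 : hyperplanes K" "H4 : hyperplanes K" using p by (auto simp: pencil_def)
   hence "?H H3 ~= ?H H4" using j p(3) by metis
   hence "quad S (?H H1) (?H H2) (?H H3) (?H H4)" unfolding quad_def using KS.pencil_trace[OF p(1)] KS.pencil_trace[OF p(2)] by blast
   thus ?thesis using j[OF h(1)] j[OF h(2)] j[OF h(3)] j[OF h(4)] by metis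
  qed
  have "same_cross K P (K.restricted \<phi>') (pullback_rep K P f \<psi>) \<longleftrightarrow> same_cross S P (restricted \<phi>) \<psi>"
  proof
   assume "same_cross K P (K.restricted \<phi>') (pullback_rep K P f \<psi>)"
   thus "same_cross S P (restricted \<phi>) \<psi>" unfolding same_cross_def using S_to_K KS.j_quad by metis
  next
   assume same': "same_cross S P (restricted \<phi>) \<psi>"
   show "same_cross K P (K.restricted \<phi>') (pullback_rep K P f \<psi>)" unfolding same_cross_def
   proof (intro allI impI)
    fix H1 H2 H3 H4 assume "quad K H1 H2 H3 H4"
    from lift[OF this] obtain G1 G2 G3 G4 where q: "quad S G1 G2 G3 G4"
    and H: "H1 = KS.j G1" "H2 = KS.j G2" "H3 = KS.j G3" "H4 = KS.j G4" by blast
    have "cr P (restricted \<phi>) G1 G2 G3 G4 = cr P \<psi> G1 G2 G3 G4" using same' q unfolding same_cross_def by blast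
    thus "cr P (K.restricted \<phi>') H1 H2 H3 H4 = cr P (pullback_rep K P f \<psi>) H1 H2 H3 H4"
    unfolding H S_to_K[OF q] .
   qed
  qed
  thus ?thesis unfolding r using KP.rescaling_iff[OF kr] by simp
 qed
 show ?thesis unfolding restrict_class_def
  using iff NP.in_cross_class[OF \<phi>] by (auto simp: cross_class_def[of S])
qed

end

section \<open>Presentations of upper sublattices and their simple matroids\<close>

lemma (in matroid) cl_exchange:
 assumes "indep M I" "x : ground M" "y ~: cl M I" "y : cl M (x+:I)"
 shows "x : cl M (y+:I)"
proof -
 have I: "I <= ground M" by (rule indep_subset_ground[OF assms(1)])
 have y: "y : ground M" using assms(4) cl_sub by blast
 have "x ~: cl M I" using cl_insert_in[OF I, of x] assms(3,4) by auto
 hence "indep M (x+:I)" "indep M (y+:I)" using cl_indep[OF assms(1)] assms(2,3) y by blast+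
 thus ?thesis
  using cl_indep[of "(x+:I)" y] cl_indep[of "(y+:I)" x] assms y cl_ext[OF y, of I] by (auto simp: insert_commute[of x y])
qed

lemma (in matroid) indep_unionI:
 assumes I: "indep M I" and Y: "Y <= ground M" and nin: "!!y. y : Y ==> y ~: cl M (I Un (Y - {y}))"
 shows "indep M (I Un Y)"
proof -
 obtain B where B: "I <= B" "B <= I Un Y" "indep M B" "card B = rk M (I Un Y)"
  by (rule extend_indep[OF I, of "I Un Y"]) auto
 have "Y <= B"
 proof
  fix y assume y: "y : Y"
  show "y : B"
  proof (rule ccontr)
   assume "y ~: B"
   hence "B <= I Un (Y - {y})" using B by blast
   moreover have "y : cl M B" using cl_basis[OF B(3,2,4)] cl_ext[of y "I Un Y"] y Y by auto
   ultimately show False using cl_mono nin[OF y] by blast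
  qed
 qed
 hence "I Un Y = B" using B by blast
 thus ?thesis using B by simp
qed

text \<open>A lattice \<open>L\<close> of subsets of another type, identified by \<open>g\<close> with the upper sublattice
 presented by \<open>I\<close> and \<open>J\<close>.\<close>

locale lattice_presentation = N: matroid N for N :: "'a matroid" +
 fixes L :: "'b set set" and g :: "'b set => 'a set" and I J :: "'a set"
 assumes pres: "presents N (g ` L) I J"
  and order: "A : L ==> B : L ==> A <= B \<longleftrightarrow> g A <= g B"
  and bottom: "\<Inter>L \<in> L"
begin

lemma IJ: "I <= ground N" "J <= ground N" "I Int J = {}" "indep N I" "cl N (ground N - J) = ground N"
 and L_eq: "g ` L = {cl N S | S. I <= S & S <= ground N - J}"
 using pres by (auto simp: presents_def)

lemma mem_L: "I <= S ==> S <= ground N - J ==> EX F:L. g F = cl N S"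
proof -
 assume "I <= S" "S <= ground N - J"
 hence "cl N S : g ` L" unfolding L_eq by blast
 thus ?thesis by (auto simp: image_iff)
qed

lemma L_mem: assumes "F : L" obtains S where "I <= S" "S <= ground N - J" "g F = cl N S"
proof -
 have "g F : {cl N S | S. I <= S & S <= ground N - J}" using assms L_eq by blast
 thus thesis using that by blast
qed

lemma g_inj: "F : L ==> F' : L ==> g F = g F' ==> F = F'"
 using order by blast

lemma g_super: assumes "F : L" shows "cl N I <= g F" "cl N (g F) = g F"
proof -
 obtain S where S: "I <= S" "S <= ground N - J" "g F = cl N S" by (rule L_mem[OF assms])
 show "cl N I <= g F" "cl N (g F) = g F" unfolding S(3) by (rule N.cl_mono[OF S(1)], rule N.cl_cl)
qed

lemma g_bottom: "g (\<Inter>L) = cl N I"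
proof -
 obtain F where F: "F : L" "g F = cl N I" using mem_L[of I] IJ by blast
 hence "g (\<Inter>L) <= g F" using order[OF bottom F(1)] by blast
 thus ?thesis using F g_super(1)[OF bottom] by blast
qed

definition pts :: "'a set" where "pts = ground N - J - cl N I"

lemma pts_L: "x : pts ==> EX F:L. g F = cl N (x+:I)"
 using mem_L[of "(x+:I)"] IJ by (auto simp: pts_def)

lemma le_g_iff: assumes "F : L" "x : pts" shows "cl N (x+:I) <= g F \<longleftrightarrow> x : g F"
proof
 show "x : g F" if "cl N (x+:I) <= g F" using that N.cl_ext[of x "(x+:I)"] assms(2) by (auto simp: pts_def)
 show "cl N (x+:I) <= g F" if "x : g F"
  using that N.cl_le[of "(x+:I)" "g F"] g_super[OF assms(1)] N.cl_superset[OF IJ(1)] by auto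
qed

lemma atomI: assumes F: "F : L" and x: "x : pts" "g F = cl N (x+:I)" shows "F : atoms L"
 unfolding atoms_def
proof (intro CollectI conjI ballI impI F)
 have x': "x : ground N" "x ~: cl N I" using x by (auto simp: pts_def)
 hence "x : g F" using x N.cl_ext by simp
 thus "F ~= \<Inter>L" using g_bottom x' by metis
 fix G assume G: "G : L" "G \<subset> F"
 obtain S where S: "I <= S" "S <= ground N - J" "g G = cl N S" by (rule L_mem[OF G(1)])
 show "G = \<Inter>L"
 proof (cases "S <= cl N I")
  case True
  hence "g G <= g (\<Inter>L)" using S g_bottom N.cl_le by simp
  thus ?thesis using order[OF G(1) bottom] G(1) by blast
 next
  case False
  then obtain y where y: "y : S" "y ~: cl N I" by blast
  hence yp: "y : pts" using S by (auto simp: pts_def)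
  have yG: "y : g G" using y S N.cl_ext[of y S] by auto
  hence "y : cl N (x+:I)" using order[OF G(1) F] G x by blast
  hence "x : cl N (y+:I)" by (rule N.cl_exchange[OF IJ(4) x'(1) y(2)])
  hence "x : g G" using le_g_iff[OF G(1) yp] yG by blast
  hence "g F <= g G" using le_g_iff[OF G(1) x(1)] x(2) by simp
  thus ?thesis using order[OF F G(1)] G(2) by blast
 qed
qed

lemma atomE: assumes A: "A : atoms L" obtains x where "x : pts" "g A = cl N (x+:I)"
proof -
 have A': "A : L" "A ~= \<Inter>L" "!!F. F : L ==> F \<subset> A ==> F = \<Inter>L" using A by (auto simp: atoms_def)
 obtain S where S: "I <= S" "S <= ground N - J" "g A = cl N S" by (rule L_mem[OF A'(1)])
 have "~ S <= cl N I"
 proof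
  assume "S <= cl N I"
  hence "g A <= g (\<Inter>L)" using S g_bottom N.cl_le by simp
  thus False using order[OF A'(1) bottom] A' by blast
 qed
 then obtain x where x: "x : S" "x ~: cl N I" by blast
 hence xp: "x : pts" using S by (auto simp: pts_def)
 then obtain F where F: "F : L" "g F = cl N (x+:I)" using pts_L by blast
 have "x : g A" using x S N.cl_ext[of x S] by auto
 hence "F <= A" using order[OF F(1) A'(1)] le_g_iff[OF A'(1) xp] F by simp
 moreover have "F ~= \<Inter>L" using atomI[OF F(1) xp F(2)] by (simp add: atoms_def)
 ultimately have "F = A" using A'(3)[OF F(1)] by blast
 thus thesis using that xp F by blast
qed

definition e :: "'b set => 'a" where
 "e A = (SOME x. x : pts & g A = cl N (x+:I))"

lemma e: "A : atoms L ==> e A : pts" "A : atoms L ==> g A = cl N ((e A)+:I)"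
proof -
 assume "A : atoms L"
 hence "EX x. x : pts & g A = cl N (x+:I)" by (meson atomE)
 from someI_ex[OF this] show "e A : pts" "g A = cl N ((e A)+:I)" by (auto simp: e_def)
qed

lemma atoms_L: "A : atoms L ==> A : L"
 by (simp add: atoms_def)

lemma e_pts: "e A : ground N" "e A ~: J" "e A ~: I" "e A ~: cl N I" if "A : atoms L"
 using e(1)[OF that] N.cl_ext[of "e A" I] by (auto simp: pts_def)

lemma atom_le: "A : atoms L ==> F : L ==> A <= F \<longleftrightarrow> e A : g F"
 using order[OF atoms_L] le_g_iff[of F "e A"] e by metis

lemma e_inj: "inj_on e (atoms L)"
 using e(2) g_inj atoms_L by (metis inj_onI)

lemma le_join: assumes "X <= atoms L" "F : L" shows "(ALL A:X. A <= F) \<longleftrightarrow> cl N (I Un e ` X) <= g F"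
proof -
 have "(ALL A:X. A <= F) \<longleftrightarrow> e ` X <= g F" using atom_le assms by blast
 moreover have "I <= g F" using g_super(1)[OF assms(2)] N.cl_superset[OF IJ(1)] by blast
 moreover have "I Un e ` X <= cl N (I Un e ` X)" by (rule N.cl_superset) (use IJ e_pts assms in blast)
 ultimately show ?thesis using N.cl_le[of "I Un e ` X" "g F"] g_super(2)[OF assms(2)] by auto
qed

lemma join_L: assumes "X <= atoms L" shows "EX F:L. g F = cl N (I Un e ` X)"
 by (rule mem_L) (use IJ e_pts assms in blast)+

text \<open>Joins of atoms in \<open>L\<close> are the spans of their representatives over
  \<open>I\<close>, by \<open>le_join\<close> and \<open>join_L\<close>. So independence in the
  lattice is independence of the representatives in \<open>N\<close> over \<open>I\<close>.\<close>

lemma simple_indep_iff: "indep (simple_matroid L) X \<longleftrightarrow> X <= atoms L & indep N (I Un e ` X)"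
proof (cases "X <= atoms L")
 case X: True
 have "indep (simple_matroid L) X \<longleftrightarrow> (ALL A:X. EX F:L. (ALL A':X - {A}. A' <= F) & ~ A <= F)"
  using X by (simp add: simple_matroid_def)
 also have "\<dots> \<longleftrightarrow> (ALL A:X. e A ~: cl N (I Un e ` (X - {A})))"
 proof (rule ball_cong[OF refl])
  fix A assume A: "A : X"
  have X': "X - {A} <= atoms L" using X by blast
  show "(EX F:L. (ALL A':X - {A}. A' <= F) & ~ A <= F) \<longleftrightarrow> e A ~: cl N (I Un e ` (X - {A}))"
   using le_join[OF X'] join_L[OF X'] atom_le[of A] A X by (metis order_refl subsetD)
 qed
 also have "\<dots> \<longleftrightarrow> indep N (I Un e ` X)"
 proof
  assume nin: "ALL A:X. e A ~: cl N (I Un e ` (X - {A}))"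
  show "indep N (I Un e ` X)"
  proof (rule N.indep_unionI[OF IJ(4)])
   show "e ` X <= ground N" using e_pts X by blast
   fix y assume "y : e ` X"
   then obtain A where A: "A : X" "y = e A" by blast
   have "e ` X - {y} = e ` (X - {A})" using A X inj_on_image_set_diff[OF e_inj, of X "{A}"] by auto
   thus "y ~: cl N (I Un (e ` X - {y}))" using nin A by simp
  qed
 next
  assume ind: "indep N (I Un e ` X)"
  show "ALL A:X. e A ~: cl N (I Un e ` (X - {A}))"
  proof
   fix A assume A: "A : X"
   have eq: "((e A)+:(I Un e ` (X - {A}))) = I Un e ` X" using A by blast
   have i: "indep N (I Un e ` (X - {A}))" by (rule N.indep_subset[OF ind]) blast
   have "e A ~: e ` (X - {A})" using A X inj_onD[OF e_inj] by blast
   thus "e A ~: cl N (I Un e ` (X - {A}))"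
    using N.cl_indep[OF i, of "e A"] ind eq e_pts(3) A X by auto
  qed
 qed
 finally show ?thesis using X by simp
qed (simp add: simple_matroid_def)

lemma ground_simple: "ground (simple_matroid L) = atoms L"
 by (simp add: simple_matroid_def)

sublocale emb: matroid_embedding N "simple_matroid L" I e
proof
 show "indep N I" by (rule IJ(4))
 show "inj_on e (ground (simple_matroid L))" unfolding ground_simple by (rule e_inj)
 show "e ` ground (simple_matroid L) <= ground N - I" unfolding ground_simple using e_pts by blast
 show "indep (simple_matroid L) X \<longleftrightarrow> X <= ground (simple_matroid L) & indep N (I Un e ` X)" for X
  unfolding ground_simple by (rule simple_indep_iff)
 have "x : cl N (I Un e ` atoms L)" if x: "x : ground N - J" for x
 proof (cases "x : cl N I")
  case True
  thus ?thesis using N.cl_mono[of I "I Un e ` atoms L"] by blast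
 next
  case False
  hence xp: "x : pts" using x by (simp add: pts_def)
  then obtain A where A: "A : L" "g A = cl N (x+:I)" using pts_L by blast
  have a: "A : atoms L" by (rule atomI[OF A(1) xp A(2)])
  have "x : cl N ((e A)+:I)" using A(2) e(2)[OF a] x N.cl_ext[of x "(x+:I)"] by simp
  moreover have "((e A)+:I) <= I Un e ` atoms L" using a by blast
  ultimately show ?thesis using N.cl_mono by blast
 qed
 hence "cl N (ground N - J) <= cl N (I Un e ` atoms L)" by (intro N.cl_le) blast
 thus "cl N (I Un e ` ground (simple_matroid L)) = ground N"
  unfolding ground_simple IJ(5) using N.cl_sub by blast
qed

lemma retraction:
 assumes "!!x. x : pts ==> f x : L & g (f x) = cl N (x+:I)"
 shows "minor_retraction N (simple_matroid L) I e J f"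
proof
 show "I Int J = {}" "cl N (ground N - J) = ground N" by (rule IJ)+
 show "e ` ground (simple_matroid L) Int J = {}" unfolding ground_simple using e_pts by blast
 show "indep (simple_matroid L) {y}" if "y : ground (simple_matroid L)" for y
  using that simple_indep_iff[of "{y}"] e_pts[of y] N.cl_indep[OF IJ(4), of "e y"] by (auto simp: ground_simple)
 show "f (e y) = y" if "y : ground (simple_matroid L)" for y
  using that assms[of "e y"] e[of y] g_inj[of "f (e y)" y] atoms_L unfolding ground_simple by simp
 fix x assume "x : ground N - J" "x ~: cl N I"
 hence x: "x : pts" by (simp add: pts_def)
 hence "f x : atoms L" using assms atomI by blast
 thus "f x : ground (simple_matroid L) & cl N ((e (f x))+:I) = cl N (x+:I)"
  using assms[OF x] e(2) by (simp add: ground_simple)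
qed

lemma j_below: assumes F: "F : L" shows "emb.j (atoms_below L F) = g F"
proof
 have ab: "atoms_below L F <= atoms L" by (auto simp: atoms_below_def)
 have "ALL A:atoms_below L F. A <= F" by (simp add: atoms_below_def)
 thus "emb.j (atoms_below L F) <= g F" unfolding emb.j_def using le_join[OF ab F] by simp
 obtain S where S: "I <= S" "S <= ground N - J" "g F = cl N S" by (rule L_mem[OF F])
 have "x : emb.j (atoms_below L F)" if x: "x : S" for x
 proof (cases "x : cl N I")
  case True
  thus ?thesis unfolding emb.j_def using N.cl_mono[of I "I Un e ` atoms_below L F"] by blast
 next
  case False
  hence xp: "x : pts" using S x by (auto simp: pts_def)
  then obtain A where A: "A : L" "g A = cl N (x+:I)" using pts_L by blast
  have a: "A : atoms L" by (rule atomI[OF A(1) xp A(2)])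
  have xF: "x : g F" using x S N.cl_ext[of x S] by auto
  hence "A : atoms_below L F" using order[OF A(1) F] A(2) le_g_iff[OF F xp] a by (simp add: atoms_below_def)
  hence "((e A)+:I) <= I Un e ` atoms_below L F" by blast
  moreover have "x : cl N ((e A)+:I)" using A(2) e(2)[OF a] S x N.cl_ext[of x "(x+:I)"] by auto
  ultimately show ?thesis unfolding emb.j_def using N.cl_mono by blast
 qed
 thus "g F <= emb.j (atoms_below L F)" unfolding S(3) emb.j_def by (intro N.cl_le) blast
qed

lemma below_flat: "F : L ==> flat (simple_matroid L) (atoms_below L F)"
proof -
 assume F: "F : L"
 have ab: "atoms_below L F <= ground (simple_matroid L)" by (auto simp: atoms_below_def ground_simple)
 thus ?thesis
  unfolding flat_def using emb.cl_eq[OF ab] j_below[OF F] atom_le[OF _ F] unfolding emb.j_def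
  by (auto simp: ground_simple atoms_below_def)
qed

lemma flat_below: assumes "flat (simple_matroid L) H" shows "EX F:L. atoms_below L F = H"
proof -
 have H: "H <= atoms L" using assms by (simp add: flat_def ground_simple)
 then obtain F where F: "F : L" "g F = emb.j H" using join_L[OF H] unfolding emb.j_def by blast
 hence "emb.j (atoms_below L F) = emb.j H" using j_below by simp
 thus ?thesis using emb.j_inj[OF below_flat[OF F(1)] assms] F(1) by blast
qed

lemma below_corank: assumes F: "F : L" shows "flat_of_corank (simple_matroid L) k (atoms_below L F) \<longleftrightarrow> flat_of_corank N k (g F)"
proof -
 have ab: "atoms_below L F <= ground (simple_matroid L)" by (auto simp: atoms_below_def ground_simple)
 have "rk (simple_matroid L) (atoms_below L F) + card I = rk N (g F)"
  using emb.rk_eq[OF ab] j_below[OF F] N.rk_cl[of "I Un e ` atoms_below L F"] unfolding emb.j_def by simp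
 moreover have "flat N (g F)" using g_super(2)[OF F] N.cl_sub by (metis flat_def)
 ultimately show ?thesis using below_flat[OF F] emb.rank_eq unfolding flat_of_corank_def by linarith
qed

lemma below_mono: "F : L ==> F' : L ==> atoms_below L F <= atoms_below L F' \<longleftrightarrow> F <= F'"
 using emb.j_mono[of "atoms_below L F" "atoms_below L F'"] j_below[of F] j_below[of F'] order[of F F']
 unfolding atoms_below_def by blast

end

abbreviation "quad_in L F1 F2 F3 F4 \<equiv>
 quad (simple_matroid L) (atoms_below L F1) (atoms_below L F2) (atoms_below L F3) (atoms_below L F4)"

abbreviation "cr_in P \<psi> L F1 F2 F3 F4 \<equiv>
 cr P \<psi> (atoms_below L F1) (atoms_below L F2) (atoms_below L F3) (atoms_below L F4)"

text \<open>The comparison is with a function of the members of \<open>L\<close>, not of sets of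
  atoms. It involves neither \<open>I\<close> nor \<open>J\<close>, so restrictions described in
  this way do not depend on the presentation.\<close>

definition agrees :: "'a set set => 'u pasture => ('a set, 'u) rep => ('a set => 'a set => 'a set => 'a set => 'u) => bool" where
 "agrees L P \<psi> \<chi> \<longleftrightarrow> (ALL F1:L. ALL F2:L. ALL F3:L. ALL F4:L.
  quad_in L F1 F2 F3 F4 -->
  cr_in P \<psi> L F1 F2 F3 F4 = \<chi> F1 F2 F3 F4)"

lemma agreesD:
 "agrees L P \<psi> \<chi> ==> F1 : L ==> F2 : L ==> F3 : L ==> F4 : L ==>
 quad_in L F1 F2 F3 F4 ==>
 cr_in P \<psi> L F1 F2 F3 F4 = \<chi> F1 F2 F3 F4"
 by (simp add: agrees_def)

context lattice_presentation
begin

lemma quad_below: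
 assumes "quad (simple_matroid L) H1 H2 H3 H4"
 shows "EX F1:L. EX F2:L. EX F3:L. EX F4:L. H1 = atoms_below L F1 & H2 = atoms_below L F2 & H3 = atoms_below L F3 & H4 = atoms_below L F4"
proof -
 have "EX F:L. H = atoms_below L F" if "H : hyperplanes (simple_matroid L)" for H
  using flat_below[OF emb.S.hyperplane_flat(1)[OF that]] by metis
 thus ?thesis using assms unfolding quad_def pencil_def by meson
qed

lemma quad_g:
 assumes "F1 : L" "F2 : L" "F3 : L" "F4 : L"
  "quad_in L F1 F2 F3 F4"
 shows "quad N (g F1) (g F2) (g F3) (g F4)"
 using emb.j_quad[OF assms(5)] j_below assms by simp

lemma same_cross_agrees:
 "same_cross (simple_matroid L) P \<psi>0 \<psi> \<longleftrightarrow> agrees L P \<psi> (cr_in P \<psi>0 L)"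
proof
 assume "same_cross (simple_matroid L) P \<psi>0 \<psi>"
 thus "agrees L P \<psi> (cr_in P \<psi>0 L)"
  unfolding same_cross_def agrees_def by simp
next
 assume a: "agrees L P \<psi> (cr_in P \<psi>0 L)"
 show "same_cross (simple_matroid L) P \<psi>0 \<psi>" unfolding same_cross_def
 proof (intro allI impI)
  fix H1 H2 H3 H4 assume q: "quad (simple_matroid L) H1 H2 H3 H4"
  from quad_below[OF q] obtain F1 F2 F3 F4 where F: "F1 : L" "F2 : L" "F3 : L" "F4 : L"
   and H: "H1 = atoms_below L F1" "H2 = atoms_below L F2" "H3 = atoms_below L F3" "H4 = atoms_below L F4" by blast
  show "cr P \<psi>0 H1 H2 H3 H4 = cr P \<psi> H1 H2 H3 H4" using agreesD[OF a F] q unfolding H by simp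
 qed
qed

lemma restricted_agrees:
 assumes "pasture P" "\<phi> : reps N P"
 shows "cross_class (simple_matroid L) P (emb.restricted \<phi>) =
  {\<psi> : reps (simple_matroid L) P. agrees L P \<psi> (\<lambda>F1 F2 F3 F4. cr P \<phi> (g F1) (g F2) (g F3) (g F4))}"
proof -
 have "cr_in P (emb.restricted \<phi>) L F1 F2 F3 F4 = cr P \<phi> (g F1) (g F2) (g F3) (g F4)"
  if "F1 : L" "F2 : L" "F3 : L" "F4 : L" "quad_in L F1 F2 F3 F4"
  for F1 F2 F3 F4
  using emb.cr_restricted[OF assms that(5)] j_below that(1-4) by simp
 thus ?thesis unfolding cross_class_def same_cross_agrees unfolding agrees_def by auto
qed

end

lemma (in matroid_embedding) j_cl: assumes X: "X <= ground S" shows "j (cl S X) = cl N (I Un e ` X)"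
proof -
 have sub: "I Un e ` X <= ground N" using I_ground image X by blast
 have "e ` cl S X <= cl N (I Un e ` X)" using cl_eq[OF X] by blast
 moreover have "I <= cl N (I Un e ` X)" using N.cl_superset[OF sub] by (rule le_supE)
 ultimately have "j (cl S X) <= cl N (I Un e ` X)" unfolding j_def by (intro N.cl_le) simp
 moreover have "I Un e ` X <= I Un e ` cl S X" using S.cl_superset[OF X] by blast
 hence "cl N (I Un e ` X) <= j (cl S X)" unfolding j_def by (rule N.cl_mono)
 ultimately show ?thesis by blast
qed

lemma (in matroid) presents_lattice:
 assumes "presents M L I J" shows "lattice_presentation M L id I J" "\<Inter>L = cl M I"
proof -
 have p: "I <= ground M - J" "L = {cl M S | S. I <= S & S <= ground M - J}" using assms by (auto simp: presents_def)
 have "cl M I : L" unfolding p(2) using p(1) by blast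
 moreover have "cl M I <= F" if "F : L" for F using that cl_mono unfolding p(2) by blast
 ultimately show i: "\<Inter>L = cl M I" by blast
 show "lattice_presentation M L id I J"
  by unfold_locales (use assms \<open>cl M I : L\<close> i in simp_all)
qed

lemma (in matroid) presents_retraction:
 assumes "presents M L I J"
 shows "minor_retraction M (simple_matroid L) I (lattice_presentation.e M id I J) J (\<lambda>x. cl M (x+:(\<Inter>L)))"
proof -
 interpret lattice_presentation M L id I J by (rule presents_lattice[OF assms])
 show ?thesis
 proof (rule retraction)
  fix x assume x: "x : pts"
  have I: "I <= cl M I" "cl M I <= cl M (x+:I)" using cl_superset[OF IJ(1)] cl_mono[of I "(x+:I)"] by auto
  have "x : cl M (x+:I)" using x cl_ext[of x "(x+:I)"] by (auto simp: pts_def)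
  hence "cl M (x+:(cl M I)) = cl M (x+:I)"
   using I by (intro subset_antisym cl_le cl_mono) auto
  thus "cl M (x+:(\<Inter>L)) : L & id (cl M (x+:(\<Inter>L))) = cl M (x+:I)"
   using pts_L[OF x] unfolding presents_lattice(2)[OF assms] by auto
 qed
qed

text \<open>An inclusion of sublattices is presented inside \<open>simple_matroid L\<close>, whose
  flats are sets of atoms. With \<open>g = atoms_below L\<close> it takes the same form as a
  presentation inside \<open>M\<close>, where \<open>g = id\<close>.\<close>

lemma (in matroid) inclusion_lattice:
 assumes L: "presents M L I J" and L': "presents M L' I1 J1" "L' <= L" and p: "presents (simple_matroid L) (atoms_below L ` L') I' J'"
 shows "lattice_presentation (simple_matroid L) L' (atoms_below L) I' J'"
  "minor_retraction (simple_matroid L) (simple_matroid L') I' (lattice_presentation.e (simple_matroid L) (atoms_below L) I' J') J'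
   (\<lambda>A. cl M (A Un \<Inter>L'))"
proof -
 interpret L: lattice_presentation M L id I J by (rule presents_lattice[OF L])
 interpret L': lattice_presentation M L' id I1 J1 by (rule presents_lattice[OF L'(1)])
 interpret N: lattice_presentation "simple_matroid L" L' "atoms_below L" I' J'
 proof
  show "presents (simple_matroid L) (atoms_below L ` L') I' J'" by (rule p)
  show "A <= B \<longleftrightarrow> atoms_below L A <= atoms_below L B" if "A : L'" "B : L'" for A B
   using L.below_mono[of A B] that L'(2) by blast
  show "\<Inter>L' \<in> L'" by (rule L'.bottom)
 qed
 show "lattice_presentation (simple_matroid L) L' (atoms_below L) I' J'" by unfold_locales
 have j: "L.emb.j (atoms_below L F) = F" if "F : L'" for F using L.j_below[of F] that L'(2) by auto
 have I': "I' <= ground (simple_matroid L)" using N.IJ by blast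
 have bot: "\<Inter>L' = cl M (I Un L.e ` I')"
  using j[OF L'.bottom] unfolding N.g_bottom L.emb.j_cl[OF I'] by simp
 show "minor_retraction (simple_matroid L) (simple_matroid L') I' (lattice_presentation.e (simple_matroid L) (atoms_below L) I' J') J'
   (\<lambda>A. cl M (A Un \<Inter>L'))"
 proof (rule N.retraction)
  fix A assume A: "A : N.pts"
  have AL: "A : atoms L" using A by (simp add: N.pts_def L.ground_simple)
  obtain F where F: "F : L'" "atoms_below L F = cl (simple_matroid L) (A+:I')" using N.pts_L[OF A] by blast
  have AI: "(A+:I') <= ground (simple_matroid L)" using AL I' by (simp add: L.ground_simple)
  let ?X = "I Un L.e ` (A+:I')"
  have F_eq: "F = cl M ?X" using j[OF F(1)] unfolding F(2) L.emb.j_cl[OF AI] by simp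
  have eA: "A = cl M ((L.e A)+:I)" using L.e(2)[OF AL] by simp
  have "A <= cl M ?X" by (subst eA, rule cl_mono) blast
  moreover have "\<Inter>L' <= cl M ?X" unfolding bot by (rule cl_mono) blast
  ultimately have 1: "cl M (A Un \<Inter>L') <= F" unfolding F_eq by (intro cl_le) simp
  have sub: "((L.e A)+:I) <= ground M" "I Un L.e ` I' <= ground M"
   using L.e_pts(1) AL I' L.IJ(1) by (auto simp: L.ground_simple)
  have "((L.e A)+:I) <= A" using cl_superset[OF sub(1)] eA by simp
  moreover have "I Un L.e ` I' <= \<Inter>L'" using cl_superset[OF sub(2)] bot by simp
  ultimately have "?X <= A Un \<Inter>L'" by blast
  hence "cl M ?X <= cl M (A Un \<Inter>L')" by (rule cl_mono)
  with 1 have "cl M (A Un \<Inter>L') = F" unfolding F_eq by blast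
  thus "cl M (A Un \<Inter>L') : L' & atoms_below L (cl M (A Un \<Inter>L')) = cl (simple_matroid L) (A+:I')" using F by simp
 qed
qed

section \<open>Morphisms of pastures and the Yoneda correspondence\<close>

lemma pasture_homD:
 assumes "g : pasture_hom P Q"
 shows "a : carrier P ==> g a : carrier Q" "g : extensional (carrier P)" "g : carrier P \<rightarrow> carrier Q"
 using assms unfolding pasture_hom_def PiE_def by auto

lemma image_mset_null:
 assumes "pasture P" "s : nullset P" "!!x. x : carrier P ==> f x = g x"
 shows "image_mset f s = image_mset g s"
proof (rule image_mset_cong)
 have "set_mset s <= carrier P" using pasture.nullset_sym3[OF assms(1)] assms(2) by (auto simp: sym3_def)
 thus "f x = g x" if "x \<in># s" for x using assms(3) that by blast
qed

lemma id_hom: assumes "pasture P" shows "(\<lambda>x\<in>carrier P. x) : pasture_hom P P"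
proof -
 interpret pasture P by fact
 have "image_mset (\<lambda>x\<in>carrier P. x) s = s" if "s : nullset P" for s
  using image_mset_null[OF assms that, of "\<lambda>x\<in>carrier P. x" "\<lambda>x. x"] by simp
 thus ?thesis by (simp add: pasture_hom_def zero_closed)
qed

lemma compose_hom:
 assumes "pasture P" "f : pasture_hom P Q" "g : pasture_hom Q R"
 shows "compose (carrier P) g f : pasture_hom P R"
proof -
 interpret pasture P by fact
 have "image_mset (compose (carrier P) g f) s = image_mset g (image_mset f s)" if "s : nullset P" for s
  using image_mset_null[OF assms(1) that, of "compose (carrier P) g f" "g \<circ> f"] by (simp add: compose_eq multiset.map_comp)
 thus ?thesis using assms(2,3) unfolding pasture_hom_def by (auto simp: compose_eq zero_closed compose_def PiE_def Pi_def)
qed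

lemma id_compose: assumes "f : pasture_hom P Q" shows "compose (carrier P) (\<lambda>x\<in>carrier Q. x) f = f"
 using pasture_homD[OF assms] by (intro Id_compose)

lemma compose_id: assumes "f : pasture_hom P Q" shows "compose (carrier P) f (\<lambda>x\<in>carrier P. x) = f"
 using pasture_homD[OF assms] by (intro compose_Id)

lemma compose_hom_assoc:
 "f : pasture_hom P Q ==> compose (carrier P) h (compose (carrier P) g f) = compose (carrier P) (compose (carrier Q) h g) f"
 using pasture_homD(3) by (rule compose_assoc)

text \<open>The identity of \<open>F\<close> corresponds to a universal representation
  \<open>\<phi>0\<close>, and the morphism sought is the one that corresponds to
  \<open>res \<phi>0\<close>; naturality gives the condition at all other pastures. It is unique by
  evaluation at the identity. The predicate \<open>D\<close> ranges over all presentations, and the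
  hypothesis on \<open>restrict_class\<close> says that they lead to the same restriction
  \<open>res\<close>.\<close>

lemma induced_morphism:
 assumes N: "matroid N" and S: "matroid S" and F: "is_foundation N F \<eta>" and F': "is_foundation S F' \<eta>'"
  and D: "D I0 J0"
  and RC: "!!I J P \<phi>. D I J ==> pasture P ==> \<phi> : reps N P ==> restrict_class N J I f S P (cross_class N P \<phi>) = cross_class S P (res \<phi>)"
  and res: "!!P \<phi>. pasture P ==> \<phi> : reps N P ==> res \<phi> : reps S P"
  and nat: "!!k \<phi>. res (\<lambda>H e. k (\<phi> H e)) = (\<lambda>H e. k (res \<phi> H e))"
  and g: "g = (THE g. ALL I J. D I J --> corresponds N J I f S F \<eta> F' \<eta>' g)"
 shows "g : pasture_hom F' F"
  "!!P h \<phi>. pasture P ==> h : pasture_hom F P ==> \<phi> : reps N P ==> \<eta> P h = cross_class N P \<phi> ==>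
   \<eta>' P (compose (carrier F') h g) = cross_class S P (res \<phi>)"
proof -
 have pF: "pasture F" and bij: "!!P. pasture P ==> bij_betw (\<eta> P) (pasture_hom F P) (rep_classes N P)"
  and \<eta>_nat: "!!P Q k h. pasture P ==> pasture Q ==> k : pasture_hom P Q ==> h : pasture_hom F P
   ==> \<eta> Q (compose (carrier F) k h) = rep_classes_map N Q k (\<eta> P h)"
  using F unfolding is_foundation_def by blast+
 have bij': "!!P. pasture P ==> bij_betw (\<eta>' P) (pasture_hom F' P) (rep_classes S P)"
  and \<eta>'_nat: "!!P Q k h. pasture P ==> pasture Q ==> k : pasture_hom P Q ==> h : pasture_hom F' P
   ==> \<eta>' Q (compose (carrier F') k h) = rep_classes_map S Q k (\<eta>' P h)"
  using F' unfolding is_foundation_def by blast+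
 interpret N: matroid N by fact
 interpret S: matroid S by fact
 interpret F: pasture F by (rule pF)
 interpret NF: matroid_over N F by unfold_locales
 interpret SF: matroid_over S F by unfold_locales
 define i where "i = (\<lambda>x\<in>carrier F. x)"
 have i: "i : pasture_hom F F" unfolding i_def by (rule id_hom[OF pF])
 obtain \<phi>0 where \<phi>0: "\<phi>0 : reps N F" "\<eta> F i = cross_class N F \<phi>0"
  using bij_betwE[OF bij[OF pF]] i unfolding NF.rep_classes_eq by blast
 note r0 = res[OF pF \<phi>0(1)]
 have "cross_class S F (res \<phi>0) : rep_classes S F" unfolding SF.rep_classes_eq using r0 by blast
 then obtain g0 where g0: "g0 : pasture_hom F' F" "\<eta>' F g0 = cross_class S F (res \<phi>0)"
  using bij'[OF pF] unfolding bij_betw_def by (metis imageE)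
 have id: "compose (carrier F') i k = k" if "k : pasture_hom F' F" for k unfolding i_def by (rule id_compose[OF that])
 have id': "compose (carrier F) k i = k" if "k : pasture_hom F P" for k P unfolding i_def by (rule compose_id[OF that])
 have corr: "corresponds N J I f S F \<eta> F' \<eta>' g0" if D': "D I J" for I J
  unfolding corresponds_def
 proof (intro conjI allI impI g0(1))
  fix P :: "'c pasture" and h assume P: "pasture P" and h: "h : pasture_hom F P"
  have "\<eta> P h = rep_classes_map N P h (\<eta> F i)" using \<eta>_nat[OF pF P h i] id'[OF h] by simp
  also have "\<dots> = cross_class N P (\<lambda>H e. h (\<phi>0 H e))" unfolding \<phi>0(2) by (rule NF.rep_classes_map_class[OF P h \<phi>0(1)])
  finally have 1: "\<eta> P h = cross_class N P (\<lambda>H e. h (\<phi>0 H e))" .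
  have "\<eta>' P (compose (carrier F') h g0) = rep_classes_map S P h (cross_class S F (res \<phi>0))"
   using \<eta>'_nat[OF pF P h g0(1)] g0(2) by simp
  also have "\<dots> = cross_class S P (\<lambda>H e. h (res \<phi>0 H e))" by (rule SF.rep_classes_map_class[OF P h r0])
  also have "\<dots> = restrict_class N J I f S P (\<eta> P h)"
   unfolding 1 using RC[OF D' P NF.map_rep(1)[OF P h \<phi>0(1)]] nat[of h \<phi>0] by simp
  finally show "\<eta>' P (compose (carrier F') h g0) = restrict_class N J I f S P (\<eta> P h)" .
 qed
 have "g = g0" unfolding g
 proof (rule the_equality)
  show "ALL I J. D I J --> corresponds N J I f S F \<eta> F' \<eta>' g0" using corr by blast
  fix k assume "ALL I J. D I J --> corresponds N J I f S F \<eta> F' \<eta>' k"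
  hence k: "corresponds N J0 I0 f S F \<eta> F' \<eta>' k" using D by blast
  hence kh: "k : pasture_hom F' F" by (simp add: corresponds_def)
  have "\<eta>' F (compose (carrier F') i k) = \<eta>' F (compose (carrier F') i g0)"
   using k corr[OF D] i pF by (simp add: corresponds_def)
  hence "\<eta>' F k = \<eta>' F g0" using id[OF kh] id[OF g0(1)] by simp
  thus "k = g0" using bij'[OF pF] kh g0(1) unfolding bij_betw_def by (blast dest: inj_onD)
 qed
 thus "g : pasture_hom F' F" using g0 by simp
 fix P h \<phi> assume P: "pasture P" "h : pasture_hom F P" "\<phi> : reps N P" "\<eta> P h = cross_class N P \<phi>"
 have "\<eta>' P (compose (carrier F') h g) = restrict_class N J0 I0 f S P (\<eta> P h)"
  using corr[OF D] P \<open>g = g0\<close> by (simp add: corresponds_def)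
 thus "\<eta>' P (compose (carrier F') h g) = cross_class S P (res \<phi>)" using RC[OF D P(1,3)] P(4) by simp
qed

lemma (in matroid) induced_to_matroid:
 assumes FM: "is_foundation M FM \<eta>M" and L: "upper_sublattice M L" and FL: "is_foundation (simple_matroid L) FL \<eta>L"
  and g: "g = induced_to_matroid M FM \<eta>M L FL \<eta>L"
 shows "g : pasture_hom FL FM"
  "!!P h \<phi>. pasture P ==> h : pasture_hom FM P ==> \<phi> : reps M P ==> \<eta>M P h = cross_class M P \<phi> ==>
   \<eta>L P (compose (carrier FL) h g) = {\<psi> : reps (simple_matroid L) P. agrees L P \<psi> (cr P \<phi>)}"
proof -
 obtain I J where p: "presents M L I J" using L by (auto simp: upper_sublattice_def)
 interpret L: lattice_presentation M L id I J by (rule presents_lattice[OF p])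
 have RC: "restrict_class M J' I' (\<lambda>e. cl M (e+:(\<Inter>L))) (simple_matroid L) P (cross_class M P \<phi>) = cross_class (simple_matroid L) P (L.emb.restricted \<phi>)"
  if "presents M L I' J'" "pasture P" "\<phi> : reps M P" for I' J' P \<phi>
 proof -
  interpret L': lattice_presentation M L id I' J' by (rule presents_lattice[OF that(1)])
  show ?thesis
   using minor_retraction.restrict_class_eq[OF presents_retraction[OF that(1)] that(2,3)]
    L.restricted_agrees[OF that(2,3)] L'.restricted_agrees[OF that(2,3)] by simp
 qed
 have nat: "L.emb.restricted (\<lambda>H e. k (\<phi> H e)) = (\<lambda>H e. k (L.emb.restricted \<phi> H e))" for k \<phi>
  by (simp add: L.emb.restricted_def)
 note facts = p RC L.emb.restricted_rep nat g[unfolded induced_to_matroid_def]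
 show "g : pasture_hom FL FM"
  by (rule induced_morphism(1)[OF matroid_axioms L.emb.S.matroid_axioms FM FL, where res = L.emb.restricted and D = "presents M L"])
   (fact facts)+
 show "\<eta>L P (compose (carrier FL) h g) = {\<psi> : reps (simple_matroid L) P. agrees L P \<psi> (cr P \<phi>)}"
  if "pasture P" "h : pasture_hom FM P" "\<phi> : reps M P" "\<eta>M P h = cross_class M P \<phi>" for P h \<phi>
 proof -
  have "\<eta>L P (compose (carrier FL) h g) = cross_class (simple_matroid L) P (L.emb.restricted \<phi>)"
   by (rule induced_morphism(2)[OF matroid_axioms L.emb.S.matroid_axioms FM FL, where res = L.emb.restricted and D = "presents M L"])
    (fact facts that)+
  thus ?thesis using L.restricted_agrees[OF that(1,3)] by simp
 qed
qed

lemma (in matroid) induced_to_sublattice: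
 assumes L: "upper_sublattice M L" and FL: "is_foundation (simple_matroid L) FL \<eta>L"
  and L': "upper_sublattice M L'" and FL': "is_foundation (simple_matroid L') FL' \<eta>L'"
  and inc: "L' <= L" "upper_sublattice (simple_matroid L) (atoms_below L ` L')"
  and g: "g = induced_to_sublattice M L FL \<eta>L L' FL' \<eta>L'"
 shows "g : pasture_hom FL' FL"
  "!!P h \<phi>. pasture P ==> h : pasture_hom FL P ==> \<phi> : reps (simple_matroid L) P ==> \<eta>L P h = cross_class (simple_matroid L) P \<phi> ==>
   \<eta>L' P (compose (carrier FL') h g) = {\<psi> : reps (simple_matroid L') P. agrees L' P \<psi>
    (cr_in P \<phi> L)}"
proof -
 obtain I0 J0 where p0: "presents M L I0 J0" using L by (auto simp: upper_sublattice_def)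
 obtain I1 J1 where p1: "presents M L' I1 J1" using L' by (auto simp: upper_sublattice_def)
 obtain I J where p: "presents (simple_matroid L) (atoms_below L ` L') I J" using inc(2) by (auto simp: upper_sublattice_def)
 interpret L0: lattice_presentation M L id I0 J0 by (rule presents_lattice[OF p0])
 interpret L: lattice_presentation "simple_matroid L" L' "atoms_below L" I J by (rule inclusion_lattice(1)[OF p0 p1 inc(1) p])
 have RC: "restrict_class (simple_matroid L) J' I' (\<lambda>A. cl M (A Un \<Inter>L')) (simple_matroid L') P (cross_class (simple_matroid L) P \<phi>)
   = cross_class (simple_matroid L') P (L.emb.restricted \<phi>)"
  if "presents (simple_matroid L) (atoms_below L ` L') I' J'" "pasture P" "\<phi> : reps (simple_matroid L) P" for I' J' P \<phi>
 proof -
  interpret L': lattice_presentation "simple_matroid L" L' "atoms_below L" I' J' by (rule inclusion_lattice(1)[OF p0 p1 inc(1) that(1)])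
  show ?thesis
   using minor_retraction.restrict_class_eq[OF inclusion_lattice(2)[OF p0 p1 inc(1) that(1)] that(2,3)]
    L.restricted_agrees[OF that(2,3)] L'.restricted_agrees[OF that(2,3)] by simp
 qed
 have nat: "L.emb.restricted (\<lambda>H e. k (\<phi> H e)) = (\<lambda>H e. k (L.emb.restricted \<phi> H e))" for k \<phi>
  by (simp add: L.emb.restricted_def)
 note facts = p RC L.emb.restricted_rep nat g[unfolded induced_to_sublattice_def]
 show "g : pasture_hom FL' FL"
  by (rule induced_morphism(1)[OF L0.emb.S.matroid_axioms L.emb.S.matroid_axioms FL FL', where res = L.emb.restricted
    and D = "presents (simple_matroid L) (atoms_below L ` L')"]) (fact facts)+
 show "\<eta>L' P (compose (carrier FL') h g) = {\<psi> : reps (simple_matroid L') P. agrees L' P \<psi>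
    (cr_in P \<phi> L)}"
  if "pasture P" "h : pasture_hom FL P" "\<phi> : reps (simple_matroid L) P" "\<eta>L P h = cross_class (simple_matroid L) P \<phi>" for P h \<phi>
  unfolding L.restricted_agrees[OF that(1,3), symmetric]
  by (rule induced_morphism(2)[OF L0.emb.S.matroid_axioms L.emb.S.matroid_axioms FL FL', where res = L.emb.restricted
    and D = "presents (simple_matroid L) (atoms_below L ` L')"]) (fact facts that)+
qed

section \<open>From patterns of bases to special sublattices\<close>

definition simple_pattern :: "nat set set => nat => bool" where
 "simple_pattern T n \<longleftrightarrow> T <= Pow {1..n} & (ALL i:{1..n}. ALL j:{1..n}. EX X:T. i : X & j : X) & (ALL i:{1..n}. EX X:T. i ~: X)"

lemma simple_patternI:
 assumes "T <= Pow {1..n}" "W <= T" "ALL i:{1..n}. ALL j:{1..n}. EX X:W. i : X & j : X" "ALL i:{1..n}. EX X:W. i ~: X"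
 shows "simple_pattern T n"
 using assms unfolding simple_pattern_def by (meson subsetD)

text \<open>The special matroids have no loops, parallel pairs or coloops. The first two make the
  elements of a pattern correspond to the atoms of a sublattice; the absence of coloops is used in
  \<open>special_solves\<close>.\<close>

lemma special_simple_pattern: "(T, n) : special_bases ==> simple_pattern T n"
proof -
 have n: "{1..4::nat} = {1,2,3,4}" "{1..5::nat} = {1,2,3,4,5}" "{1..7::nat} = {1,2,3,4,5,6,7}" by auto
 \<comment> \<open>These bases are chosen so that any two elements lie together in one of them and
   together outside another; hence their complements do the same for the dual.\<close>
 let ?F = "{{1,2,4},{1,3,5},{1,2,6},{1,3,7},{2,3,4},{2,3,5},{2,3,6},{2,3,7},{4,5,6},{4,5,7},{5,6,7},{1,4,7}} :: nat set set"
 have U: "uniform_bases r n <= Pow {1..n}" "uniform_bases r n - Y <= Pow {1..n}" for r n Y by (auto simp: uniform_bases_def)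
 have F: "?F <= Fano_bases"
  unfolding Fano_bases_def uniform_bases_def Fano_lines_def by (simp add: set_eq_subset)
 have "simple_pattern (uniform_bases 2 4) 4"
  by (rule simple_patternI[OF U(1), of "{{1,2},{1,3},{1,4},{2,3},{2,4},{3,4}}"]) (simp_all add: uniform_bases_def n set_eq_subset del: One_nat_def)
 moreover have "simple_pattern (uniform_bases 2 5) 5"
  by (rule simple_patternI[OF U(1), of "{{1,2},{1,3},{1,4},{1,5},{2,3},{2,4},{2,5},{3,4},{3,5},{4,5}}"]) (simp_all add: uniform_bases_def n set_eq_subset del: One_nat_def)
 moreover have "simple_pattern (uniform_bases 3 5) 5"
  by (rule simple_patternI[OF U(1), of "{{1,2,4},{1,2,5},{1,3,4},{1,3,5},{2,3,4},{2,3,5},{1,4,5}}"]) (simp_all add: uniform_bases_def n set_eq_subset del: One_nat_def)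
 moreover have "simple_pattern (uniform_bases 3 5 - {{1,2,3}}) 5"
  by (rule simple_patternI[OF U(2), of "{{1,2,4},{1,2,5},{1,3,4},{1,3,5},{2,3,4},{2,3,5},{1,4,5}}"]) (simp_all add: uniform_bases_def n set_eq_subset del: One_nat_def)
 moreover have "simple_pattern Fano_bases 7"
 proof (rule simple_patternI[OF _ F])
  show "Fano_bases <= Pow {1..7}" by (auto simp: Fano_bases_def uniform_bases_def)
 qed (simp_all add: n del: One_nat_def)
 moreover have "simple_pattern (dual_family {1..7} Fano_bases) 7"
 proof (rule simple_patternI)
  show "dual_family {1..7} Fano_bases <= Pow {1..7}" by (auto simp: dual_family_def)
  show "dual_family {1..7} ?F <= dual_family {1..7} Fano_bases" using F unfolding dual_family_def by (rule image_mono)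
 qed (simp_all add: n dual_family_def del: One_nat_def)
 moreover assume "(T, n) : special_bases"
 ultimately show ?thesis unfolding special_bases_def by auto
qed

lemma (in matroid_embedding) basis_eq: "basis S X \<longleftrightarrow> X <= ground S & basis N (I Un e ` X)"
 using indep_iff[of X] card_union[of X] rank_eq unfolding S.basis_iff N.basis_iff by auto

lemma basis_of_bases:
 assumes "!!B. B : T ==> finite B & card B = r"
 shows "basis (matroid_of_bases E T) B \<longleftrightarrow> B : T"
proof
 assume b: "basis (matroid_of_bases E T) B"
 then obtain B' where B': "B' : T" "B <= B'" by (auto simp: basis_def matroid_of_bases_def)
 hence "B' = B" using b by (auto simp: basis_def matroid_of_bases_def)
 thus "B : T" using B' by simp
next
 assume B: "B : T"
 have "X = B" if "B' : T" "X <= B'" "B <= X" for B' X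
  using card_subset_eq[of B' B] assms[OF B] assms[OF that(1)] that by auto
 thus "basis (matroid_of_bases E T) B" using B by (auto simp: basis_def matroid_of_bases_def)
qed

lemma dual_Fano: "dual_matroid Fano_matroid = matroid_of_bases {1..7} (dual_family {1..7} Fano_bases)"
proof -
 have F: "Fano_matroid = matroid_of_bases {1..7} Fano_bases"
  by (simp add: Fano_matroid_def Fano_bases_def uniform_bases_def Fano_lines_def)
 have b: "basis Fano_matroid B \<longleftrightarrow> B : Fano_bases" for B
  unfolding F by (rule basis_of_bases[where r = 3]) (auto simp: Fano_bases_def uniform_bases_def intro: finite_subset)
 have "X <= {1..7} & (EX B:Fano_bases. X Int B = {}) \<longleftrightarrow> (EX B:Fano_bases. X <= {1..7} - B)" for X :: "nat set"
  by blast
 thus ?thesis unfolding dual_matroid_def b unfolding F by (simp add: matroid_of_bases_def dual_family_def Bex_def)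
qed

lemma special_type:
 assumes "(T, n) : special_bases" "has_type L (matroid_of_bases {1..n} T)" "upper_sublattice M L"
 shows "L : special_sublattices M"
proof -
 have "matroid_of_bases {1..n} T : {uniform_matroid 2 4, uniform_matroid 2 5, uniform_matroid 3 5, C5_matroid, Fano_matroid, dual_matroid Fano_matroid}"
  using assms(1) unfolding special_bases_def dual_Fano
  by (auto simp: uniform_matroid_def C5_matroid_def Fano_matroid_def Fano_bases_def uniform_bases_def Fano_lines_def)
 thus ?thesis using assms(2,3) unfolding special_sublattices_def by auto
qed

context matroid
begin

text \<open>Contract \<open>Z\<close> and delete everything outside \<open>Z\<close> and the
  \<open>x i\<close>. As the pattern is simple, different \<open>x i\<close> span different atoms,
  and \<open>x i\<close> is the only representative that its atom can have.\<close>

lemma pattern_lattice: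
 assumes T: "simple_pattern T n" and n: "1 <= n" and inj: "inj_on x {1..n}" and dis: "x ` {1..n} Int Z = {}"
  and bases: "!!B. Z <= B ==> B <= Z Un x ` {1..n} ==> basis M B \<longleftrightarrow> (EX X:T. B = Z Un x ` X)"
  and L: "L = {cl M S | S. Z <= S & S <= Z Un x ` {1..n}}" and J: "J = ground M - (Z Un x ` {1..n})"
 shows "presents M L Z J" "has_type L (matroid_of_bases {1..n} T)" "lattice_presentation.e M id Z J ` atoms L = x ` {1..n}"
proof -
 have T': "!!X. X : T ==> X <= {1..n}" and pair: "!!i k. i : {1..n} ==> k : {1..n} ==> EX X:T. i : X & k : X"
  using T by (auto simp: simple_pattern_def)
 have b: "indep M (Z Un x ` X)" "card (Z Un x ` X) = \<rho>" if "X : T" for X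
 proof -
  have "basis M (Z Un x ` X)" using bases[of "Z Un x ` X"] T'[OF that] that by blast
  thus "indep M (Z Un x ` X)" "card (Z Un x ` X) = \<rho>" by (auto simp: basis_iff)
 qed
 have pair_indep: "indep M ((x i)+:(x k)+:Z)" if ik: "i : {1..n}" "k : {1..n}" for i k
 proof -
  obtain X where X: "X : T" "i : X" "k : X" using pair[OF ik] by blast
  show ?thesis by (rule indep_subset[OF b(1)[OF X(1)]]) (use X in blast)
 qed
 have sub: "Z Un x ` {1..n} <= ground M"
 proof -
  have "((x i)+:Z) <= ground M" if "i : {1..n}" for i using indep_subset_ground[OF pair_indep[OF that that]] by simp
  moreover have "1 : {1..n}" using n by simp
  ultimately show ?thesis by blast
 qed
 have Z: "indep M Z" using indep_subset[OF pair_indep[of 1 1], of Z] n by auto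
 obtain X0 where X0: "X0 : T" using pair[of 1 1] n by auto
 have span: "cl M (Z Un x ` {1..n}) = ground M"
 proof -
  have "Z Un x ` X0 <= ground M" using sub T'[OF X0] by blast
  hence "cl M (ground M) = cl M (Z Un x ` X0)" by (rule cl_basis[OF b(1)[OF X0] _ b(2)[OF X0]])
  also have "\<dots> <= cl M (Z Un x ` {1..n})" by (rule cl_mono) (use T'[OF X0] in blast)
  finally show ?thesis using cl_superset[of "ground M"] cl_sub by blast
 qed
 have gJ: "ground M - J = Z Un x ` {1..n}" using J sub by blast
 show pr: "presents M L Z J" unfolding presents_def gJ
  using Z sub span L J by auto
 interpret L: lattice_presentation M L id Z J by (rule presents_lattice[OF pr])
 have pts: "x i : L.pts" if i: "i : {1..n}" for i
 proof -
  have "x i ~: Z" using dis i by blast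
  moreover have "indep M ((x i)+:Z)" using pair_indep[OF i i] by simp
  ultimately have "x i ~: cl M Z" using cl_indep[OF Z] by blast
  thus ?thesis unfolding L.pts_def gJ using i by blast
 qed
 have "L.pts <= x ` {1..n}" unfolding L.pts_def gJ using cl_superset[OF L.IJ(1)] by blast
 hence e_in: "L.e A : x ` {1..n}" if "A : atoms L" for A using L.e(1)[OF that] by blast
 have e_at: "EX A:atoms L. L.e A = x i" if i: "i : {1..n}" for i
 proof -
  obtain A where A: "A : L" "id A = cl M ((x i)+:Z)" using L.pts_L[OF pts[OF i]] by blast
  hence at: "A : atoms L" using L.atomI[OF A(1) pts[OF i]] by simp
  obtain k where k: "k : {1..n}" "L.e A = x k" using e_in[OF at] by blast
  have "x k : ground M" using k(1) sub by blast
  hence "x k : cl M ((x i)+:Z)"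
   using L.e(2)[OF at] A(2) cl_ext[of "x k" "((x k)+:Z)"] k(2) by simp
  moreover have "indep M ((x i)+:Z)" using pair_indep[OF i i] by simp
  ultimately have "x k : ((x i)+:Z)" using cl_indep pair_indep[OF k(1) i] by blast
  hence "x k = x i" using dis k(1) by blast
  thus ?thesis using at k by metis
 qed
 show e_img: "L.e ` atoms L = x ` {1..n}"
  using e_in e_at by (auto simp: image_iff) metis
 define f where "f A = inv_into {1..n} x (L.e A)" for A
 have xf: "x (f A) = L.e A" "f A : {1..n}" if "A : atoms L" for A
  unfolding f_def using e_in[OF that] f_inv_into_f inv_into_into by metis+
 have "bij_betw f (atoms L) {1..n}" unfolding bij_betw_def
 proof
  show "inj_on f (atoms L)" using xf(1) L.e_inj by (metis inj_onI inj_onD)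
  have "i : f ` atoms L" if i: "i : {1..n}" for i
  proof -
   obtain A where A: "A : atoms L" "L.e A = x i" using e_at[OF i] by blast
   hence "f A = i" using xf[OF A(1)] inj_onD[OF inj] i by metis
   thus ?thesis using A by blast
  qed
  thus "f ` atoms L = {1..n}" using xf(2) by blast
 qed
 moreover have "indep (simple_matroid L) X \<longleftrightarrow> indep (matroid_of_bases {1..n} T) (f ` X)" if X: "X <= atoms L" for X
 proof -
  have eX: "L.e ` X = x ` f ` X" using xf(1) X by (force simp: image_image)
  have fX: "f ` X <= {1..n}" using xf(2) X by blast
  have "indep M (Z Un x ` f ` X) \<longleftrightarrow> (EX B:T. f ` X <= B)"
  proof
   assume i: "indep M (Z Un x ` f ` X)"
   have "Z Un x ` f ` X <= Z Un x ` {1..n}" using fX by blast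
   from extend_indep[OF i this] obtain B where B: "Z Un x ` f ` X <= B" "B <= Z Un x ` {1..n}" "indep M B" "card B = rk M (Z Un x ` {1..n})" .
   have "rk M (Z Un x ` {1..n}) = \<rho>" using rk_cl[of "Z Un x ` {1..n}"] span by simp
   hence "basis M B" using B by (simp add: basis_iff)
   moreover have "Z <= B" using B by blast
   ultimately obtain X' where X': "X' : T" "B = Z Un x ` X'" using bases[of B] B(2) by blast
   have "f ` X <= X'"
   proof
    fix i assume iX: "i : f ` X"
    hence i: "i : {1..n}" using fX by blast
    hence "x i : x ` X'" using B(1) X'(2) dis iX by blast
    thus "i : X'" using inj_onD[OF inj] i T'[OF X'(1)] by blast
   qed
   thus "EX B:T. f ` X <= B" using X'(1) by blast
  next
   assume "EX B:T. f ` X <= B"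
   then obtain B where B: "B : T" "f ` X <= B" by blast
   show "indep M (Z Un x ` f ` X)" by (rule indep_subset[OF b(1)[OF B(1)]]) (use B in blast)
  qed
  thus ?thesis using L.simple_indep_iff[of X] X eX by (simp add: matroid_of_bases_def)
 qed
 ultimately show "has_type L (matroid_of_bases {1..n} T)"
  unfolding has_type_def matroid_isomorphic_def L.ground_simple by (auto simp: matroid_of_bases_def)
qed

definition quad_sublattice :: "'a set => 'a set => 'a set => 'a set => 'a set set" where
 "quad_sublattice H1 H2 H3 H4 = {H1 Int H2, H1, H2, H3, H4, ground M}"

text \<open>Over a basis \<open>T\<close> of the common flat, one point from each of the four
  hyperplanes gives four elements, any two of which complete \<open>T\<close> to a basis.\<close>

lemma quad_lattice:
 assumes q: "quad M H1 H2 H3 H4"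
 shows "upper_sublattice M (quad_sublattice H1 H2 H3 H4)" "has_type (quad_sublattice H1 H2 H3 H4) (matroid_of_bases {1..4} (uniform_bases 2 4))"
proof -
 obtain F where p: "pencil M F H1 H2 H3" "pencil M F H1 H2 H4" "H3 ~= H4" using q by (auto simp: quad_def)
 obtain T where T: "line T" "F = cl M T" using p(1) unfolding pencil_def corank2_iff by blast
 define H where "H i = [H1, H2, H3, H4] ! (i - 1)" for i :: nat
 have H: "H 1 = H1" "H 2 = H2" "H 3 = H3" "H 4 = H4" by (simp_all add: H_def)
 have four: "{1..4::nat} = {1,2,3,4}" by auto
 have Hi: "H i : hyperplanes M & cl M T <= H i" if "i : {1..4}" for i
  using that p unfolding four pencil_def T(2)[symmetric] by (elim insertE emptyE) (simp_all add: H del: One_nat_def)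
 have Hinj: "inj_on H {1..4}" using p unfolding four pencil_def by (simp add: H del: One_nat_def)
 have "EX a. a : ground M & a ~: cl M T & H i = cl M (a+:T)" if "i : {1..4}" for i
  using line_hyperplane[OF T(1), of "H i"] Hi[OF that] by metis
 then obtain x where x: "!!i. i : {1..4} ==> x i : ground M & x i ~: cl M T & H i = cl M ((x i)+:T)" by metis
 have pair: "basis M ((x i)+:(x k)+:T)" if "i : {1..4}" "k : {1..4}" "i ~= k" for i k
  using line_basis[OF T(1), of "x i" "x k"] line_cl_eq[OF T(1), of "x i" "x k"] x[OF that(1)] x[OF that(2)] inj_onD[OF Hinj _ that(1,2)] that(3) by metis
 have Tg: "T <= ground M" "finite T" "card T + 2 = \<rho>" "indep M T" using T(1) indep_subset_ground indep_finite by (auto simp: line_def)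
 have xT: "x i ~: T" if "i : {1..4}" for i using x[OF that] cl_superset[OF Tg(1)] by blast
 have inj: "inj_on x {1..4}" by (rule inj_onI) (use x inj_onD[OF Hinj] in metis)
 have ln: "(uniform_bases 2 4, 4) : special_bases" by (simp add: special_bases_def)
 have bases: "basis M B \<longleftrightarrow> (EX X:uniform_bases 2 4. B = T Un x ` X)" if B: "T <= B" "B <= T Un x ` {1..4}" for B
 proof
  assume b: "basis M B"
  define X where "X = {i : {1..4}. x i : B}"
  have B_eq: "B = T Un x ` X" using B by (auto simp: X_def)
  have "card (x ` X) = card X" by (rule card_image[OF inj_on_subset[OF inj]]) (auto simp: X_def)
  moreover have "card B = card T + card (x ` X)" unfolding B_eq
   by (rule card_Un_disjoint) (use Tg(2) xT in \<open>auto simp: X_def\<close>)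
  ultimately have "card X = 2" using b Tg(3) by (simp add: basis_iff)
  moreover have "X <= {1..4}" by (auto simp: X_def)
  ultimately have "X : uniform_bases 2 4" by (simp add: uniform_bases_def)
  thus "EX X:uniform_bases 2 4. B = T Un x ` X" using B_eq by (rule rev_bexI)
 next
  assume "EX X:uniform_bases 2 4. B = T Un x ` X"
  then obtain X where X: "X <= {1..4}" "card X = 2" "B = T Un x ` X" by (auto simp: uniform_bases_def)
  then obtain i k where ik: "X = {i, k}" "i ~= k" unfolding card_2_iff by blast
  have "B = ((x i)+:(x k)+:T)" using X(3) ik by auto
  thus "basis M B" using pair[of i k] X(1) ik by simp
 qed
 have L: "quad_sublattice H1 H2 H3 H4 = {cl M S | S. T <= S & S <= T Un x ` {1..4}}"
 proof (intro equalityI subsetI)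
  fix G assume "G : quad_sublattice H1 H2 H3 H4"
  then consider "G = H1 Int H2" | "G : H ` {1..4}" | "G = ground M" unfolding quad_sublattice_def four by (auto simp: H simp del: One_nat_def)
  thus "G : {cl M S | S. T <= S & S <= T Un x ` {1..4}}"
  proof cases
   case 1
   hence "G = cl M T" using pencil_meet(1)[OF p(1)] T by simp
   thus ?thesis by blast
  next
   case 2
   then obtain i where i: "i : {1..4}" "G = H i" by blast
   hence "G = cl M ((x i)+:T)" using x by blast
   moreover have "T <= ((x i)+:T)" "((x i)+:T) <= T Un x ` {1..4}" using i by auto
   ultimately show ?thesis by blast
  next
   case 3
   have "basis M ((x 1)+:(x 2)+:T)" by (rule pair) auto
   hence bb: "indep M ((x 1)+:(x 2)+:T)" "card ((x 1)+:(x 2)+:T) = \<rho>" by (auto simp: basis_iff)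
   hence "cl M (ground M) = cl M ((x 1)+:(x 2)+:T)" using cl_basis[OF bb(1) indep_subset_ground[OF bb(1)]] by simp
   hence "G = cl M ((x 1)+:(x 2)+:T)" using 3 cl_superset[of "ground M"] cl_sub by blast
   moreover have "((x 1)+:(x 2)+:T) <= T Un x ` {1..4}" "T <= ((x 1)+:(x 2)+:T)" by auto
   ultimately show ?thesis by blast
  qed
 next
  fix G assume "G : {cl M S | S. T <= S & S <= T Un x ` {1..4}}"
  then obtain S where S: "T <= S" "S <= T Un x ` {1..4}" "G = cl M S" by blast
  have Sg: "S <= ground M" using S(2) Tg(1) x by blast
  consider "S = T" | i where "i : {1..4}" "S = ((x i)+:T)" | i k where "i : {1..4}" "k : {1..4}" "i ~= k" "x i : S" "x k : S"
  proof (cases "EX i k. i : {1..4} & k : {1..4} & i ~= k & x i : S & x k : S")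
   case False
   show thesis
   proof (cases "S = T")
    case nST: False
    then obtain y where y: "y : S" "y ~: T" using S(1) by blast
    then obtain i where i: "i : {1..4}" "y = x i" using S(2) by blast
    have "S <= ((x i)+:T)"
    proof
    fix z assume z: "z : S"
    show "z : ((x i)+:T)"
    proof (cases "z : T")
    case zT: False
    then obtain k where "k : {1..4}" "z = x k" using S(2) z by blast
    hence "k = i" using False i y z by blast
    thus ?thesis using \<open>z = x k\<close> by simp
    qed simp
    qed
    hence "S = ((x i)+:T)" using S(1) y i by blast
    thus thesis using that(2) i by blast
   qed (use that(1) in blast)
  qed (use that(3) in blast)
  thus "G : quad_sublattice H1 H2 H3 H4"
  proof cases
   case 1
   thus ?thesis using S(3) pencil_meet(1)[OF p(1)] T by (simp add: quad_sublattice_def)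
  next
   case 2
   hence "G = H i" using x S(3) by blast
   hence "G : H ` {1..4}" using 2 by blast
   thus ?thesis unfolding four image_insert H quad_sublattice_def by blast
  next
   case 3
   have bb: "indep M ((x i)+:(x k)+:T)" "card ((x i)+:(x k)+:T) = \<rho>"
    using pair[OF 3(1-3)] by (auto simp: basis_iff)
   have "cl M (ground M) = cl M ((x i)+:(x k)+:T)" using cl_basis[OF bb(1) indep_subset_ground[OF bb(1)]] bb(2) by simp
   also have "\<dots> <= cl M S" by (rule cl_mono) (use 3 S in blast)
   finally have "G = ground M" using S(3) cl_superset[of "ground M"] cl_sub by blast
   thus ?thesis by (simp add: quad_sublattice_def)
  qed
 qed
 have dis: "x ` {1..4} Int T = {}" using xT by blast
 note l = pattern_lattice[OF special_simple_pattern[OF ln] _ inj dis bases L refl]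
 show "upper_sublattice M (quad_sublattice H1 H2 H3 H4)" unfolding upper_sublattice_def using l(1) by auto
 show "has_type (quad_sublattice H1 H2 H3 H4) (matroid_of_bases {1..4} (uniform_bases 2 4))" using l(2) by simp
qed

lemma quad_special: "quad M H1 H2 H3 H4 ==> quad_sublattice H1 H2 H3 H4 : special_sublattices M"
 using quad_lattice by (intro special_type[of "uniform_bases 2 4" 4]) (simp_all add: special_bases_def)

end

context lattice_presentation
begin

lemma pencil_below:
 assumes "pencil N (g G) (g F1) (g F2) (g F3)" and L: "G : L" "F1 : L" "F2 : L" "F3 : L"
 shows "pencil (simple_matroid L) (atoms_below L G) (atoms_below L F1) (atoms_below L F2) (atoms_below L F3)"
proof -
 have "atoms_below L A = atoms_below L B \<longleftrightarrow> A = B" if "A : L" "B : L" for A B using below_mono[OF that] below_mono[OF that(2,1)] by blast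
 thus ?thesis using assms order[of G] L below_corank below_mono unfolding pencil_def hyperplanes_def by auto
qed

end

text \<open>The common flat of four hyperplanes in \<open>L\<close> may be missing from
  \<open>L\<close>, since joins in \<open>L\<close> are those of flats of \<open>M\<close> but meets
  need not be. Hence the extra condition.\<close>

lemma (in matroid) quad_below_iff:
 assumes L: "presents M L I J" and F: "F1 : L" "F2 : L" "F3 : L" "F4 : L"
 shows "quad_in L F1 F2 F3 F4 \<longleftrightarrow> quad M F1 F2 F3 F4 & F1 Int F2 : L"
proof -
 interpret L: lattice_presentation M L id I J by (rule presents_lattice[OF L])
 show ?thesis
 proof
  assume q: "quad_in L F1 F2 F3 F4"
  then obtain F where p: "pencil (simple_matroid L) F (atoms_below L F1) (atoms_below L F2) (atoms_below L F3)" by (auto simp: quad_def)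
  hence "flat (simple_matroid L) F" by (simp add: pencil_def flat_of_corank_def)
  then obtain G where G: "G : L" "atoms_below L G = F" using L.flat_below by blast
  have "pencil M G F1 F2 F3" using L.emb.j_pencil[OF p] L.j_below F G by auto
  hence "F1 Int F2 = G" by (rule pencil_meet)
  thus "quad M F1 F2 F3 F4 & F1 Int F2 : L" using L.quad_g[OF F q] G by simp
 next
  assume q: "quad M F1 F2 F3 F4 & F1 Int F2 : L"
  then obtain F where p: "pencil M F F1 F2 F3" "pencil M F F1 F2 F4" "F3 ~= F4" by (auto simp: quad_def)
  have "F : L" using pencil_meet(1)[OF p(1)] q by simp
  hence "pencil (simple_matroid L) (atoms_below L F) (atoms_below L F1) (atoms_below L F2) (atoms_below L F3)"
   "pencil (simple_matroid L) (atoms_below L F) (atoms_below L F1) (atoms_below L F2) (atoms_below L F4)"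
   using L.pencil_below[of F F1 F2 F3] L.pencil_below[of F F1 F2 F4] p F by auto
  moreover have "atoms_below L F3 ~= atoms_below L F4" using L.below_mono[OF F(3,4)] L.below_mono[OF F(4,3)] p(3) by blast
  ultimately show "quad_in L F1 F2 F3 F4"
   unfolding quad_def by blast
 qed
qed

lemma (in matroid) quad_sublattice_quad:
 assumes q: "quad M H1 H2 H3 H4" and L: "L = quad_sublattice H1 H2 H3 H4"
 shows "quad_in L H1 H2 H3 H4"
proof -
 obtain I J where "presents M L I J" using quad_lattice(1)[OF q] L by (auto simp: upper_sublattice_def)
 from quad_below_iff[OF this, of H1 H2 H3 H4] q show ?thesis unfolding L quad_sublattice_def by simp
qed

text \<open>Every cross ratio of a special sublattice is thus seen by an arrow of the diagram that
  starts at a sublattice of type U_{2,4}.\<close>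

lemma (in matroid) quad_inclusion:
 assumes L: "L : special_sublattices M" and F: "F1 : L" "F2 : L" "F3 : L" "F4 : L"
  and q: "quad_in L F1 F2 F3 F4"
 shows "(quad_sublattice F1 F2 F3 F4, L) : special_inclusions M" "quad M F1 F2 F3 F4"
proof -
 obtain I J where p: "presents M L I J" using L by (auto simp: special_sublattices_def upper_sublattice_def)
 interpret L: lattice_presentation M L id I J by (rule presents_lattice[OF p])
 note q' = quad_below_iff[OF p F, THEN iffD1, OF q]
 thus "quad M F1 F2 F3 F4" by blast
 have "ground M : L" using L.mem_L[of "ground M - J"] L.IJ by auto
 hence sub: "quad_sublattice F1 F2 F3 F4 <= L" using q' F by (simp add: quad_sublattice_def)
 have "atoms_below L (F1 Int F2) = atoms_below L F1 Int atoms_below L F2" by (auto simp: atoms_below_def)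
 moreover have "atoms_below L (ground M) = ground (simple_matroid L)"
  using L.atoms_L L.g_super(2) cl_sub unfolding atoms_below_def L.ground_simple by fastforce
 ultimately have "atoms_below L ` quad_sublattice F1 F2 F3 F4 =
   matroid.quad_sublattice (simple_matroid L) (atoms_below L F1) (atoms_below L F2) (atoms_below L F3) (atoms_below L F4)"
  unfolding quad_sublattice_def L.emb.S.quad_sublattice_def by simp
 hence "upper_sublattice (simple_matroid L) (atoms_below L ` quad_sublattice F1 F2 F3 F4)"
  using L.emb.S.quad_lattice(1)[OF q] by simp
 thus "(quad_sublattice F1 F2 F3 F4, L) : special_inclusions M"
  unfolding special_inclusions_def using quad_special q' L sub by auto
qed

lemma quad_perm:
 assumes "quad M H1 H2 H3 H4" shows "quad M H1 H2 H4 H3" "quad M H3 H4 H1 H2"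
proof -
 obtain F where p: "pencil M F H1 H2 H3" "pencil M F H1 H2 H4" "H3 ~= H4" using assms by (auto simp: quad_def)
 thus "quad M H1 H2 H4 H3" unfolding quad_def by metis
 have "pencil M F H3 H4 H1" "pencil M F H3 H4 H2" "H1 ~= H2" using p by (simp_all add: pencil_def not_sym)
 thus "quad M H3 H4 H1 H2" unfolding quad_def by metis
qed

section \<open>Symmetries of cross ratios, and gluing of compatible representations\<close>

context matroid_over
begin

lemma cr_swap:
 assumes \<phi>: "\<phi> : reps M P" and q: "quad M H1 H2 H3 H4"
 shows "lg (cr P \<phi> H1 H2 H4 H3) \<doteq> - lg (cr P \<phi> H1 H2 H3 H4)"
proof -
 obtain F where p: "pencil M F H1 H2 H3" "pencil M F H1 H2 H4" using q by (auto simp: quad_def)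
 obtain x y where x: "x : H3 - F" and y: "y : H4 - F" using pencil_third[OF p(1)] pencil_third[OF p(2)] by auto
 show ?thesis by (rule cg_lin2[OF cr_eq[OF \<phi> p(2,1) y x] cr_eq[OF \<phi> p x y]]) simp
qed

text \<open>The two cross ratios differ by two instances of \<open>rep_tri\<close>, for
  \<open>H1, H2, H3\<close> and for \<open>H1, H2, H4\<close>, whose signs cancel.\<close>

lemma cr_flip:
 assumes \<phi>: "\<phi> : reps M P" and q: "quad M H1 H2 H3 H4"
 shows "cr P \<phi> H3 H4 H1 H2 = cr P \<phi> H1 H2 H3 H4"
proof -
 obtain F where p: "pencil M F H1 H2 H3" "pencil M F H1 H2 H4" "H3 ~= H4" using q by (auto simp: quad_def)
 hence p': "pencil M F H3 H4 H1" "pencil M F H3 H4 H2" by (simp_all add: pencil_def not_sym)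
 obtain x y where x: "x : H3 - F" and y: "y : H4 - F" using pencil_third[OF p(1)] pencil_third[OF p(2)] by auto
 obtain a b where a: "a : H1 - F" and b: "b : H2 - F" using pencil_third[OF p'(1)] pencil_third[OF p'(2)] by auto
 have "lg (cr P \<phi> H3 H4 H1 H2) \<doteq> lg (cr P \<phi> H1 H2 H3 H4)"
  by (rule cg_lin4[OF cr_eq[OF \<phi> p' a b] cg_sym[OF cr_eq[OF \<phi> p(1,2) x y]]
   cg_sym[OF rep_tri[OF \<phi> p(1) a b x]] rep_tri[OF \<phi> p(2) a b y]]) simp
 thus ?thesis using cr_nonzero[of \<phi> H3 H4 H1 H2] cr_nonzero[of \<phi> H1 H2 H3 H4] by (simp add: cg_iff ev_lg)
qed

end

text \<open>Representations \<open>\<psi> L\<close> of the special sublattices, compatible with the inclusions, are glued to one of \<open>M\<close>.\<close>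

locale compatible_family = matroid_over M P for M :: "'a matroid" and P :: "'u pasture" (structure) +
 fixes \<psi> :: "'a set set => ('a set, 'u) rep"
 assumes \<psi>_rep: "L : special_sublattices M ==> \<psi> L : reps (simple_matroid L) P"
  and compat: "(L', L) : special_inclusions M ==>
   agrees L' P (\<psi> L') (cr_in P (\<psi> L) L)"
begin

text \<open>The cross ratio is read off in the sublattice of type U_{2,4} that belongs to the four
  hyperplanes. Its bottom is written symmetrically as their common intersection;
  \<open>quad_meet\<close> identifies it with \<open>H1 Int H2\<close>.\<close>

definition \<chi> :: "'a set => 'a set => 'a set => 'a set => 'u" where
 "\<chi> H1 H2 H3 H4 = (let L = ((H1 Int H2 Int H3 Int H4)+:{H1, H2, H3, H4, ground M}) in
  cr_in P (\<psi> L) L H1 H2 H3 H4)"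

abbreviation "\<B> \<equiv> Collect (basis M)"

lemma quad_meet: assumes "quad M H1 H2 H3 H4" shows "H1 Int H2 Int H3 Int H4 = H1 Int H2"
proof -
 obtain F where p: "pencil M F H1 H2 H3" "pencil M F H1 H2 H4" using assms by (auto simp: quad_def)
 have "H1 Int H2 = F" "F <= H3" "F <= H4" using pencil_meet(1)[OF p(1)] p by (simp_all add: pencil_def)
 thus ?thesis by (simp add: Int_absorb2)
qed

lemma \<chi>_eq: "quad M H1 H2 H3 H4 ==> L = quad_sublattice H1 H2 H3 H4 ==>
  \<chi> H1 H2 H3 H4 = cr_in P (\<psi> L) L H1 H2 H3 H4"
 unfolding \<chi>_def Let_def quad_sublattice_def by (simp add: quad_meet)

lemma special_matroid_over: "L : special_sublattices M ==> matroid_over (simple_matroid L) P"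
proof -
 assume "L : special_sublattices M"
 then obtain I J where p: "presents M L I J" by (auto simp: special_sublattices_def upper_sublattice_def)
 interpret L: lattice_presentation M L id I J by (rule presents_lattice[OF p])
 show ?thesis by unfold_locales
qed

text \<open>Compatibility along the arrow from the sublattice of the four hyperplanes, which exists
  by \<open>quad_inclusion\<close>. So all \<open>\<psi> L\<close> share one system of cross
  ratios.\<close>

lemma \<psi>_agrees: assumes L: "L : special_sublattices M" shows "agrees L P (\<psi> L) \<chi>"
 unfolding agrees_def
proof (intro ballI impI)
 fix F1 F2 F3 F4 assume F: "F1 : L" "F2 : L" "F3 : L" "F4 : L"
  and q: "quad_in L F1 F2 F3 F4"
 note i = quad_inclusion[OF L F q]
 let ?L = "quad_sublattice F1 F2 F3 F4"
 have "F1 : ?L" "F2 : ?L" "F3 : ?L" "F4 : ?L" by (simp_all add: quad_sublattice_def)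
 from agreesD[OF compat[OF i(1)] this quad_sublattice_quad[OF i(2) refl]] \<chi>_eq[OF i(2) refl]
 show "cr_in P (\<psi> L) L F1 F2 F3 F4 = \<chi> F1 F2 F3 F4" by simp
qed

lemma \<chi>_nonzero: "\<chi> H1 H2 H3 H4 : nonzeros P"
 unfolding \<chi>_def Let_def by (simp add: cr_def ev_nonzero Let_def)

lemma \<chi>_swap: assumes q: "quad M H1 H2 H3 H4" shows "lg (\<chi> H1 H2 H4 H3) \<doteq> - lg (\<chi> H1 H2 H3 H4)"
proof -
 have s: "quad_sublattice H1 H2 H4 H3 = quad_sublattice H1 H2 H3 H4" by (simp add: quad_sublattice_def insert_commute)
 interpret S: matroid_over "simple_matroid (quad_sublattice H1 H2 H3 H4)" P by (rule special_matroid_over[OF quad_special[OF q]])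
 show ?thesis unfolding \<chi>_eq[OF q refl] \<chi>_eq[OF quad_perm(1)[OF q] refl] s
  by (rule S.cr_swap[OF \<psi>_rep[OF quad_special[OF q]] quad_sublattice_quad[OF q refl]])
qed

lemma \<chi>_flip: assumes q: "quad M H1 H2 H3 H4" shows "\<chi> H3 H4 H1 H2 = \<chi> H1 H2 H3 H4"
proof -
 have s: "quad_sublattice H3 H4 H1 H2 = quad_sublattice H1 H2 H3 H4"
 proof -
  have "H3 Int H4 = H3 Int H4 Int H1 Int H2" using quad_meet[OF quad_perm(2)[OF q]] by simp
  also have "\<dots> = H1 Int H2 Int H3 Int H4" by (simp only: Int_ac)
  finally have "H3 Int H4 = H1 Int H2" using quad_meet[OF q] by simp
  thus ?thesis unfolding quad_sublattice_def by (simp add: insert_commute)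
 qed
 interpret S: matroid_over "simple_matroid (quad_sublattice H1 H2 H3 H4)" P by (rule special_matroid_over[OF quad_special[OF q]])
 show ?thesis unfolding \<chi>_eq[OF q refl] \<chi>_eq[OF quad_perm(2)[OF q] refl] s
  by (rule S.cr_flip[OF \<psi>_rep[OF quad_special[OF q]] quad_sublattice_quad[OF q refl]])
qed

definition rank_of :: "'a => nat" where "rank_of = (SOME r. inj_on r (ground M))"

lemma rank_of_inj: "inj_on rank_of (ground M)"
 unfolding rank_of_def using finite_imp_inj_to_nat_seg[OF finite_ground] by (metis (mono_tags, lifting) someI_ex)

text \<open>Signs from an arbitrary order of the ground set: for two distinct elements of it,
  exactly one of \<open>s x z\<close> and \<open>s z x\<close> is \<open>\<epsilon>\<close>.\<close>

definition s :: "'a => 'a => 'u \<Rightarrow>\<^sub>0 int" where "s x z = (if rank_of x < rank_of z then 0 else \<epsilon>)"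

lemma s_sign: "x : ground M ==> z : ground M ==> x ~= z ==> s x z - s z x \<doteq> \<epsilon>"
proof -
 assume *: "x : ground M" "z : ground M" "x ~= z"
 have "- \<epsilon> \<doteq> \<epsilon>" by (rule cg_lin1[OF cg_sym[OF eps_double]]) simp
 moreover have "rank_of x ~= rank_of z" using inj_onD[OF rank_of_inj] * by blast
 ultimately show ?thesis by (auto simp: s_def)
qed

abbreviation "w \<equiv> cross_label M \<chi>"

end

context compatible_family
begin

text \<open>The pattern gives a special sublattice \<open>L\<close>, and \<open>\<psi> L\<close>
  gives a solution on the bases of its simple matroid by \<open>rep_solution\<close>. The map
  \<open>tr\<close> carries it over to the minor. Signs of atoms are taken at their representatives,
  so that both sets of equations have the same signs.\<close>

lemma special_solves:
 assumes T: "(T, n) : special_bases" and pat: "pattern T n (interval \<B> I J)"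
 shows "EX f. solves (\<lambda>S a b c d. w S a b c d + (s a c + s b d - s a d - s b c)) (interval \<B> I J) f"
proof -
 let ?N = "interval \<B> I J"
 obtain Z x where inj: "inj_on x {1..n}" and dis: "x ` {1..n} Int Z = {}" and N: "?N = {Z Un x ` X | X. X : T}"
  using pat by (auto simp: pattern_def)
 note sp = special_simple_pattern[OF T]
 have n: "1 <= n" using T by (auto simp: special_bases_def)
 have T': "!!X. X : T ==> X <= {1..n}" and cov: "!!i. i : {1..n} ==> EX X:T. i : X" and av: "!!i. i : {1..n} ==> EX X:T. i ~: X"
  using sp unfolding simple_pattern_def by blast+
 have mem: "basis M (Z Un x ` X)" "I <= Z Un x ` X" "(Z Un x ` X) Int J = {}" if "X : T" for X
 proof -
  have "Z Un x ` X : ?N" unfolding N using that by blast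
  thus "basis M (Z Un x ` X)" "I <= Z Un x ` X" "(Z Un x ` X) Int J = {}" by (auto simp: interval_def)
 qed
 \<comment> \<open>An element \<open>x i\<close> is missing from some basis of the minor, whereas
   \<open>I\<close> is contained in all of them.\<close>
 have I: "I <= Z"
 proof
  fix z assume z: "z : I"
  show "z : Z"
  proof (rule ccontr)
   assume zZ: "z ~: Z"
   obtain X1 where "X1 : T" using cov[of 1] n by auto
   then obtain i where i: "i : {1..n}" "z = x i" using mem(2)[of X1] z zZ T' by blast
   obtain X where X: "X : T" "i ~: X" using av[OF i(1)] by blast
   hence "x i ~: x ` X" using inj_onD[OF inj] i(1) T' by blast
   thus False using mem(2)[OF X(1)] z zZ i(2) by blast
  qed
 qed
 have J: "(Z Un x ` {1..n}) Int J = {}"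
 proof -
  have "(Z Un {x i}) Int J = {}" if i: "i : {1..n}" for i
  proof -
   obtain X where "X : T" "i : X" using cov[OF i] by blast
   thus ?thesis using mem(3)[of X] by blast
  qed
  moreover have "1 : {1..n}" using n by simp
  ultimately show ?thesis by blast
 qed
 have bases: "basis M B \<longleftrightarrow> (EX X:T. B = Z Un x ` X)" if B: "Z <= B" "B <= Z Un x ` {1..n}" for B
 proof
  assume "basis M B"
  hence "B : ?N" using B I J unfolding interval_def by blast
  thus "EX X:T. B = Z Un x ` X" unfolding N by blast
 qed (use mem in blast)
 define J' where "J' = ground M - (Z Un x ` {1..n})"
 define L where "L = {cl M S | S. Z <= S & S <= Z Un x ` {1..n}}"
 note pl = pattern_lattice[OF sp n inj dis bases L_def J'_def]
 have Ls: "L : special_sublattices M" by (rule special_type[OF T pl(2)]) (use pl(1) in \<open>auto simp: upper_sublattice_def\<close>)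
 interpret L: lattice_presentation M L id Z J' by (rule presents_lattice[OF pl(1)])
 interpret LP: matroid_over "simple_matroid L" P by (rule special_matroid_over[OF Ls])
 have sg: "s (L.e A) (L.e B) - s (L.e B) (L.e A) \<doteq> \<epsilon>" if "A : ground (simple_matroid L)" "B : ground (simple_matroid L)" "A ~= B" for A B
  using that L.e_pts(1) inj_onD[OF L.e_inj] unfolding L.ground_simple by (intro s_sign) auto
 from LP.rep_solution[OF \<psi>_rep[OF Ls], of "\<lambda>A B. s (L.e A) (L.e B)"] sg
 obtain f' where f': "solves (\<lambda>S a b c d. cross_label (simple_matroid L) (cr P (\<psi> L)) S a b c d
   + (s (L.e a) (L.e c) + s (L.e b) (L.e d) - s (L.e a) (L.e d) - s (L.e b) (L.e c))) (Collect (basis (simple_matroid L))) f'" by blast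
 define tr where "tr B = {A : atoms L. L.e A : B}" for B
 have tr_sub: "tr B <= atoms L" for B by (auto simp: tr_def)
 have e_tr: "L.e ` tr B = B Int x ` {1..n}" for B
 proof -
  have "L.e ` tr B = B Int L.e ` atoms L" by (auto simp: tr_def)
  thus ?thesis using pl(3) by simp
 qed
 have tr_e: "tr ((L.e A)+:B) = (A+:(tr B))" if "A : atoms L" for A B
  using that inj_onD[OF L.e_inj] by (auto simp: tr_def)
 have "f' (tr (a+:c+:S)) + f' (tr (b+:d+:S)) \<doteq> w S a b c d + (s a c + s b d - s a d - s b c)
  + (f' (tr (a+:d+:S)) + f' (tr (b+:c+:S)))" if sq: "square ?N S a b c d" for S a b c d
 proof -
  note s' = sq[unfolded square_def]
  have inN: "Z <= B & B <= Z Un x ` {1..n} & basis M B" if "B : ?N" for B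
   using that T' unfolding N by (auto dest: mem(1))
  have iv: "Z <= (a+:c+:S)" "Z <= (b+:d+:S)" "(a+:c+:S) <= Z Un x ` {1..n}" "(b+:d+:S) <= Z Un x ` {1..n}"
   using inN s' by blast+
  have d: "a ~= b" "a ~= d" "c ~= b" "c ~= d" "a ~= c" "b ~= d" "a ~: S" "b ~: S" "c ~: S" "d ~: S" using s' by auto
  have ZS: "Z <= S" using iv(1,2) d by blast
  have SZ: "S = Z Un L.e ` tr S" unfolding e_tr using ZS iv(3) by blast
  have nZ: "z ~: Z" if "z ~: S" for z using that ZS by blast
  have at_ex: "EX A:atoms L. L.e A = z" if "z : Z Un x ` {1..n}" "z ~: S" for z
  proof -
   have "z : L.e ` atoms L" using that nZ[OF that(2)] pl(3) by simp
   thus ?thesis by (auto simp: image_iff)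
  qed
  have inZ: "a : Z Un x ` {1..n}" "b : Z Un x ` {1..n}" "c : Z Un x ` {1..n}" "d : Z Un x ` {1..n}"
   using iv(3,4) by simp_all
  obtain A where A: "A : atoms L" "a = L.e A" using at_ex[OF inZ(1)] d by metis
  obtain B where B: "B : atoms L" "b = L.e B" using at_ex[OF inZ(2)] d by metis
  obtain C where C: "C : atoms L" "c = L.e C" using at_ex[OF inZ(3)] d by metis
  obtain D where D: "D : atoms L" "d = L.e D" using at_ex[OF inZ(4)] d by metis
  note at = A(1) B(1) C(1) D(1) and eq = A(2) B(2) C(2) D(2)
  have i1: "((L.e U)+:S) = Z Un L.e ` (U+:(tr S))" for U using SZ by blast
  have i2: "((L.e U)+:(L.e V)+:S) = Z Un L.e ` (U+:V+:(tr S))" for U V using SZ by blast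
  have bas: "(U+:V+:(tr S)) : Collect (basis (simple_matroid L)) \<longleftrightarrow> basis M ((L.e U)+:(L.e V)+:S)"
   if "U : atoms L" "V : atoms L" for U V
   using L.emb.basis_eq[of "(U+:V+:(tr S))"] that tr_sub[of S] unfolding i2 L.ground_simple by simp
  have ntr: "U ~: tr S" if "L.e U ~: S" for U using that by (simp add: tr_def)
  have sqL: "square (Collect (basis (simple_matroid L))) (tr S) A B C D"
   unfolding square_def bas[OF at(1,3)] bas[OF at(2,4)] bas[OF at(1,4)] bas[OF at(2,3)]
   using s' inN d ntr unfolding eq by auto
  have clj: "cl M ((L.e U)+:S) = L.emb.j (cl (simple_matroid L) (U+:(tr S)))" if "U : atoms L" for U
   unfolding i1 by (rule L.emb.j_cl[symmetric]) (use that tr_sub in \<open>auto simp: L.ground_simple\<close>)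
  have fl: "flat (simple_matroid L) (cl (simple_matroid L) X)" for X
   unfolding flat_def using L.emb.S.cl_sub L.emb.S.cl_cl by blast
  have cle: "cl M ((L.e U)+:S) = cl M ((L.e V)+:S) \<longleftrightarrow>
   cl (simple_matroid L) (U+:(tr S)) = cl (simple_matroid L) (V+:(tr S))" if "U : atoms L" "V : atoms L" for U V
   unfolding clj[OF that(1)] clj[OF that(2)]
   using L.emb.j_inj[OF fl fl, of "(U+:(tr S))" "(V+:(tr S))"] by auto
  have "w S a b c d = cross_label (simple_matroid L) (cr P (\<psi> L)) (tr S) A B C D"
  proof (cases "cl M (a+:S) = cl M (b+:S) \<or> cl M (c+:S) = cl M (d+:S)")
   case True
   thus ?thesis using cle[OF at(1,2)] cle[OF at(3,4)] unfolding cross_label_def eq by simp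
  next
   case False
   let ?H = "\<lambda>U. cl (simple_matroid L) (U+:(tr S))"
   have n': "?H A ~= ?H B" "?H C ~= ?H D" using False cle[OF at(1,2)] cle[OF at(3,4)] unfolding eq by auto
   have qd: "quad (simple_matroid L) (?H A) (?H B) (?H C) (?H D)" by (rule L.emb.S.square_quad[OF sqL n'])
   obtain F1 F2 F3 F4 where F: "F1 : L" "F2 : L" "F3 : L" "F4 : L"
    and H: "?H A = atoms_below L F1" "?H B = atoms_below L F2" "?H C = atoms_below L F3" "?H D = atoms_below L F4"
    using L.quad_below[OF qd] by blast
   have "cl M (a+:S) = F1" "cl M (b+:S) = F2" "cl M (c+:S) = F3" "cl M (d+:S) = F4"
    unfolding eq clj[OF at(1)] clj[OF at(2)] clj[OF at(3)] clj[OF at(4)] H using L.j_below F by simp_all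
   thus ?thesis using False agreesD[OF \<psi>_agrees[OF Ls] F qd[unfolded H]] n' unfolding cross_label_def H by simp
  qed
  moreover have "f' (A+:C+:(tr S)) + f' (B+:D+:(tr S)) \<doteq> cross_label (simple_matroid L) (cr P (\<psi> L)) (tr S) A B C D
   + (s (L.e A) (L.e C) + s (L.e B) (L.e D) - s (L.e A) (L.e D) - s (L.e B) (L.e C)) + (f' (A+:D+:(tr S)) + f' (B+:C+:(tr S)))"
   using f' sqL unfolding solves_def by blast
  ultimately show ?thesis unfolding eq by (simp add: tr_e at)
 qed
 hence "solves (\<lambda>S a b c d. w S a b c d + (s a c + s b d - s a d - s b c)) ?N (\<lambda>B. f' (tr B))" unfolding solves_def by blast
 thus ?thesis by blast
qed

lemma labels: "cross_labels (ev_kernel P) \<B> (ground M) s \<epsilon> w"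
proof -
 interpret bf: basis_family \<B> by (rule bases_family)
 show ?thesis
 proof
  show "finite (ground M)" by (rule finite_ground)
  show "\<Union>\<B> <= ground M" using indep_subset_ground basis_iff by blast
  show "s x z - s z x \<doteq> \<epsilon>" if "x : ground M" "z : ground M" "x ~= z" for x z by (rule s_sign[OF that])
 next
  fix S a b c d assume sq: "square \<B> S a b c d"
  note q = square_quad[OF sq]
  show "w S c d a b \<doteq> w S a b c d" using \<chi>_flip[OF q] by (auto simp: cross_label_def)
  show "w S a b d c \<doteq> - w S a b c d" using \<chi>_swap[OF q] by (auto simp: cross_label_def)
  note l = square_line[OF matroid_axioms sq]
  have eq: "cl M (x+:S) = cl M (y+:S)" if "(x+:y+:S) ~: \<B>" "x : ground M" "x ~: cl M S" "y : ground M" "y ~: cl M S" for x y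
   using line_basis[OF l(1), of x y] line_cl_eq[OF l(1), of x y] that by simp
  show "w S a b c d \<doteq> 0" if "(c+:d+:S) ~: \<B>" using eq[OF that] l(2) by (simp add: cross_label_def)
  show "w S a b c d \<doteq> w S a b c d'" if "square \<B> S a b c d'" "(d+:d'+:S) ~: \<B>" for d'
   using eq[OF that(2)] l(2) square_line(2)[OF matroid_axioms that(1)] by (simp add: cross_label_def)
 next
  fix S z z' a b c d assume sq: "square \<B> (z+:S) a b c d" "square \<B> (z'+:S) a b c d" and z: "z ~: S" "z' ~: S"
   and nb: "!!x. x : {a, b, c, d} ==> (x+:z+:z'+:S) ~: \<B>"
  note l = square_line[OF matroid_axioms sq(1)] and l' = square_line[OF matroid_axioms sq(2)]
  \<comment> \<open>Both closures are hyperplanes; as \<open>x\<close>, \<open>z\<close>,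
    \<open>z'\<close> and \<open>S\<close> do not form a basis, \<open>z\<close> lies in the second
    one.\<close>
  have half: "cl M (x+:z+:S) <= cl M (x+:z'+:S)"
   if l: "line (z+:S)" and l': "line (z'+:S)" and x: "x : ground M" "x ~: cl M (z'+:S)" and nb: "(x+:z+:z'+:S) ~: \<B>" for x z z'
  proof -
   have zg: "(z+:S) <= ground M" using l indep_subset_ground unfolding line_def by blast
   have "z : cl M (x+:z'+:S)"
    using basis_insert[OF line_insert(1,2)[OF l' x], of z] nb zg by (simp add: insert_commute)
   moreover have "(x+:S) <= cl M (x+:z'+:S)"
    using cl_superset[of "(x+:z'+:S)"] x zg indep_subset_ground l' unfolding line_def by blast
   ultimately show ?thesis by (intro cl_le) simp
  qed
  have eq: "cl M (x+:z+:S) = cl M (x+:z'+:S)" if x: "x : {a, b, c, d}" for x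
  proof (rule subset_antisym)
   have nb': "(x+:z'+:z+:S) ~: \<B>" using nb[OF x] by (simp add: insert_commute)
   show "cl M (x+:z+:S) <= cl M (x+:z'+:S)"
    using half[OF l(1) l'(1), of x] l'(2)[OF x] nb[OF x] by blast
   show "cl M (x+:z'+:S) <= cl M (x+:z+:S)"
    using half[OF l'(1) l(1), of x] l(2)[OF x] nb' by blast
  qed
  show "w (z+:S) a b c d \<doteq> w (z'+:S) a b c d" using eq by (simp add: cross_label_def)
 qed (use special_solves in blast)
qed

end

context compatible_family
begin

text \<open>For a basis \<open>S\<close> of a hyperplane \<open>H\<close>, the values of
  \<open>f\<close> at \<open>S + x\<close> give, up to signs, the function of \<open>H\<close>. The
  two multiplicative conditions of \<open>repsI\<close> follow from the equations for
  \<open>f\<close> and the signs; the null condition is copied from \<open>\<psi> L\<close> for a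
  suitable \<open>L\<close> of type U_{2,4}.\<close>

lemma glued:
 obtains \<phi> where "\<phi> : reps M P" "!!L. L : special_sublattices M ==> agrees L P (\<psi> L) (cr P \<phi>)"
proof -
 interpret cl: cross_labels "ev_kernel P" \<B> "ground M" s \<epsilon> w by (rule labels)
 obtain f where f: "solves (\<lambda>S a b c d. w S a b c d + (s a c + s b d - s a d - s b c)) \<B> f" using cl.cross_labels_solvable by blast
 define G where "G S x = f (x+:S) - (\<Sum>z\<in>S. s z x)" for S x
 define bas where "bas H = (SOME S. indep M S & Suc (card S) = \<rho> & H = cl M S)" for H
 have bas: "indep M (bas H) & Suc (card (bas H)) = \<rho> & H = cl M (bas H)" if "H : hyperplanes M" for H
  unfolding bas_def by (rule someI_ex) (use that hyperplanes_iff in blast)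
 define \<phi> where "\<phi> H x = (if x : H then pzero P else ev P (G (bas H) x))" for H x
 have square_G: "G (a+:T) c - G (a+:T) d + G (b+:T) d - G (b+:T) c \<doteq> w T a b c d" if sq: "square \<B> T a b c d" for T a b c d
 proof -
  have fin: "finite T" using square_line(1)[OF matroid_axioms sq] indep_finite by (auto simp: line_def)
  note s' = sq[unfolded square_def]
  have "f (a+:c+:T) + f (b+:d+:T) \<doteq> w T a b c d + (s a c + s b d - s a d - s b c)
   + (f (a+:d+:T) + f (b+:c+:T))" using f sq unfolding solves_def by blast
  thus ?thesis by (rule cg_lin1)
   (use fin s' in \<open>simp add: G_def insert_commute[of c a] insert_commute[of d a] insert_commute[of c b] insert_commute[of d b]\<close>)
 qed
 \<comment> \<open>The bases of one hyperplane are connected by exchanges of \<open>a\<close> for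
   \<open>b\<close>. In the square that compares them, \<open>a + R\<close> and \<open>b + R\<close>
   span the same hyperplane, so its label is 0.\<close>
 have change: "G S x - G S y \<doteq> G S' x - G S' y"
  if "indep M S" "Suc (card S) = \<rho>" "indep M S'" "Suc (card S') = \<rho>" "cl M S = cl M S'" "x : ground M - cl M S" "y : ground M - cl M S" for S S' x y
  using that
 proof (induction "card (S - S')" arbitrary: S rule: less_induct)
  case (less S)
  note S = less.prems(1,2) and S' = less.prems(3,4) and cl = less.prems(5) and xy = less.prems(6,7)
  have fin: "finite S" "finite S'" using S S' indep_finite by auto
  show ?case
  proof (cases "S <= S' \<or> x = y")
   case True
   thus ?thesis using card_subset_eq[OF fin(2), of S] S(2) S'(2) by auto
  next
   case False
   then obtain a where a: "a : S" "a ~: S'" by blast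
   have bs: "basis M (u+:S)" "basis M (u+:S')" "u ~: S" "u ~: S'" if "u : ground M - cl M S" for u
    using basis_insert[OF S, of u] basis_insert[OF S', of u] that cl cl_ext[of u S] cl_ext[of u S'] by auto
   have "a : (x+:S)" "a ~: (x+:S')" using a bs(3)[OF xy(1)] by auto
   then obtain b where b: "b : (x+:S')" "b ~: (x+:S)" "basis M (b+:((x+:S) - {a}))"
    using basis_family.exchange1[OF bases_family, of "(x+:S)" "(x+:S')" a] bs(1,2)[OF xy(1)] by auto
   define R where "R = S - {a}"
   have R: "S = (a+:R)" "a ~: R" using a by (auto simp: R_def)
   have b': "b : S'" "b ~: S" "b ~= x" using b by auto
   have clg: "S <= cl M S" "S' <= cl M S" using cl_superset indep_subset_ground S S' cl by blast+
   have iR: "indep M R" by (rule indep_subset[OF S(1)]) (use R in blast)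
   have "(b+:((x+:S) - {a})) = (x+:b+:R)" using R bs(3)[OF xy(1)] a by auto
   hence bx: "indep M (x+:b+:R)" using b(3) by (simp add: basis_iff)
   have ib: "indep M (b+:R)" by (rule indep_subset[OF bx]) blast
   have cb: "Suc (card (b+:R)) = \<rho>" using S(2) R b' fin(1) by simp
   have "cl M S = cl M (b+:R)"
    using flat_basis[OF _ ib, of "cl M S"] rk_cl[of S] rk_indep[OF S(1)] cb S(2) clg b' R cl_cl cl_sub unfolding flat_def by auto
   hence clb: "cl M (b+:R) = cl M S'" "cl M (b+:R) = cl M S" using cl by auto
   have psub: "(b+:R) - S' \<subset> S - S'" using a b' R by auto
   have "card ((b+:R) - S') < card (S - S')" by (rule psubset_card_mono[OF _ psub]) (use fin in simp)
   from less.hyps[OF this ib cb S' clb(1)] xy clb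
   have IH: "G (b+:R) x - G (b+:R) y \<doteq> G S' x - G S' y" by simp
   have sq: "square \<B> R a b x y"
   proof -
    have bb: "basis M (u+:b+:R)" "u ~: (b+:R)" if "u : ground M - cl M S" for u
    using basis_insert[OF ib cb, of u] that clb(2) cl_ext[of u "(b+:R)"] by auto
    have n: "a ~= b" using a b' by blast
    have "a ~= x" "a ~= y" using bs(3)[OF xy(1)] bs(3)[OF xy(2)] a by auto
    thus ?thesis unfolding square_def
    using bb[OF xy(1)] bb[OF xy(2)] bs[OF xy(1)] bs[OF xy(2)] R n b' False
    by (simp add: insert_commute[of a x] insert_commute[of a y] insert_commute[of b x] insert_commute[of b y]) blast
   qed
   have "w R a b x y = 0" using clb(2) unfolding R(1) by (simp add: cross_label_def)
   with square_G[OF sq] have "G S x - G S y + G (b+:R) y - G (b+:R) x \<doteq> 0" unfolding R(1) by simp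
   from this IH show ?thesis by (rule cg_lin2) simp
  qed
 qed
 have Y: "Y \<phi> H x - Y \<phi> H y \<doteq> G S x - G S y"
  if "H = cl M S" "indep M S" "Suc (card S) = \<rho>" "x : ground M - H" "y : ground M - H" for H S x y
 proof -
  have H: "H : hyperplanes M" using that hyperplanes_iff by blast
  note b = bas[OF H]
  have c: "G (bas H) x - G (bas H) y \<doteq> G S x - G S y"
   by (rule change) (use b that in auto)
  show ?thesis by (rule cg_lin3[OF lg_ev[of "G (bas H) x"] cg_sym[OF lg_ev[of "G (bas H) y"]] c])
   (use that(4,5) in \<open>simp add: \<phi>_def\<close>)
 qed
 have sup: "supported \<phi>" unfolding supported_def \<phi>_def using ev_closed ev_neq zero_closed by auto
 have square_Y: "Y \<phi> (cl M (a+:T)) c - Y \<phi> (cl M (a+:T)) d + Y \<phi> (cl M (b+:T)) d - Y \<phi> (cl M (b+:T)) c \<doteq> w T a b c d"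
  if sq: "square \<B> T a b c d" for T a b c d
 proof -
  note l = square_line[OF matroid_axioms sq]
  have g: "x : ground M" "x ~: cl M T" if "x : {a, b, c, d}" for x using l(2) that by auto
  have Yt: "Y \<phi> (cl M (u+:T)) c - Y \<phi> (cl M (u+:T)) d \<doteq> G (u+:T) c - G (u+:T) d" if u: "u : {a, b}" for u
   using l(3)[OF u] g u by (intro Y[OF refl line_insert(1,2)[OF l(1)]]) auto
  show ?thesis by (rule cg_lin3[OF Yt[of a] cg_sym[OF Yt[of b]] square_G[OF sq]]) simp_all
 qed
 have tri: "Y \<phi> H2 a + Y \<phi> H3 b + Y \<phi> H1 c \<doteq> \<epsilon> + Y \<phi> H3 a + Y \<phi> H1 b + Y \<phi> H2 c"
  if p: "pencil M F H1 H2 H3" and abc: "a : H1 - F" "b : H2 - F" "c : H3 - F" for F H1 H2 H3 a b c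
 proof -
  obtain T where T: "line T" "F = cl M T" using p unfolding pencil_def corank2_iff by blast
  note o = pencil_out[OF pencil_perm(2)[OF p] abc(1)] pencil_out[OF pencil_perm(2)[OF pencil_perm(2)[OF p]] abc(2)] pencil_out[OF p abc(3)]
  have g: "a : ground M" "b : ground M" "c : ground M" "a ~: cl M T" "b ~: cl M T" "c ~: cl M T"
   "a ~: H2" "a ~: H3" "b ~: H1" "b ~: H3" "c ~: H1" "c ~: H2"
   using o abc unfolding T(2) by simp_all
  have H: "H1 = cl M (a+:T)" "H2 = cl M (b+:T)" "H3 = cl M (c+:T)"
   by (rule hyperplane_over[OF T(1)]; use p abc in \<open>simp add: pencil_def T(2)\<close>)+
  have ne: "a ~= b" "b ~= c" "c ~= a" using abc(1-3) g(7-12) by blast+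
  have fT: "finite T" "a ~: T" "b ~: T" "c ~: T" using T(1) indep_finite line_insert(3)[OF T(1)] g by (auto simp: line_def)
  have 1: "Y \<phi> H1 c - Y \<phi> H1 b \<doteq> G (a+:T) c - G (a+:T) b"
   by (rule Y[OF H(1) line_insert(1,2)[OF T(1)]]) (use g in auto)
  have 2: "Y \<phi> H2 a - Y \<phi> H2 c \<doteq> G (b+:T) a - G (b+:T) c"
   by (rule Y[OF H(2) line_insert(1,2)[OF T(1)]]) (use g in auto)
  have 3: "Y \<phi> H3 b - Y \<phi> H3 a \<doteq> G (c+:T) b - G (c+:T) a"
   by (rule Y[OF H(3) line_insert(1,2)[OF T(1)]]) (use g in auto)
  \<comment> \<open>The values of \<open>f\<close> cancel because each basis occurs twice. Three
    sign differences remain, and \<open>\<epsilon> + \<epsilon> + \<epsilon>\<close> is congruent to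
    \<open>\<epsilon>\<close>.\<close>
  have gs: "G (a+:T) c - G (a+:T) b + (G (b+:T) a - G (b+:T) c) + (G (c+:T) b - G (c+:T) a) \<doteq> \<epsilon>"
   by (rule cg_lin4[OF s_sign[OF g(1,2) ne(1)] s_sign[OF g(2,3) ne(2)] s_sign[OF g(3,1) ne(3)] eps_double])
    (use fT ne in \<open>simp add: G_def insert_commute[of c a] insert_commute[of b a] insert_commute[of c b]\<close>)
  show ?thesis by (rule cg_lin4[OF 1 2 3 gs]) simp
 qed
 have square_pencil: "square \<B> T u u' v v'"
  if T: "line T" and g: "u : ground M - cl M T" "u' : ground M - cl M T" "v : ground M - cl M T" "v' : ground M - cl M T"
   and d: "u ~= u'" "v ~= v'" and n: "v ~: cl M (u+:T)" "v' ~: cl M (u+:T)" "v ~: cl M (u'+:T)" "v' ~: cl M (u'+:T)"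
  for T u u' v v'
 proof -
  have b: "basis M (x+:y+:T)" "x ~= y" "x ~: T" if "y ~: cl M (x+:T)" "x : ground M - cl M T" "y : ground M - cl M T" for x y
   using line_basis[OF T, of x y] line_insert(3)[OF T, of x] cl_ext[of y "(y+:T)"] that by auto
  have b': "v ~: T" "v' ~: T" using line_insert(3)[OF T, of v] line_insert(3)[OF T, of v'] g by auto
  show ?thesis unfolding square_def
   using b[OF n(1) g(1,3)] b[OF n(2) g(1,4)] b[OF n(3) g(2,3)] b[OF n(4) g(2,4)] b' d by simp
 qed
 have cross_Y: "Y \<phi> H1 x - Y \<phi> H1 y + Y \<phi> H2 y - Y \<phi> H2 x \<doteq> lg (\<chi> H1 H2 H3 H4)"
  if p: "pencil M F H1 H2 H3" "pencil M F H1 H2 H4" "H3 ~= H4" and xy: "x : H3 - F" "y : H4 - F" for F H1 H2 H3 H4 x y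
 proof -
  obtain T where T: "line T" "F = cl M T" using p(1) unfolding pencil_def corank2_iff by blast
  note m = pencil_meet[OF p(1)] and m' = pencil_meet[OF p(2)]
  have sF: "F <= H1" "F <= H2" "H1 ~= H2" using p(1) by (simp_all add: pencil_def)
  obtain a b where ab: "a : H1 - F" "b : H2 - F" using m(4,5) sF by blast
  have H: "H1 = cl M (a+:T)" "H2 = cl M (b+:T)" "H3 = cl M (x+:T)" "H4 = cl M (y+:T)"
   by (rule hyperplane_over[OF T(1)]; use p ab xy in \<open>simp add: pencil_def T(2)\<close>)+
  have "a ~: H2" using ab(1) m(1) by blast
  hence ne: "a ~= b" "x ~= y" using ab p(3) H by auto
  have g: "a : ground M - cl M T" "b : ground M - cl M T" "x : ground M - cl M T" "y : ground M - cl M T"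
   using ab xy subsetD[OF m(7)] subsetD[OF m(8)] subsetD[OF m(9)] subsetD[OF m'(9)] unfolding T(2) by simp_all
  have n: "x ~: cl M (a+:T)" "y ~: cl M (a+:T)" "x ~: cl M (b+:T)" "y ~: cl M (b+:T)"
   unfolding H(1)[symmetric] H(2)[symmetric] using pencil_out[OF p(1) xy(1)] pencil_out[OF p(2) xy(2)] by simp_all
  from square_Y[OF square_pencil[OF T(1) g ne n]] show ?thesis
   unfolding cross_label_def H(1)[symmetric] H(2)[symmetric] H(3)[symmetric] H(4)[symmetric] using sF(3) p(3) by simp
 qed
 have par: "Y \<phi> H2 x + Y \<phi> H3 x' \<doteq> Y \<phi> H2 x' + Y \<phi> H3 x"
  if p: "pencil M F H1 H2 H3" and x: "x : H1 - F" "x' : H1 - F" for F H1 H2 H3 x x'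
 proof (cases "x = x'")
  case False
  obtain T where T: "line T" "F = cl M T" using p unfolding pencil_def corank2_iff by blast
  note m = pencil_meet[OF p]
  have sF: "F <= H1" "F <= H2" "F <= H3" "H2 ~= H3" using p by (simp_all add: pencil_def)
  obtain a b where ab: "a : H2 - F" "b : H3 - F" using m(5,6) sF by blast
  have H: "H2 = cl M (a+:T)" "H3 = cl M (b+:T)" "H1 = cl M (x+:T)" "H1 = cl M (x'+:T)"
   by (rule hyperplane_over[OF T(1)]; use p ab x in \<open>simp add: pencil_def T(2)\<close>)+
  have "a ~: H3" using ab(1) m(3) by blast
  hence ne: "a ~= b" using ab by blast
  have g: "a : ground M - cl M T" "b : ground M - cl M T" "x : ground M - cl M T" "x' : ground M - cl M T"
   using ab x subsetD[OF m(7)] subsetD[OF m(8)] subsetD[OF m(9)] unfolding T(2) by simp_all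
  have n: "x ~: cl M (a+:T)" "x' ~: cl M (a+:T)" "x ~: cl M (b+:T)" "x' ~: cl M (b+:T)"
   unfolding H(1)[symmetric] H(2)[symmetric] using pencil_out[OF pencil_perm(2)[OF p] x(1)] pencil_out[OF pencil_perm(2)[OF p] x(2)] by simp_all
  have "Y \<phi> H2 x - Y \<phi> H2 x' + Y \<phi> H3 x' - Y \<phi> H3 x \<doteq> 0"
   using square_Y[OF square_pencil[OF T(1) g ne False n]] unfolding H(1)[symmetric] H(2)[symmetric]
   by (simp add: cross_label_def H(3)[symmetric] H(4)[symmetric])
  thus ?thesis by (rule cg_lin1) simp
 qed (simp add: add.commute)
 have \<phi>: "\<phi> : reps M P"
 proof (rule repsI[OF sup par tri])
  fix F H1 H2 H3 a c e assume p: "pencil M F H1 H2 H3" and ac: "a : H1 - F" "c : H3 - F" and e: "e : ground M - (H1 Un H2 Un H3)"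
  show "{#ev P (Y \<phi> H1 e + Y \<phi> H2 c + Y \<phi> H3 a), ev P (\<epsilon> + Y \<phi> H1 c + Y \<phi> H3 a + Y \<phi> H2 e), ev P (Y \<phi> H1 c + Y \<phi> H2 a + Y \<phi> H3 e)#} : nullset P"
  proof -
   obtain T where T: "line T" "F = cl M T" using p unfolding pencil_def corank2_iff by blast
   have sF: "F <= H1" "F <= H2" "F <= H3" and ne: "H1 ~= H2" "H1 ~= H3" "H2 ~= H3" using p by (simp_all add: pencil_def)
   \<comment> \<open>The hyperplane over \<open>F\<close> through \<open>e\<close>. Up to a common
     factor the terms of the null relation at \<open>e\<close> are cross ratios of the four
     hyperplanes, so the relation follows from the one for \<open>\<psi> L\<close>.\<close>
   define H4 where "H4 = cl M (e+:T)"
   have eg: "e : ground M" "e ~: cl M T" using e sF T(2) by blast+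
   have e4: "e : H4" unfolding H4_def by (rule cl_ext) (use eg in simp_all)
   have ne4: "H4 ~= H1" "H4 ~= H2" "H4 ~= H3" using e4 e by blast+
   have F4: "F <= H4" unfolding H4_def T(2) by (rule cl_mono) blast
   have p4: "pencil M F H1 H2 H4" "pencil M F H3 H2 H4" "pencil M F H3 H2 H1"
    using p ne4 F4 line_insert(4)[OF T(1) eg] unfolding H4_def[symmetric] by (simp_all add: pencil_def not_sym)
   have q: "quad M H1 H2 H3 H4" unfolding quad_def using p p4(1) ne4 by metis
   define L where "L = quad_sublattice H1 H2 H3 H4"
   have L: "L : special_sublattices M" unfolding L_def by (rule quad_special[OF q])
   have in_L: "H1 : L" "H2 : L" "H3 : L" "H4 : L" by (simp_all add: L_def quad_sublattice_def)
   interpret LP: matroid_over "simple_matroid L" P by (rule special_matroid_over[OF L])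
   let ?A = "atoms_below L"
   obtain G where P: "pencil (simple_matroid L) G (?A H1) (?A H2) (?A H3)" "pencil (simple_matroid L) G (?A H1) (?A H2) (?A H4)" "?A H3 ~= ?A H4"
    using quad_sublattice_quad[OF q L_def] by (auto simp: quad_def)
   hence P': "pencil (simple_matroid L) G (?A H3) (?A H2) (?A H4)" "pencil (simple_matroid L) G (?A H3) (?A H2) (?A H1)" "?A H4 ~= ?A H1"
    "pencil (simple_matroid L) G (?A H1) (?A H3) (?A H4)"
    by (simp_all add: pencil_def not_sym)
   obtain a' c' e' where pt: "a' : ?A H1 - G" "c' : ?A H3 - G" "e' : ?A H4 - G"
    using LP.pencil_third[OF P(1)] LP.pencil_third[OF P(2)] LP.pencil_third[OF P'(2)] by blast
   have e'g: "e' : ground (simple_matroid L) - (?A H1 Un ?A H2 Un ?A H3)"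
    using LP.pencil_out[OF P(2) pt(3)] LP.pencil_out[OF P'(1) pt(3)] by blast
   note nul = LP.rep_null[OF \<psi>_rep[OF L] P(1) pt(1,2) e'g]
   have Q: "quad (simple_matroid L) (?A H1) (?A H2) (?A H4) (?A H3)" "quad (simple_matroid L) (?A H3) (?A H2) (?A H4) (?A H1)"
    unfolding quad_def using P P' by metis+
   note c1 = LP.cr_eq[OF \<psi>_rep[OF L] P(2,1) pt(3,2), unfolded agreesD[OF \<psi>_agrees[OF L] in_L(1,2,4,3) Q(1)]]
   note c2 = LP.cr_eq[OF \<psi>_rep[OF L] P'(1,2) pt(3,1), unfolded agreesD[OF \<psi>_agrees[OF L] in_L(3,2,4,1) Q(2)]]
   have eF: "e : H4 - F" using e4 eg T(2) by blast
   note d1 = cross_Y[OF p4(1) p ne4(3) eF ac(2)] and d2 = cross_Y[OF p4(2,3) ne4(1) eF ac(1)]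
   show ?thesis
   proof (rule null_shift[OF nul])
    show "Y \<phi> H1 e + Y \<phi> H2 c + Y \<phi> H3 a - (lg (\<psi> L (?A H1) e') + lg (\<psi> L (?A H2) c') + lg (\<psi> L (?A H3) a')) \<doteq>
    \<epsilon> + Y \<phi> H1 c + Y \<phi> H3 a + Y \<phi> H2 e - (\<epsilon> + lg (\<psi> L (?A H1) c') + lg (\<psi> L (?A H3) a') + lg (\<psi> L (?A H2) e'))"
    by (rule cg_lin2[OF d1 c1]) simp
    show "Y \<phi> H1 e + Y \<phi> H2 c + Y \<phi> H3 a - (lg (\<psi> L (?A H1) e') + lg (\<psi> L (?A H2) c') + lg (\<psi> L (?A H3) a')) \<doteq>
    Y \<phi> H1 c + Y \<phi> H2 a + Y \<phi> H3 e - (lg (\<psi> L (?A H1) c') + lg (\<psi> L (?A H2) a') + lg (\<psi> L (?A H3) e'))"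
    by (rule cg_lin4[OF d1 c1 cg_sym[OF d2] cg_sym[OF c2]]) simp
   qed
  qed
 qed
 have "agrees L P (\<psi> L) (cr P \<phi>)" if L: "L : special_sublattices M" for L
  unfolding agrees_def
 proof (intro ballI impI)
  fix F1 F2 F3 F4 assume F: "F1 : L" "F2 : L" "F3 : L" "F4 : L"
   and q: "quad_in L F1 F2 F3 F4"
  obtain G where p: "pencil M G F1 F2 F3" "pencil M G F1 F2 F4" "F3 ~= F4" using quad_inclusion(2)[OF L F q] by (auto simp: quad_def)
  obtain x y where xy: "x : F3 - G" "y : F4 - G" using pencil_third[OF p(1)] pencil_third[OF p(2)] by auto
  have "lg (cr P \<phi> F1 F2 F3 F4) \<doteq> lg (\<chi> F1 F2 F3 F4)"
   by (rule cg_lin2[OF cr_eq[OF \<phi> p(1,2) xy] cross_Y[OF p xy]]) simp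
  hence "cr P \<phi> F1 F2 F3 F4 = \<chi> F1 F2 F3 F4"
   using cr_nonzero[of \<phi> F1 F2 F3 F4] \<chi>_nonzero[of F1 F2 F3 F4] by (simp add: cg_iff ev_lg)
  thus "cr_in P (\<psi> L) L F1 F2 F3 F4 = cr P \<phi> F1 F2 F3 F4"
   using agreesD[OF \<psi>_agrees[OF L] F q] by simp
 qed
 with \<phi> show thesis by (rule that)
qed

end

theorem theorem2p36:
 fixes M :: "'e matroid"
  and F_M :: "'u pasture" and \<eta>_M :: "('e, 'u) rep_bij"
  and F :: "'e set set \<Rightarrow> 'u pasture" and \<eta> :: "'e set set \<Rightarrow> ('e set, 'u) rep_bij"
  and C :: "'u pasture" and \<iota> :: "'e set set \<Rightarrow> 'u \<Rightarrow> 'u"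
 assumes universe: "infinite (UNIV :: 'u set)"
  and matroid: "matroid M"
  and foundation_M: "is_foundation M F_M \<eta>_M"
  and foundations: "\<And>L. L \<in> special_sublattices M \<Longrightarrow> is_foundation (simple_matroid L) (F L) (\<eta> L)"
  and colimit: "is_colimit (special_sublattices M) (special_inclusions M) F
   (\<lambda>L' L. induced_to_sublattice M L (F L) (\<eta> L) L' (F L') (\<eta> L')) C \<iota>"
 shows "(\<exists>!h. mediates (special_sublattices M) F C \<iota> F_M
    (\<lambda>L. induced_to_matroid M F_M \<eta>_M L (F L) (\<eta> L)) h)
  \<and> (\<forall>h. mediates (special_sublattices M) F C \<iota> F_M
    (\<lambda>L. induced_to_matroid M F_M \<eta>_M L (F L) (\<eta> L)) h \<longrightarrow> pasture_iso C F_M h)"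
proof -
 interpret M: matroid M by (rule matroid)
 let ?Ob = "special_sublattices M" and ?Ar = "special_inclusions M" and ?S = simple_matroid
 define d where "d L' L = induced_to_sublattice M L (F L) (\<eta> L) L' (F L') (\<eta> L')" for L' L
 define g where "g L = induced_to_matroid M F_M \<eta>_M L (F L) (\<eta> L)" for L
 have pM: "pasture F_M" and bijM: "!!P. pasture P ==> bij_betw (\<eta>_M P) (pasture_hom F_M P) (rep_classes M P)"
  using foundation_M unfolding is_foundation_def by blast+
 have pF: "pasture (F L)" and bij: "!!P. pasture P ==> bij_betw (\<eta> L P) (pasture_hom (F L) P) (rep_classes (?S L) P)"
  if "L : ?Ob" for L using foundations[OF that] unfolding is_foundation_def by blast+
 have colim: "is_cocone ?Ob ?Ar F d C \<iota>" "!!P \<kappa>. is_cocone ?Ob ?Ar F d P \<kappa> ==> EX! h. mediates ?Ob F C \<iota> P \<kappa> h"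
  using colimit unfolding is_colimit_def d_def by blast+
 have pC: "pasture C" and \<iota>: "!!L. L : ?Ob ==> \<iota> L : pasture_hom (F L) C"
  and \<iota>_arrow: "!!L' L. (L', L) : ?Ar ==> compose (carrier (F L')) (\<iota> L) (d L' L) = \<iota> L'"
  using colim(1) unfolding is_cocone_def by blast+
 have upper: "upper_sublattice M L" if "L : ?Ob" for L using that by (simp add: special_sublattices_def)
 have Ar: "L' : ?Ob" "L : ?Ob" "L' <= L" "upper_sublattice (?S L) (atoms_below L ` L')" if "(L', L) : ?Ar" for L' L
  using that by (simp_all add: special_inclusions_def)
 have over: "matroid_over (?S L) P" if L: "L : ?Ob" and P: "pasture P" for L P
 proof -
  obtain I J where p: "presents M L I J" using upper[OF L] by (auto simp: upper_sublattice_def)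
  interpret L: lattice_presentation M L id I J by (rule M.presents_lattice[OF p])
  interpret P: pasture P by (rule P)
  show ?thesis by unfold_locales
 qed
 have overM: "matroid_over M P" if "pasture P" for P
 proof -
  interpret P: pasture P by (rule that)
  show ?thesis by unfold_locales
 qed
 note g_hom = M.induced_to_matroid(1)[OF foundation_M upper foundations g_def]
 note g_class = M.induced_to_matroid(2)[OF foundation_M upper foundations g_def]
 have d_hom: "d L' L : pasture_hom (F L') (F L)" if a: "(L', L) : ?Ar" for L' L
  by (rule M.induced_to_sublattice(1)[OF upper foundations upper foundations _ _ d_def]) (use Ar[OF a] in auto)
 have d_class: "\<eta> L' P (compose (carrier (F L')) h (d L' L)) = {\<psi> : reps (?S L') P. agrees L' P \<psi>
   (cr_in P \<phi> L)}"
  if a: "(L', L) : ?Ar" and h: "pasture P" "h : pasture_hom (F L) P" "\<phi> : reps (?S L) P" "\<eta> L P h = cross_class (?S L) P \<phi>" for L' L P h \<phi>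
  by (rule M.induced_to_sublattice(2)[OF upper foundations upper foundations _ _ d_def h]) (use Ar[OF a] in auto)
 have class_rep: "EX \<phi>:reps (?S L) P. \<eta> L P h = cross_class (?S L) P \<phi> & \<phi> : \<eta> L P h"
  if L: "L : ?Ob" and P: "pasture P" and h: "h : pasture_hom (F L) P" for L P h
 proof -
  interpret LP: matroid_over "?S L" P by (rule over[OF L P])
  have X: "\<eta> L P h : rep_classes (?S L) P" using bij_betwE[OF bij[OF L P]] h by blast
  obtain \<phi> where \<phi>: "\<phi> : \<eta> L P h" using LP.rep_class_obtain[OF X] by blast
  from LP.rep_class_member[OF X this] \<phi> show ?thesis by blast
 qed
 have class_repM: "EX \<phi>:reps M P. \<eta>_M P h = cross_class M P \<phi>" if P: "pasture P" and h: "h : pasture_hom F_M P" for P h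
 proof -
  have "\<eta>_M P h : rep_classes M P" using bij_betwE[OF bijM[OF P]] h by blast
  thus ?thesis unfolding matroid_over.rep_classes_eq[OF overM[OF P]] by blast
 qed
 have eq_hom: "h = h'" if "L : ?Ob" "pasture P" "h : pasture_hom (F L) P" "h' : pasture_hom (F L) P" "\<eta> L P h = \<eta> L P h'" for L P h h'
  using bij[OF that(1,2)] that(3-5) unfolding bij_betw_def by (blast dest: inj_onD)
 have eq_homM: "h = h'" if "pasture P" "h : pasture_hom F_M P" "h' : pasture_hom F_M P" "\<eta>_M P h = \<eta>_M P h'" for P h h'
  using bijM[OF that(1)] that(2-4) unfolding bij_betw_def by (blast dest: inj_onD)

 \<comment> \<open>The identity of \<open>F_M\<close> corresponds to a universal representation
   \<open>\<phi>0\<close>, whose cross ratios describe all the morphisms \<open>g L\<close>.\<close>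
 define i where "i = (\<lambda>x\<in>carrier F_M. x)"
 have i: "i : pasture_hom F_M F_M" unfolding i_def by (rule id_hom[OF pM])
 obtain \<phi>0 where \<phi>0: "\<phi>0 : reps M F_M" "\<eta>_M F_M i = cross_class M F_M \<phi>0" using class_repM[OF pM i] by blast
 have gL: "\<eta> L F_M (g L) = {\<psi> : reps (?S L) F_M. agrees L F_M \<psi> (cr F_M \<phi>0)}" if L: "L : ?Ob" for L
  using g_class[OF L L pM i \<phi>0] id_compose[OF g_hom[OF L L]] by (simp add: i_def)
 \<comment> \<open>Restricting to \<open>L'\<close> directly or by way of \<open>L\<close> gives the
   same cross ratios, since a \<open>quad\<close> of \<open>L'\<close> is also one of
   \<open>L\<close> by \<open>quad_below_iff\<close>.\<close>
 have cocone: "is_cocone ?Ob ?Ar F d F_M g" unfolding is_cocone_def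
 proof (intro conjI ballI pM)
  show "g L : pasture_hom (F L) F_M" if "L : ?Ob" for L by (rule g_hom[OF that that])
  have "compose (carrier (F L')) (g L) (d L' L) = g L'" if a: "(L', L) : ?Ar" for L' L
  proof (rule eq_hom[OF Ar(1)[OF a] pM])
   note L = Ar(1,2)[OF a]
   show "compose (carrier (F L')) (g L) (d L' L) : pasture_hom (F L') F_M"
    by (rule compose_hom[OF pF[OF L(1)] d_hom[OF a] g_hom[OF L(2) L(2)]])
   show "g L' : pasture_hom (F L') F_M" by (rule g_hom[OF L(1) L(1)])
   obtain \<psi>0 where \<psi>0: "\<psi>0 : reps (?S L) F_M" "\<eta> L F_M (g L) = cross_class (?S L) F_M \<psi>0" "\<psi>0 : \<eta> L F_M (g L)"
    using class_rep[OF L(2) pM g_hom[OF L(2) L(2)]] by blast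
   hence ag: "agrees L F_M \<psi>0 (cr F_M \<phi>0)" unfolding gL[OF L(2)] by blast
   obtain I J where p: "presents M L I J" using upper[OF L(2)] by (auto simp: upper_sublattice_def)
   obtain I' J' where p': "presents M L' I' J'" using upper[OF L(1)] by (auto simp: upper_sublattice_def)
   have same: "cr_in F_M \<psi>0 L F1 F2 F3 F4 = cr F_M \<phi>0 F1 F2 F3 F4"
    if F': "F1 : L'" "F2 : L'" "F3 : L'" "F4 : L'"
    and q: "quad_in L' F1 F2 F3 F4" for F1 F2 F3 F4
   proof -
    have FL: "F1 : L" "F2 : L" "F3 : L" "F4 : L" using F' Ar(3)[OF a] by auto
    have "quad M F1 F2 F3 F4 & F1 Int F2 : L" using M.quad_below_iff[OF p' F'] q Ar(3)[OF a] by blast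
    thus ?thesis using agreesD[OF ag FL] M.quad_below_iff[OF p FL] by blast
   qed
   show "\<eta> L' F_M (compose (carrier (F L')) (g L) (d L' L)) = \<eta> L' F_M (g L')"
    unfolding d_class[OF a pM g_hom[OF L(2) L(2)] \<psi>0(1,2)] gL[OF L(1)] agrees_def using same by simp
  qed
  thus "case x of (L', L) => compose (carrier (F L')) (g L) (d L' L) = g L'" if "x : ?Ar" for x using that by auto
 qed
 from colim(2)[OF this] have ex1: "EX! h. mediates ?Ob F C \<iota> F_M g h" .

 \<comment> \<open>The cocone of the colimit amounts to a compatible family of representations over
   \<open>C\<close>. Gluing it yields a representation of \<open>M\<close> over \<open>C\<close>,
   that is, a morphism \<open>k\<close> from \<open>F_M\<close> back to \<open>C\<close>.\<close>
 have "EX \<psi>. ALL L:?Ob. \<psi> L : reps (?S L) C & \<eta> L C (\<iota> L) = cross_class (?S L) C (\<psi> L) & \<psi> L : \<eta> L C (\<iota> L)"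
  by (rule bchoice) (use class_rep[OF _ pC \<iota>] in blast)
 then obtain \<psi> where \<psi>: "!!L. L : ?Ob ==> \<psi> L : reps (?S L) C" "!!L. L : ?Ob ==> \<eta> L C (\<iota> L) = cross_class (?S L) C (\<psi> L)"
  "!!L. L : ?Ob ==> \<psi> L : \<eta> L C (\<iota> L)" by blast
 interpret MC: matroid_over M C by (rule overM[OF pC])
 interpret fam: compatible_family M C \<psi>
 proof
  show "\<psi> L : reps (?S L) C" if "L : ?Ob" for L by (rule \<psi>(1)[OF that])
  fix L' L assume a: "(L', L) : ?Ar"
  show "agrees L' C (\<psi> L') (cr_in C (\<psi> L) L)"
   using d_class[OF a pC \<iota>[OF Ar(2)[OF a]] \<psi>(1,2)[OF Ar(2)[OF a]]] \<psi>(3)[OF Ar(1)[OF a]] unfolding \<iota>_arrow[OF a] by blast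
 qed
 obtain \<phi> where \<phi>: "\<phi> : reps M C" "!!L. L : ?Ob ==> agrees L C (\<psi> L) (cr C \<phi>)" using fam.glued by blast
 obtain k where k: "k : pasture_hom F_M C" "\<eta>_M C k = cross_class M C \<phi>"
  using bijM[OF pC] \<phi>(1) MC.rep_classes_eq unfolding bij_betw_def by (metis (no_types, lifting) image_iff)
 have kg: "compose (carrier (F L)) k (g L) = \<iota> L" if L: "L : ?Ob" for L
 proof (rule eq_hom[OF L pC _ \<iota>[OF L]])
  show kgh: "compose (carrier (F L)) k (g L) : pasture_hom (F L) C" by (rule compose_hom[OF pF[OF L] g_hom[OF L L] k(1)])
  interpret LC: matroid_over "?S L" C by (rule over[OF L pC])
  have "\<psi> L : \<eta> L C (compose (carrier (F L)) k (g L))" unfolding g_class[OF L L pC k(1) \<phi>(1) k(2)] using \<psi>(1)[OF L] \<phi>(2)[OF L] by blast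
  moreover have "\<eta> L C (compose (carrier (F L)) k (g L)) : rep_classes (?S L) C" using bij_betwE[OF bij[OF L pC]] kgh by blast
  ultimately show "\<eta> L C (compose (carrier (F L)) k (g L)) = \<eta> L C (\<iota> L)" using LC.rep_class_member \<psi>(2)[OF L] by blast
 qed

 have iso: "pasture_iso C F_M h" if h: "mediates ?Ob F C \<iota> F_M g h" for h
 proof -
  have hh: "h : pasture_hom C F_M" and h\<iota>: "!!L. L : ?Ob ==> compose (carrier (F L)) h (\<iota> L) = g L"
   using h unfolding mediates_def by blast+
  have "mediates ?Ob F C \<iota> C \<iota> (compose (carrier C) k h)" unfolding mediates_def
   using compose_hom[OF pC hh k(1)] compose_hom_assoc[OF \<iota>, of _ k h] h\<iota> kg by simp
  moreover have "mediates ?Ob F C \<iota> C \<iota> (\<lambda>x\<in>carrier C. x)" unfolding mediates_def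
   using id_hom[OF pC] id_compose[OF \<iota>] by blast
  ultimately have kh: "compose (carrier C) k h = (\<lambda>x\<in>carrier C. x)" using colim(2)[OF colim(1)] by blast
  \<comment> \<open>For this composite the uniqueness in the colimit is of no help. Instead, the
    representation belonging to \<open>?hk\<close> is compared with the universal one: each cross
    ratio is visible in a sublattice of type U_{2,4}, composing \<open>?hk\<close> with the induced
    morphism of that sublattice changes nothing, and cross ratios determine the class.\<close>
  let ?hk = "compose (carrier F_M) h k"
  have hkh: "?hk : pasture_hom F_M F_M" by (rule compose_hom[OF pM k(1) hh])
  obtain \<phi>1 where \<phi>1: "\<phi>1 : reps M F_M" "\<eta>_M F_M ?hk = cross_class M F_M \<phi>1" using class_repM[OF pM hkh] by blast
  interpret MF: matroid_over M F_M by (rule overM[OF pM])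
  have "same_cross M F_M \<phi>1 \<phi>0" unfolding same_cross_def
  proof (intro allI impI)
   fix H1 H2 H3 H4 assume q: "quad M H1 H2 H3 H4"
   define L where "L = M.quad_sublattice H1 H2 H3 H4"
   have L: "L : ?Ob" unfolding L_def by (rule M.quad_special[OF q])
   have "compose (carrier (F L)) ?hk (g L) = compose (carrier (F L)) h (compose (carrier (F L)) k (g L))"
    using compose_hom_assoc[OF g_hom[OF L L]] by metis
   hence "compose (carrier (F L)) ?hk (g L) = g L" using kg[OF L] h\<iota>[OF L] by simp
   hence eq: "\<eta> L F_M (g L) = {\<psi> : reps (?S L) F_M. agrees L F_M \<psi> (cr F_M \<phi>1)}"
    using g_class[OF L L pM hkh \<phi>1] by simp
   obtain \<psi>0 where "\<psi>0 : \<eta> L F_M (g L)" using class_rep[OF L pM g_hom[OF L L]] by blast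
   hence ag: "agrees L F_M \<psi>0 (cr F_M \<phi>1)" "agrees L F_M \<psi>0 (cr F_M \<phi>0)" using eq gL[OF L] by blast+
   have HL: "H1 : L" "H2 : L" "H3 : L" "H4 : L" by (simp_all add: L_def M.quad_sublattice_def)
   note qL = M.quad_sublattice_quad[OF q L_def]
   show "cr F_M \<phi>1 H1 H2 H3 H4 = cr F_M \<phi>0 H1 H2 H3 H4"
    using agreesD[OF ag(1) HL qL] agreesD[OF ag(2) HL qL] by simp
  qed
  hence "\<eta>_M F_M ?hk = \<eta>_M F_M i" using \<phi>1(2) \<phi>0(2) MF.cross_class_eq by simp
  hence "?hk = i" by (rule eq_homM[OF pM hkh i])
  thus ?thesis unfolding pasture_iso_def using hh k(1) kh unfolding i_def by blast
 qed
 show ?thesis using ex1 iso unfolding g_def by blast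
qed

end
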